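(* Let $\Omega$, $F$, $U$, $I$, $x_0$, the finite element space $\underline V^h$, the time grid $t_m=m\Delta t$ ($\Delta t=T/M$), and the filtered scheme (S) be as in the context. Suppose that the curve shortening problem (P) of the context has a smooth solution $x$ on the time interval $[0,T]$ satisfying $$c_0\le |x_\rho|\le C_0\quad\text{in } I\times[0,T]$$ for some constants $c_0,C_0\in\mathbb R_{>0}$. Let $x_h^0=I_hx_0$ and assume that $x_h^1\in\underline V^h$ is such that $$\|I_h x(\cdot,t_1)-x_h^1\|_1^2\le c_*\,\bigl(h^4+(\Delta t)^4\bigr),$$ with a constant $c_*>0$ independent of $h$ and $\Delta t$. Then there exist $h_0>0$, $\gamma>0$ and a constant $c>0$, all independent of $h$ and $\Delta t$, such that if $0<h\le h_0$ and $\Delta t\le\gamma h^{1/2}$, then the scheme (S) has a unique solution $(x_h^m)_{m=2,\dots,M}$, and the following error bounds hold: $$\max_{0\le m\le M}\|x(\cdot,t_m)-x_h^m\|_0^2\le c\bigl(h^4+(\Delta t)^4\bigr),$$ $$\max_{0\le m\le M}|x(\cdot,t_m)-x_h^m|_1^2\le c\bigl(h^2+(\Delta t)^4\bigr).$$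
   Context: **Domain.** $n\ge2$ and $\Omega\subset\mathbb R^n$ is a domain; $U$ is an open neighbourhood of $\partial\Omega$ and $F\in C^3(U)$ satisfies $\partial\Omega=\{z\in U: F(z)=0\}$ and $|\nabla F(z)|=1$ for all $z\in\partial\Omega$. **Continuous problem (P).** Either $I=\mathbb R/\mathbb Z$ (closed curve, $\partial I=\emptyset$) or $I=(0,1)$ (open curve, $\partial I=\{0,1\}$). Find $x:\overline I\times[0,T]\to\mathbb R^n$ with $$|x_\rho|^2x_t-x_{\rho\rho}=0\ \text{ in } I\times(0,T],\qquad x(\cdot,0)=x_0\ \text{ in }\overline I,$$ and, in the case of an open curve, $x(\rho,t)\in\partial\Omega$ and $x_\rho(\rho,t)\cdot v=0$ for all $v\in T_{x(\rho,t)}\partial\Omega$ (the tangent space), for all $(\rho,t)\in\partial I\times(0,T]$. For open curves $F(x_0)=0$ on $\partial I$. For closed curves all boundary conditions are void. **Norms.** $\|\cdot\|_\ell$, $|\cdot|_\ell$ are the norm and semi-norm of $H^\ell(I)$ (also for vector-valued functions); $(\cdot,\cdot)$ is the $L^2(I)$ inner product. **Discretization.** $J\ge2$, $h=1/J$, $\rho_j=jh$ ($j=0,\dots,J$), $I_j=[\rho_{j-1},\rho_j]$; for closed curves $\rho_J$ is identified with $\rho_0$. $V^h=\{\chi\in C^0(\overline I):\chi|_{I_j}\text{ affine},\ j=1,\dots,J\}$, $\underline V^h=[V^h]^n$, and $I_h:[C^0(\overline I)]^n\to\underline V^h$ is Lagrange interpolation at the nodes. For $w\in[H^1(I)]^n$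 (with boundary values in $U$), $\underline V^h_\partial(w)=\{\eta\in\underline V^h:\eta\cdot\nabla F(w)=0\text{ on }\partial I\}$. For piecewise continuous $u,v$ (possibly jumping at nodes), $$(u,v)^h=\tfrac12\sum_{j=1}^Jh\bigl[(u\cdot v)(\rho_j^-)+(u\cdot v)(\rho_{j-1}^+)\bigr],$$ with one-sided limits. $\Delta t=T/M$, $t_m=m\Delta t$, $m=0,\dots,M$. **Scheme (S).** Given $x_h^0,x_h^1\in\underline V^h$, for $m=1,\dots,M-1$: set $\hat x_h^{m+1}=2x_h^m-x_h^{m-1}$; find $\bar x_h^{m+1}\in\underline V^h$ with $\bar x_h^{m+1}-x_h^m\in\underline V^h_\partial(\hat x_h^{m+1})$ such that $$\Bigl(\frac{\bar x_h^{m+1}-x_h^m}{\Delta t},\eta_h|\hat x_{h,\rho}^{m+1}|^2\Bigr)^h+\bigl(\bar x_{h,\rho}^{m+1},\eta_{h,\rho}\bigr)=0\qquad\forall\,\eta_h\in\underline V^h_\partial(\hat x_h^{m+1}),$$ and then set $x_h^{m+1}=\tfrac23\bar x_h^{m+1}+\tfrac23x_h^m-\tfrac13x_h^{m-1}$. The subscript $\rho$ denotes the derivative in $\rho$. (For the scheme to be meaningful at step $m$ in the open case, the boundary values of $\hat x_h^{m+1}$ must lie in $U$; this is part of the existence claim.) Constants "independent of $h$ and $\Delta t$" may depend on $x$, $F$, $\Omega$, $T$, $c_0$, $C_0$ and on the constant $c_*$ in the assumption on $x_h^1$. *)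

theory Defs
  imports "HOL-Analysis.Analysis"
begin

text \<open>
  Derivatives are taken within \<open>S\<close>, so one notion covers open sets and the closed parabolic
  cylinders below, on whose boundary it means \<open>C\<^sup>k\<close> up to the boundary. It is meant only for sets
  \<open>S\<close> on which the derivative within \<open>S\<close> is unique.
\<close>

primrec Ck_on :: "nat \<Rightarrow> 'a::euclidean_space set \<Rightarrow> ('a \<Rightarrow> 'b::real_normed_vector) \<Rightarrow> bool" where
  "Ck_on 0 S f \<longleftrightarrow> continuous_on S f"
| "Ck_on (Suc k) S f \<longleftrightarrow>
     f differentiable_on S \<and> (\<forall>b\<in>Basis. Ck_on k S (\<lambda>z. frechet_derivative f (at z within S) b))"

definition smooth_on :: "'a::euclidean_space set \<Rightarrow> ('a \<Rightarrow> 'b::real_normed_vector) \<Rightarrow> bool" where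
  "smooth_on S f \<longleftrightarrow> (\<forall>k. Ck_on k S f)"

definition grad :: "('a::real_inner \<Rightarrow> real) \<Rightarrow> 'a \<Rightarrow> 'a" where
  "grad F z = (THE D. GDERIV F z :> D)"

definition tangent_space :: "'a::real_normed_vector set \<Rightarrow> 'a \<Rightarrow> 'a set" where
  "tangent_space S p = {v. \<exists>\<gamma> e. e > 0 \<and> \<gamma> C1_differentiable_on {-e<..<e} \<and> \<gamma> ` {-e<..<e} \<subseteq> S \<and>
     \<gamma> 0 = p \<and> (\<gamma> has_vector_derivative v) (at 0)}"

definition level_set_domain :: "'a::euclidean_space set \<Rightarrow> 'a set \<Rightarrow> ('a \<Rightarrow> real) \<Rightarrow> bool" where
  "level_set_domain \<Omega> U F \<longleftrightarrow>
     open \<Omega> \<and> connected \<Omega> \<and> \<Omega> \<noteq> {} \<and>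
     open U \<and> frontier \<Omega> \<subseteq> U \<and> Ck_on 3 U F \<and>
     frontier \<Omega> = {z\<in>U. F z = 0} \<and> (\<forall>z\<in>frontier \<Omega>. norm (grad F z) = 1)"


text \<open>
  For \<open>Closed_curve\<close>, the continuous solution is a 1-periodic function on the whole real line;
  all other functions on \<open>\<real>/\<int>\<close> are represented on the fundamental domain \<open>[0,1]\<close>.
\<close>

datatype curve_type = Closed_curve | Open_curve

primrec dom_int :: "curve_type \<Rightarrow> real set" where
  "dom_int Closed_curve = UNIV"
| "dom_int Open_curve = {0<..<1}"

primrec dom_cl :: "curve_type \<Rightarrow> real set" where
  "dom_cl Closed_curve = UNIV"
| "dom_cl Open_curve = {0..1}"

primrec dom_bd :: "curve_type \<Rightarrow> real set" where
  "dom_bd Closed_curve = {}"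
| "dom_bd Open_curve = {0, 1}"

definition D_rho :: "curve_type \<Rightarrow> (real \<Rightarrow> real \<Rightarrow> 'a::real_normed_vector) \<Rightarrow> real \<Rightarrow> real \<Rightarrow> 'a" where
  "D_rho \<kappa> x \<rho> t = vector_derivative (\<lambda>r. x r t) (at \<rho> within dom_cl \<kappa>)"

definition D_t :: "real \<Rightarrow> (real \<Rightarrow> real \<Rightarrow> 'a::real_normed_vector) \<Rightarrow> real \<Rightarrow> real \<Rightarrow> 'a" where
  "D_t T x \<rho> t = vector_derivative (\<lambda>s. x \<rho> s) (at t within {0..T})"

definition smooth_curve_flow ::
    "curve_type \<Rightarrow> real \<Rightarrow> (real \<Rightarrow> real \<Rightarrow> 'a::real_normed_vector) \<Rightarrow> bool" where
  "smooth_curve_flow \<kappa> T x \<longleftrightarrow>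
     smooth_on (dom_cl \<kappa> \<times> {0..T}) (\<lambda>(\<rho>, t). x \<rho> t) \<and>
     (\<kappa> = Closed_curve \<longrightarrow> (\<forall>\<rho>. \<forall>t\<in>{0..T}. x (\<rho> + 1) t = x \<rho> t))"

definition solves_P :: "curve_type \<Rightarrow> 'a::euclidean_space set \<Rightarrow> real \<Rightarrow> (real \<Rightarrow> 'a) \<Rightarrow>
    (real \<Rightarrow> real \<Rightarrow> 'a) \<Rightarrow> bool" where
  "solves_P \<kappa> \<Omega> T x0 x \<longleftrightarrow>
     (\<forall>\<rho>\<in>dom_int \<kappa>. \<forall>t\<in>{0<..T}.
        (norm (D_rho \<kappa> x \<rho> t))\<^sup>2 *\<^sub>R D_t T x \<rho> t - D_rho \<kappa> (D_rho \<kappa> x) \<rho> t = 0) \<and>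
     (\<forall>\<rho>\<in>dom_cl \<kappa>. x \<rho> 0 = x0 \<rho>) \<and>
     (\<forall>\<rho>\<in>dom_bd \<kappa>. \<forall>t\<in>{0<..T}. x \<rho> t \<in> frontier \<Omega> \<and>
        (\<forall>v\<in>tangent_space (frontier \<Omega>) (x \<rho> t). D_rho \<kappa> x \<rho> t \<bullet> v = 0))"


definition l2_inner :: "(real \<Rightarrow> 'a::real_inner) \<Rightarrow> (real \<Rightarrow> 'a) \<Rightarrow> real" where
  "l2_inner u v = (LBINT \<rho>:{0..1}. u \<rho> \<bullet> v \<rho>)"

definition l2_norm :: "(real \<Rightarrow> 'a::real_inner) \<Rightarrow> real" where
  "l2_norm u = sqrt (l2_inner u u)"

definition in_L2 :: "(real \<Rightarrow> 'a::euclidean_space) \<Rightarrow> bool" where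
  "in_L2 u \<longleftrightarrow> set_borel_measurable lborel {0..1} u \<and>
     set_integrable lborel {0..1} (\<lambda>\<rho>. (norm (u \<rho>))\<^sup>2)"

text \<open>
  As usual for Sobolev spaces on intervals, weak derivatives are tested with \<open>C\<^sup>1\<close> functions,
  compactly supported in \<open>(0,1)\<close> respectively 1-periodic.
\<close>

primrec test_function :: "curve_type \<Rightarrow> (real \<Rightarrow> real) \<Rightarrow> bool" where
  "test_function Closed_curve \<phi> \<longleftrightarrow> Ck_on 1 UNIV \<phi> \<and> (\<forall>\<rho>. \<phi> (\<rho> + 1) = \<phi> \<rho>)"
| "test_function Open_curve \<phi> \<longleftrightarrow> Ck_on 1 UNIV \<phi> \<and>
     (\<exists>a b. 0 < a \<and> b < 1 \<and> (\<forall>\<rho>. \<rho> \<notin> {a..b} \<longrightarrow> \<phi> \<rho> = 0))"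

definition is_weak_deriv ::
    "curve_type \<Rightarrow> (real \<Rightarrow> 'a::euclidean_space) \<Rightarrow> (real \<Rightarrow> 'a) \<Rightarrow> bool" where
  "is_weak_deriv \<kappa> u g \<longleftrightarrow> in_L2 g \<and>
     (\<forall>\<phi>. test_function \<kappa> \<phi> \<longrightarrow>
        (LBINT \<rho>:{0..1}. deriv \<phi> \<rho> *\<^sub>R u \<rho>) = - (LBINT \<rho>:{0..1}. \<phi> \<rho> *\<^sub>R g \<rho>))"

text \<open>
  The weak derivative is unique only almost everywhere, which is enough for the seminorm. The
  values of the (semi-)norms are meaningful only for \<open>u \<in> H\<^sup>1(I)\<close>, in particular for continuous,
  piecewise \<open>C\<^sup>1\<close> functions (with equal values at 0 and 1 in the case of closed curves).
\<close>

definition h1_seminorm :: "curve_type \<Rightarrow> (real \<Rightarrow> 'a::euclidean_space) \<Rightarrow> real" where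
  "h1_seminorm \<kappa> u = l2_norm (SOME g. is_weak_deriv \<kappa> u g)"

definition h1_norm :: "curve_type \<Rightarrow> (real \<Rightarrow> 'a::euclidean_space) \<Rightarrow> real" where
  "h1_norm \<kappa> u = sqrt ((l2_norm u)\<^sup>2 + (h1_seminorm \<kappa> u)\<^sup>2)"


definition node :: "nat \<Rightarrow> nat \<Rightarrow> real" where
  "node J j = real j / real J"

text \<open>
  Only the restrictions of finite element functions to \<open>[0,1]\<close> are relevant; the values outside
  are arbitrary, and equality of such functions is to be read as equality on \<open>[0,1]\<close>.
\<close>

definition fe_space :: "curve_type \<Rightarrow> nat \<Rightarrow> (real \<Rightarrow> 'a::real_normed_vector) set" where
  "fe_space \<kappa> J = {v. continuous_on {0..1} v \<and>
     (\<forall>j\<in>{1..J}. \<exists>a b. \<forall>\<rho>\<in>{node J (j - 1)..node J j}. v \<rho> = a + \<rho> *\<^sub>R b) \<and>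
     (\<kappa> = Closed_curve \<longrightarrow> v 0 = v 1)}"

definition lagrange_interp :: "nat \<Rightarrow> (real \<Rightarrow> 'a::real_normed_vector) \<Rightarrow> real \<Rightarrow> 'a" where
  "lagrange_interp J f \<rho> = (\<Sum>j=0..J. max 0 (1 - \<bar>real J * \<rho> - real j\<bar>) *\<^sub>R f (node J j))"

definition fe_space_bd ::
    "curve_type \<Rightarrow> nat \<Rightarrow> ('a::real_inner \<Rightarrow> real) \<Rightarrow> (real \<Rightarrow> 'a) \<Rightarrow> (real \<Rightarrow> 'a) set" where
  "fe_space_bd \<kappa> J F w = {\<eta>\<in>fe_space \<kappa> J. \<forall>\<rho>\<in>dom_bd \<kappa>. \<eta> \<rho> \<bullet> grad F (w \<rho>) = 0}"

definition lumped_inner :: "nat \<Rightarrow> (real \<Rightarrow> 'a::real_inner) \<Rightarrow> (real \<Rightarrow> 'a) \<Rightarrow> real" where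
  "lumped_inner J u v = 1/2 * (\<Sum>j=1..J. (1 / real J) *
     (Lim (at_left (node J j)) (\<lambda>\<rho>. u \<rho> \<bullet> v \<rho>) +
      Lim (at_right (node J (j - 1))) (\<lambda>\<rho>. u \<rho> \<bullet> v \<rho>)))"

text \<open>For finite element functions, the following is the derivative away from the nodes.\<close>

definition fe_deriv :: "(real \<Rightarrow> 'a::real_normed_vector) \<Rightarrow> real \<Rightarrow> 'a" where
  "fe_deriv v \<rho> = vector_derivative v (at \<rho>)"

text \<open>
  \<open>scheme_step \<kappa> U F J \<tau> y\<^sub>0 y\<^sub>1 y\<^sub>2\<close>: with time step size \<open>\<tau>\<close>, the new iterate \<open>y\<^sub>2\<close> is obtained from
  the two preceding ones, \<open>y\<^sub>0\<close> and then \<open>y\<^sub>1\<close>. The intermediate function \<open>ybar\<close> is determined by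
  \<open>y\<^sub>0\<close>, \<open>y\<^sub>1\<close>, \<open>y\<^sub>2\<close>, so that uniqueness of \<open>y\<^sub>2\<close> includes uniqueness of \<open>ybar\<close>.
\<close>

definition scheme_step :: "curve_type \<Rightarrow> 'a::real_inner set \<Rightarrow> ('a \<Rightarrow> real) \<Rightarrow> nat \<Rightarrow> real \<Rightarrow>
    (real \<Rightarrow> 'a) \<Rightarrow> (real \<Rightarrow> 'a) \<Rightarrow> (real \<Rightarrow> 'a) \<Rightarrow> bool" where
  "scheme_step \<kappa> U F J \<tau> y\<^sub>0 y\<^sub>1 y\<^sub>2 \<longleftrightarrow>
     (let yhat = (\<lambda>\<rho>. 2 *\<^sub>R y\<^sub>1 \<rho> - y\<^sub>0 \<rho>) in
      (\<forall>\<rho>\<in>dom_bd \<kappa>. yhat \<rho> \<in> U) \<and>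
      (\<exists>ybar\<in>fe_space \<kappa> J.
         (\<lambda>\<rho>. ybar \<rho> - y\<^sub>1 \<rho>) \<in> fe_space_bd \<kappa> J F yhat \<and>
         (\<forall>\<eta>\<in>fe_space_bd \<kappa> J F yhat.
            lumped_inner J (\<lambda>\<rho>. (1 / \<tau>) *\<^sub>R (ybar \<rho> - y\<^sub>1 \<rho>))
                           (\<lambda>\<rho>. (norm (fe_deriv yhat \<rho>))\<^sup>2 *\<^sub>R \<eta> \<rho>) +
            l2_inner (fe_deriv ybar) (fe_deriv \<eta>) = 0) \<and>
         (\<forall>\<rho>\<in>{0..1}. y\<^sub>2 \<rho> = (2/3) *\<^sub>R ybar \<rho> + (2/3) *\<^sub>R y\<^sub>1 \<rho> - (1/3) *\<^sub>R y\<^sub>0 \<rho>)))"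

definition solves_S :: "curve_type \<Rightarrow> 'a::real_inner set \<Rightarrow> ('a \<Rightarrow> real) \<Rightarrow> nat \<Rightarrow> nat \<Rightarrow> real \<Rightarrow>
    (real \<Rightarrow> 'a) \<Rightarrow> (real \<Rightarrow> 'a) \<Rightarrow> (nat \<Rightarrow> real \<Rightarrow> 'a) \<Rightarrow> bool" where
  "solves_S \<kappa> U F J M T xh0 xh1 xh \<longleftrightarrow>
     (\<forall>m\<le>M. xh m \<in> fe_space \<kappa> J) \<and>
     (\<forall>\<rho>\<in>{0..1}. xh 0 \<rho> = xh0 \<rho> \<and> xh 1 \<rho> = xh1 \<rho>) \<and>
     (\<forall>m\<in>{1..<M}. scheme_step \<kappa> U F J (T / real M) (xh (m - 1)) (xh m) (xh (m + 1)))"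

end

theory Submission
  imports Defs
begin

text \<open>
  A finite element function is determined by its values at the nodes, and written in terms of these
  values the scheme is a finite difference scheme: \<open>nodal_step\<close> says the same as \<open>scheme_step\<close>
  (\<open>scheme_step_nodal\<close>). The analysis is done for nodal vectors. With \<open>a, b, c\<close> the nodal errors at
  the times \<open>t\<close>, \<open>t - \<tau>\<close>, \<open>t - 2\<tau>\<close>, the quantity \<open>\<tau>\<^sup>-\<^sup>1 bdf a b c\<close> is the error of the discrete
  velocity, \<open>vbar a b c\<close> the error of the unfiltered iterate and \<open>vhat b c\<close> the error of the
  extrapolation.

  \<^emph>\<open>Stability.\<close> Filtering makes the scheme a two step method which is G-stable: for every inner
  product, the product of \<open>vbar a b c\<close> and \<open>bdf a b c\<close> is the increment of a positive quadratic
  form in two successive errors, plus a square (\<open>stiff_bdf\<close>). Testing the error equation with the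
  discrete velocity \<open>\<tau>\<^sup>-\<^sup>1 bdf a b c\<close> therefore controls the discrete \<open>H\<^sup>1\<close> norm of the error and
  leaves the lumped \<open>L\<^sup>2\<close> norm of the velocity on the good side, where it absorbs the residual.

  \<^emph>\<open>Consistency.\<close> Let \<open>D = h\<^sup>2 + \<tau>\<^sup>2\<close>. Inserting the exact curve into the scheme leaves, against a
  test vector \<open>\<eta>\<close>, a residual of order \<open>D\<close> plus the \<open>H\<^sup>1\<close> norm of the extrapolated error, measured in
  the lumped \<open>L\<^sup>2\<close> norm of \<open>\<eta>\<close>, and a boundary flux (\<open>consistency\<close>). For closed curves the fluxes at
  the two ends cancel. For open curves they involve point values of \<open>\<eta>\<close>, which the \<open>L\<^sup>2\<close> norm does
  not control. Two observations help. The part of the flux of order \<open>D\<close> is smooth in time, so it can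
  be summed by parts in time. The leading part is \<open>x\<^sub>\<rho> \<bullet> \<eta>\<close>; since \<open>x\<^sub>\<rho>\<close> is normal to the boundary at
  \<open>x\<close> while \<open>\<eta>\<close> is tangential at the extrapolated point, it is, up to higher order, the Hessian of
  \<open>F\<close> applied to the extrapolated error and to \<open>\<eta>\<close>. As the Hessian is symmetric, this term is again
  the increment of a quadratic form in the errors (\<open>bilinear_bdf\<close>). Both contributions are moved into
  the energy, which stays coercive by the trace inequality (\<open>energy_bounds\<close>). The discrete velocity
  is not itself an admissible test vector, because its normal component at the ends need not vanish;
  that component is small and is removed by a lifting of the boundary values (\<open>energy_step\<close>).

  \<^emph>\<open>Induction in time.\<close> As long as the extrapolated error is small in \<open>W\<^sup>1\<^sup>,\<^sup>\<infinity>\<close>, the weights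
  \<open>\<bar>xhat\<^sub>\<rho>\<bar>\<^sup>2\<close> are bounded above and below and the extrapolated end points lie near the boundary.
  Then the linear system of the next step is symmetric and positive definite, so that it has exactly
  one solution (\<open>step_exists\<close>), and the energy grows at most by a factor \<open>1 + O(\<tau>)\<close> up to
  \<open>O(\<tau> D\<^sup>2)\<close> (\<open>step_energy\<close>). Gronwall's inequality bounds the squared \<open>H\<^sup>1\<close> error by \<open>K D\<^sup>2\<close>. An
  inverse estimate costs \<open>h\<^sup>-\<^sup>1\<^sup>/\<^sup>2\<close>, and \<open>h\<^sup>-\<^sup>1\<^sup>/\<^sup>2 D\<close> is small because \<open>\<tau>\<^sup>2\<close> is at most of the order of \<open>h\<close>;
  thus smallness persists (\<open>nodal_convergence\<close>).

  \<^emph>\<open>Transfer.\<close> The hypotheses used for the nodal vectors are derived from the smooth solution in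
  \<open>bd_flow_of_solution\<close>; the normal boundary condition needs that every vector orthogonal to the
  gradient of \<open>F\<close> is a velocity of a curve in the boundary (\<open>level_set_tangent\<close>). In the other
  direction, uniqueness of weak derivatives (\<open>weak_deriv_unique\<close>) identifies the \<open>H\<^sup>1\<close> seminorm, and
  interpolation estimates turn nodal errors into errors of functions (\<open>error_norms\<close>).
\<close>

section \<open>Nodal vectors\<close>

text \<open>
  For the nodal values of piecewise affine functions on a uniform grid with \<open>J\<close> cells, \<open>stiff\<close> is the
  \<open>L\<^sup>2\<close> product of the derivatives, and \<open>lump\<close> the product given by the trapezoidal rule with a weight
  that is constant on each cell.
\<close>

definition stiff :: "nat \<Rightarrow> (nat \<Rightarrow> 'a::real_inner) \<Rightarrow> (nat \<Rightarrow> 'a) \<Rightarrow> real" where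
  "stiff J u v = real J * (\<Sum>j<J. (u (Suc j) - u j) \<bullet> (v (Suc j) - v j))"

definition lump :: "nat \<Rightarrow> (nat \<Rightarrow> real) \<Rightarrow> (nat \<Rightarrow> 'a::real_inner) \<Rightarrow> (nat \<Rightarrow> 'a) \<Rightarrow> real" where
  "lump J W u v = (\<Sum>j<J. W j * (u (Suc j) \<bullet> v (Suc j) + u j \<bullet> v j)) / (2 * real J)"

abbreviation stiff_sq :: "nat \<Rightarrow> (nat \<Rightarrow> 'a::real_inner) \<Rightarrow> real" where
  "stiff_sq J v \<equiv> stiff J v v"

abbreviation lump_sq :: "nat \<Rightarrow> (nat \<Rightarrow> 'a::real_inner) \<Rightarrow> real" where
  "lump_sq J v \<equiv> lump J (\<lambda>_. 1) v v"

definition h1_sq :: "nat \<Rightarrow> (nat \<Rightarrow> 'a::real_inner) \<Rightarrow> real" where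
  "h1_sq J v = stiff_sq J v + lump_sq J v"

lemma stiff_sq_nonneg: "0 \<le> stiff_sq J v"
  by (simp add: stiff_def sum_nonneg)

lemma lump_sq_nonneg: "0 \<le> lump_sq J v"
  by (simp add: lump_def sum_nonneg)

lemma h1_sq_nonneg: "0 \<le> h1_sq J v"
  using stiff_sq_nonneg[of J v] lump_sq_nonneg[of J v] by (simp add: h1_sq_def)

lemma stiff_add: "stiff J (\<lambda>j. u j + v j) w = stiff J u w + stiff J v w"
  by (simp add: stiff_def algebra_simps inner_simps sum.distrib sum_subtractf)

lemma stiff_diff: "stiff J (\<lambda>j. u j - v j) w = stiff J u w - stiff J v w"
  by (simp add: stiff_def algebra_simps inner_simps sum.distrib sum_subtractf)

lemma stiff_scale: "stiff J (\<lambda>j. c *\<^sub>R u j) w = c * stiff J u w"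
  by (simp add: stiff_def scaleR_diff_right[symmetric] sum_distrib_left mult_ac)

lemma stiff_commute: "stiff J u v = stiff J v u"
  by (simp add: stiff_def inner_commute)

lemma lump_add: "lump J W (\<lambda>j. u j + v j) w = lump J W u w + lump J W v w"
  by (simp add: lump_def algebra_simps inner_simps sum.distrib sum_subtractf add_divide_distrib)

lemma lump_diff: "lump J W (\<lambda>j. u j - v j) w = lump J W u w - lump J W v w"
  by (simp add: lump_def algebra_simps inner_simps sum.distrib sum_subtractf add_divide_distrib diff_divide_distrib)

lemma lump_scale: "lump J W (\<lambda>j. c *\<^sub>R u j) w = c * lump J W u w"
  by (simp add: lump_def sum_distrib_left distrib_left mult_ac)

lemma lump_commute: "lump J W u v = lump J W v u"
  by (simp add: lump_def inner_commute)

lemmas stiff_lin = stiff_add stiff_diff stiff_scale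
lemmas lump_lin = lump_add lump_diff lump_scale

lemma stiff_lin2: 
  "stiff J w (\<lambda>j. u j + v j) = stiff J w u + stiff J w v"
  "stiff J w (\<lambda>j. u j - v j) = stiff J w u - stiff J w v"
  "stiff J w (\<lambda>j. c *\<^sub>R u j) = c * stiff J w u"
  by (simp_all add: stiff_commute[of J w] stiff_lin)

lemma lump_lin2: 
  "lump J W w (\<lambda>j. u j + v j) = lump J W w u + lump J W w v"
  "lump J W w (\<lambda>j. u j - v j) = lump J W w u - lump J W w v"
  "lump J W w (\<lambda>j. c *\<^sub>R u j) = c * lump J W w u"
  by (simp_all add: lump_commute[of J W w] lump_lin)

lemma inner_young:
  fixes u v :: "'a::real_inner"
  assumes "0 < \<epsilon>"
  shows "\<bar>u \<bullet> v\<bar> \<le> \<epsilon> * (norm u)\<^sup>2 + (1 / (4 * \<epsilon>)) * (norm v)\<^sup>2"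
proof -
  have "0 \<le> (2 * \<epsilon> * norm u - norm v)\<^sup>2" by simp
  then have "norm u * norm v \<le> (4 * \<epsilon>\<^sup>2 * (norm u)\<^sup>2 + (norm v)\<^sup>2) / (4 * \<epsilon>)"
    using assms by (simp add: pos_le_divide_eq power2_diff power_mult_distrib mult_ac)
  also have "\<dots> = \<epsilon> * (norm u)\<^sup>2 + (1 / (4 * \<epsilon>)) * (norm v)\<^sup>2"
    using assms by (simp add: field_simps power2_eq_square)
  finally have "norm u * norm v \<le> \<epsilon> * (norm u)\<^sup>2 + (1 / (4 * \<epsilon>)) * (norm v)\<^sup>2" .
  then show ?thesis
    using Cauchy_Schwarz_ineq2[of u v] by linarith
qed

lemma real_young:
  fixes u v :: real
  assumes "0 < \<epsilon>"
  shows "u * v \<le> \<epsilon> * u\<^sup>2 + (1 / (4 * \<epsilon>)) * v\<^sup>2"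
  using inner_young[OF assms, of u v] by simp

text \<open>
  The lumped product is a Euclidean product over the pairs (cell, end point), so weights bounded by
  \<open>w\<close> cost a factor \<open>w\<close>.
\<close>

lemma lump_cauchy_schwarz:
  assumes "\<And>j. j < J \<Longrightarrow> \<bar>W j\<bar> \<le> w"
  shows "\<bar>lump J W u v\<bar> \<le> w * (sqrt (lump_sq J u) * sqrt (lump_sq J v))"
proof (cases "J = 0")
  case True
  then show ?thesis by (simp add: lump_def)
next
  case False
  then have w: "0 \<le> w" using assms[of 0] by simp
  define f where "f = (\<lambda>u (i::bool, j). norm (if i then u (Suc j) else (u j :: 'a)))"
  have S: "(\<Sum>x\<in>UNIV \<times> {..<J}. g x) = (\<Sum>j<J. g (True, j) + g (False, j))" for g :: "bool \<times> nat \<Rightarrow> real"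
    by (subst sum.cartesian_product[symmetric, of "\<lambda>x y. g (x, y)", simplified])
       (simp add: UNIV_bool sum.distrib)
  have L: "L2_set (f u) (UNIV \<times> {..<J}) = sqrt (2 * real J) * sqrt (lump_sq J u)" for u
    using False unfolding L2_set_def S
    by (simp add: f_def lump_def power2_norm_eq_inner flip: real_sqrt_mult)
  have "\<bar>\<Sum>j<J. W j * (u (Suc j) \<bullet> v (Suc j) + u j \<bullet> v j)\<bar>
     \<le> (\<Sum>j<J. w * (norm (u (Suc j)) * norm (v (Suc j)) + norm (u j) * norm (v j)))"
  proof (rule order_trans[OF sum_abs], rule sum_mono)
    fix j assume "j \<in> {..<J}"
    then have "\<bar>W j\<bar> \<le> w" using assms by simp
    moreover have "\<bar>u (Suc j) \<bullet> v (Suc j) + u j \<bullet> v j\<bar> \<le> norm (u (Suc j)) * norm (v (Suc j)) + norm (u j) * norm (v j)"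
      using Cauchy_Schwarz_ineq2[of "u j" "v j"] Cauchy_Schwarz_ineq2[of "u (Suc j)" "v (Suc j)"] by linarith
    ultimately show "\<bar>W j * (u (Suc j) \<bullet> v (Suc j) + u j \<bullet> v j)\<bar> \<le> w * (norm (u (Suc j)) * norm (v (Suc j)) + norm (u j) * norm (v j))"
      using w by (simp add: abs_mult mult_mono)
  qed
  also have "\<dots> = w * (\<Sum>x\<in>UNIV \<times> {..<J}. \<bar>f u x\<bar> * \<bar>f v x\<bar>)"
    unfolding S by (simp add: f_def sum_distrib_left)
  also have "\<dots> \<le> w * (L2_set (f u) (UNIV \<times> {..<J}) * L2_set (f v) (UNIV \<times> {..<J}))"
    using w L2_set_mult_ineq by (intro mult_left_mono) auto
  also have "\<dots> = w * (sqrt (lump_sq J u) * sqrt (lump_sq J v)) * (2 * real J)"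
    by (simp add: L)
  finally show ?thesis
    using False by (simp add: lump_def abs_divide pos_divide_le_eq)
qed

lemma lump_sq_triangle: "sqrt (lump_sq J (\<lambda>j. u j - v j)) \<le> sqrt (lump_sq J u) + sqrt (lump_sq J v)"
proof -
  have "lump_sq J (\<lambda>j. u j - v j) = lump_sq J u - 2 * lump J (\<lambda>_. 1) u v + lump_sq J v"
    by (simp add: lump_lin lump_lin2 lump_commute[of _ _ v u])
  also have "\<dots> \<le> (sqrt (lump_sq J u) + sqrt (lump_sq J v))\<^sup>2"
    using lump_cauchy_schwarz[of J "\<lambda>_. 1" 1 u v]
    by (simp add: power2_sum lump_sq_nonneg)
  finally show ?thesis
    by (intro real_le_lsqrt add_nonneg_nonneg real_sqrt_ge_zero lump_sq_nonneg)
qed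

lemma stiff_young: "stiff J u v \<le> (stiff_sq J u + stiff_sq J v) / 2"
  using stiff_sq_nonneg[of J "\<lambda>j. u j - v j"]
  by (simp add: stiff_lin stiff_lin2 stiff_commute[of _ v u])

text \<open>
  An inverse estimate: the value at one node enters the lumped norm with a weight of at least \<open>h/2\<close>.
\<close>

lemma node_sq_le_lump:
  assumes "k \<le> J" "0 < J"
  shows "(norm (v k))\<^sup>2 \<le> 2 * real J * lump_sq J v"
proof -
  have *: "(norm (v k))\<^sup>2 \<le> (\<Sum>j<J. v (Suc j) \<bullet> v (Suc j) + v j \<bullet> v j)"
  proof (cases "k = 0")
    case True
    have "(norm (v 0))\<^sup>2 \<le> v (Suc 0) \<bullet> v (Suc 0) + v 0 \<bullet> v 0" by (simp add: power2_norm_eq_inner)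
    also have "\<dots> \<le> (\<Sum>j<J. v (Suc j) \<bullet> v (Suc j) + v j \<bullet> v j)"
      using assms by (intro member_le_sum[of 0]) auto
    finally show ?thesis using True by simp
  next
    case False
    then obtain i where i: "k = Suc i" "i < J" using assms by (cases k) auto
    have "(norm (v k))\<^sup>2 \<le> v (Suc i) \<bullet> v (Suc i) + v i \<bullet> v i" by (simp add: i power2_norm_eq_inner)
    also have "\<dots> \<le> (\<Sum>j<J. v (Suc j) \<bullet> v (Suc j) + v j \<bullet> v j)"
      using i by (intro member_le_sum[of i]) auto
    finally show ?thesis .
  qed
  then show ?thesis using assms by (simp add: lump_def)
qed

lemma slope_sq_le_stiff:
  assumes "j < J"
  shows "(norm (v (Suc j) - v j))\<^sup>2 * real J \<le> stiff_sq J v"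
proof -
  have "(norm (v (Suc j) - v j))\<^sup>2 \<le> (\<Sum>j<J. (v (Suc j) - v j) \<bullet> (v (Suc j) - v j))"
    unfolding power2_norm_eq_inner using assms by (intro member_le_sum) auto
  then show ?thesis unfolding stiff_def by (simp add: mult.commute mult_left_mono)
qed

text \<open>
  The discrete trace inequality: the squared size of \<open>v\<close> varies by at most
  \<open>\<Sum>\<bar>v\<^sub>i\<^sub>+\<^sub>1 - v\<^sub>i\<bar>\<bar>v\<^sub>i\<^sub>+\<^sub>1 + v\<^sub>i\<bar>\<close> from the node where it is smallest, and there it is below its mean.
\<close>

lemma trace_inequality:
  fixes v :: "nat \<Rightarrow> 'a::real_inner"
  assumes "0 < \<epsilon>" "0 < J" "k \<le> J"
  shows "(norm (v k))\<^sup>2 \<le> \<epsilon> * stiff_sq J v + (1 + 1 / \<epsilon>) * lump_sq J v"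
proof -
  let ?q = "\<lambda>i. (norm (v i))\<^sup>2"
  let ?V = "\<Sum>i<J. \<bar>?q (Suc i) - ?q i\<bar>"
  have mono: "?q b - ?q a \<le> ?V \<and> ?q a - ?q b \<le> ?V" if "a \<le> b" "b \<le> J" for a b
  proof -
    have "?q b - ?q a = (\<Sum>i=a..<b. ?q (Suc i) - ?q i)"
      by (rule sum_Suc_diff'[OF that(1), symmetric])
    then have "\<bar>?q b - ?q a\<bar> \<le> (\<Sum>i=a..<b. \<bar>?q (Suc i) - ?q i\<bar>)" by (simp only: sum_abs)
    also have "\<dots> \<le> ?V" using that by (intro sum_mono2) auto
    finally show ?thesis by linarith
  qed
  obtain i where i: "i \<le> J" "\<And>j. j \<le> J \<Longrightarrow> ?q i \<le> ?q j"
  proof -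
    have "Min (?q ` {..J}) \<in> ?q ` {..J}" by (intro Min_in) auto
    then obtain i where "i \<le> J" "?q i = Min (?q ` {..J})" by (metis (no_types, lifting) atMost_iff imageE)
    then show thesis by (intro that[of i]) (auto intro!: Min_le)
  qed
  have low: "?q i \<le> lump_sq J v"
  proof -
    have "(\<Sum>j<J. 2 * ?q i) \<le> (\<Sum>j<J. v (Suc j) \<bullet> v (Suc j) + v j \<bullet> v j)"
    proof (rule sum_mono)
      fix j assume "j \<in> {..<J}"
      then show "2 * ?q i \<le> v (Suc j) \<bullet> v (Suc j) + v j \<bullet> v j"
        using i(2)[of j] i(2)[of "Suc j"] by (simp add: power2_norm_eq_inner)
    qed
    then show ?thesis using assms by (simp add: lump_def field_simps)
  qed
  have "?V \<le> (\<Sum>j<J. \<epsilon> * (real J * ((v (Suc j) - v j) \<bullet> (v (Suc j) - v j)))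
        + (1 / \<epsilon>) * ((v (Suc j) \<bullet> v (Suc j) + v j \<bullet> v j) / (2 * real J)))"
  proof (rule sum_mono)
    fix j
    let ?p = "v (Suc j)" and ?r = "v j"
    have "\<bar>?q (Suc j) - ?q j\<bar> = \<bar>(?p - ?r) \<bullet> (?p + ?r)\<bar>"
      by (simp add: power2_norm_eq_inner inner_simps inner_commute)
    also have "\<dots> \<le> \<epsilon> * real J * (norm (?p - ?r))\<^sup>2 + 1 / (4 * (\<epsilon> * real J)) * (norm (?p + ?r))\<^sup>2"
      using assms by (intro inner_young) simp
    also have "(norm (?p + ?r))\<^sup>2 \<le> 2 * ((norm ?p)\<^sup>2 + (norm ?r)\<^sup>2)"
      using zero_le_power2[of "norm (?p - ?r)"]
      by (simp add: power2_norm_eq_inner inner_simps inner_commute)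
    finally show "\<bar>?q (Suc j) - ?q j\<bar> \<le> \<epsilon> * (real J * ((?p - ?r) \<bullet> (?p - ?r))) + (1 / \<epsilon>) * ((?p \<bullet> ?p + ?r \<bullet> ?r) / (2 * real J))"
      using assms by (simp add: power2_norm_eq_inner field_simps)
  qed
  also have "\<dots> = \<epsilon> * stiff_sq J v + (1 / \<epsilon>) * lump_sq J v"
    by (simp add: sum.distrib sum_distrib_left[symmetric] sum_divide_distrib[symmetric] stiff_def lump_def)
  finally have V: "?V \<le> \<epsilon> * stiff_sq J v + (1 / \<epsilon>) * lump_sq J v" .
  have "?q k - ?q i \<le> ?V" using mono[of i k] mono[of k i] assms i(1) by (cases "i \<le> k") auto
  with low V show ?thesis by (simp add: algebra_simps)
qed

section \<open>The energy estimate\<close>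

text \<open>
  If \<open>a\<close>, \<open>b\<close>, \<open>c\<close> are the new, the present and the old iterate, then \<open>vbar\<close> is the iterate before
  filtering, \<open>bdf\<close> its difference to \<open>b\<close> and \<open>vhat\<close> the extrapolation from \<open>b\<close> and \<open>c\<close>. Up to the
  factor \<open>\<tau>\<close>, \<open>bdf\<close> is the second order backward difference quotient.
\<close>

definition bdf :: "(nat \<Rightarrow> 'a::real_vector) \<Rightarrow> (nat \<Rightarrow> 'a) \<Rightarrow> (nat \<Rightarrow> 'a) \<Rightarrow> nat \<Rightarrow> 'a" where
  "bdf a b c j = (3/2) *\<^sub>R a j - 2 *\<^sub>R b j + (1/2) *\<^sub>R c j"

definition vbar :: "(nat \<Rightarrow> 'a::real_vector) \<Rightarrow> (nat \<Rightarrow> 'a) \<Rightarrow> (nat \<Rightarrow> 'a) \<Rightarrow> nat \<Rightarrow> 'a" where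
  "vbar a b c j = (3/2) *\<^sub>R a j - b j + (1/2) *\<^sub>R c j"

definition vhat :: "(nat \<Rightarrow> 'a::real_vector) \<Rightarrow> (nat \<Rightarrow> 'a) \<Rightarrow> nat \<Rightarrow> 'a" where
  "vhat b c j = 2 *\<^sub>R b j - c j"

definition diff2 :: "(nat \<Rightarrow> 'a::real_vector) \<Rightarrow> (nat \<Rightarrow> 'a) \<Rightarrow> (nat \<Rightarrow> 'a) \<Rightarrow> nat \<Rightarrow> 'a" where
  "diff2 a b c j = a j - 2 *\<^sub>R b j + c j"

definition genergy :: "('v \<Rightarrow> 'v \<Rightarrow> real) \<Rightarrow> 'v \<Rightarrow> 'v \<Rightarrow> real" where
  "genergy f a b = (3 * f a a - 3 * f a b + f b b) / 2"

text \<open>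
  G-stability: with \<open>G(a, b) = (3\<bar>a\<bar>\<^sup>2 - 3 a\<bullet>b + \<bar>b\<bar>\<^sup>2) / 2\<close>, the product of \<open>vbar\<close> and \<open>bdf\<close> is an
  increment of \<open>G\<close> plus a nonnegative square. The same identity holds for every symmetric form.
\<close>

lemma stiff_bdf:
  "stiff J (vbar a b c) (bdf a b c) =
     genergy (stiff J) a b - genergy (stiff J) b c + 3/4 * stiff_sq J (diff2 a b c)"
  unfolding bdf_def[abs_def] vbar_def[abs_def] diff2_def[abs_def] genergy_def
  by (simp add: stiff_lin stiff_lin2 stiff_commute[of J b a] stiff_commute[of J c a] stiff_commute[of J c b]
      field_simps)

lemma lump_bdf:
  "lump J W (vbar a b c) (bdf a b c) =
     genergy (lump J W) a b - genergy (lump J W) b c + 3/4 * lump J W (diff2 a b c) (diff2 a b c)"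
  unfolding bdf_def[abs_def] vbar_def[abs_def] diff2_def[abs_def] genergy_def
  by (simp add: lump_lin lump_lin2 lump_commute[of J W b a] lump_commute[of J W c a] lump_commute[of J W c b]
      field_simps)

text \<open>
  For the extrapolation in place of \<open>vbar\<close> the quadratic form is no longer definite, which is harmless
  for the boundary terms to which the identity is applied: only the increment structure matters, and
  the remaining square is controlled by the squares in the other two identities.
\<close>

lemma bilinear_bdf:
  fixes S :: "'a::real_normed_vector \<Rightarrow> 'a \<Rightarrow> real"
  assumes "bounded_bilinear S" and sym: "\<And>u v. S u v = S v u"
  shows "S (vhat b c k) (bdf a b c k) =
    (3/4 * S (a k) (a k) - 1/4 * S (b k) (b k)) - (3/4 * S (b k) (b k) - 1/4 * S (c k) (c k))
     - 3/4 * S (diff2 a b c k) (diff2 a b c k)"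
proof -
  interpret bounded_bilinear S by fact
  show ?thesis
    unfolding bdf_def vhat_def diff2_def
    by (simp add: add_left add_right diff_left diff_right scaleR_left scaleR_right
         sym[of "b k" "a k"] sym[of "c k" "a k"] sym[of "c k" "b k"] field_simps)
qed

text \<open>
  The matrix of \<open>G\<close> has eigenvalues \<open>1 \<plusminus> \<surd>13 / 4\<close>, both between \<open>1/12\<close> and \<open>3\<close>.
\<close>

lemma stiff_genergy_bounds:
  "(stiff_sq J a + stiff_sq J b) / 12 \<le> genergy (stiff J) a b"
  "genergy (stiff J) a b \<le> 3 * (stiff_sq J a + stiff_sq J b)"
proof -
  have "0 \<le> stiff_sq J (\<lambda>j. b j - (9/5) *\<^sub>R a j)" "0 \<le> stiff_sq J (\<lambda>j. a j + b j)"
    by (rule stiff_sq_nonneg)+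
  then show "(stiff_sq J a + stiff_sq J b) / 12 \<le> genergy (stiff J) a b"
    "genergy (stiff J) a b \<le> 3 * (stiff_sq J a + stiff_sq J b)"
    using stiff_sq_nonneg[of J a] stiff_sq_nonneg[of J b] unfolding genergy_def
    by (simp_all add: stiff_lin stiff_lin2 stiff_commute[of J b a] field_simps)
qed

lemma lump_genergy_bounds:
  "(lump_sq J a + lump_sq J b) / 12 \<le> genergy (lump J (\<lambda>_. 1)) a b"
  "genergy (lump J (\<lambda>_. 1)) a b \<le> 3 * (lump_sq J a + lump_sq J b)"
proof -
  have "0 \<le> lump_sq J (\<lambda>j. b j - (9/5) *\<^sub>R a j)" "0 \<le> lump_sq J (\<lambda>j. a j + b j)"
    by (rule lump_sq_nonneg)+
  then show "(lump_sq J a + lump_sq J b) / 12 \<le> genergy (lump J (\<lambda>_. 1)) a b"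
    "genergy (lump J (\<lambda>_. 1)) a b \<le> 3 * (lump_sq J a + lump_sq J b)"
    using lump_sq_nonneg[of J a] lump_sq_nonneg[of J b] unfolding genergy_def
    by (simp_all add: lump_lin lump_lin2 lump_commute[of J _ b a] field_simps)
qed

lemma norm_sq_combination2:
  fixes u v :: "'a::real_inner"
  shows "(norm (p *\<^sub>R u + q *\<^sub>R v))\<^sup>2 \<le> 2 * (p\<^sup>2 * (norm u)\<^sup>2 + q\<^sup>2 * (norm v)\<^sup>2)"
proof -
  have "0 \<le> (norm (p *\<^sub>R u - q *\<^sub>R v))\<^sup>2" by simp
  then show ?thesis
    by (simp only: power2_norm_eq_inner) (simp add: inner_simps inner_commute power2_eq_square algebra_simps)
qed

lemma norm_sq_extrapolation:
  fixes u v :: "'a::real_inner"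
  shows "(norm ((3/2) *\<^sub>R u - (1/2) *\<^sub>R v))\<^sup>2 \<le> 9/2 * (norm u)\<^sup>2 + 1/2 * (norm v)\<^sup>2"
  using norm_sq_combination2[of "3/2" u "-1/2" v] by (simp add: power2_eq_square)

lemma h1_sq_vhat: "h1_sq J (vhat b c) \<le> 8 * h1_sq J b + 2 * h1_sq J c"
proof -
  have "0 \<le> h1_sq J (\<lambda>j. 2 *\<^sub>R b j + c j)" by (rule h1_sq_nonneg)
  then show ?thesis
    unfolding h1_sq_def vhat_def[abs_def]
    by (simp add: stiff_lin stiff_lin2 lump_lin lump_lin2 stiff_commute[of J c b] lump_commute[of J _ c b])
qed

lemma h1_sq_vbar: "h1_sq J (vbar a b c) \<le> 7 * (h1_sq J a + h1_sq J b + h1_sq J c)"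
proof -
  have "0 \<le> h1_sq J (\<lambda>j. (3/2) *\<^sub>R a j + b j)" "0 \<le> h1_sq J (\<lambda>j. (3/2) *\<^sub>R a j - (1/2) *\<^sub>R c j)"
    "0 \<le> h1_sq J (\<lambda>j. b j + (1/2) *\<^sub>R c j)" "0 \<le> h1_sq J a" "0 \<le> h1_sq J b" "0 \<le> h1_sq J c"
    by (rule h1_sq_nonneg)+
  then show ?thesis
    unfolding h1_sq_def vbar_def[abs_def]
    by (simp add: stiff_lin stiff_lin2 lump_lin lump_lin2 stiff_commute[of J c b] lump_commute[of J _ c b]
       stiff_commute[of J c a] lump_commute[of J _ c a] stiff_commute[of J b a] lump_commute[of J _ b a] field_simps)
qed

lemma trace_h1:
  assumes "0 < J" "k \<le> J"
  shows "(norm (v k))\<^sup>2 \<le> 2 * h1_sq J v"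
  using trace_inequality[of 1 J k v] assms stiff_sq_nonneg[of J v] by (simp add: h1_sq_def)

text \<open>
  The boundary terms of the error equation, written as a function of two successive errors so that
  their contribution to one time step is an increment: \<open>bdf a b c\<close> is the difference of
  \<open>3/2 a - 1/2 b\<close> and \<open>3/2 b - 1/2 c\<close>, which handles the linear part, and \<open>bilinear_bdf\<close> handles the
  quadratic part.
\<close>

definition bd_energy :: "nat set \<Rightarrow> (nat \<Rightarrow> 'a::real_inner) \<Rightarrow> (nat \<Rightarrow> 'a \<Rightarrow> 'a \<Rightarrow> real) \<Rightarrow>
    (nat \<Rightarrow> 'a) \<Rightarrow> (nat \<Rightarrow> 'a) \<Rightarrow> real" where
  "bd_energy bd \<beta> S a b = (\<Sum>k\<in>bd. \<beta> k \<bullet> ((3/2) *\<^sub>R a k - (1/2) *\<^sub>R b k)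
      + 3/4 * S k (a k) (a k) - 1/4 * S k (b k) (b k))"

text \<open>
  The lumped \<open>L\<^sup>2\<close> part is given a large factor and \<open>D\<^sup>2\<close> is added in order to dominate \<open>bd_energy\<close>.
\<close>

definition energy :: "nat \<Rightarrow> nat set \<Rightarrow> real \<Rightarrow> real \<Rightarrow> (nat \<Rightarrow> 'a::real_inner) \<Rightarrow>
    (nat \<Rightarrow> 'a \<Rightarrow> 'a \<Rightarrow> real) \<Rightarrow> (nat \<Rightarrow> 'a) \<Rightarrow> (nat \<Rightarrow> 'a) \<Rightarrow> real" where
  "energy J bd \<Lambda> D \<beta> S a b = genergy (stiff J) a b + 5000 * \<Lambda>\<^sup>2 * genergy (lump J (\<lambda>_. 1)) a b
      - bd_energy bd \<beta> S a b + 2 * \<Lambda>\<^sup>2 * D\<^sup>2"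

lemma sum_boundary_le:
  fixes f :: "nat \<Rightarrow> real"
  assumes "bd \<subseteq> {0, J}" "\<And>k. k \<in> bd \<Longrightarrow> f k \<le> B" "0 \<le> B"
  shows "(\<Sum>k\<in>bd. f k) \<le> 2 * B"
proof -
  have "card bd \<le> card {0, J}" using assms(1) by (intro card_mono) auto
  also have "\<dots> \<le> 2" by (simp add: card_insert_if)
  finally have c: "real (card bd) \<le> 2" by simp
  have "(\<Sum>k\<in>bd. f k) \<le> real (card bd) * B" using assms(2) by (intro sum_bounded_above) auto
  also have "\<dots> \<le> 2 * B" using c assms(3) by (intro mult_right_mono)
  finally show ?thesis .
qed

lemma trace_scaled:
  assumes "1 \<le> \<Lambda>" "0 < J" "k \<le> J"
  shows "\<Lambda> * (norm (v k))\<^sup>2 \<le> stiff_sq J v / 96 + 97 * \<Lambda>\<^sup>2 * lump_sq J v"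
proof -
  have "\<Lambda> * (norm (v k))\<^sup>2 \<le> \<Lambda> * (1 / (96 * \<Lambda>) * stiff_sq J v + (1 + 1 / (1 / (96 * \<Lambda>))) * lump_sq J v)"
    using assms trace_inequality[of "1 / (96 * \<Lambda>)" J k v] by (intro mult_left_mono) auto
  also have "\<dots> = stiff_sq J v / 96 + (\<Lambda> + 96 * \<Lambda>\<^sup>2) * lump_sq J v"
    using assms by (simp add: field_simps power2_eq_square)
  also have "\<dots> \<le> stiff_sq J v / 96 + 97 * \<Lambda>\<^sup>2 * lump_sq J v"
    using assms self_le_power[of \<Lambda> 2] by (intro add_left_mono mult_right_mono lump_sq_nonneg) auto
  finally show ?thesis .
qed

text \<open>
  The trace inequality with a small parameter of size \<open>1/\<Lambda>\<close> bounds the boundary terms by a fraction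
  of the stiffness norm and a large multiple, of order \<open>\<Lambda>\<^sup>2\<close>, of the lumped norm. The constants match
  those in \<open>energy\<close>.
\<close>

lemma bd_energy_bound:
  assumes "1 \<le> \<Lambda>" "0 < J" "bd \<subseteq> {0, J}" "0 \<le> D"
    and \<beta>: "\<And>k. k \<in> bd \<Longrightarrow> norm (\<beta> k) \<le> \<Lambda> * D"
    and S: "\<And>k u v. k \<in> bd \<Longrightarrow> \<bar>S k u v\<bar> \<le> \<Lambda> * norm u * norm v"
  shows "\<bar>bd_energy bd \<beta> S a b\<bar> \<le> 2 * \<Lambda>\<^sup>2 * D\<^sup>2 + (stiff_sq J a + stiff_sq J b) / 24
      + 388 * \<Lambda>\<^sup>2 * (lump_sq J a + lump_sq J b)"
proof -
  let ?t = "\<lambda>k. \<beta> k \<bullet> ((3/2) *\<^sub>R a k - (1/2) *\<^sub>R b k) + 3/4 * S k (a k) (a k) - 1/4 * S k (b k) (b k)"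
  let ?B = "\<Lambda>\<^sup>2 * D\<^sup>2 + (stiff_sq J a + stiff_sq J b) / 48 + 194 * \<Lambda>\<^sup>2 * (lump_sq J a + lump_sq J b)"
  have "\<bar>?t k\<bar> \<le> ?B" if k: "k \<in> bd" for k
  proof -
    have "k \<le> J" using k assms(3) by auto
    note tr = trace_scaled[OF assms(1,2) this, of a] trace_scaled[OF assms(1,2) this, of b]
    have "\<bar>\<beta> k \<bullet> ((3/2) *\<^sub>R a k - (1/2) *\<^sub>R b k)\<bar> \<le> 1 * (norm (\<beta> k))\<^sup>2 + (1 / (4 * 1)) * (norm ((3/2) *\<^sub>R a k - (1/2) *\<^sub>R b k))\<^sup>2"
      by (rule inner_young) simp
    also have "(norm (\<beta> k))\<^sup>2 \<le> \<Lambda>\<^sup>2 * D\<^sup>2"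
      using \<beta>[OF k] by (metis norm_ge_zero power_mono power_mult_distrib)
    also have "(norm ((3/2) *\<^sub>R a k - (1/2) *\<^sub>R b k))\<^sup>2 \<le> 5 * ((norm (a k))\<^sup>2 + (norm (b k))\<^sup>2)"
      using norm_sq_extrapolation[of "a k" "b k"] zero_le_power2[of "norm (a k)"] zero_le_power2[of "norm (b k)"]
      unfolding distrib_left by linarith
    finally have 1: "\<bar>\<beta> k \<bullet> ((3/2) *\<^sub>R a k - (1/2) *\<^sub>R b k)\<bar> \<le> \<Lambda>\<^sup>2 * D\<^sup>2 + 5/4 * ((norm (a k))\<^sup>2 + (norm (b k))\<^sup>2)"
      by simp
    have 2: "\<bar>S k (a k) (a k)\<bar> \<le> \<Lambda> * (norm (a k))\<^sup>2" "\<bar>S k (b k) (b k)\<bar> \<le> \<Lambda> * (norm (b k))\<^sup>2"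
      using S[OF k, of "a k" "a k"] S[OF k, of "b k" "b k"] by (simp_all add: power2_eq_square mult.assoc)
    have 3: "(norm (a k))\<^sup>2 \<le> \<Lambda> * (norm (a k))\<^sup>2" "(norm (b k))\<^sup>2 \<le> \<Lambda> * (norm (b k))\<^sup>2"
      using assms(1) mult_right_mono[of 1 \<Lambda> "(norm (a k))\<^sup>2"] mult_right_mono[of 1 \<Lambda> "(norm (b k))\<^sup>2"] by auto
    have "\<bar>?t k\<bar> \<le> \<Lambda>\<^sup>2 * D\<^sup>2 + 2 * (\<Lambda> * (norm (a k))\<^sup>2 + \<Lambda> * (norm (b k))\<^sup>2)"
      using 1 2 3 unfolding distrib_left by linarith
    also have "\<dots> \<le> ?B"
      using tr unfolding distrib_left mult.assoc add_divide_distrib by linarith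
    finally show ?thesis .
  qed
  then have "(\<Sum>k\<in>bd. \<bar>?t k\<bar>) \<le> 2 * ?B"
    using stiff_sq_nonneg[of J a] stiff_sq_nonneg[of J b] lump_sq_nonneg[of J a] lump_sq_nonneg[of J b]
    by (intro sum_boundary_le[OF assms(3)]) auto
  moreover have "\<bar>bd_energy bd \<beta> S a b\<bar> \<le> (\<Sum>k\<in>bd. \<bar>?t k\<bar>)"
    unfolding bd_energy_def by (rule sum_abs)
  ultimately show ?thesis unfolding distrib_left mult.assoc add_divide_distrib by linarith
qed

lemma energy_bounds:
  assumes "1 \<le> \<Lambda>" "0 < J" "bd \<subseteq> {0, J}" "0 \<le> D"
    and \<beta>: "\<And>k. k \<in> bd \<Longrightarrow> norm (\<beta> k) \<le> \<Lambda> * D"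
    and S: "\<And>k u v. k \<in> bd \<Longrightarrow> \<bar>S k u v\<bar> \<le> \<Lambda> * norm u * norm v"
  shows "(h1_sq J a + h1_sq J b) / 24 \<le> energy J bd \<Lambda> D \<beta> S a b"
    and "energy J bd \<Lambda> D \<beta> S a b \<le> 16000 * \<Lambda>\<^sup>2 * (h1_sq J a + h1_sq J b) + 4 * \<Lambda>\<^sup>2 * D\<^sup>2"
proof -
  define n1 where "n1 = stiff_sq J a + stiff_sq J b"
  define n0 where "n0 = lump_sq J a + lump_sq J b"
  have n: "0 \<le> n1" "0 \<le> n0"
    using stiff_sq_nonneg[of J a] stiff_sq_nonneg[of J b] lump_sq_nonneg[of J a] lump_sq_nonneg[of J b]
    by (auto simp: n0_def n1_def)
  have L: "1 \<le> \<Lambda>\<^sup>2" using assms(1) by simp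
  have b: "\<bar>bd_energy bd \<beta> S a b\<bar> \<le> 2 * \<Lambda>\<^sup>2 * D\<^sup>2 + n1 / 24 + 388 * \<Lambda>\<^sup>2 * n0"
    unfolding n0_def n1_def by (rule bd_energy_bound[OF assms])
  have g: "\<Lambda>\<^sup>2 * (n0 / 12) \<le> \<Lambda>\<^sup>2 * genergy (lump J (\<lambda>_. 1)) a b"
    "\<Lambda>\<^sup>2 * genergy (lump J (\<lambda>_. 1)) a b \<le> \<Lambda>\<^sup>2 * (3 * n0)"
    using lump_genergy_bounds[of J a b] unfolding n0_def by (intro mult_left_mono; simp)+
  have p: "n0 \<le> \<Lambda>\<^sup>2 * n0" "n1 \<le> \<Lambda>\<^sup>2 * n1"
    using mult_right_mono[OF L n(2)] mult_right_mono[OF L n(1)] by auto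
  have gs: "n1 / 12 \<le> genergy (stiff J) a b" "genergy (stiff J) a b \<le> 3 * n1"
    using stiff_genergy_bounds[of J a b] unfolding n1_def by auto
  have e: "(h1_sq J a + h1_sq J b) = n1 + n0" by (simp add: h1_sq_def n0_def n1_def)
  show "(h1_sq J a + h1_sq J b) / 24 \<le> energy J bd \<Lambda> D \<beta> S a b"
    unfolding e energy_def using b g(1) p(1) gs(1) n(2) unfolding mult.assoc times_divide_eq_right add_divide_distrib by linarith
  show "energy J bd \<Lambda> D \<beta> S a b \<le> 16000 * \<Lambda>\<^sup>2 * (h1_sq J a + h1_sq J b) + 4 * \<Lambda>\<^sup>2 * D\<^sup>2"
    unfolding e energy_def using b g(2) p gs(2) n unfolding mult.assoc distrib_left by linarith
qed

text \<open>
  Subtracting the affine lifting of the normal components at the two ends makes a nodal vector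
  admissible as a test vector, at a cost controlled by the size of these components.
\<close>

definition bd_lift :: "nat \<Rightarrow> (nat \<Rightarrow> 'a::real_vector) \<Rightarrow> nat \<Rightarrow> 'a" where
  "bd_lift J p j = (1 - real j / real J) *\<^sub>R p 0 + (real j / real J) *\<^sub>R p J"

lemma bd_lift_node: "0 < J \<Longrightarrow> k \<in> {0, J} \<Longrightarrow> bd_lift J p k = p k"
  by (auto simp: bd_lift_def)

lemma bd_lift_bounds:
  assumes "0 < J"
  shows "lump_sq J (bd_lift J p) \<le> 2 * ((norm (p 0))\<^sup>2 + (norm (p J))\<^sup>2)"
    and "stiff_sq J (bd_lift J p) \<le> 2 * ((norm (p 0))\<^sup>2 + (norm (p J))\<^sup>2)"
proof -
  let ?P = "(norm (p 0))\<^sup>2 + (norm (p J))\<^sup>2"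
  have n: "bd_lift J p j \<bullet> bd_lift J p j \<le> 2 * ?P" if "j \<le> J" for j
  proof -
    let ?s = "real j / real J"
    have s: "0 \<le> ?s" "?s \<le> 1" using that assms by auto
    have "bd_lift J p j \<bullet> bd_lift J p j \<le> 2 * ((1 - ?s)\<^sup>2 * (norm (p 0))\<^sup>2 + ?s\<^sup>2 * (norm (p J))\<^sup>2)"
      using norm_sq_combination2[of "1 - ?s" "p 0" ?s "p J"] by (simp add: bd_lift_def power2_norm_eq_inner)
    also have "\<dots> \<le> 2 * (1 * (norm (p 0))\<^sup>2 + 1 * (norm (p J))\<^sup>2)"
      using s by (intro mult_left_mono add_mono mult_right_mono) (auto simp: power_le_one)
    finally show ?thesis by simp
  qed
  have "(\<Sum>j<J. 1 * (bd_lift J p (Suc j) \<bullet> bd_lift J p (Suc j) + bd_lift J p j \<bullet> bd_lift J p j))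
     \<le> (\<Sum>j<J. 4 * ?P)"
  proof (rule sum_mono)
    fix j assume "j \<in> {..<J}"
    then show "1 * (bd_lift J p (Suc j) \<bullet> bd_lift J p (Suc j) + bd_lift J p j \<bullet> bd_lift J p j) \<le> 4 * ?P"
      using n[of "Suc j"] n[of j] by simp
  qed
  then show "lump_sq J (bd_lift J p) \<le> 2 * ?P"
    using assms by (simp add: lump_def field_simps)
  have d: "bd_lift J p (Suc j) - bd_lift J p j = (1 / real J) *\<^sub>R (p J - p 0)" for j
    by (simp add: bd_lift_def algebra_simps add_divide_distrib)
  have "stiff_sq J (bd_lift J p) = (norm (p J - p 0))\<^sup>2"
    using assms unfolding stiff_def d by (simp add: power2_norm_eq_inner)
  also have "\<dots> \<le> 2 * ?P"
    using norm_sq_combination2[of 1 "p J" "-1" "p 0"] by simp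
  finally show "stiff_sq J (bd_lift J p) \<le> 2 * ?P" .
qed

text \<open>
  The coefficients of the boundary energy vary slowly in time, so replacing them by those of the next
  time level costs only \<open>O(\<tau>)\<close> times the squared error.
\<close>

lemma bd_energy_change:
  assumes "1 \<le> \<Lambda>" "0 < J" "bd \<subseteq> {0, J}" "0 \<le> D" "0 \<le> \<tau>"
    and \<beta>: "\<And>k. k \<in> bd \<Longrightarrow> norm (\<beta>' k - \<beta> k) \<le> \<Lambda> * \<tau> * D"
    and S: "\<And>k u v. k \<in> bd \<Longrightarrow> \<bar>S' k u v - S k u v\<bar> \<le> \<Lambda> * \<tau> * norm u * norm v"
  shows "\<bar>bd_energy bd \<beta>' S' b c - bd_energy bd \<beta> S b c\<bar> \<le> \<tau> * (12 * \<Lambda> * (h1_sq J b + h1_sq J c + D\<^sup>2))"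
proof -
  let ?p = "\<lambda>k. (3/2) *\<^sub>R b k - (1/2) *\<^sub>R c k"
  let ?t = "\<lambda>k. (\<beta>' k - \<beta> k) \<bullet> ?p k + 3/4 * (S' k (b k) (b k) - S k (b k) (b k)) - 1/4 * (S' k (c k) (c k) - S k (c k) (c k))"
  let ?N = "h1_sq J b + h1_sq J c"
  have lt: "0 \<le> \<Lambda> * \<tau>" using assms by simp
  have "\<bar>?t k\<bar> \<le> \<Lambda> * \<tau> * (6 * ?N + D\<^sup>2)" if k: "k \<in> bd" for k
  proof -
    have "k \<le> J" using k assms(3) by auto
    note tr = trace_h1[OF assms(2) this, of b] trace_h1[OF assms(2) this, of c]
    have "\<bar>(\<beta>' k - \<beta> k) \<bullet> ?p k\<bar> \<le> norm (\<beta>' k - \<beta> k) * norm (?p k)" by (rule Cauchy_Schwarz_ineq2)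
    also have "\<dots> \<le> (\<Lambda> * \<tau> * D) * norm (?p k)" using \<beta>[OF k] by (intro mult_right_mono) auto
    also have "\<dots> = \<Lambda> * \<tau> * (D * norm (?p k))" by simp
    also have "\<dots> \<le> \<Lambda> * \<tau> * (1/2 * D\<^sup>2 + 1/2 * (norm (?p k))\<^sup>2)"
      using real_young[of "1/2" D "norm (?p k)"] lt by (intro mult_left_mono) auto
    also have "\<dots> \<le> \<Lambda> * \<tau> * (D\<^sup>2 + 9/4 * ((norm (b k))\<^sup>2 + (norm (c k))\<^sup>2))"
    proof (intro mult_left_mono lt)
      show "1/2 * D\<^sup>2 + 1/2 * (norm (?p k))\<^sup>2 \<le> D\<^sup>2 + 9/4 * ((norm (b k))\<^sup>2 + (norm (c k))\<^sup>2)"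
        using norm_sq_extrapolation[of "b k" "c k"] zero_le_power2[of D] zero_le_power2[of "norm (c k)"] unfolding distrib_left by linarith
    qed
    finally have 1: "\<bar>(\<beta>' k - \<beta> k) \<bullet> ?p k\<bar> \<le> \<Lambda> * \<tau> * (D\<^sup>2 + 9/4 * ((norm (b k))\<^sup>2 + (norm (c k))\<^sup>2))" .
    have 2: "\<bar>S' k (b k) (b k) - S k (b k) (b k)\<bar> \<le> \<Lambda> * \<tau> * (norm (b k))\<^sup>2"
      "\<bar>S' k (c k) (c k) - S k (c k) (c k)\<bar> \<le> \<Lambda> * \<tau> * (norm (c k))\<^sup>2"
      using S[OF k, of "b k" "b k"] S[OF k, of "c k" "c k"] by (simp_all add: power2_eq_square mult.assoc)
    have "\<bar>?t k\<bar> \<le> \<Lambda> * \<tau> * (D\<^sup>2 + 9/4 * ((norm (b k))\<^sup>2 + (norm (c k))\<^sup>2)) + 3/4 * (\<Lambda> * \<tau> * (norm (b k))\<^sup>2)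
       + 1/4 * (\<Lambda> * \<tau> * (norm (c k))\<^sup>2)"
      using 1 2 unfolding right_diff_distrib by linarith
    also have "\<dots> = \<Lambda> * \<tau> * (D\<^sup>2 + 3 * (norm (b k))\<^sup>2 + 5/2 * (norm (c k))\<^sup>2)"
      by (simp add: algebra_simps)
    also have "\<dots> \<le> \<Lambda> * \<tau> * (6 * ?N + D\<^sup>2)"
    proof (intro mult_left_mono lt)
      show "D\<^sup>2 + 3 * (norm (b k))\<^sup>2 + 5/2 * (norm (c k))\<^sup>2 \<le> 6 * ?N + D\<^sup>2"
        using tr h1_sq_nonneg[of J c] unfolding distrib_left by linarith
    qed
    finally show ?thesis .
  qed
  then have "(\<Sum>k\<in>bd. \<bar>?t k\<bar>) \<le> 2 * (\<Lambda> * \<tau> * (6 * ?N + D\<^sup>2))"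
    using h1_sq_nonneg[of J b] h1_sq_nonneg[of J c] lt
    by (intro sum_boundary_le[OF assms(3)]) auto
  also have "\<dots> \<le> \<tau> * (12 * \<Lambda> * (?N + D\<^sup>2))"
    using mult_left_mono[OF zero_le_power2[of D] lt] by (simp add: algebra_simps)
  finally have *: "(\<Sum>k\<in>bd. \<bar>?t k\<bar>) \<le> \<tau> * (12 * \<Lambda> * (?N + D\<^sup>2))" .
  have "bd_energy bd \<beta>' S' b c - bd_energy bd \<beta> S b c = (\<Sum>k\<in>bd. ?t k)"
    by (simp add: bd_energy_def sum_subtractf[symmetric] algebra_simps)
  then show ?thesis using * sum_abs[of ?t bd] by (simp only:)
qed

text \<open>
  One step of the energy estimate, for arbitrary data with the required structure: weights bounded
  above and below, an error equation with residual \<open>R\<close> on the admissible test vectors, a small normal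
  component of the velocity error, and a residual consisting of a part bounded in the lumped norm and
  boundary terms of the form treated by \<open>bd_energy\<close>. The product of \<open>vbar\<close> with the velocity yields the
  increment of the stiffness energy. The increment of the lumped energy is bounded by Young's
  inequality, because \<open>bdf\<close> is \<open>\<tau>\<close> times the velocity.
\<close>

lemma energy_step:
  fixes a b c g :: "nat \<Rightarrow> 'a::real_inner"
  assumes \<Lambda>: "1 \<le> \<Lambda>" and J: "0 < J" and bd: "bd \<subseteq> {0, J}" and D: "0 \<le> D" and \<tau>: "0 < \<tau>"
    and W: "\<And>j. j < J \<Longrightarrow> 1 / \<Lambda> \<le> W j \<and> W j \<le> \<Lambda>"
    and closed: "cl \<Longrightarrow> bd = {} \<and> a 0 = a J \<and> b 0 = b J \<and> c 0 = c J"
    and err: "\<And>\<eta>. (\<forall>k\<in>bd. \<eta> k \<bullet> g k = 0) \<Longrightarrow> (cl \<longrightarrow> \<eta> 0 = \<eta> J) \<Longrightarrow>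
        lump J W (\<lambda>j. (1 / \<tau>) *\<^sub>R bdf a b c j) \<eta> + stiff J (vbar a b c) \<eta> = R \<eta>"
    and g: "\<And>k. k \<in> bd \<Longrightarrow> 1 / 2 \<le> norm (g k)"
    and tangential: "\<And>k. k \<in> bd \<Longrightarrow> \<bar>((1 / \<tau>) *\<^sub>R bdf a b c k) \<bullet> g k\<bar> \<le> \<Lambda> * (D + norm (vhat b c k))"
    and cons: "\<And>\<eta>. (\<forall>k\<in>bd. \<eta> k \<bullet> g k = 0) \<Longrightarrow> (cl \<longrightarrow> \<eta> 0 = \<eta> J) \<Longrightarrow>
        R \<eta> \<le> (\<Sum>k\<in>bd. \<beta>' k \<bullet> \<eta> k + S' k (vhat b c k) (\<eta> k))
           + \<Lambda> * (D + sqrt (h1_sq J (vhat b c))) * sqrt (lump_sq J \<eta>)"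
    and \<beta>': "\<And>k. k \<in> bd \<Longrightarrow> norm (\<beta>' k) \<le> \<Lambda> * D"
    and \<beta>: "\<And>k. k \<in> bd \<Longrightarrow> norm (\<beta>' k - \<beta> k) \<le> \<Lambda> * \<tau> * D"
    and S': "\<And>k. k \<in> bd \<Longrightarrow> bounded_bilinear (S' k)" "\<And>k u v. k \<in> bd \<Longrightarrow> S' k u v = S' k v u"
       "\<And>k u v. k \<in> bd \<Longrightarrow> \<bar>S' k u v\<bar> \<le> \<Lambda> * norm u * norm v"
    and S: "\<And>k u v. k \<in> bd \<Longrightarrow> \<bar>S' k u v - S k u v\<bar> \<le> \<Lambda> * \<tau> * norm u * norm v"
  shows "energy J bd \<Lambda> D \<beta>' S' a b \<le> energy J bd \<Lambda> D \<beta> S b c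
     + \<tau> * (10 ^ 9 * \<Lambda> ^ 5 * (h1_sq J a + h1_sq J b + h1_sq J c + D\<^sup>2))"
proof -
  define d where "d = bdf a b c"
  define dd where "dd = (\<lambda>j. (1 / \<tau>) *\<^sub>R d j)"
  define e where "e = vbar a b c"
  define z where "z = vhat b c"
  define d2 where "d2 = diff2 a b c"
  define E where "E = h1_sq J a + h1_sq J b + h1_sq J c + D\<^sup>2"
  define X where "X = lump_sq J dd"
  have hn: "0 \<le> h1_sq J a" "0 \<le> h1_sq J b" "0 \<le> h1_sq J c" by (rule h1_sq_nonneg)+
  have E: "0 \<le> E" using hn by (simp add: E_def)
  have X: "0 \<le> X" unfolding X_def by (rule lump_sq_nonneg)
  have L: "\<Lambda> ^ i * E \<le> \<Lambda> ^ 5 * E" if "i \<le> 5" for i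
    using that \<Lambda> E by (intro mult_right_mono power_increasing) auto
  have d: "d j = \<tau> *\<^sub>R dd j" for j using \<tau> by (simp add: dd_def)
  have hz: "h1_sq J z \<le> 8 * E"
  proof -
    have "h1_sq J z \<le> 8 * h1_sq J b + 2 * h1_sq J c" unfolding z_def by (rule h1_sq_vhat)
    then show ?thesis using hn zero_le_power2[of D] unfolding E_def distrib_left by linarith
  qed
  have he: "h1_sq J e \<le> 7 * E"
  proof -
    have "h1_sq J e \<le> 7 * (h1_sq J a + h1_sq J b + h1_sq J c)" unfolding e_def by (rule h1_sq_vbar)
    then show ?thesis using zero_le_power2[of D] unfolding E_def distrib_left by linarith
  qed
  have DE: "D\<^sup>2 \<le> E" using hn by (simp add: E_def)
  have zk: "(norm (z k))\<^sup>2 \<le> 16 * E" if "k \<in> bd" for k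
    using trace_h1[OF J, of k z] hz that bd by auto
  have Dz: "(D + norm (z k))\<^sup>2 \<le> 34 * E" if "k \<in> bd" for k
  proof -
    have "(D + norm (z k))\<^sup>2 \<le> 2 * (D\<^sup>2 + (norm (z k))\<^sup>2)"
      using zero_le_power2[of "D - norm (z k)"] by (simp add: power2_sum power2_diff)
    then show ?thesis using zk[OF that] DE unfolding distrib_left by linarith
  qed
  (* The test vector is the discrete velocity dd minus the lifting psi of its normal components at
     the end points, which are small by the hypothesis on the constraint. *)
  define q where "q k = (if k \<in> bd then (dd k \<bullet> g k / (norm (g k))\<^sup>2) *\<^sub>R g k else 0)" for k
  define \<psi> where "\<psi> = bd_lift J q"
  define \<eta> where "\<eta> = (\<lambda>j. dd j - \<psi> j)"
  have q1: "norm (q k) \<le> 2 * \<Lambda> * (D + norm (z k))" if k: "k \<in> bd" for k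
  proof -
    have gp: "0 < norm (g k)" using g[OF k] by linarith
    have "norm (q k) = \<bar>dd k \<bullet> g k\<bar> / norm (g k)"
      using k gp by (simp add: q_def power2_eq_square)
    also have "\<dots> \<le> \<bar>dd k \<bullet> g k\<bar> * 2"
      using g[OF k] gp mult_left_mono[of 1 "2 * norm (g k)" "\<bar>dd k \<bullet> g k\<bar>"] by (simp add: pos_divide_le_eq mult_ac)
    also have "\<dots> \<le> \<Lambda> * (D + norm (z k)) * 2"
      using tangential[OF k] unfolding dd_def d_def z_def by (intro mult_right_mono) auto
    finally show ?thesis by simp
  qed
  have q2: "(norm (q k))\<^sup>2 \<le> 136 * \<Lambda>\<^sup>2 * E" for k
  proof (cases "k \<in> bd")
    case True
    have "(norm (q k))\<^sup>2 \<le> (2 * \<Lambda> * (D + norm (z k)))\<^sup>2"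
      using q1[OF True] by (intro power_mono) auto
    also have "\<dots> = 4 * \<Lambda>\<^sup>2 * (D + norm (z k))\<^sup>2" by (simp add: power_mult_distrib)
    also have "\<dots> \<le> 4 * \<Lambda>\<^sup>2 * (34 * E)" using Dz[OF True] by (intro mult_left_mono) auto
    finally show ?thesis by simp
  qed (use E in \<open>simp add: q_def\<close>)
  have \<psi>0: "lump_sq J \<psi> \<le> 544 * \<Lambda>\<^sup>2 * E" and \<psi>1: "stiff_sq J \<psi> \<le> 544 * \<Lambda>\<^sup>2 * E"
    using bd_lift_bounds[OF J, of q] q2[of 0] q2[of J] by (simp_all add: \<psi>_def)
  have \<psi>k: "\<psi> k = q k" if "k \<in> bd" for k
    using that bd J by (auto simp: \<psi>_def bd_lift_node)
  have adm: "\<forall>k\<in>bd. \<eta> k \<bullet> g k = 0" "cl \<longrightarrow> \<eta> 0 = \<eta> J"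
  proof -
    show "\<forall>k\<in>bd. \<eta> k \<bullet> g k = 0"
    proof
      fix k assume k: "k \<in> bd"
      then have "g k \<noteq> 0" using g[OF k] by auto
      then show "\<eta> k \<bullet> g k = 0" using k
        by (simp add: \<eta>_def \<psi>k q_def inner_diff_left power2_norm_eq_inner)
    qed
    show "cl \<longrightarrow> \<eta> 0 = \<eta> J"
      using closed by (auto simp: \<eta>_def \<psi>_def bd_lift_def q_def dd_def d_def bdf_def)
  qed
  have eq: "lump J W dd dd + stiff J e dd = lump J W dd \<psi> + stiff J e \<psi> + R \<eta>"
    using err[OF adm] by (simp add: \<eta>_def lump_lin2 stiff_lin2 dd_def[symmetric] d_def[symmetric] e_def[symmetric])
  have W': "\<bar>W j\<bar> \<le> \<Lambda>" if "j < J" for j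
  proof -
    have "0 < 1 / \<Lambda>" using \<Lambda> by simp
    then show ?thesis using W[OF that] by linarith
  qed
  have lower: "X / \<Lambda> \<le> lump J W dd dd"
  proof -
    have "(1 / \<Lambda>) * (\<Sum>j<J. 1 * (dd (Suc j) \<bullet> dd (Suc j) + dd j \<bullet> dd j)) \<le> (\<Sum>j<J. W j * (dd (Suc j) \<bullet> dd (Suc j) + dd j \<bullet> dd j))"
      unfolding sum_distrib_left
    proof (rule sum_mono)
      fix j assume "j \<in> {..<J}"
      then have "1 / \<Lambda> \<le> W j" using W by simp
      then show "1 / \<Lambda> * (1 * (dd (Suc j) \<bullet> dd (Suc j) + dd j \<bullet> dd j)) \<le> W j * (dd (Suc j) \<bullet> dd (Suc j) + dd j \<bullet> dd j)"
        unfolding mult_1 by (intro mult_right_mono) auto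
    qed
    then have "(1 / \<Lambda>) * (\<Sum>j<J. 1 * (dd (Suc j) \<bullet> dd (Suc j) + dd j \<bullet> dd j)) / (2 * real J) \<le> lump J W dd dd"
      unfolding lump_def by (intro divide_right_mono) auto
    then show ?thesis by (simp add: X_def lump_def mult.commute[of \<Lambda>])
  qed
  (* Every term in the velocity dd is split so that the lumped norm X of dd, which the coercivity
     "lower" provides with the factor 1 / Lambda, absorbs it. *)
  have absorb: "\<Lambda> ^ i * y * sqrt X \<le> X / (8 * \<Lambda>) + 2 * \<Lambda> * (\<Lambda> ^ i * y)\<^sup>2" for i y
    using real_young[of "2 * \<Lambda>" "\<Lambda> ^ i * y" "sqrt X"] \<Lambda> X by simp
  have T1: "lump J W dd \<psi> \<le> X / (8 * \<Lambda>) + 1088 * (\<Lambda> ^ 5 * E)"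
  proof -
    have "lump J W dd \<psi> \<le> \<Lambda> * (sqrt X * sqrt (lump_sq J \<psi>))"
      using lump_cauchy_schwarz[where J=J and W=W and w=\<Lambda> and u=dd and v=\<psi>, OF W'] by (simp add: X_def)
    also have "\<dots> \<le> X / (8 * \<Lambda>) + 2 * \<Lambda> * (\<Lambda> ^ 1 * sqrt (lump_sq J \<psi>))\<^sup>2"
      using absorb[of 1 "sqrt (lump_sq J \<psi>)"] by (simp add: mult_ac)
    also have "(\<Lambda> ^ 1 * sqrt (lump_sq J \<psi>))\<^sup>2 = \<Lambda>\<^sup>2 * lump_sq J \<psi>"
      by (simp add: power_mult_distrib lump_sq_nonneg)
    also have "2 * \<Lambda> * (\<Lambda>\<^sup>2 * lump_sq J \<psi>) \<le> 2 * \<Lambda> * (\<Lambda>\<^sup>2 * (544 * \<Lambda>\<^sup>2 * E))"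
      using \<psi>0 \<Lambda> by (intro mult_left_mono) auto
    also have "\<dots> = 1088 * (\<Lambda> ^ 5 * E)" by (simp add: eval_nat_numeral)
    finally show ?thesis by simp
  qed
  have T2: "stiff J e \<psi> \<le> 276 * (\<Lambda> ^ 5 * E)"
  proof -
    have "stiff_sq J e \<le> 7 * E" using he lump_sq_nonneg[of J e] by (simp add: h1_sq_def)
    then have "stiff J e \<psi> \<le> (7 * E + 544 * \<Lambda>\<^sup>2 * E) / 2"
      using stiff_young[of J e \<psi>] \<psi>1 by simp
    then show ?thesis using L[of 2] L[of 0] E by (simp add: mult.assoc)
  qed
  have \<eta>n: "sqrt (lump_sq J \<eta>) \<le> sqrt X + sqrt (lump_sq J \<psi>)"
    unfolding \<eta>_def X_def by (rule lump_sq_triangle)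
  define y where "y = D + sqrt (h1_sq J z)"
  have y: "0 \<le> y" "y\<^sup>2 \<le> 18 * E"
  proof -
    show "0 \<le> y" using D h1_sq_nonneg[of J z] by (simp add: y_def)
    have "y\<^sup>2 \<le> 2 * (D\<^sup>2 + (sqrt (h1_sq J z))\<^sup>2)"
      using zero_le_power2[of "D - sqrt (h1_sq J z)"] unfolding y_def power2_sum power2_diff by argo
    then show "y\<^sup>2 \<le> 18 * E" using hz DE by (simp add: h1_sq_nonneg)
  qed
  have T3: "\<Lambda> * y * sqrt (lump_sq J \<eta>) \<le> X / (8 * \<Lambda>) + 400 * (\<Lambda> ^ 5 * E)"
  proof -
    have "\<Lambda> * y * sqrt (lump_sq J \<eta>) \<le> \<Lambda> * y * (sqrt X + sqrt (lump_sq J \<psi>))"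
      using \<eta>n \<Lambda> y by (intro mult_left_mono) auto
    also have "\<dots> = \<Lambda> ^ 1 * y * sqrt X + \<Lambda> * (y * sqrt (lump_sq J \<psi>))" by (simp add: algebra_simps)
    also have "\<Lambda> ^ 1 * y * sqrt X \<le> X / (8 * \<Lambda>) + 2 * \<Lambda> * (\<Lambda> ^ 1 * y)\<^sup>2" by (rule absorb)
    also have "(\<Lambda> ^ 1 * y)\<^sup>2 = \<Lambda>\<^sup>2 * y\<^sup>2" by (simp add: power_mult_distrib)
    also have "2 * \<Lambda> * (\<Lambda>\<^sup>2 * y\<^sup>2) \<le> 2 * \<Lambda> * (\<Lambda>\<^sup>2 * (18 * E))"
      using y \<Lambda> by (intro mult_left_mono) auto
    also have "\<dots> = 36 * (\<Lambda> ^ 3 * E)" by (simp add: eval_nat_numeral)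
    also have "y * sqrt (lump_sq J \<psi>) \<le> 1/2 * y\<^sup>2 + 1/2 * lump_sq J \<psi>"
      using real_young[of "1/2" y "sqrt (lump_sq J \<psi>)"] by (simp add: lump_sq_nonneg)
    also have "\<dots> \<le> 9 * E + 272 * \<Lambda>\<^sup>2 * E" using y \<psi>0 by simp
    also have "\<Lambda> * (9 * E + 272 * \<Lambda>\<^sup>2 * E) = 9 * (\<Lambda> ^ 1 * E) + 272 * (\<Lambda> ^ 3 * E)" by (simp add: eval_nat_numeral algebra_simps)
    finally have "\<Lambda> * y * sqrt (lump_sq J \<eta>) \<le> X / (8 * \<Lambda>) + 36 * (\<Lambda> ^ 3 * E) + (9 * (\<Lambda> ^ 1 * E) + 272 * (\<Lambda> ^ 3 * E))"
      using \<Lambda> by (simp add: mult_left_mono)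
    moreover have "0 \<le> \<Lambda> ^ 5 * E" using \<Lambda> E by simp
    ultimately show ?thesis using L[of 1] L[of 3] by linarith
  qed
  have T4: "- (\<Sum>k\<in>bd. \<beta>' k \<bullet> \<psi> k + S' k (z k) (\<psi> k)) \<le> 136 * (\<Lambda> ^ 5 * E)"
  proof -
    have "- (\<beta>' k \<bullet> \<psi> k + S' k (z k) (\<psi> k)) \<le> 68 * (\<Lambda>\<^sup>2 * E)" if k: "k \<in> bd" for k
    proof -
      have "\<bar>\<beta>' k \<bullet> \<psi> k\<bar> \<le> norm (\<beta>' k) * norm (\<psi> k)" by (rule Cauchy_Schwarz_ineq2)
      also have "\<dots> \<le> \<Lambda> * D * norm (\<psi> k)" using \<beta>'[OF k] by (rule mult_right_mono) simp
      finally have "- (\<beta>' k \<bullet> \<psi> k + S' k (z k) (\<psi> k)) \<le> \<Lambda> * D * norm (\<psi> k) + \<Lambda> * norm (z k) * norm (\<psi> k)"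
        using S'(3)[OF k, of "z k" "\<psi> k"] by linarith
      also have "\<dots> = \<Lambda> * (D + norm (z k)) * norm (\<psi> k)" by (simp add: algebra_simps)
      also have "\<dots> \<le> \<Lambda> * (D + norm (z k)) * (2 * \<Lambda> * (D + norm (z k)))"
        using q1[OF k] \<Lambda> D by (intro mult_left_mono) (auto simp: \<psi>k[OF k])
      also have "\<dots> = 2 * \<Lambda>\<^sup>2 * (D + norm (z k))\<^sup>2" by (simp add: power2_eq_square)
      also have "\<dots> \<le> 2 * \<Lambda>\<^sup>2 * (34 * E)" using Dz[OF k] by (intro mult_left_mono) auto
      finally show ?thesis by simp
    qed
    then have "(\<Sum>k\<in>bd. - (\<beta>' k \<bullet> \<psi> k + S' k (z k) (\<psi> k))) \<le> 2 * (68 * (\<Lambda>\<^sup>2 * E))"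
      using E by (intro sum_boundary_le[OF bd]) auto
    then show ?thesis using L[of 2] unfolding sum_negf by simp
  qed
  have T5: "(\<Sum>k\<in>bd. \<beta>' k \<bullet> d k + S' k (z k) (d k)) \<le>
     bd_energy bd \<beta>' S' a b - bd_energy bd \<beta> S b c + \<tau> * (12 * (\<Lambda> ^ 5 * E))
       + 3/4 * (stiff_sq J d2 + 5000 * \<Lambda>\<^sup>2 * lump_sq J d2)"
  proof -
    have d': "d k = ((3/2) *\<^sub>R a k - (1/2) *\<^sub>R b k) - ((3/2) *\<^sub>R b k - (1/2) *\<^sub>R c k)" for k
    proof -
      have "2 *\<^sub>R b k = (1/2) *\<^sub>R b k + (3/2) *\<^sub>R b k" by (simp flip: scaleR_add_left)
      then show ?thesis by (simp add: d_def bdf_def)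
    qed
    have "(\<Sum>k\<in>bd. \<beta>' k \<bullet> d k + S' k (z k) (d k)) = (\<Sum>k\<in>bd.
        (\<beta>' k \<bullet> ((3/2) *\<^sub>R a k - (1/2) *\<^sub>R b k) + 3/4 * S' k (a k) (a k) - 1/4 * S' k (b k) (b k))
      - (\<beta>' k \<bullet> ((3/2) *\<^sub>R b k - (1/2) *\<^sub>R c k) + 3/4 * S' k (b k) (b k) - 1/4 * S' k (c k) (c k))
      + (- (3/4) * S' k (d2 k) (d2 k)))"
    proof (intro sum.cong refl)
      fix k assume k: "k \<in> bd"
      have "S' k (z k) (d k) = (3/4 * S' k (a k) (a k) - 1/4 * S' k (b k) (b k)) - (3/4 * S' k (b k) (b k) - 1/4 * S' k (c k) (c k))
        - 3/4 * S' k (d2 k) (d2 k)"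
        unfolding z_def d_def d2_def by (rule bilinear_bdf[OF S'(1)[OF k] S'(2)[OF k]])
      then show "\<beta>' k \<bullet> d k + S' k (z k) (d k) =
        (\<beta>' k \<bullet> ((3/2) *\<^sub>R a k - (1/2) *\<^sub>R b k) + 3/4 * S' k (a k) (a k) - 1/4 * S' k (b k) (b k))
        - (\<beta>' k \<bullet> ((3/2) *\<^sub>R b k - (1/2) *\<^sub>R c k) + 3/4 * S' k (b k) (b k) - 1/4 * S' k (c k) (c k))
        + (- (3/4) * S' k (d2 k) (d2 k))"
        by (subst d') (simp add: inner_diff_right)
    qed
    also have "\<dots> = bd_energy bd \<beta>' S' a b - bd_energy bd \<beta>' S' b c + (\<Sum>k\<in>bd. - (3/4) * S' k (d2 k) (d2 k))"
      unfolding bd_energy_def sum.distrib sum_subtractf by simp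
    also have "(\<Sum>k\<in>bd. - (3/4) * S' k (d2 k) (d2 k)) \<le> 2 * (3/4 * (stiff_sq J d2 / 96 + 97 * \<Lambda>\<^sup>2 * lump_sq J d2))"
    proof (rule sum_boundary_le[OF bd])
      fix k assume k: "k \<in> bd"
      then have "k \<le> J" using bd by auto
      note t = trace_scaled[OF \<Lambda> J this, of d2]
      have "- (3/4) * S' k (d2 k) (d2 k) \<le> 3/4 * (\<Lambda> * (norm (d2 k))\<^sup>2)"
        using S'(3)[OF k, of "d2 k" "d2 k"] by (simp add: power2_eq_square mult.assoc)
      with t show "- (3/4) * S' k (d2 k) (d2 k) \<le> 3/4 * (stiff_sq J d2 / 96 + 97 * \<Lambda>\<^sup>2 * lump_sq J d2)" unfolding distrib_left by linarith
    qed (simp add: stiff_sq_nonneg lump_sq_nonneg)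
    also have "\<dots> \<le> 3/4 * (stiff_sq J d2 + 5000 * \<Lambda>\<^sup>2 * lump_sq J d2)"
    proof -
      have "0 \<le> \<Lambda>\<^sup>2 * lump_sq J d2" by (simp add: lump_sq_nonneg)
      then show ?thesis using stiff_sq_nonneg[of J d2] unfolding distrib_left mult.assoc by linarith
    qed
    finally have 1: "(\<Sum>k\<in>bd. \<beta>' k \<bullet> d k + S' k (z k) (d k)) \<le>
     bd_energy bd \<beta>' S' a b - bd_energy bd \<beta>' S' b c + 3/4 * (stiff_sq J d2 + 5000 * \<Lambda>\<^sup>2 * lump_sq J d2)" by simp
    have 2: "\<bar>bd_energy bd \<beta>' S' b c - bd_energy bd \<beta> S b c\<bar> \<le> \<tau> * (12 * \<Lambda> * (h1_sq J b + h1_sq J c + D\<^sup>2))"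
      using \<tau> by (intro bd_energy_change[OF \<Lambda> J bd D _ \<beta> S]) auto
    have "12 * \<Lambda> * (h1_sq J b + h1_sq J c + D\<^sup>2) \<le> 12 * \<Lambda> * E"
      using hn \<Lambda> by (intro mult_left_mono) (auto simp: E_def)
    also have "\<dots> \<le> 12 * (\<Lambda> ^ 5 * E)" using L[of 1] by simp
    finally have "\<tau> * (12 * \<Lambda> * (h1_sq J b + h1_sq J c + D\<^sup>2)) \<le> \<tau> * (12 * (\<Lambda> ^ 5 * E))"
      using \<tau> by (intro mult_left_mono) auto
    with 1 2 show ?thesis by linarith
  qed
  have T6: "5000 * \<Lambda>\<^sup>2 * lump J (\<lambda>_. 1) e dd \<le> X / (8 * \<Lambda>) + 350000000 * (\<Lambda> ^ 5 * E)"
  proof -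
    let ?y = "5000 * sqrt (lump_sq J e)"
    have "5000 * \<Lambda>\<^sup>2 * lump J (\<lambda>_. 1) e dd \<le> 5000 * \<Lambda>\<^sup>2 * (sqrt (lump_sq J e) * sqrt X)"
      using lump_cauchy_schwarz[of J "\<lambda>_. 1" 1 e dd] by (intro mult_left_mono) (auto simp: X_def)
    also have "\<dots> = \<Lambda> ^ 2 * ?y * sqrt X" by simp
    also have "\<dots> \<le> X / (8 * \<Lambda>) + 2 * \<Lambda> * (\<Lambda> ^ 2 * ?y)\<^sup>2" by (rule absorb)
    also have "(\<Lambda> ^ 2 * ?y)\<^sup>2 = \<Lambda> ^ 4 * (25000000 * lump_sq J e)"
      by (simp add: power_mult_distrib lump_sq_nonneg flip: power_mult)
    also have "2 * \<Lambda> * (\<Lambda> ^ 4 * (25000000 * lump_sq J e)) \<le> 2 * \<Lambda> * (\<Lambda> ^ 4 * (25000000 * (7 * E)))"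
      using he stiff_sq_nonneg[of J e] \<Lambda> by (intro mult_left_mono) (auto simp: h1_sq_def)
    also have "\<dots> = 350000000 * (\<Lambda> ^ 5 * E)" by (simp add: eval_nat_numeral)
    finally show ?thesis by simp
  qed
  have R: "R \<eta> \<le> (\<Sum>k\<in>bd. \<beta>' k \<bullet> dd k + S' k (z k) (dd k)) - (\<Sum>k\<in>bd. \<beta>' k \<bullet> \<psi> k + S' k (z k) (\<psi> k)) + \<Lambda> * y * sqrt (lump_sq J \<eta>)"
  proof -
    have "(\<Sum>k\<in>bd. \<beta>' k \<bullet> \<eta> k + S' k (z k) (\<eta> k)) = (\<Sum>k\<in>bd. \<beta>' k \<bullet> dd k + S' k (z k) (dd k)) - (\<Sum>k\<in>bd. \<beta>' k \<bullet> \<psi> k + S' k (z k) (\<psi> k))"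
      unfolding sum_subtractf[symmetric]
      by (intro sum.cong refl) (simp add: \<eta>_def inner_diff_right bounded_bilinear.diff_right[OF S'(1)])
    then show ?thesis using cons[OF adm] by (simp add: z_def y_def)
  qed
  have "stiff J e dd + 5000 * \<Lambda>\<^sup>2 * lump J (\<lambda>_. 1) e dd
     \<le> (\<Sum>k\<in>bd. \<beta>' k \<bullet> dd k + S' k (z k) (dd k)) + 350001900 * (\<Lambda> ^ 5 * E)"
    (is "?l \<le> ?s + _")
  proof -
    have "3 * (X / (8 * \<Lambda>)) \<le> X / \<Lambda>" using X \<Lambda> by (simp add: field_simps)
    then show ?thesis using eq lower T1 T2 T3 T4 T6 R by linarith
  qed
  then have "\<tau> * ?l \<le> \<tau> * (?s + 350001900 * (\<Lambda> ^ 5 * E))"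
    using \<tau> by (intro mult_left_mono) auto
  moreover have "\<tau> * ?l = stiff J e d + 5000 * \<Lambda>\<^sup>2 * lump J (\<lambda>_. 1) e d"
    using \<tau> by (simp add: dd_def stiff_lin2 lump_lin2 field_simps)
  moreover have "\<tau> * ?s = (\<Sum>k\<in>bd. \<beta>' k \<bullet> d k + S' k (z k) (d k))"
  proof -
    have "\<beta>' k \<bullet> d k + S' k (z k) (d k) = \<tau> * (\<beta>' k \<bullet> dd k + S' k (z k) (dd k))" if "k \<in> bd" for k
      unfolding d by (simp add: bounded_bilinear.scaleR_right[OF S'(1)[OF that]] distrib_left)
    then show ?thesis by (simp add: sum_distrib_left)
  qed
  ultimately have "stiff J e d + 5000 * \<Lambda>\<^sup>2 * lump J (\<lambda>_. 1) e d \<le> (\<Sum>k\<in>bd. \<beta>' k \<bullet> d k + S' k (z k) (d k))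
      + \<tau> * (350001900 * (\<Lambda> ^ 5 * E))"
    by (simp only: distrib_left)
  moreover have "stiff J e d + 5000 * \<Lambda>\<^sup>2 * lump J (\<lambda>_. 1) e d \<le> bd_energy bd \<beta>' S' a b - bd_energy bd \<beta> S b c
       + 3/4 * (stiff_sq J d2 + 5000 * \<Lambda>\<^sup>2 * lump_sq J d2) + 10 ^ 9 * (\<tau> * (\<Lambda> ^ 5 * E))"
    if "stiff J e d + 5000 * \<Lambda>\<^sup>2 * lump J (\<lambda>_. 1) e d \<le> (\<Sum>k\<in>bd. \<beta>' k \<bullet> d k + S' k (z k) (d k))
      + \<tau> * (350001900 * (\<Lambda> ^ 5 * E))"
  proof -
    have 0: "0 \<le> \<tau> * (\<Lambda> ^ 5 * E)" using \<tau> \<Lambda> E by simp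
    have 1: "\<tau> * (12 * (\<Lambda> ^ 5 * E)) = 12 * (\<tau> * (\<Lambda> ^ 5 * E))" by simp
    have 2: "\<tau> * (350001900 * (\<Lambda> ^ 5 * E)) = 350001900 * (\<tau> * (\<Lambda> ^ 5 * E))" by simp
    have 3: "(10 :: real) ^ 9 = 1000000000" by simp
    show ?thesis using T5 that 0 unfolding 1 2 3 by linarith
  qed
  moreover have "stiff J e d = genergy (stiff J) a b - genergy (stiff J) b c + 3/4 * stiff_sq J d2"
    unfolding e_def d_def d2_def by (rule stiff_bdf)
  moreover have "lump J (\<lambda>_. 1) e d = genergy (lump J (\<lambda>_. 1)) a b - genergy (lump J (\<lambda>_. 1)) b c + 3/4 * lump_sq J d2"
    unfolding e_def d_def d2_def by (rule lump_bdf)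
  ultimately show ?thesis
    unfolding energy_def E_def[symmetric] by (simp add: algebra_simps)
qed

section \<open>Consistency\<close>

text \<open>
  Taylor's formula for vector valued functions on an interval, in both directions; the factorial in the
  remainder is dropped.
\<close>

lemma taylor_bound:
  fixes f :: "nat \<Rightarrow> real \<Rightarrow> 'a::banach"
  assumes der: "\<And>i r. i < p \<Longrightarrow> r \<in> {lo..hi} \<Longrightarrow> (f i has_vector_derivative f (Suc i) r) (at r within {lo..hi})"
    and bd: "\<And>r. r \<in> {lo..hi} \<Longrightarrow> norm (f p r) \<le> B"
    and p: "0 < p" and st: "s \<in> {lo..hi}" "t \<in> {lo..hi}"
  shows "norm (f 0 s - (\<Sum>i<p. ((s - t) ^ i / fact i) *\<^sub>R f i t)) \<le> B * \<bar>s - t\<bar> ^ p"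
proof -
  have B: "0 \<le> B" using bd[OF st(1)] norm_ge_zero order_trans by blast
  have fwd: "norm (g 0 b - (\<Sum>i<p. ((b - a) ^ i / fact i) *\<^sub>R g i a)) \<le> B * (b - a) ^ p"
    if "a \<le> b" and der': "\<And>i r. i < p \<Longrightarrow> a \<le> r \<Longrightarrow> r \<le> b \<Longrightarrow> (g i has_vector_derivative g (Suc i) r) (at r within {a..b})"
    and bd': "\<And>r. r \<in> {a..b} \<Longrightarrow> norm (g p r) \<le> B" for g :: "nat \<Rightarrow> real \<Rightarrow> 'a" and a b
  proof -
    have int: "((\<lambda>r. ((b - r) ^ (p - 1) / fact (p - 1)) *\<^sub>R g p r) has_integral g 0 b - (\<Sum>i<p. ((b - a) ^ i / fact i) *\<^sub>R g i a)) (cbox a b)"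
      using Taylor_has_integral[where Df=g and f="g 0" and p=p and a=a and b=b, OF p refl der' that(1)] by simp
    have "norm (((b - r) ^ (p - 1) / fact (p - 1)) *\<^sub>R g p r) \<le> (b - a) ^ (p - 1) * B" if r: "r \<in> {a..b}" for r
    proof -
      have "(b - r) ^ (p - 1) / fact (p - 1) \<le> (b - a) ^ (p - 1) / 1"
        using r by (intro frac_le power_mono) auto
      then have "\<bar>(b - r) ^ (p - 1) / fact (p - 1)\<bar> \<le> (b - a) ^ (p - 1)" using r by simp
      then show ?thesis unfolding norm_scaleR by (intro mult_mono) (use r bd'[OF r] in auto)
    qed
    then have "norm (g 0 b - (\<Sum>i<p. ((b - a) ^ i / fact i) *\<^sub>R g i a)) \<le> (b - a) ^ (p - 1) * B * measure lborel (cbox a b)"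
      using that(1) B by (intro has_integral_bound[OF _ int]) auto
    also have "\<dots> = B * (b - a) ^ p" using that(1) p by (cases p) auto
    finally show ?thesis .
  qed
  show ?thesis
  proof (cases "t \<le> s")
    case True
    have "(f i has_vector_derivative f (Suc i) r) (at r within {t..s})" if "i < p" "t \<le> r" "r \<le> s" for i r
      using that st by (intro has_vector_derivative_within_subset[OF der]) auto
    then show ?thesis using fwd[OF True, of f] bd True st by auto
  next
    case False
    define g where "g i r = (-1) ^ i *\<^sub>R f i (- r)" for i r
    have d: "(g i has_vector_derivative g (Suc i) r) (at r within {-t..-s})" if "i < p" "-t \<le> r" "r \<le> -s" for i r
    proof -
      have "(f i has_vector_derivative f (Suc i) (-r)) (at (-r) within uminus ` {-t..-s})"
        using that st by (intro has_vector_derivative_within_subset[OF der]) auto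
      then have "((f i \<circ> uminus) has_vector_derivative (-1) *\<^sub>R f (Suc i) (-r)) (at r within {-t..-s})"
        by (intro vector_diff_chain_within) (auto intro!: derivative_eq_intros)
      then have "((\<lambda>r. (-1) ^ i *\<^sub>R f i (-r)) has_vector_derivative (-1) ^ i *\<^sub>R ((-1) *\<^sub>R f (Suc i) (-r))) (at r within {-t..-s})"
        unfolding o_def by (intro bounded_linear.has_vector_derivative[OF bounded_linear_scaleR_right])
      then show ?thesis by (simp add: g_def[abs_def])
    qed
    have "norm (g 0 (-s) - (\<Sum>i<p. ((-s - -t) ^ i / fact i) *\<^sub>R g i (-t))) \<le> B * (-s - -t) ^ p"
    proof (intro fwd)
      show "norm (g p r) \<le> B" if "r \<in> {-t..-s}" for r
        using that bd[of "-r"] st by (simp add: g_def)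
    qed (use False d in auto)
    moreover have "((-s - -t) ^ i / fact i) *\<^sub>R g i (-t) = ((s - t) ^ i / fact i) *\<^sub>R f i t" for i
    proof -
      have "(-s - -t) ^ i * (-1) ^ i = (s - t) ^ i" by (simp flip: power_mult_distrib)
      then show ?thesis by (simp add: g_def)
    qed
    ultimately have "norm (g 0 (-s) - (\<Sum>i<p. ((s - t) ^ i / fact i) *\<^sub>R f i t)) \<le> B * (-s - -t) ^ p"
      by (simp only:)
    then show ?thesis using False by (simp add: g_def)
  qed
qed

lemma sum_lessThan_2: "(\<Sum>i<(2::nat). g i) = g 0 + (g 1 :: 'b::comm_monoid_add)"
  by (simp add: numeral_2_eq_2)

lemma sum_lessThan_3: "(\<Sum>i<(3::nat). g i) = g 0 + g 1 + (g 2 :: 'b::comm_monoid_add)"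
  by (simp add: numeral_3_eq_3 numeral_2_eq_2)

lemma sum_lessThan_4: "(\<Sum>i<(4::nat). g i) = g 0 + g 1 + g 2 + (g 3 :: 'b::comm_monoid_add)"
  by (simp add: eval_nat_numeral)

text \<open>
  Second differences in time are of order \<open>\<tau>\<^sup>2\<close>, and the backward difference quotient is exact for
  quadratic polynomials.
\<close>

lemma time_differences:
  fixes f :: "nat \<Rightarrow> real \<Rightarrow> 'a::banach"
  assumes der: "\<And>i r. r \<in> {0..T} \<Longrightarrow> (f i has_vector_derivative f (Suc i) r) (at r within {0..T})"
    and bd: "\<And>i r. i \<le> 3 \<Longrightarrow> r \<in> {0..T} \<Longrightarrow> norm (f i r) \<le> B"
    and t: "0 < \<tau>" "2 * \<tau> \<le> t" "t \<le> T"
  shows "norm (f 0 t - 2 *\<^sub>R f 0 (t - \<tau>) + f 0 (t - 2 * \<tau>)) \<le> 6 * B * \<tau>\<^sup>2"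
    and "norm (f 0 t - 2 *\<^sub>R f 0 (t - \<tau>) + f 0 (t - 2 * \<tau>) - \<tau>\<^sup>2 *\<^sub>R f 2 t) \<le> 10 * B * \<tau> ^ 3"
    and "norm ((1 / \<tau>) *\<^sub>R ((3/2) *\<^sub>R f 0 t - 2 *\<^sub>R f 0 (t - \<tau>) + (1/2) *\<^sub>R f 0 (t - 2 * \<tau>)) - f 1 t) \<le> 6 * B * \<tau>\<^sup>2"
proof -
  have in0: "t - \<tau> \<in> {0..T}" "t - 2 * \<tau> \<in> {0..T}" "t \<in> {0..T}" using t by auto
  define r1 where "r1 = f 0 (t - \<tau>) - (f 0 t - \<tau> *\<^sub>R f 1 t)"
  define r2 where "r2 = f 0 (t - 2 * \<tau>) - (f 0 t - (2 * \<tau>) *\<^sub>R f 1 t)"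
  have n2: "norm r1 \<le> B * \<tau>\<^sup>2" "norm r2 \<le> 4 * B * \<tau>\<^sup>2"
  proof -
    have *: "norm (f 0 s - (f 0 t + (s - t) *\<^sub>R f 1 t)) \<le> B * \<bar>s - t\<bar>\<^sup>2" if "s \<in> {0..T}" for s
    proof -
      have "norm (f 0 s - (\<Sum>i<2. ((s - t) ^ i / fact i) *\<^sub>R f i t)) \<le> B * \<bar>s - t\<bar>\<^sup>2"
        by (rule taylor_bound[where lo=0 and hi=T]) (use der bd in0 that in auto)
      then show ?thesis by (simp add: sum_lessThan_2)
    qed
    show "norm r1 \<le> B * \<tau>\<^sup>2" using *[OF in0(1)] t by (simp add: r1_def)
    show "norm r2 \<le> 4 * B * \<tau>\<^sup>2" using *[OF in0(2)] t by (simp add: r2_def power_mult_distrib)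
  qed
  have "f 0 t - 2 *\<^sub>R f 0 (t - \<tau>) + f 0 (t - 2 * \<tau>) = r2 - 2 *\<^sub>R r1"
    by (simp add: r1_def r2_def scaleR_add_right scaleR_diff_right scaleR_2)
  then show "norm (f 0 t - 2 *\<^sub>R f 0 (t - \<tau>) + f 0 (t - 2 * \<tau>)) \<le> 6 * B * \<tau>\<^sup>2"
    using n2 norm_triangle_ineq4[of r2 "2 *\<^sub>R r1"] by simp
  define s1 where "s1 = f 0 (t - \<tau>) - (f 0 t - \<tau> *\<^sub>R f 1 t + (\<tau>\<^sup>2 / 2) *\<^sub>R f 2 t)"
  define s2 where "s2 = f 0 (t - 2 * \<tau>) - (f 0 t - (2 * \<tau>) *\<^sub>R f 1 t + (2 * \<tau>\<^sup>2) *\<^sub>R f 2 t)"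
  have n3: "norm s1 \<le> B * \<tau> ^ 3" "norm s2 \<le> 8 * B * \<tau> ^ 3"
  proof -
    have *: "norm (f 0 s - (f 0 t + (s - t) *\<^sub>R f 1 t + ((s - t)\<^sup>2 / 2) *\<^sub>R f 2 t)) \<le> B * \<bar>s - t\<bar> ^ 3" if "s \<in> {0..T}" for s
    proof -
      have "norm (f 0 s - (\<Sum>i<3. ((s - t) ^ i / fact i) *\<^sub>R f i t)) \<le> B * \<bar>s - t\<bar> ^ 3"
        by (rule taylor_bound[where lo=0 and hi=T]) (use der bd in0 that in auto)
      then show ?thesis by (simp add: sum_lessThan_3)
    qed
    show "norm s1 \<le> B * \<tau> ^ 3" using *[OF in0(1)] t by (simp add: s1_def)
    show "norm s2 \<le> 8 * B * \<tau> ^ 3" using *[OF in0(2)] t by (simp add: s2_def power_mult_distrib)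
  qed
  have "f 0 t - 2 *\<^sub>R f 0 (t - \<tau>) + f 0 (t - 2 * \<tau>) - \<tau>\<^sup>2 *\<^sub>R f 2 t = s2 - 2 *\<^sub>R s1"
    
  proof -
    have "(2 * \<tau>\<^sup>2) *\<^sub>R f 2 t = \<tau>\<^sup>2 *\<^sub>R f 2 t + \<tau>\<^sup>2 *\<^sub>R f 2 t" by (simp flip: scaleR_add_left)
    then show ?thesis by (simp add: s1_def s2_def scaleR_add_right scaleR_diff_right scaleR_2[of "f 0 t"])
  qed
  then show "norm (f 0 t - 2 *\<^sub>R f 0 (t - \<tau>) + f 0 (t - 2 * \<tau>) - \<tau>\<^sup>2 *\<^sub>R f 2 t) \<le> 10 * B * \<tau> ^ 3"
    using n3 norm_triangle_ineq4[of s2 "2 *\<^sub>R s1"] by simp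
  have "(3/2) *\<^sub>R f 0 t - 2 *\<^sub>R f 0 (t - \<tau>) + (1/2) *\<^sub>R f 0 (t - 2 * \<tau>) = \<tau> *\<^sub>R f 1 t + ((1/2) *\<^sub>R s2 - 2 *\<^sub>R s1)"
  proof -
    define w where "w = \<tau> *\<^sub>R f 1 t"
    define m where "m = (\<tau>\<^sup>2 / 2) *\<^sub>R f 2 t"
    have "f 0 (t - \<tau>) = s1 + (f 0 t - w + m)" "f 0 (t - 2 * \<tau>) = s2 + (f 0 t - 2 *\<^sub>R w + 4 *\<^sub>R m)"
      by (simp_all add: s1_def s2_def w_def m_def)
    moreover have "(3/2) *\<^sub>R f 0 t = 2 *\<^sub>R f 0 t - (1/2) *\<^sub>R f 0 t"
      by (simp flip: scaleR_diff_left)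
    moreover have "2 *\<^sub>R w - w = w" by (simp add: scaleR_2)
    ultimately show ?thesis unfolding w_def[symmetric]
      by (simp add: scaleR_add_right scaleR_diff_right)
  qed
  then have "(1 / \<tau>) *\<^sub>R ((3/2) *\<^sub>R f 0 t - 2 *\<^sub>R f 0 (t - \<tau>) + (1/2) *\<^sub>R f 0 (t - 2 * \<tau>)) - f 1 t
     = (1 / \<tau>) *\<^sub>R ((1/2) *\<^sub>R s2 - 2 *\<^sub>R s1)"
    using t by (simp add: scaleR_add_right)
  moreover have "norm ((1/2) *\<^sub>R s2 - 2 *\<^sub>R s1) \<le> 6 * B * \<tau> ^ 3"
    using n3 norm_triangle_ineq4[of "(1/2) *\<^sub>R s2" "2 *\<^sub>R s1"] by simp
  ultimately show "norm ((1 / \<tau>) *\<^sub>R ((3/2) *\<^sub>R f 0 t - 2 *\<^sub>R f 0 (t - \<tau>) + (1/2) *\<^sub>R f 0 (t - 2 * \<tau>)) - f 1 t) \<le> 6 * B * \<tau>\<^sup>2"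
    using t by (simp add: pos_divide_le_eq eval_nat_numeral)
qed

text \<open>
  Residuals that are collected cell by cell are bounded in the dual of the lumped norm.
\<close>

lemma cellwise_cauchy_schwarz:
  fixes \<eta> :: "nat \<Rightarrow> 'a::real_inner"
  assumes "0 < J"
  shows "(\<Sum>j<J. \<kappa> j * (norm (\<eta> (Suc j)) + norm (\<eta> j))) / (2 * real J)
    \<le> sqrt ((\<Sum>j<J. (\<kappa> j)\<^sup>2) / real J) * sqrt (lump_sq J \<eta>)"
proof -
  let ?m = "\<lambda>j. norm (\<eta> (Suc j)) + norm (\<eta> j)"
  have "(\<Sum>j<J. \<kappa> j * ?m j) \<le> (\<Sum>j<J. \<bar>\<kappa> j\<bar> * \<bar>?m j\<bar>)"
    by (intro sum_mono) (auto intro: mult_right_mono)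
  also have "\<dots> \<le> L2_set \<kappa> {..<J} * L2_set ?m {..<J}" by (rule L2_set_mult_ineq)
  also have "L2_set ?m {..<J} \<le> sqrt (2 * (\<Sum>j<J. \<eta> (Suc j) \<bullet> \<eta> (Suc j) + \<eta> j \<bullet> \<eta> j))"
    unfolding L2_set_def sum_distrib_left
  proof (intro real_sqrt_le_mono sum_mono)
    fix j show "(?m j)\<^sup>2 \<le> 2 * (\<eta> (Suc j) \<bullet> \<eta> (Suc j) + \<eta> j \<bullet> \<eta> j)"
      using zero_le_power2[of "norm (\<eta> (Suc j)) - norm (\<eta> j)"]
      by (simp add: power2_sum power2_diff flip: power2_norm_eq_inner)
  qed
  finally have "(\<Sum>j<J. \<kappa> j * ?m j) \<le> L2_set \<kappa> {..<J} * sqrt (2 * (\<Sum>j<J. \<eta> (Suc j) \<bullet> \<eta> (Suc j) + \<eta> j \<bullet> \<eta> j))"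
    by (simp add: mult_left_mono)
  also have "\<dots> = sqrt ((\<Sum>j<J. (\<kappa> j)\<^sup>2) * (2 * (\<Sum>j<J. \<eta> (Suc j) \<bullet> \<eta> (Suc j) + \<eta> j \<bullet> \<eta> j)))"
    by (simp only: L2_set_def real_sqrt_mult)
  finally have "(\<Sum>j<J. \<kappa> j * ?m j) / (2 * real J) \<le> sqrt ((\<Sum>j<J. (\<kappa> j)\<^sup>2) * (2 * (\<Sum>j<J. \<eta> (Suc j) \<bullet> \<eta> (Suc j) + \<eta> j \<bullet> \<eta> j))) / (2 * real J)"
    by (intro divide_right_mono) auto
  also have "\<dots> = sqrt ((\<Sum>j<J. (\<kappa> j)\<^sup>2) * (2 * (\<Sum>j<J. \<eta> (Suc j) \<bullet> \<eta> (Suc j) + \<eta> j \<bullet> \<eta> j)) / (2 * real J)\<^sup>2)"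
    unfolding real_sqrt_divide real_sqrt_abs by simp
  also have "\<dots> = sqrt ((\<Sum>j<J. (\<kappa> j)\<^sup>2) / real J * lump_sq J \<eta>)"
    using assms by (simp add: lump_def power2_eq_square field_simps)
  finally show ?thesis by (simp only: real_sqrt_mult)
qed

lemma sum_cells:
  fixes f g :: "nat \<Rightarrow> 'b::ab_group_add"
  assumes "0 < J"
  shows "(\<Sum>j<J. f j + g (Suc j)) = (\<Sum>j=1..<J. f j + g j) + f 0 + g J"
proof -
  obtain n where J: "J = Suc n" using assms by (cases J) auto
  have "(\<Sum>j<J. f j) = f 0 + (\<Sum>j=1..<J. f j)"
    using assms by (simp add: sum.atLeast_Suc_lessThan lessThan_atLeast0)
  moreover have "(\<Sum>j<J. g (Suc j)) = (\<Sum>j=1..<J. g j) + g J"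
    unfolding J by (simp add: sum.shift_bounds_Suc_ivl[symmetric] lessThan_atLeast0)
  ultimately show ?thesis by (simp add: sum.distrib algebra_simps)
qed

text \<open>
  Summation by parts leaves the one-sided differences at the two ends: this is where the boundary flux
  comes from.
\<close>

lemma stiff_by_parts:
  fixes v \<eta> :: "nat \<Rightarrow> 'a::real_inner"
  assumes "0 < J"
  shows "stiff J v \<eta> = - (\<Sum>j=1..<J. real J * ((v (Suc j) - 2 *\<^sub>R v j + v (j - 1)) \<bullet> \<eta> j))
     - real J * ((v 1 - v 0) \<bullet> \<eta> 0) - real J * ((v (J - 1) - v J) \<bullet> \<eta> J)"
proof -
  have "stiff J v \<eta> = real J * (\<Sum>j<J. - ((v (Suc j) - v j) \<bullet> \<eta> j) + (v (Suc j) - v (Suc j - 1)) \<bullet> \<eta> (Suc j))"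
    unfolding stiff_def by (simp add: inner_diff_right algebra_simps)
  also have "\<dots> = real J * ((\<Sum>j=1..<J. - ((v (Suc j) - v j) \<bullet> \<eta> j) + (v j - v (j - 1)) \<bullet> \<eta> j)
      - (v 1 - v 0) \<bullet> \<eta> 0 + (v J - v (J - 1)) \<bullet> \<eta> J)"
    by (subst sum_cells[OF assms, of "\<lambda>j. - ((v (Suc j) - v j) \<bullet> \<eta> j)" "\<lambda>j. (v j - v (j - 1)) \<bullet> \<eta> j"]) simp
  also have "(\<Sum>j=1..<J. - ((v (Suc j) - v j) \<bullet> \<eta> j) + (v j - v (j - 1)) \<bullet> \<eta> j)
     = - (\<Sum>j=1..<J. (v (Suc j) - 2 *\<^sub>R v j + v (j - 1)) \<bullet> \<eta> j)"
    unfolding sum_negf[symmetric] by (intro sum.cong refl) (simp add: inner_simps algebra_simps)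
  finally show ?thesis by (simp add: sum_distrib_left inner_simps algebra_simps)
qed

lemma lump_by_nodes:
  fixes u \<eta> :: "nat \<Rightarrow> 'a::real_inner"
  assumes "0 < J"
  shows "lump J Q u \<eta> = ((\<Sum>j=1..<J. (Q j + Q (j - 1)) * (u j \<bullet> \<eta> j)) + Q 0 * (u 0 \<bullet> \<eta> 0) + Q (J - 1) * (u J \<bullet> \<eta> J)) / (2 * real J)"
proof -
  have "(\<Sum>j<J. Q j * (u (Suc j) \<bullet> \<eta> (Suc j) + u j \<bullet> \<eta> j))
    = (\<Sum>j<J. Q j * (u j \<bullet> \<eta> j) + Q (Suc j - 1) * (u (Suc j) \<bullet> \<eta> (Suc j)))"
    by (simp add: algebra_simps)
  also have "\<dots> = (\<Sum>j=1..<J. Q j * (u j \<bullet> \<eta> j) + Q (j - 1) * (u j \<bullet> \<eta> j)) + Q 0 * (u 0 \<bullet> \<eta> 0) + Q (J - 1) * (u J \<bullet> \<eta> J)"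
    by (rule sum_cells[OF assms, of "\<lambda>j. Q j * (u j \<bullet> \<eta> j)" "\<lambda>j. Q (j - 1) * (u j \<bullet> \<eta> j)"])
  finally show ?thesis by (simp add: lump_def distrib_right)
qed

text \<open>
  Vector identities are proved by taking inner products, which reduces them to commutative algebra.
\<close>

lemma vec_eqI:
  fixes x y :: "'a::real_inner"
  assumes "\<And>z. x \<bullet> z = y \<bullet> z"
  shows "x = y"
  using assms vector_eq_rdot by blast

lemma norm_sq_perturb:
  fixes p r :: "'a::real_inner"
  shows "\<bar>(norm (p + r))\<^sup>2 - (norm p)\<^sup>2\<bar> \<le> norm r * (2 * norm p + norm r)"
proof -
  have "(norm (p + r))\<^sup>2 - (norm p)\<^sup>2 = r \<bullet> (2 *\<^sub>R p + r)"
    by (simp add: power2_norm_eq_inner inner_simps inner_commute)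
  also have "\<bar>\<dots>\<bar> \<le> norm r * norm (2 *\<^sub>R p + r)" by (rule Cauchy_Schwarz_ineq2)
  also have "\<dots> \<le> norm r * (2 * norm p + norm r)"
    using norm_triangle_ineq[of "2 *\<^sub>R p" r] by (intro mult_left_mono) auto
  finally show ?thesis .
qed

lemma norm_div_le:
  fixes z :: "'a::real_normed_vector"
  assumes "0 < h" "norm z \<le> C * (h * m)"
  shows "norm ((1/h) *\<^sub>R z) \<le> C * m"
  using assms by (simp add: pos_divide_le_eq mult_ac)

text \<open>
  A family of functions closed under the partial derivatives that occur: \<open>X i k\<close> stands for
  \<open>\<partial>\<^sub>t\<^sup>k \<partial>\<^sub>\<rho>\<^sup>i x\<close>, with the derivatives in \<open>\<rho>\<close> taken first.
\<close>

locale smooth_flow =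
  fixes X :: "nat \<Rightarrow> nat \<Rightarrow> real \<Rightarrow> real \<Rightarrow> 'a::euclidean_space" and T B :: real
  assumes der_rho: "\<And>i \<rho> t. \<rho> \<in> {0..1} \<Longrightarrow> t \<in> {0..T} \<Longrightarrow>
      ((\<lambda>r. X i 0 r t) has_vector_derivative X (Suc i) 0 \<rho> t) (at \<rho> within {0..1})"
    and der_t: "\<And>i k \<rho> t. \<rho> \<in> {0..1} \<Longrightarrow> t \<in> {0..T} \<Longrightarrow>
      (X i k \<rho> has_vector_derivative X i (Suc k) \<rho> t) (at t within {0..T})"
    and bound: "\<And>i k \<rho> t. i \<le> 4 \<Longrightarrow> k \<le> 4 \<Longrightarrow> \<rho> \<in> {0..1} \<Longrightarrow> t \<in> {0..T} \<Longrightarrow> norm (X i k \<rho> t) \<le> B"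
    and B1: "1 \<le> B"
    and pde: "\<And>\<rho> t. \<rho> \<in> {0..1} \<Longrightarrow> t \<in> {0<..T} \<Longrightarrow> (norm (X 1 0 \<rho> t))\<^sup>2 *\<^sub>R X 0 1 \<rho> t = X 2 0 \<rho> t"
begin

definition xnode :: "nat \<Rightarrow> real \<Rightarrow> nat \<Rightarrow> 'a" where
  "xnode J t j = X 0 0 (node J j) t"

definition dtt :: "real \<Rightarrow> real \<Rightarrow> nat \<Rightarrow> real \<Rightarrow> 'a" where
  "dtt \<tau> t i \<rho> = X i 0 \<rho> t - 2 *\<^sub>R X i 0 \<rho> (t - \<tau>) + X i 0 \<rho> (t - 2 * \<tau>)"

text \<open>
  The one-sided difference at an end point differs from \<open>x\<^sub>\<rho>\<close> by \<open>\<plusminus>(h/2) x\<^sub>\<rho>\<^sub>\<rho>\<close>, which the half cell of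
  the lumped product compensates by the equation, and by terms of second order. The term with \<open>\<tau>\<^sup>2\<close>
  appears because the stiffness form is applied to \<open>vbar\<close> in place of the new iterate. The terms of
  second order must be kept: tested with a point value they are too large for the lumped norm, but
  they depend smoothly on time.
\<close>

definition bd_flux :: "real \<Rightarrow> real \<Rightarrow> real \<Rightarrow> real \<Rightarrow> 'a" where
  "bd_flux h \<tau> \<rho> t = X 1 0 \<rho> t + h\<^sup>2 *\<^sub>R ((1/6) *\<^sub>R X 3 0 \<rho> t - (1/2 * (X 1 0 \<rho> t \<bullet> X 2 0 \<rho> t)) *\<^sub>R X 0 1 \<rho> t)
     + (\<tau>\<^sup>2 / 2) *\<^sub>R X 1 2 \<rho> t"

lemma node_in: "j \<le> J \<Longrightarrow> node J j \<in> {0..1}"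
  by (cases "J = 0") (auto simp: node_def)

lemma node_Suc: "0 < J \<Longrightarrow> node J (Suc j) = node J j + 1 * (1 / real J)"
  by (simp add: node_def field_simps)

lemma node_pred: "0 < J \<Longrightarrow> 0 < j \<Longrightarrow> node J (j - 1) = node J j + (- 1) * (1 / real J)"
  by (cases j) (auto simp: node_def field_simps)

lemma dtt_bound:
  assumes "i \<le> 4" "\<rho> \<in> {0..1}" "0 < \<tau>" "2 * \<tau> \<le> t" "t \<le> T"
  shows "norm (dtt \<tau> t i \<rho>) \<le> 6 * B * \<tau>\<^sup>2"
    and "norm (dtt \<tau> t i \<rho> - \<tau>\<^sup>2 *\<^sub>R X i 2 \<rho> t) \<le> 10 * B * \<tau> ^ 3"
  unfolding dtt_def using assms
  by (intro time_differences[where T=T and f="\<lambda>k. X i k \<rho>"] der_t bound; simp)+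

lemma dtt_der:
  assumes "\<rho> \<in> {0..1}" "0 < \<tau>" "2 * \<tau> \<le> t" "t \<le> T"
  shows "(dtt \<tau> t i has_vector_derivative dtt \<tau> t (Suc i) \<rho>) (at \<rho> within {0..1})"
  unfolding dtt_def[abs_def] using assms
  by (intro has_vector_derivative_add has_vector_derivative_diff der_rho
       bounded_linear.has_vector_derivative[OF bounded_linear_scaleR_right]) auto

lemma space_taylor:
  assumes der: "\<And>i r. r \<in> {0..1} \<Longrightarrow> (f i has_vector_derivative f (Suc i) r) (at r within {0..1})"
    and bd: "\<And>i r. i \<le> 4 \<Longrightarrow> r \<in> {0..1} \<Longrightarrow> norm (f i r :: 'a) \<le> b"
    and \<rho>: "\<rho> \<in> {0..1}" "\<rho> + \<sigma> * h \<in> {0..1}" and \<sigma>: "\<sigma> = 1 \<or> \<sigma> = -1" and h: "0 < h"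
  shows "norm (f 0 (\<rho> + \<sigma> * h) - f 0 \<rho>) \<le> b * h"
    and "norm (f 0 (\<rho> + \<sigma> * h) - (f 0 \<rho> + (\<sigma> * h) *\<^sub>R f 1 \<rho>)) \<le> b * h\<^sup>2"
    and "norm (f 0 (\<rho> + \<sigma> * h) - (f 0 \<rho> + (\<sigma> * h) *\<^sub>R f 1 \<rho> + (h\<^sup>2 / 2) *\<^sub>R f 2 \<rho>)) \<le> b * h ^ 3"
    and "norm (f 0 (\<rho> + \<sigma> * h) - (f 0 \<rho> + (\<sigma> * h) *\<^sub>R f 1 \<rho> + (h\<^sup>2 / 2) *\<^sub>R f 2 \<rho> + (\<sigma> * h ^ 3 / 6) *\<^sub>R f 3 \<rho>)) \<le> b * h ^ 4"
proof -
  have *: "norm (f 0 (\<rho> + \<sigma> * h) - (\<Sum>i<p. ((\<rho> + \<sigma> * h - \<rho>) ^ i / fact i) *\<^sub>R f i \<rho>)) \<le> b * \<bar>\<rho> + \<sigma> * h - \<rho>\<bar> ^ p"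
    if "0 < p" "p \<le> 4" for p
    by (rule taylor_bound[where lo=0 and hi=1]) (use der bd \<rho> that in auto)
  have s: "\<bar>\<sigma> * h\<bar> = h" "(\<sigma> * h)\<^sup>2 = h\<^sup>2" "(\<sigma> * h) ^ 3 = \<sigma> * h ^ 3" using \<sigma> h by (auto simp: power_mult_distrib)
  have f3: "fact 3 = (6::real)" by (simp add: fact_numeral)
  show "norm (f 0 (\<rho> + \<sigma> * h) - f 0 \<rho>) \<le> b * h" using *[of 1] s by simp
  show "norm (f 0 (\<rho> + \<sigma> * h) - (f 0 \<rho> + (\<sigma> * h) *\<^sub>R f 1 \<rho>)) \<le> b * h\<^sup>2"
    using *[of 2] s unfolding sum_lessThan_2 by simp
  show "norm (f 0 (\<rho> + \<sigma> * h) - (f 0 \<rho> + (\<sigma> * h) *\<^sub>R f 1 \<rho> + (h\<^sup>2 / 2) *\<^sub>R f 2 \<rho>)) \<le> b * h ^ 3"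
    using *[of 3] s unfolding sum_lessThan_3 by simp
  show "norm (f 0 (\<rho> + \<sigma> * h) - (f 0 \<rho> + (\<sigma> * h) *\<^sub>R f 1 \<rho> + (h\<^sup>2 / 2) *\<^sub>R f 2 \<rho> + (\<sigma> * h ^ 3 / 6) *\<^sub>R f 3 \<rho>)) \<le> b * h ^ 4"
    using *[of 4] s f3 unfolding sum_lessThan_4 by simp
qed

lemma x_taylor:
  assumes "t \<in> {0..T}" "\<rho> \<in> {0..1}" "\<rho> + \<sigma> * h \<in> {0..1}" "\<sigma> = 1 \<or> \<sigma> = -1" "0 < h"
  shows "norm (X 0 0 (\<rho> + \<sigma> * h) t - X 0 0 \<rho> t) \<le> B * h"
    and "norm (X 0 0 (\<rho> + \<sigma> * h) t - (X 0 0 \<rho> t + (\<sigma> * h) *\<^sub>R X 1 0 \<rho> t)) \<le> B * h\<^sup>2"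
    and "norm (X 0 0 (\<rho> + \<sigma> * h) t - (X 0 0 \<rho> t + (\<sigma> * h) *\<^sub>R X 1 0 \<rho> t + (h\<^sup>2 / 2) *\<^sub>R X 2 0 \<rho> t)) \<le> B * h ^ 3"
    and "norm (X 0 0 (\<rho> + \<sigma> * h) t - (X 0 0 \<rho> t + (\<sigma> * h) *\<^sub>R X 1 0 \<rho> t + (h\<^sup>2 / 2) *\<^sub>R X 2 0 \<rho> t + (\<sigma> * h ^ 3 / 6) *\<^sub>R X 3 0 \<rho> t)) \<le> B * h ^ 4"
  using assms by (intro space_taylor[where f="\<lambda>i r. X i 0 r t" and b=B] der_rho bound; simp)+

lemma dtt_taylor:
  assumes "0 < \<tau>" "2 * \<tau> \<le> t" "t \<le> T" "\<rho> \<in> {0..1}" "\<rho> + \<sigma> * h \<in> {0..1}" "\<sigma> = 1 \<or> \<sigma> = -1" "0 < h"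
  shows "norm (dtt \<tau> t 0 (\<rho> + \<sigma> * h) - dtt \<tau> t 0 \<rho>) \<le> 6 * B * \<tau>\<^sup>2 * h"
    and "norm (dtt \<tau> t 0 (\<rho> + \<sigma> * h) - (dtt \<tau> t 0 \<rho> + (\<sigma> * h) *\<^sub>R dtt \<tau> t 1 \<rho>)) \<le> 6 * B * \<tau>\<^sup>2 * h\<^sup>2"
    and "norm (dtt \<tau> t 0 (\<rho> + \<sigma> * h) - (dtt \<tau> t 0 \<rho> + (\<sigma> * h) *\<^sub>R dtt \<tau> t 1 \<rho> + (h\<^sup>2 / 2) *\<^sub>R dtt \<tau> t 2 \<rho>)) \<le> 6 * B * \<tau>\<^sup>2 * h ^ 3"
    and "norm (dtt \<tau> t 0 (\<rho> + \<sigma> * h) - (dtt \<tau> t 0 \<rho> + (\<sigma> * h) *\<^sub>R dtt \<tau> t 1 \<rho> + (h\<^sup>2 / 2) *\<^sub>R dtt \<tau> t 2 \<rho> + (\<sigma> * h ^ 3 / 6) *\<^sub>R dtt \<tau> t 3 \<rho>)) \<le> 6 * B * \<tau>\<^sup>2 * h ^ 4"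
  using assms by (intro space_taylor[where f="dtt \<tau> t" and b="6 * B * \<tau>\<^sup>2"] dtt_der dtt_bound(1); simp)+

text \<open>
  At an interior node the equation is tested with the mean of the weights of the two adjacent cells.
  Central differences are exact up to second order, and \<open>\<bar>x\<^sub>\<rho>\<bar>\<^sup>2 x\<^sub>t = x\<^sub>\<rho>\<^sub>\<rho>\<close> cancels the leading terms.
\<close>

lemma interior_residual:
  assumes J: "0 < J" and j: "0 < j" "j < J" and \<tau>: "0 < \<tau>" "2 * \<tau> \<le> t" "t \<le> T"
  defines "a \<equiv> xnode J t" and "y \<equiv> \<lambda>j. dtt \<tau> t 0 (node J j)" and "h \<equiv> 1 / real J"
  shows "norm ((((norm (real J *\<^sub>R (a (Suc j) - a j)))\<^sup>2 + (norm (real J *\<^sub>R (a j - a (j - 1))))\<^sup>2) / 2) *\<^sub>R X 0 1 (node J j) t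
      - (real J)\<^sup>2 *\<^sub>R (a (Suc j) - 2 *\<^sub>R a j + a (j - 1)) - ((real J)\<^sup>2 / 2) *\<^sub>R (y (Suc j) - 2 *\<^sub>R y j + y (j - 1)))
     \<le> 7 * B ^ 3 * (h\<^sup>2 + \<tau>\<^sup>2)"
proof -
  define \<rho> where "\<rho> = node J j"
  have h: "0 < h" "h \<le> 1" and Jh: "real J = 1 / h" using J by (auto simp: h_def)
  have tT: "t \<in> {0..T}" using \<tau> by auto
  have \<rho>: "\<rho> \<in> {0..1}" and \<rho>p: "node J (Suc j) = \<rho> + 1 * h" and \<rho>m: "node J (j - 1) = \<rho> + (-1) * h"
    using node_in[of j J] node_Suc[OF J, of j] node_pred[OF J j(1)] j by (auto simp: \<rho>_def h_def)
  have \<rho>p': "\<rho> + 1 * h \<in> {0..1}" and \<rho>m': "\<rho> + (-1) * h \<in> {0..1}"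
    unfolding \<rho>p[symmetric] \<rho>m[symmetric] by (rule node_in; use j in simp)+
  note tx = x_taylor[OF tT \<rho>]
  note ty = dtt_taylor[OF \<tau> \<rho>]
  define u where "u = X 1 0 \<rho> t"
  define v where "v = X 2 0 \<rho> t"
  define w where "w = X 0 1 \<rho> t"
  have n: "norm u \<le> B" "norm v \<le> B" "norm w \<le> B" using bound[OF _ _ \<rho> tT] by (auto simp: u_def v_def w_def)
  have a: "a j = X 0 0 \<rho> t" "a (Suc j) = X 0 0 (\<rho> + 1 * h) t" "a (j - 1) = X 0 0 (\<rho> + (-1) * h) t"
    by (simp_all only: a_def xnode_def \<rho>_def[symmetric] \<rho>p \<rho>m)
  have yy: "y j = dtt \<tau> t 0 \<rho>" "y (Suc j) = dtt \<tau> t 0 (\<rho> + 1 * h)" "y (j - 1) = dtt \<tau> t 0 (\<rho> + (-1) * h)"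
    by (simp_all only: y_def \<rho>_def[symmetric] \<rho>p \<rho>m)
  (* The difference quotients on the two adjacent cells agree with x_rho +- (h/2) x_rho_rho up to
     second order; the first order parts cancel in the mean of the two weights. *)
  define rp where "rp = (1/h) *\<^sub>R (a (Suc j) - a j) - (u + (h/2) *\<^sub>R v)"
  define rm where "rm = (1/h) *\<^sub>R (a j - a (j - 1)) - (u - (h/2) *\<^sub>R v)"
  have slope: "norm ((1/h) *\<^sub>R z) \<le> B * h\<^sup>2" if "norm z \<le> B * h ^ 3" for z :: 'a
    using that h by (simp add: pos_divide_le_eq eval_nat_numeral)
  have rp: "norm rp \<le> B * h\<^sup>2"
  proof -
    have "rp = (1/h) *\<^sub>R (a (Suc j) - (a j + (1 * h) *\<^sub>R u + (h\<^sup>2 / 2) *\<^sub>R v))"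
      by (rule vec_eqI) (use h in \<open>simp add: rp_def inner_simps field_simps power2_eq_square\<close>)
    then show ?thesis using slope tx(3)[OF \<rho>p' _ h(1)] by (simp add: a u_def v_def)
  qed
  have rm: "norm rm \<le> B * h\<^sup>2"
  proof -
    have "rm = - ((1/h) *\<^sub>R (a (j - 1) - (a j + ((-1) * h) *\<^sub>R u + (h\<^sup>2 / 2) *\<^sub>R v)))"
      by (rule vec_eqI) (use h in \<open>simp add: rm_def inner_simps field_simps power2_eq_square\<close>)
    then have "norm rm = norm ((1/h) *\<^sub>R (a (j - 1) - (a j + ((-1) * h) *\<^sub>R u + (h\<^sup>2 / 2) *\<^sub>R v)))"
      by (simp only: norm_minus_cancel)
    also have "\<dots> \<le> B * h\<^sup>2"
      by (rule slope, unfold a u_def v_def, rule tx(3)[OF \<rho>m' _ h(1)]) simp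
    finally show ?thesis .
  qed
  have pert: "\<bar>(norm (p + r))\<^sup>2 - (norm p)\<^sup>2\<bar> \<le> 4 * B\<^sup>2 * h\<^sup>2" if "norm p \<le> 3/2 * B" "norm r \<le> B * h\<^sup>2" for p r :: 'a
  proof -
    have "norm r * (2 * norm p + norm r) \<le> (B * h\<^sup>2) * (2 * (3/2 * B) + B * 1)"
      using that h B1 by (intro mult_mono add_mono order_trans[OF that(2)] mult_left_mono) (auto simp: power_le_one)
    also have "\<dots> = 4 * B\<^sup>2 * h\<^sup>2" by (simp add: power2_eq_square)
    finally show ?thesis using norm_sq_perturb[of p r] by linarith
  qed
  have hv: "norm ((h/2) *\<^sub>R v) \<le> 1/2 * B"
    using n h mult_mono[of h 1 "norm v" B] by simp
  have pp: "norm (u + (h/2) *\<^sub>R v) \<le> 3/2 * B" "norm (u - (h/2) *\<^sub>R v) \<le> 3/2 * B"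
    using norm_triangle_ineq[of u "(h/2) *\<^sub>R v"] norm_triangle_ineq4[of u "(h/2) *\<^sub>R v"] hv n by linarith+
  define Qp where "Qp = (norm ((1/h) *\<^sub>R (a (Suc j) - a j)))\<^sup>2"
  define Qm where "Qm = (norm ((1/h) *\<^sub>R (a j - a (j - 1))))\<^sup>2"
  have Q1: "\<bar>Qp - (norm (u + (h/2) *\<^sub>R v))\<^sup>2\<bar> \<le> 4 * B\<^sup>2 * h\<^sup>2"
    using pert[OF pp(1) rp] by (simp add: rp_def Qp_def)
  have Q2: "\<bar>Qm - (norm (u - (h/2) *\<^sub>R v))\<^sup>2\<bar> \<le> 4 * B\<^sup>2 * h\<^sup>2"
    using pert[OF pp(2) rm] by (simp add: rm_def Qm_def)
  have Q3: "(norm (u + (h/2) *\<^sub>R v))\<^sup>2 + (norm (u - (h/2) *\<^sub>R v))\<^sup>2 = 2 * (norm u)\<^sup>2 + 1/2 * (h\<^sup>2 * (norm v)\<^sup>2)"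
    unfolding power2_norm_eq_inner by (simp add: inner_simps inner_commute power2_eq_square)
  have v2: "h\<^sup>2 * (norm v)\<^sup>2 \<le> B\<^sup>2 * h\<^sup>2"
    unfolding mult.commute[of "h\<^sup>2"] using n by (intro mult_right_mono power_mono) auto
  have Q: "\<bar>(Qp + Qm) / 2 - (norm u)\<^sup>2\<bar> \<le> 5 * B\<^sup>2 * h\<^sup>2"
  proof -
    have "0 \<le> h\<^sup>2 * (norm v)\<^sup>2" by simp
    then show ?thesis using Q1 Q2 Q3 v2 unfolding mult.assoc add_divide_distrib by linarith
  qed
  define r where "r = (1/h)\<^sup>2 *\<^sub>R (a (Suc j) - 2 *\<^sub>R a j + a (j - 1)) - v"
  have r: "norm r \<le> 2 * B * h\<^sup>2"
  proof -
    define z1 where "z1 = a (Suc j) - (a j + (1 * h) *\<^sub>R u + (h\<^sup>2 / 2) *\<^sub>R v + (1 * h ^ 3 / 6) *\<^sub>R X 3 0 \<rho> t)"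
    define z2 where "z2 = a (j - 1) - (a j + ((-1) * h) *\<^sub>R u + (h\<^sup>2 / 2) *\<^sub>R v + ((-1) * h ^ 3 / 6) *\<^sub>R X 3 0 \<rho> t)"
    have "norm z1 \<le> B * h ^ 4" "norm z2 \<le> B * h ^ 4"
      unfolding a u_def v_def z1_def z2_def by (rule tx(4)[OF _ _ h(1)]; use \<rho>p' \<rho>m' in simp)+
    then have "norm (z1 + z2) \<le> 2 * B * h ^ 4" using norm_triangle_ineq[of z1 z2] by linarith
    moreover have "r = (1/h)\<^sup>2 *\<^sub>R (z1 + z2)"
      by (rule vec_eqI) (use h in \<open>simp add: r_def z1_def z2_def inner_simps field_simps power2_eq_square\<close>)
    ultimately show ?thesis using h by (simp add: power_divide pos_divide_le_eq eval_nat_numeral)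
  qed
  have s: "norm (((1/h)\<^sup>2 / 2) *\<^sub>R (y (Suc j) - 2 *\<^sub>R y j + y (j - 1))) \<le> 6 * B * \<tau>\<^sup>2"
  proof -
    define z1 where "z1 = y (Suc j) - (y j + (1 * h) *\<^sub>R dtt \<tau> t 1 \<rho>)"
    define z2 where "z2 = y (j - 1) - (y j + ((-1) * h) *\<^sub>R dtt \<tau> t 1 \<rho>)"
    have "norm z1 \<le> 6 * B * \<tau>\<^sup>2 * h\<^sup>2" "norm z2 \<le> 6 * B * \<tau>\<^sup>2 * h\<^sup>2"
      unfolding yy z1_def z2_def by (rule ty(2)[OF _ _ h(1)]; use \<rho>p' \<rho>m' in simp)+
    then have "norm (z1 + z2) \<le> 12 * B * \<tau>\<^sup>2 * h\<^sup>2" using norm_triangle_ineq[of z1 z2] by linarith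
    moreover have "y (Suc j) - 2 *\<^sub>R y j + y (j - 1) = z1 + z2"
      by (rule vec_eqI) (simp add: z1_def z2_def inner_simps)
    ultimately show ?thesis using h by (simp add: power_divide pos_divide_le_eq)
  qed
  have pd: "(norm u)\<^sup>2 *\<^sub>R w = v" using pde[OF \<rho>, of t] \<tau> by (simp add: u_def v_def w_def)
  have eq: "((Qp + Qm) / 2) *\<^sub>R w - (1/h)\<^sup>2 *\<^sub>R (a (Suc j) - 2 *\<^sub>R a j + a (j - 1)) - ((1/h)\<^sup>2 / 2) *\<^sub>R (y (Suc j) - 2 *\<^sub>R y j + y (j - 1))
     = ((Qp + Qm) / 2 - (norm u)\<^sup>2) *\<^sub>R w - r - ((1/h)\<^sup>2 / 2) *\<^sub>R (y (Suc j) - 2 *\<^sub>R y j + y (j - 1))"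
    by (simp add: r_def scaleR_diff_left pd)
  have "norm (((Qp + Qm) / 2 - (norm u)\<^sup>2) *\<^sub>R w) \<le> 5 * B\<^sup>2 * h\<^sup>2 * B"
    using Q n B1 by (simp add: mult_mono)
  then have "norm (((Qp + Qm) / 2) *\<^sub>R w - (1/h)\<^sup>2 *\<^sub>R (a (Suc j) - 2 *\<^sub>R a j + a (j - 1)) - ((1/h)\<^sup>2 / 2) *\<^sub>R (y (Suc j) - 2 *\<^sub>R y j + y (j - 1)))
    \<le> 5 * B\<^sup>2 * h\<^sup>2 * B + 2 * B * h\<^sup>2 + 6 * B * \<tau>\<^sup>2"
    unfolding eq using r s by (intro order_trans[OF norm_triangle_ineq4] add_mono) auto
  also have "\<dots> \<le> 7 * B ^ 3 * (h\<^sup>2 + \<tau>\<^sup>2)"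
  proof -
    have "B * h\<^sup>2 \<le> B ^ 3 * h\<^sup>2" "B * \<tau>\<^sup>2 \<le> B ^ 3 * \<tau>\<^sup>2"
      using self_le_power[OF B1, of 3] by (auto intro: mult_right_mono)
    moreover have "B\<^sup>2 * h\<^sup>2 * B = B ^ 3 * h\<^sup>2" by (simp add: eval_nat_numeral)
    moreover have "0 \<le> B ^ 3 * \<tau>\<^sup>2" using B1 by simp
    ultimately show ?thesis unfolding distrib_left mult.assoc by linarith
  qed
  finally show ?thesis by (simp add: Qp_def Qm_def w_def \<rho>_def[symmetric] Jh)
qed

text \<open>
  At an end point only half a cell is available, so the residual is compared with the flux. What
  remains is of third order, which is what a point value of the test vector can afford.
\<close>

lemma boundary_residual:
  assumes J: "0 < J" and k: "(k = 0 \<and> k' = 1 \<and> \<sigma> = 1) \<or> (k = J \<and> k' = J - 1 \<and> \<sigma> = -1)"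
    and \<tau>: "0 < \<tau>" "2 * \<tau> \<le> t" "t \<le> T"
  defines "a \<equiv> xnode J t" and "y \<equiv> \<lambda>j. dtt \<tau> t 0 (node J j)" and "h \<equiv> 1 / real J"
  shows "norm (((norm (real J *\<^sub>R (a k' - a k)))\<^sup>2 / (2 * real J)) *\<^sub>R X 0 1 (node J k) t
      - real J *\<^sub>R (a k' - a k) - (real J / 2) *\<^sub>R (y k' - y k) + \<sigma> *\<^sub>R bd_flux h \<tau> (node J k) t)
     \<le> 10 * B ^ 3 * (h ^ 3 + \<tau>\<^sup>2 * h + \<tau> ^ 3)"
proof -
  define \<rho> where "\<rho> = node J k"
  have h: "0 < h" "h \<le> 1" and Jh: "real J = 1 / h" using J by (auto simp: h_def)
  have tT: "t \<in> {0..T}" using \<tau> by auto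
  have kJ: "k \<le> J" "k' \<le> J" using k J by auto
  have \<rho>: "\<rho> \<in> {0..1}" using node_in[OF kJ(1)] by (simp add: \<rho>_def)
  have \<rho>p: "node J k' = \<rho> + \<sigma> * h"
    using k node_Suc[OF J, of 0] node_pred[OF J J] by (auto simp: \<rho>_def h_def)
  have \<rho>p': "\<rho> + \<sigma> * h \<in> {0..1}" using node_in[OF kJ(2)] by (simp add: \<rho>p)
  have \<sigma>: "\<sigma> = 1 \<or> \<sigma> = -1" using k by auto
  then have \<sigma>2: "\<sigma> * \<sigma> = 1" and \<sigma>a: "\<bar>\<sigma>\<bar> = 1" by auto
  note tx = x_taylor[OF tT \<rho> \<rho>p' \<sigma> h(1)]
  note ty = dtt_taylor[OF \<tau> \<rho> \<rho>p' \<sigma> h(1)]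
  define u where "u = X 1 0 \<rho> t"
  define v where "v = X 2 0 \<rho> t"
  define z where "z = X 3 0 \<rho> t"
  define w where "w = X 0 1 \<rho> t"
  have n: "norm u \<le> B" "norm v \<le> B" "norm w \<le> B" using bound[OF _ _ \<rho> tT] by (auto simp: u_def v_def w_def)
  have a: "a k = X 0 0 \<rho> t" "a k' = X 0 0 (\<rho> + \<sigma> * h) t"
    by (simp_all only: a_def xnode_def \<rho>_def[symmetric] \<rho>p)
  have yy: "y k = dtt \<tau> t 0 \<rho>" "y k' = dtt \<tau> t 0 (\<rho> + \<sigma> * h)"
    by (simp_all only: y_def \<rho>_def[symmetric] \<rho>p)
  define p where "p = \<sigma> *\<^sub>R u + (h/2) *\<^sub>R v"
  define r2 where "r2 = (1/h) *\<^sub>R (a k' - a k) - p"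
  define r3 where "r3 = (1/h) *\<^sub>R (a k' - a k) - (p + (\<sigma> * h\<^sup>2 / 6) *\<^sub>R z)"
  have r2: "norm r2 \<le> B * h\<^sup>2"
  proof -
    have "r2 = (1/h) *\<^sub>R (a k' - (a k + (\<sigma> * h) *\<^sub>R u + (h\<^sup>2 / 2) *\<^sub>R v))"
      by (rule vec_eqI) (use h in \<open>simp add: r2_def p_def inner_simps diff_divide_distrib add_divide_distrib power2_eq_square\<close>)
    moreover have "norm (a k' - (a k + (\<sigma> * h) *\<^sub>R u + (h\<^sup>2 / 2) *\<^sub>R v)) \<le> B * (h * h\<^sup>2)"
      using tx(3) unfolding a u_def v_def by (simp only: power3_eq_cube power2_eq_square mult.assoc)
    ultimately show ?thesis using norm_div_le[OF h(1)] by simp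
  qed
  have r3: "norm r3 \<le> B * h ^ 3"
  proof -
    have "r3 = (1/h) *\<^sub>R (a k' - (a k + (\<sigma> * h) *\<^sub>R u + (h\<^sup>2 / 2) *\<^sub>R v + (\<sigma> * h ^ 3 / 6) *\<^sub>R z))"
      by (rule vec_eqI) (use h in \<open>simp add: r3_def p_def inner_simps diff_divide_distrib add_divide_distrib power2_eq_square power3_eq_cube\<close>)
    moreover have "norm (a k' - (a k + (\<sigma> * h) *\<^sub>R u + (h\<^sup>2 / 2) *\<^sub>R v + (\<sigma> * h ^ 3 / 6) *\<^sub>R z)) \<le> B * (h * h ^ 3)"
      using tx(4) unfolding a u_def v_def z_def by (simp only: power4_eq_xxxx power3_eq_cube mult.assoc)
    ultimately show ?thesis using norm_div_le[OF h(1)] by simp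
  qed
  have hv: "norm ((h/2) *\<^sub>R v) \<le> 1/2 * B"
    using n h mult_mono[of h 1 "norm v" B] by simp
  have pn: "norm p \<le> 3/2 * B"
    using norm_triangle_ineq[of "\<sigma> *\<^sub>R u" "(h/2) *\<^sub>R v"] hv n \<sigma>a by (simp add: p_def)
  define Q where "Q = (norm ((1/h) *\<^sub>R (a k' - a k)))\<^sup>2"
  have Q1: "\<bar>Q - (norm p)\<^sup>2\<bar> \<le> 4 * B\<^sup>2 * h\<^sup>2"
  proof -
    have "norm r2 * (2 * norm p + norm r2) \<le> (B * h\<^sup>2) * (2 * (3/2 * B) + B * 1)"
      using r2 pn h B1 by (intro mult_mono add_mono order_trans[OF r2] mult_left_mono) (auto simp: power_le_one)
    also have "\<dots> = 4 * B\<^sup>2 * h\<^sup>2" by (simp add: power2_eq_square)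
    finally show ?thesis using norm_sq_perturb[of p r2] by (simp add: r2_def Q_def)
  qed
  have Q2: "(norm p)\<^sup>2 = (norm u)\<^sup>2 + \<sigma> * h * (u \<bullet> v) + 1/4 * (h\<^sup>2 * (norm v)\<^sup>2)"
  proof -
    have "(norm p)\<^sup>2 = (\<sigma> * \<sigma>) * (u \<bullet> u) + \<sigma> * h * (u \<bullet> v) + 1/4 * (h\<^sup>2 * (norm v)\<^sup>2)"
      unfolding p_def power2_norm_eq_inner by (simp add: inner_add_left inner_add_right inner_commute[of v u] power2_eq_square distrib_left add_divide_distrib)
    then show ?thesis by (simp add: \<sigma>2 power2_norm_eq_inner)
  qed
  have v2: "h\<^sup>2 * (norm v)\<^sup>2 \<le> B\<^sup>2 * h\<^sup>2"
    unfolding mult.commute[of "h\<^sup>2"] using n by (intro mult_right_mono power_mono) auto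
  have Q: "\<bar>Q - (norm u)\<^sup>2 - \<sigma> * h * (u \<bullet> v)\<bar> \<le> 5 * B\<^sup>2 * h\<^sup>2"
  proof -
    have "0 \<le> h\<^sup>2 * (norm v)\<^sup>2" by simp
    then show ?thesis using Q1 Q2 v2 unfolding mult.assoc by linarith
  qed
  define s1 where "s1 = (1/h) *\<^sub>R (y k' - y k) - \<sigma> *\<^sub>R dtt \<tau> t 1 \<rho>"
  have s1: "norm s1 \<le> 6 * B * \<tau>\<^sup>2 * h"
  proof -
    have "s1 = (1/h) *\<^sub>R (y k' - (y k + (\<sigma> * h) *\<^sub>R dtt \<tau> t 1 \<rho>))"
      by (rule vec_eqI) (use h in \<open>simp add: s1_def inner_simps diff_divide_distrib add_divide_distrib\<close>)
    moreover have "norm (y k' - (y k + (\<sigma> * h) *\<^sub>R dtt \<tau> t 1 \<rho>)) \<le> 6 * B * \<tau>\<^sup>2 * (h * h)"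
      using ty(2) unfolding yy by (simp only: power2_eq_square)
    ultimately show ?thesis using norm_div_le[OF h(1)] by simp
  qed
  define s2 where "s2 = dtt \<tau> t 1 \<rho> - \<tau>\<^sup>2 *\<^sub>R X 1 2 \<rho> t"
  have s2: "norm s2 \<le> 10 * B * \<tau> ^ 3" unfolding s2_def using dtt_bound(2)[OF _ \<rho> \<tau>] by simp
  have pd: "(norm u)\<^sup>2 *\<^sub>R w = v" using pde[OF \<rho>, of t] \<tau> by (simp add: u_def v_def w_def)
  have pd': "v \<bullet> x = (norm u)\<^sup>2 * (w \<bullet> x)" for x unfolding pd[symmetric] by simp
  have eq: "(Q * h / 2) *\<^sub>R w - (1/h) *\<^sub>R (a k' - a k) - (1 / (2 * h)) *\<^sub>R (y k' - y k) + \<sigma> *\<^sub>R bd_flux h \<tau> \<rho> t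
     = ((h / 2) * (Q - (norm u)\<^sup>2 - \<sigma> * h * (u \<bullet> v))) *\<^sub>R w - r3 - (1/2) *\<^sub>R s1 - (\<sigma>/2) *\<^sub>R s2" (is "?l = ?r")
  proof (rule vec_eqI)
    fix x
    have y: "(y k' - y k) \<bullet> x = h * (s1 \<bullet> x + \<sigma> * (s2 \<bullet> x + \<tau>\<^sup>2 * (X 1 2 \<rho> t \<bullet> x)))"
      using h by (simp add: s1_def s2_def inner_simps distrib_left right_diff_distrib)
    have ak: "(a k' - a k) \<bullet> x = h * (r3 \<bullet> x + \<sigma> * (u \<bullet> x) + h / 2 * ((norm u)\<^sup>2 * (w \<bullet> x)) + \<sigma> * h\<^sup>2 / 6 * (z \<bullet> x))"
      using h by (simp add: r3_def p_def inner_simps distrib_left right_diff_distrib pd')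
    have "?l \<bullet> x = (Q * h / 2) * (w \<bullet> x) - (1/h) * ((a k' - a k) \<bullet> x) - (1 / (2 * h)) * ((y k' - y k) \<bullet> x)
        + \<sigma> * (u \<bullet> x + h\<^sup>2 * (1/6 * (z \<bullet> x) - 1/2 * (u \<bullet> v) * (w \<bullet> x)) + \<tau>\<^sup>2 / 2 * (X 1 2 \<rho> t \<bullet> x))"
      by (simp only: bd_flux_def u_def v_def w_def z_def inner_simps inner_scaleR_left)
    also have "\<dots> = ?r \<bullet> x"
    proof -
      have c: "(1 / h) * (h * q) = q" "(1 / (2 * h)) * (h * q) = q / 2" for q using h by auto
      show ?thesis unfolding y ak c unfolding inner_simps inner_scaleR_left by (simp add: field_simps power2_eq_square)
    qed
    finally show "?l \<bullet> x = ?r \<bullet> x" .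
  qed
  have "norm (((h / 2) * (Q - (norm u)\<^sup>2 - \<sigma> * h * (u \<bullet> v))) *\<^sub>R w) \<le> (h / 2) * (5 * B\<^sup>2 * h\<^sup>2) * B"
    unfolding norm_scaleR abs_mult using Q n B1 h by (intro mult_mono) auto
  then have "norm ((Q * h / 2) *\<^sub>R w - (1/h) *\<^sub>R (a k' - a k) - (1 / (2 * h)) *\<^sub>R (y k' - y k) + \<sigma> *\<^sub>R bd_flux h \<tau> \<rho> t)
    \<le> (h / 2) * (5 * B\<^sup>2 * h\<^sup>2) * B + B * h ^ 3 + 3 * B * \<tau>\<^sup>2 * h + 5 * B * \<tau> ^ 3"
    unfolding eq using r3 s1 s2 \<sigma>a by (intro order_trans[OF norm_triangle_ineq4] add_mono) auto
  also have "\<dots> \<le> 10 * B ^ 3 * (h ^ 3 + \<tau>\<^sup>2 * h + \<tau> ^ 3)"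
  proof -
    have mm: "B * x \<le> B ^ 3 * x" "0 \<le> B ^ 3 * x" if "0 \<le> x" for x
      using self_le_power[OF B1, of 3] B1 that by (auto intro: mult_right_mono)
    have p: "0 \<le> h ^ 3" "0 \<le> \<tau>\<^sup>2 * h" "0 \<le> \<tau> ^ 3" using h \<tau> by auto
    note m = mm[OF p(1)] mm[OF p(2)] mm[OF p(3)]
    have "(h / 2) * (5 * B\<^sup>2 * h\<^sup>2) * B = 5/2 * (B ^ 3 * h ^ 3)" by (simp add: eval_nat_numeral)
    then show ?thesis using m unfolding distrib_left mult.assoc by linarith
  qed
  moreover have "Q * h / 2 = (norm (real J *\<^sub>R (a k' - a k)))\<^sup>2 / (2 * real J)" "1 / (2 * h) = real J / 2" "1 / h = real J"
    using h by (simp_all add: Q_def Jh)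
  ultimately show ?thesis by (simp add: w_def \<rho>_def)
qed

end

lemma norm_node_le:
  assumes "0 < J" "k \<le> J"
  shows "norm (\<eta> k) \<le> 3/2 * sqrt (real J) * sqrt (lump_sq J \<eta>)"
proof -
  have "norm (\<eta> k) \<le> sqrt (2 * real J * lump_sq J \<eta>)"
    using node_sq_le_lump[OF assms(2,1), of \<eta>] by (intro real_le_rsqrt) auto
  also have "\<dots> = sqrt 2 * (sqrt (real J) * sqrt (lump_sq J \<eta>))" by (simp add: real_sqrt_mult)
  also have "\<dots> \<le> 3/2 * (sqrt (real J) * sqrt (lump_sq J \<eta>))"
    by (intro mult_right_mono real_le_lsqrt) (auto simp: power2_eq_square lump_sq_nonneg)
  finally show ?thesis by simp
qed

text \<open>
  Remainders of third order at the end points, multiplied by the factor \<open>h\<^sup>-\<^sup>1\<^sup>/\<^sup>2\<close> from the inverse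
  estimate, are of order \<open>h\<^sup>2 + \<tau>\<^sup>2\<close>. This uses \<open>\<tau>\<^sup>2 \<le> h\<close>.
\<close>

lemma cubic_remainder:
  assumes J: "0 < J" and \<tau>: "0 < \<tau>" "\<tau>\<^sup>2 \<le> 1 / real J"
  shows "((1 / real J) ^ 3 + \<tau>\<^sup>2 * (1 / real J) + \<tau> ^ 3) * sqrt (real J) \<le> 2 * ((1 / real J)\<^sup>2 + \<tau>\<^sup>2)"
proof -
  define s where "s = sqrt (real J)"
  have s: "1 \<le> s" "real J = s * s" using J by (auto simp: s_def)
  have ts: "\<tau> * s \<le> 1"
  proof -
    have "(\<tau> * s)\<^sup>2 \<le> 1" using \<tau> J by (simp add: power_mult_distrib s_def field_simps)
    then show ?thesis using s \<tau> by (simp add: power2_le_iff_abs_le abs_le_iff flip: power2_eq_square) (metis abs_of_nonneg abs_square_le_1 abs_le_D1)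
  qed
  have 1: "(1 / real J) ^ 3 * s \<le> (1 / real J)\<^sup>2"
  proof -
    have "(1 / real J) ^ 3 * s = (1 / real J)\<^sup>2 * (s / real J)" by (simp add: power3_eq_cube power2_eq_square)
    also have "\<dots> \<le> (1 / real J)\<^sup>2" using s by (intro mult_left_le) (auto simp: divide_le_eq)
    finally show ?thesis .
  qed
  have 2: "\<tau>\<^sup>2 * (1 / real J) * s \<le> \<tau>\<^sup>2"
  proof -
    have "1 / real J * s \<le> 1" using s by (simp add: divide_le_eq)
    then show ?thesis unfolding mult.assoc by (intro mult_left_le) auto
  qed
  have 3: "\<tau> ^ 3 * s \<le> \<tau>\<^sup>2"
  proof -
    have "\<tau> ^ 3 * s = \<tau>\<^sup>2 * (\<tau> * s)" by (simp add: power3_eq_cube power2_eq_square)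
    also have "\<dots> \<le> \<tau>\<^sup>2" using ts by (intro mult_left_le) auto
    finally show ?thesis .
  qed
  have "0 \<le> (1 / real J)\<^sup>2" by simp
  then show ?thesis using 1 2 3 unfolding s_def[symmetric] distrib_right distrib_left by linarith
qed

context smooth_flow
begin

lemma vbar_xnode:
  "vbar (xnode J t) (xnode J (t - \<tau>)) (xnode J (t - 2 * \<tau>)) = (\<lambda>j. xnode J t j + (1/2) *\<^sub>R dtt \<tau> t 0 (node J j))"
  by (rule ext, rule vec_eqI) (simp add: vbar_def xnode_def dtt_def inner_simps field_simps)

lemma vhat_xnode:
  "vhat (xnode J (t - \<tau>)) (xnode J (t - 2 * \<tau>)) j = xnode J t j - dtt \<tau> t 0 (node J j)"
  by (rule vec_eqI) (simp add: vhat_def xnode_def dtt_def inner_simps)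

lemma slope_bounds:
  assumes J: "j < J" and \<tau>: "0 < \<tau>" "2 * \<tau> \<le> t" "t \<le> T"
  shows "norm (real J *\<^sub>R (xnode J t (Suc j) - xnode J t j)) \<le> B"
    and "norm (real J *\<^sub>R (xnode J t (Suc j) - xnode J t j) - X 1 0 (node J j) t) \<le> B / real J"
    and "norm (real J *\<^sub>R (dtt \<tau> t 0 (node J (Suc j)) - dtt \<tau> t 0 (node J j))) \<le> 6 * B * \<tau>\<^sup>2"
proof -
  define h where "h = 1 / real J"
  have J0: "0 < J" using J by simp
  have h: "0 < h" and Jh: "real J = 1 / h" using J0 by (auto simp: h_def)
  have tT: "t \<in> {0..T}" using \<tau> by auto
  have \<rho>: "node J j \<in> {0..1}" using J by (intro node_in) simp
  have \<rho>p: "node J (Suc j) = node J j + 1 * h" using node_Suc[OF J0] by (simp add: h_def)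
  have \<rho>': "node J j + 1 * h \<in> {0..1}" unfolding \<rho>p[symmetric] using J by (intro node_in) simp
  have one: "(1::real) = 1 \<or> (1::real) = -1" by simp
  note tx = x_taylor[OF tT \<rho> \<rho>' one h]
  note ty = dtt_taylor[OF \<tau> \<rho> \<rho>' one h]
  show "norm (real J *\<^sub>R (xnode J t (Suc j) - xnode J t j)) \<le> B"
    using norm_div_le[of h "xnode J t (Suc j) - xnode J t j" B 1] h tx(1) unfolding xnode_def \<rho>p Jh by simp
  show "norm (real J *\<^sub>R (dtt \<tau> t 0 (node J (Suc j)) - dtt \<tau> t 0 (node J j))) \<le> 6 * B * \<tau>\<^sup>2"
    using norm_div_le[of h "dtt \<tau> t 0 (node J (Suc j)) - dtt \<tau> t 0 (node J j)" "6 * B * \<tau>\<^sup>2" 1] h ty(1) unfolding \<rho>p Jh by simp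
  have "real J *\<^sub>R (xnode J t (Suc j) - xnode J t j) - X 1 0 (node J j) t
     = (1/h) *\<^sub>R (xnode J t (Suc j) - (xnode J t j + (1 * h) *\<^sub>R X 1 0 (node J j) t))"
    by (rule vec_eqI) (use h in \<open>simp add: Jh inner_simps diff_divide_distrib add_divide_distrib\<close>)
  then show "norm (real J *\<^sub>R (xnode J t (Suc j) - xnode J t j) - X 1 0 (node J j) t) \<le> B / real J"
    using norm_div_le[of h "xnode J t (Suc j) - (xnode J t j + (1 * h) *\<^sub>R X 1 0 (node J j) t)" B h] h tx(2)
    unfolding xnode_def \<rho>p Jh by (simp add: power2_eq_square)
qed

text \<open>
  The weights are evaluated at the extrapolated discrete curve \<open>w\<close>, whose slopes differ from those of
  the exact curve by the extrapolation error in time and the slopes of the error \<open>E\<close>.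
\<close>

lemma extrapolated_slope:
  fixes E :: "nat \<Rightarrow> 'a"
  assumes J: "j < J" and \<tau>: "0 < \<tau>" "2 * \<tau> \<le> t" "t \<le> T"
  defines "w \<equiv> \<lambda>j. vhat (xnode J (t - \<tau>)) (xnode J (t - 2 * \<tau>)) j - E j"
  shows "norm (real J *\<^sub>R (w (Suc j) - w j) - real J *\<^sub>R (xnode J t (Suc j) - xnode J t j)) \<le> 6 * B * \<tau>\<^sup>2 + real J * norm (E (Suc j) - E j)"
proof -
  have "real J *\<^sub>R (w (Suc j) - w j) - real J *\<^sub>R (xnode J t (Suc j) - xnode J t j)
    = - (real J *\<^sub>R (dtt \<tau> t 0 (node J (Suc j)) - dtt \<tau> t 0 (node J j))) - real J *\<^sub>R (E (Suc j) - E j)"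
    unfolding w_def vhat_xnode by (simp add: algebra_simps)
  also have "norm \<dots> \<le> 6 * B * \<tau>\<^sup>2 + real J * norm (E (Suc j) - E j)"
    using slope_bounds(3)[OF J \<tau>] by (intro order_trans[OF norm_triangle_ineq4] add_mono) auto
  finally show ?thesis .
qed

text \<open>
  Inserting the exact curve into a step of the scheme whose weights belong to the extrapolation of the
  discrete curve. Nodes are treated by \<open>interior_residual\<close> and \<open>boundary_residual\<close>, after replacing the
  backward difference by \<open>x\<^sub>t\<close> and the weights by those of the exact curve.
\<close>

theorem consistency:
  fixes E \<eta> :: "nat \<Rightarrow> 'a"
  assumes J: "0 < J" and \<tau>: "0 < \<tau>" "2 * \<tau> \<le> t" "t \<le> T" and \<tau>J: "\<tau>\<^sup>2 \<le> 1 / real J"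
    and E: "\<And>j. j < J \<Longrightarrow> real J * norm (E (Suc j) - E j) \<le> 1"
  defines "a \<equiv> xnode J t" and "b \<equiv> xnode J (t - \<tau>)" and "c \<equiv> xnode J (t - 2 * \<tau>)" and "h \<equiv> 1 / real J"
  defines "w \<equiv> \<lambda>j. vhat b c j - E j"
  defines "W \<equiv> \<lambda>j. (norm (real J *\<^sub>R (w (Suc j) - w j)))\<^sup>2"
  shows "\<bar>lump J W (\<lambda>j. (1 / \<tau>) *\<^sub>R bdf a b c j) \<eta> + stiff J (vbar a b c) \<eta>
      - (bd_flux h \<tau> 1 t \<bullet> \<eta> J - bd_flux h \<tau> 0 t \<bullet> \<eta> 0)\<bar>
    \<le> 500 * B ^ 3 * (h\<^sup>2 + \<tau>\<^sup>2 + sqrt (stiff_sq J E)) * sqrt (lump_sq J \<eta>)"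
proof -
  define q where "q j = real J *\<^sub>R (a (Suc j) - a j)" for j
  define Q where "Q j = (norm (q j))\<^sup>2" for j
  define y where "y j = dtt \<tau> t 0 (node J j)" for j
  define xt where "xt j = X 0 1 (node J j) t" for j
  define Dx where "Dx j = (1 / \<tau>) *\<^sub>R bdf a b c j" for j
  define \<epsilon> where "\<epsilon> j = real J * norm (E (Suc j) - E j)" for j
  define N where "N = sqrt (lump_sq J \<eta>)"
  have N: "0 \<le> N" by (simp add: N_def lump_sq_nonneg)
  have B0: "0 \<le> B" using B1 by simp
  have tT: "t \<in> {0..T}" using \<tau> by auto
  have \<tau>1: "\<tau>\<^sup>2 \<le> 1" using \<tau>J J by (rule_tac order_trans[OF \<tau>J]) simp
  have xtB: "norm (xt j) \<le> B" if "j \<le> J" for j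
    unfolding xt_def using node_in[OF that] tT by (intro bound) auto
  have Dx1: "norm (Dx j - xt j) \<le> 6 * B * \<tau>\<^sup>2" if "j \<le> J" for j
  proof -
    have "norm ((1 / \<tau>) *\<^sub>R ((3/2) *\<^sub>R X 0 0 (node J j) t - 2 *\<^sub>R X 0 0 (node J j) (t - \<tau>) + (1/2) *\<^sub>R X 0 0 (node J j) (t - 2 * \<tau>)) - X 0 1 (node J j) t) \<le> 6 * B * \<tau>\<^sup>2"
      using node_in[OF that] \<tau> by (intro time_differences(3)[where T=T and f="\<lambda>k. X 0 k (node J j)"] der_t bound) auto
    then show ?thesis by (simp add: Dx_def xt_def bdf_def a_def b_def c_def xnode_def)
  qed
  have Dx2: "norm (Dx j) \<le> 7 * B" if "j \<le> J" for j
  proof -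
    have "6 * B * \<tau>\<^sup>2 \<le> 6 * B * 1" using \<tau>1 B0 by (intro mult_left_mono) auto
    then show ?thesis using Dx1[OF that] xtB[OF that] norm_triangle_ineq2[of "Dx j" "xt j"] by linarith
  qed
  have qB: "norm (q j) \<le> B" if "j < J" for j
    unfolding q_def a_def by (rule slope_bounds(1)[OF that \<tau>])
  have WQ: "\<bar>W j - Q j\<bar> \<le> 54 * B\<^sup>2 * (\<tau>\<^sup>2 + \<epsilon> j)" if j: "j < J" for j
  proof -
    define r where "r = real J *\<^sub>R (w (Suc j) - w j) - q j"
    have e: "0 \<le> \<epsilon> j" "\<epsilon> j \<le> 1" using E[OF j] by (auto simp: \<epsilon>_def)
    have r: "norm r \<le> 6 * B * \<tau>\<^sup>2 + \<epsilon> j"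
      using extrapolated_slope[OF j \<tau>, of E] by (simp add: r_def w_def q_def a_def b_def c_def \<epsilon>_def)
    have "6 * B * \<tau>\<^sup>2 \<le> 6 * B * 1" using \<tau>1 B0 by (intro mult_left_mono) auto
    then have r7: "norm r \<le> 7 * B" using r e B1 by linarith
    have "\<bar>W j - Q j\<bar> \<le> norm r * (2 * norm (q j) + norm r)"
      using norm_sq_perturb[of "q j" r] by (simp add: W_def Q_def r_def)
    also have "\<dots> \<le> (6 * B * \<tau>\<^sup>2 + \<epsilon> j) * (9 * B)"
      using r r7 qB[OF j] B0 e by (intro mult_mono) auto
    also have "\<dots> \<le> (6 * B * \<tau>\<^sup>2 + 6 * B * \<epsilon> j) * (9 * B)"
      using mult_right_mono[of 1 "6 * B" "\<epsilon> j"] e B1 by (intro mult_right_mono) auto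
    also have "\<dots> = 54 * B\<^sup>2 * (\<tau>\<^sup>2 + \<epsilon> j)" by (simp add: power2_eq_square algebra_simps)
    finally show ?thesis .
  qed
  have cell: "norm (W j *\<^sub>R Dx i - Q j *\<^sub>R xt i) \<le> 400 * B ^ 3 * (\<tau>\<^sup>2 + \<epsilon> j)" if j: "j < J" and i: "i \<le> J" for i j
  proof -
    have e: "0 \<le> \<epsilon> j" by (simp add: \<epsilon>_def)
    have "W j *\<^sub>R Dx i - Q j *\<^sub>R xt i = (W j - Q j) *\<^sub>R Dx i + Q j *\<^sub>R (Dx i - xt i)" by (simp add: algebra_simps)
    also have "norm \<dots> \<le> \<bar>W j - Q j\<bar> * norm (Dx i) + Q j * norm (Dx i - xt i)"
      by (rule order_trans[OF norm_triangle_ineq]) (simp add: Q_def)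
    also have "\<dots> \<le> (54 * B\<^sup>2 * (\<tau>\<^sup>2 + \<epsilon> j)) * (7 * B) + B\<^sup>2 * (6 * B * \<tau>\<^sup>2)"
      using WQ[OF j] Dx1[OF i] Dx2[OF i] qB[OF j] e B0 by (intro add_mono mult_mono) (auto simp: Q_def power_mono)
    also have "\<dots> = 384 * B ^ 3 * \<tau>\<^sup>2 + 378 * B ^ 3 * \<epsilon> j" by (simp add: eval_nat_numeral algebra_simps)
    also have "\<dots> \<le> 400 * B ^ 3 * (\<tau>\<^sup>2 + \<epsilon> j)"
      unfolding distrib_left using B0 e by (intro add_mono mult_right_mono) auto
    finally show ?thesis .
  qed
  have cs1: "(\<Sum>j<J. norm (\<eta> (Suc j)) + norm (\<eta> j)) / (2 * real J) \<le> N"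
    using cellwise_cauchy_schwarz[OF J, of "\<lambda>_. 1" \<eta>] J by (simp add: N_def)
  have cs2: "(\<Sum>j<J. \<epsilon> j * (norm (\<eta> (Suc j)) + norm (\<eta> j))) / (2 * real J) \<le> sqrt (stiff_sq J E) * N"
  proof -
    have "(\<Sum>j<J. (\<epsilon> j)\<^sup>2) / real J = stiff_sq J E"
      using J by (simp add: \<epsilon>_def stiff_def power_mult_distrib power2_norm_eq_inner sum_distrib_left[symmetric] power2_eq_square[of "real J"])
    then show ?thesis using cellwise_cauchy_schwarz[OF J, of \<epsilon> \<eta>] by (simp add: N_def)
  qed
  have lumpdiff: "\<bar>lump J W Dx \<eta> - lump J Q xt \<eta>\<bar> \<le> 400 * B ^ 3 * (\<tau>\<^sup>2 + sqrt (stiff_sq J E)) * N"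
  proof -
    let ?m = "\<lambda>j. norm (\<eta> (Suc j)) + norm (\<eta> j)"
    let ?d = "\<lambda>j i. (W j *\<^sub>R Dx i - Q j *\<^sub>R xt i) \<bullet> \<eta> i"
    have "lump J W Dx \<eta> - lump J Q xt \<eta> = (\<Sum>j<J. ?d j (Suc j) + ?d j j) / (2 * real J)"
      unfolding lump_def diff_divide_distrib[symmetric] sum_subtractf[symmetric] by (simp add: inner_simps algebra_simps)
    also have "\<bar>\<dots>\<bar> \<le> (\<Sum>j<J. 400 * B ^ 3 * (\<tau>\<^sup>2 + \<epsilon> j) * ?m j) / (2 * real J)"
      unfolding abs_divide
    proof (rule divide_mono)
      show "\<bar>\<Sum>j<J. ?d j (Suc j) + ?d j j\<bar> \<le> (\<Sum>j<J. 400 * B ^ 3 * (\<tau>\<^sup>2 + \<epsilon> j) * ?m j)"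
      proof (rule order_trans[OF sum_abs], rule sum_mono)
        fix j assume "j \<in> {..<J}"
        then have j: "j < J" by simp
        have "\<bar>?d j i\<bar> \<le> 400 * B ^ 3 * (\<tau>\<^sup>2 + \<epsilon> j) * norm (\<eta> i)" if "i \<le> J" for i
          by (rule order_trans[OF Cauchy_Schwarz_ineq2 mult_right_mono[OF cell[OF j that]]]) simp
        from this[of j] this[of "Suc j"] j
        show "\<bar>?d j (Suc j) + ?d j j\<bar> \<le> 400 * B ^ 3 * (\<tau>\<^sup>2 + \<epsilon> j) * ?m j"
          unfolding distrib_left by linarith
      qed
    qed (use J B0 in \<open>auto intro!: sum_nonneg simp: \<epsilon>_def\<close>)
    also have "\<dots> = 400 * B ^ 3 * (\<tau>\<^sup>2 * ((\<Sum>j<J. ?m j) / (2 * real J)) + (\<Sum>j<J. \<epsilon> j * ?m j) / (2 * real J))"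
    proof -
      have "(\<Sum>j<J. 400 * B ^ 3 * (\<tau>\<^sup>2 + \<epsilon> j) * ?m j) = 400 * B ^ 3 * (\<tau>\<^sup>2 * (\<Sum>j<J. ?m j) + (\<Sum>j<J. \<epsilon> j * ?m j))"
        unfolding sum_distrib_left sum.distrib[symmetric] by (intro sum.cong refl) (simp add: algebra_simps)
      then show ?thesis by (simp only: times_divide_eq_right add_divide_distrib[symmetric])
    qed
    also have "\<dots> \<le> 400 * B ^ 3 * (\<tau>\<^sup>2 * N + sqrt (stiff_sq J E) * N)"
      using cs1 cs2 B0 by (intro mult_left_mono add_mono) auto
    finally show ?thesis by (simp add: algebra_simps)
  qed
  define res where "res j = ((Q j + Q (j - 1)) / 2) *\<^sub>R xt j - (real J)\<^sup>2 *\<^sub>R (a (Suc j) - 2 *\<^sub>R a j + a (j - 1))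
     - ((real J)\<^sup>2 / 2) *\<^sub>R (y (Suc j) - 2 *\<^sub>R y j + y (j - 1))" for j
  have res: "norm (res j) \<le> 7 * B ^ 3 * (h\<^sup>2 + \<tau>\<^sup>2)" if "j \<in> {1..<J}" for j
  proof -
    have j: "0 < j" "j < J" "Suc (j - 1) = j" using that by auto
    show ?thesis
      using interior_residual[OF J j(1,2) \<tau>] unfolding res_def Q_def q_def j(3) by (simp only: xt_def y_def a_def h_def)
  qed
  define bv where "bv k k' = ((norm (real J *\<^sub>R (a k' - a k)))\<^sup>2 / (2 * real J)) *\<^sub>R xt k - real J *\<^sub>R (a k' - a k) - (real J / 2) *\<^sub>R (y k' - y k)" for k k'
  have Q0: "Q 0 = (norm (real J *\<^sub>R (a 1 - a 0)))\<^sup>2" by (simp add: Q_def q_def)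
  have QJ: "Q (J - 1) = (norm (real J *\<^sub>R (a (J - 1) - a J)))\<^sup>2" using J by (simp add: Q_def q_def norm_minus_commute)
  have split: "lump J Q xt \<eta> + stiff J (vbar a b c) \<eta> = (\<Sum>j=1..<J. (res j \<bullet> \<eta> j) / real J) + bv 0 1 \<bullet> \<eta> 0 + bv J (J - 1) \<bullet> \<eta> J"
  proof -
    have st: "stiff J (vbar a b c) \<eta> = stiff J a \<eta> + 1/2 * stiff J y \<eta>"
      unfolding a_def b_def c_def vbar_xnode stiff_add stiff_scale y_def[abs_def] by simp
    have sm: "(\<Sum>j=1..<J. (res j \<bullet> \<eta> j) / real J) = (\<Sum>j=1..<J. (Q j + Q (j - 1)) * (xt j \<bullet> \<eta> j)) / (2 * real J)
       - (\<Sum>j=1..<J. real J * ((a (Suc j) - 2 *\<^sub>R a j + a (j - 1)) \<bullet> \<eta> j))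
       - 1/2 * (\<Sum>j=1..<J. real J * ((y (Suc j) - 2 *\<^sub>R y j + y (j - 1)) \<bullet> \<eta> j))"
      unfolding sum_divide_distrib sum_distrib_left sum_subtractf[symmetric]
    proof (intro sum.cong refl)
      fix j
      let ?A = "a (Suc j) - 2 *\<^sub>R a j + a (j - 1)" and ?Y = "y (Suc j) - 2 *\<^sub>R y j + y (j - 1)"
      have "res j \<bullet> \<eta> j = (Q j + Q (j - 1)) / 2 * (xt j \<bullet> \<eta> j) - (real J)\<^sup>2 * (?A \<bullet> \<eta> j) - (real J)\<^sup>2 / 2 * (?Y \<bullet> \<eta> j)"
        unfolding res_def by (simp only: inner_diff_left inner_scaleR_left)
      then show "(res j \<bullet> \<eta> j) / real J = (Q j + Q (j - 1)) * (xt j \<bullet> \<eta> j) / (2 * real J) - real J * (?A \<bullet> \<eta> j) - 1/2 * (real J * (?Y \<bullet> \<eta> j))"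
        using J by (simp add: diff_divide_distrib power2_eq_square)
    qed
    have b0: "bv 0 1 \<bullet> \<eta> 0 = Q 0 * (xt 0 \<bullet> \<eta> 0) / (2 * real J) - real J * ((a 1 - a 0) \<bullet> \<eta> 0) - 1/2 * (real J * ((y 1 - y 0) \<bullet> \<eta> 0))"
      unfolding bv_def Q0 by (simp only: inner_diff_left inner_scaleR_left) simp
    have bJ: "bv J (J - 1) \<bullet> \<eta> J = Q (J - 1) * (xt J \<bullet> \<eta> J) / (2 * real J) - real J * ((a (J - 1) - a J) \<bullet> \<eta> J) - 1/2 * (real J * ((y (J - 1) - y J) \<bullet> \<eta> J))"
      unfolding bv_def QJ by (simp only: inner_diff_left inner_scaleR_left) simp
    show ?thesis
      unfolding st unfolding lump_by_nodes[OF J] stiff_by_parts[OF J, of a] stiff_by_parts[OF J, of y] sm b0 bJ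
        add_divide_distrib right_diff_distrib by linarith
  qed
  have int: "\<bar>\<Sum>j=1..<J. (res j \<bullet> \<eta> j) / real J\<bar> \<le> 7 * B ^ 3 * (h\<^sup>2 + \<tau>\<^sup>2) * N"
  proof -
    have "\<bar>\<Sum>j=1..<J. (res j \<bullet> \<eta> j) / real J\<bar> \<le> (\<Sum>j=1..<J. 7 * B ^ 3 * (h\<^sup>2 + \<tau>\<^sup>2) * (norm (\<eta> j) / real J))"
    proof (rule order_trans[OF sum_abs], rule sum_mono)
      fix j assume j: "j \<in> {1..<J}"
      have "\<bar>res j \<bullet> \<eta> j\<bar> \<le> 7 * B ^ 3 * (h\<^sup>2 + \<tau>\<^sup>2) * norm (\<eta> j)"
        by (rule order_trans[OF Cauchy_Schwarz_ineq2 mult_right_mono[OF res[OF j]]]) simp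
      then show "\<bar>(res j \<bullet> \<eta> j) / real J\<bar> \<le> 7 * B ^ 3 * (h\<^sup>2 + \<tau>\<^sup>2) * (norm (\<eta> j) / real J)"
        using J by (simp add: abs_divide divide_right_mono)
    qed
    also have "\<dots> = 7 * B ^ 3 * (h\<^sup>2 + \<tau>\<^sup>2) * ((\<Sum>j=1..<J. norm (\<eta> j)) / real J)"
      by (simp only: sum_distrib_left[symmetric] sum_divide_distrib[symmetric])
    also have "(\<Sum>j=1..<J. norm (\<eta> j)) / real J \<le> (\<Sum>j<J. norm (\<eta> (Suc j)) + norm (\<eta> j)) / (2 * real J)"
    proof -
      have "(\<Sum>j<J. norm (\<eta> (Suc j)) + norm (\<eta> j)) = (\<Sum>j<J. norm (\<eta> j) + norm (\<eta> (Suc j)))" by (simp add: add.commute)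
      also have "\<dots> = (\<Sum>j=1..<J. norm (\<eta> j) + norm (\<eta> j)) + norm (\<eta> 0) + norm (\<eta> J)"
        by (rule sum_cells[OF J, of "\<lambda>j. norm (\<eta> j)" "\<lambda>j. norm (\<eta> j)"])
      also have "\<dots> = 2 * (\<Sum>j=1..<J. norm (\<eta> j)) + norm (\<eta> 0) + norm (\<eta> J)"
        by (simp add: sum_distrib_left)
      finally show ?thesis using J by (simp add: field_simps)
    qed
    also have "\<dots> \<le> N" by (rule cs1)
    finally show ?thesis using B0 by (simp add: mult_left_mono)
  qed
  have node: "node J 0 = 0" "node J J = 1" using J by (auto simp: node_def)
  have bdry: "10 * B ^ 3 * (h ^ 3 + \<tau>\<^sup>2 * h + \<tau> ^ 3) * norm (\<eta> k) \<le> 30 * B ^ 3 * (h\<^sup>2 + \<tau>\<^sup>2) * N" if "k \<le> J" for k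
  proof -
    have h0: "0 \<le> h" by (simp add: h_def)
    have "(h ^ 3 + \<tau>\<^sup>2 * h + \<tau> ^ 3) * norm (\<eta> k) \<le> (h ^ 3 + \<tau>\<^sup>2 * h + \<tau> ^ 3) * (3/2 * sqrt (real J) * N)"
      using norm_node_le[OF J that, of \<eta>] h0 \<tau> by (intro mult_left_mono) (auto simp: N_def)
    also have "\<dots> = 3/2 * ((h ^ 3 + \<tau>\<^sup>2 * h + \<tau> ^ 3) * sqrt (real J)) * N" by simp
    also have "\<dots> \<le> 3/2 * (2 * (h\<^sup>2 + \<tau>\<^sup>2)) * N"
      using cubic_remainder[OF J \<tau>(1) \<tau>J] N by (intro mult_right_mono mult_left_mono) (auto simp: h_def)
    finally have "10 * B ^ 3 * ((h ^ 3 + \<tau>\<^sup>2 * h + \<tau> ^ 3) * norm (\<eta> k)) \<le> 10 * B ^ 3 * (3/2 * (2 * (h\<^sup>2 + \<tau>\<^sup>2)) * N)"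
      using B0 by (intro mult_left_mono) auto
    moreover have "10 * B ^ 3 * (3/2 * (2 * (h\<^sup>2 + \<tau>\<^sup>2)) * N) = 30 * B ^ 3 * (h\<^sup>2 + \<tau>\<^sup>2) * N" by simp
    ultimately show ?thesis by (simp only: mult.assoc)
  qed
  have bd0: "\<bar>bv 0 1 \<bullet> \<eta> 0 + bd_flux h \<tau> 0 t \<bullet> \<eta> 0\<bar> \<le> 30 * B ^ 3 * (h\<^sup>2 + \<tau>\<^sup>2) * N"
  proof -
    have "norm (bv 0 1 + 1 *\<^sub>R bd_flux h \<tau> (node J 0) t) \<le> 10 * B ^ 3 * (h ^ 3 + \<tau>\<^sup>2 * h + \<tau> ^ 3)"
      using boundary_residual[OF J _ \<tau>, of 0 1 1] unfolding bv_def xt_def a_def y_def h_def by blast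
    then have "\<bar>(bv 0 1 + 1 *\<^sub>R bd_flux h \<tau> (node J 0) t) \<bullet> \<eta> 0\<bar> \<le> 10 * B ^ 3 * (h ^ 3 + \<tau>\<^sup>2 * h + \<tau> ^ 3) * norm (\<eta> 0)"
      by (intro order_trans[OF Cauchy_Schwarz_ineq2 mult_right_mono]) auto
    also have "\<dots> \<le> 30 * B ^ 3 * (h\<^sup>2 + \<tau>\<^sup>2) * N" by (rule bdry) simp
    finally show ?thesis by (simp add: node inner_add_left)
  qed
  have bd1: "\<bar>bv J (J - 1) \<bullet> \<eta> J - bd_flux h \<tau> 1 t \<bullet> \<eta> J\<bar> \<le> 30 * B ^ 3 * (h\<^sup>2 + \<tau>\<^sup>2) * N"
  proof -
    have "norm (bv J (J - 1) + (-1) *\<^sub>R bd_flux h \<tau> (node J J) t) \<le> 10 * B ^ 3 * (h ^ 3 + \<tau>\<^sup>2 * h + \<tau> ^ 3)"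
      using boundary_residual[OF J _ \<tau>, of J "J - 1" "-1"] unfolding bv_def xt_def a_def y_def h_def by blast
    then have "\<bar>(bv J (J - 1) + (-1) *\<^sub>R bd_flux h \<tau> (node J J) t) \<bullet> \<eta> J\<bar> \<le> 10 * B ^ 3 * (h ^ 3 + \<tau>\<^sup>2 * h + \<tau> ^ 3) * norm (\<eta> J)"
      by (intro order_trans[OF Cauchy_Schwarz_ineq2 mult_right_mono]) auto
    also have "\<dots> \<le> 30 * B ^ 3 * (h\<^sup>2 + \<tau>\<^sup>2) * N" by (rule bdry) simp
    finally show ?thesis by (simp add: node inner_diff_left inner_add_left)
  qed
  have "0 \<le> B ^ 3 * h\<^sup>2 * N" "0 \<le> B ^ 3 * sqrt (stiff_sq J E) * N" "0 \<le> B ^ 3 * \<tau>\<^sup>2 * N" using B0 N stiff_sq_nonneg[of J E] by auto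
  then show ?thesis
    using lumpdiff split int bd0 bd1 unfolding N_def[symmetric] Dx_def[abs_def] distrib_left distrib_right mult.assoc by linarith
qed

end

section \<open>Solvability of the linear systems\<close>

text \<open>
  By induction on the number of unknowns: the Schur complement of one unknown is again symmetric and
  positive definite.
\<close>

lemma positive_definite_solvable:
  fixes A :: "'i \<Rightarrow> 'i \<Rightarrow> real"
  assumes "finite I"
    and sym: "\<And>i j. i \<in> I \<Longrightarrow> j \<in> I \<Longrightarrow> A i j = A j i"
    and pos: "\<And>c. \<exists>i\<in>I. c i \<noteq> 0 \<Longrightarrow> 0 < (\<Sum>i\<in>I. \<Sum>j\<in>I. c i * A i j * c j)"
  shows "\<exists>c. \<forall>i\<in>I. (\<Sum>j\<in>I. A i j * c j) = b i"
  using assms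
proof (induction I arbitrary: b rule: finite_induct)
  case empty
  then show ?case by simp
next
  case (insert k I)
  have pos': "0 < (\<Sum>i\<in>I. \<Sum>j\<in>I. c i * A i j * c j)" if "\<exists>i\<in>I. c i \<noteq> 0" for c
  proof -
    define c' where "c' i = (if i = k then 0 else c i)" for i
    have eq: "c' i = c i" if "i \<in> I" for i using that insert.hyps by (auto simp: c'_def)
    have "\<exists>i\<in>insert k I. c' i \<noteq> 0" using that eq by auto
    from insert.prems(2)[OF this] show ?thesis
      using insert.hyps by (simp add: c'_def[of k] eq cong: sum.cong)
  qed
  have sym': "\<And>i j. i \<in> I \<Longrightarrow> j \<in> I \<Longrightarrow> A i j = A j i" using insert.prems(1) by auto
  note IH = insert.IH[OF sym' pos']
  obtain p where p: "\<forall>i\<in>I. (\<Sum>j\<in>I. A i j * p j) = A i k" using IH[of "\<lambda>i. A i k"] by auto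
  obtain q where q: "\<forall>i\<in>I. (\<Sum>j\<in>I. A i j * q j) = b i" using IH[of b] by auto
  define s where "s = A k k - (\<Sum>j\<in>I. A k j * p j)"
  have s: "0 < s"
  proof -
    define c where "c i = (if i = k then 1 else - p i)" for i
    have eq: "c i = - p i" if "i \<in> I" for i using that insert.hyps by (auto simp: c_def)
    have "0 < (\<Sum>i\<in>insert k I. \<Sum>j\<in>insert k I. c i * A i j * c j)"
      by (intro insert.prems(2)) (auto simp: c_def)
    also have "\<dots> = (A k k - (\<Sum>j\<in>I. A k j * p j)) + (\<Sum>i\<in>I. - p i * (A i k - (\<Sum>j\<in>I. A i j * p j)))"
      using insert.hyps by (simp add: c_def[of k] eq sum_subtractf sum_negf sum_distrib_left algebra_simps sum.distrib cong: sum.cong)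
    also have "(\<Sum>i\<in>I. - p i * (A i k - (\<Sum>j\<in>I. A i j * p j))) = 0"
      using p by (intro sum.neutral) auto
    finally show ?thesis by (simp add: s_def)
  qed
  define \<gamma> where "\<gamma> = (b k - (\<Sum>j\<in>I. A k j * q j)) / s"
  define c where "c i = (if i = k then \<gamma> else q i - \<gamma> * p i)" for i
  have eq: "c i = q i - \<gamma> * p i" if "i \<in> I" for i using that insert.hyps by (auto simp: c_def)
  have row: "(\<Sum>j\<in>insert k I. A i j * c j) = A i k * \<gamma> + (\<Sum>j\<in>I. A i j * q j) - \<gamma> * (\<Sum>j\<in>I. A i j * p j)" for i
    using insert.hyps by (simp add: c_def[of k] eq sum_subtractf sum_distrib_left algebra_simps cong: sum.cong)
  have "(\<Sum>j\<in>insert k I. A i j * c j) = b i" if "i \<in> I" for i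
    unfolding row using p q that by simp
  moreover have "(\<Sum>j\<in>insert k I. A k j * c j) = b k"
  proof -
    have "A k k * \<gamma> - \<gamma> * (\<Sum>j\<in>I. A k j * p j) = \<gamma> * s" by (simp add: s_def algebra_simps)
    also have "\<dots> = b k - (\<Sum>j\<in>I. A k j * q j)" using s by (simp add: \<gamma>_def)
    finally show ?thesis unfolding row by linarith
  qed
  ultimately show ?case by auto
qed

definition step_form :: "nat \<Rightarrow> (nat \<Rightarrow> real) \<Rightarrow> real \<Rightarrow> (nat \<Rightarrow> 'a::real_inner) \<Rightarrow> (nat \<Rightarrow> 'a) \<Rightarrow> real" where
  "step_form J W \<tau> u v = (1 / \<tau>) * lump J W u v + stiff J u v"

lemma step_form_pos:
  assumes J: "0 < J" and \<tau>: "0 < \<tau>" and W: "\<And>j. j < J \<Longrightarrow> 0 < W j" and k: "k \<le> J" "v k \<noteq> (0::'a::real_inner)"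
  shows "0 < step_form J W \<tau> v v"
proof -
  have nn: "0 \<le> W j * (v (Suc j) \<bullet> v (Suc j) + v j \<bullet> v j)" if "j < J" for j
    using W[OF that] by auto
  obtain j where j: "j < J" "k = j \<or> k = Suc j"
  proof (cases k)
    case 0
    then show ?thesis using that[of 0] J by simp
  next
    case (Suc i)
    then show ?thesis using that[of i] k(1) by simp
  qed
  have "0 < W j * (v (Suc j) \<bullet> v (Suc j) + v j \<bullet> v j)"
    using W[OF j(1)] j(2) k(2)
    by (intro mult_pos_pos) (metis add_nonneg_pos add_pos_nonneg inner_ge_zero inner_gt_zero_iff)+
  also have "\<dots> \<le> (\<Sum>j<J. W j * (v (Suc j) \<bullet> v (Suc j) + v j \<bullet> v j))"
    using j nn by (intro member_le_sum) auto
  finally have "0 < lump J W v v" using J by (simp add: lump_def)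
  then show ?thesis using \<tau> stiff_sq_nonneg[of J v] by (simp add: step_form_def add_pos_nonneg)
qed

text \<open>
  The flag \<open>cl\<close> is set for closed curves, where the nodes \<open>0\<close> and \<open>J\<close> are identified; for open curves,
  \<open>bd\<close> consists of the end nodes, at which the vectors are tangential.
\<close>

definition nodal_space :: "bool \<Rightarrow> nat \<Rightarrow> nat set \<Rightarrow> (nat \<Rightarrow> 'a::real_inner) \<Rightarrow> (nat \<Rightarrow> 'a) set" where
  "nodal_space cl J bd g = {\<eta>. (\<forall>k\<in>bd. \<eta> k \<bullet> g k = 0) \<and> (cl \<longrightarrow> \<eta> 0 = \<eta> J)}"

text \<open>
  The space of nodal vectors has a basis indexed by the nodes and, at each node, by an orthonormal
  basis of the admissible directions. In these coordinates the problem is a positive definite system.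
  Nodal vectors are functions on all natural numbers of which only the values up to \<open>J\<close> matter, so the
  right hand side \<open>f\<close> has to respect that.
\<close>

lemma step_solvable:
  fixes g :: "nat \<Rightarrow> 'a::euclidean_space"
  assumes J: "0 < J" and \<tau>: "0 < \<tau>" and W: "\<And>j. j < J \<Longrightarrow> 0 < W j"
    and cl: "cl \<Longrightarrow> bd = {}"
    and f_sum: "\<And>(S :: (nat \<times> 'a) set) v. finite S \<Longrightarrow> f (\<lambda>j. \<Sum>i\<in>S. v i j) = (\<Sum>i\<in>S. f (v i))"
    and f_scale: "\<And>r v. f (\<lambda>j. r *\<^sub>R v j) = r * f v"
    and f_cong: "\<And>u v. (\<And>j. j \<le> J \<Longrightarrow> u j = v j) \<Longrightarrow> f u = (f v :: real)"
  obtains u where "u \<in> nodal_space cl J bd g" "\<And>\<eta>. \<eta> \<in> nodal_space cl J bd g \<Longrightarrow> step_form J W \<tau> u \<eta> = f \<eta>"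
proof -
  define V where "V k = (if k \<in> bd then {v. v \<bullet> g k = 0} else UNIV)" for k
  have subV: "subspace (V k)" for k
    by (auto simp: V_def subspace_def inner_simps)
  have "\<exists>P. P \<subseteq> V k \<and> pairwise orthogonal P \<and> (\<forall>x\<in>P. norm x = 1) \<and> independent P \<and> span P = V k" for k
    using orthonormal_basis_subspace[OF subV[of k]] by metis
  then obtain P where P: "\<And>k. P k \<subseteq> V k" "\<And>k. pairwise orthogonal (P k)" "\<And>k x. x \<in> P k \<Longrightarrow> norm x = 1"
     "\<And>k. independent (P k)" "\<And>k. span (P k) = V k"
    by metis
  have fP: "finite (P k)" for k using P(4) by (simp add: independent_imp_finite)
  define n where "n = (if cl then J else Suc J)"
  define r where "r j = (if cl \<and> j = J then 0 else j)" for j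
  have n0: "0 < n" using J by (auto simp: n_def)
  define I where "I = (SIGMA k:{..<n}. P k)"
  have fI: "finite I" using fP by (auto simp: I_def)
  define \<phi> where "\<phi> i j = (if r j = fst i then snd i else 0)" for i :: "nat \<times> 'a" and j
  have \<phi>in: "\<phi> i \<in> nodal_space cl J bd g" if "i \<in> I" for i
  proof -
    have "\<phi> i k \<bullet> g k = 0" if "k \<in> bd" for k
    proof -
      have "\<not> cl" using cl that by auto
      then have "r k = k" by (simp add: r_def)
      then show ?thesis using \<open>i \<in> I\<close> P(1)[of k] that by (auto simp: \<phi>_def I_def V_def)
    qed
    then show ?thesis using J by (auto simp: nodal_space_def \<phi>_def r_def)
  qed
  have rep: "\<exists>c. \<forall>j\<le>J. \<eta> j = (\<Sum>i\<in>I. c i *\<^sub>R \<phi> i j)" if \<eta>: "\<eta> \<in> nodal_space cl J bd g" for \<eta>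
  proof -
    have sp: "\<eta> k \<in> span (P k)" for k using \<eta> by (auto simp: P(5) V_def nodal_space_def)
    have "\<exists>c. (\<Sum>x\<in>P k. c x *\<^sub>R x) = \<eta> k" for k
      using sp[of k] span_finite[OF fP[of k]] by auto
    then obtain c where c: "\<And>k. (\<Sum>x\<in>P k. c k x *\<^sub>R x) = \<eta> k" by metis
    have "\<eta> j = (\<Sum>i\<in>I. c (fst i) (snd i) *\<^sub>R \<phi> i j)" if "j \<le> J" for j
    proof -
      have rj: "r j < n" using that J by (auto simp: r_def n_def)
      have "(\<Sum>i\<in>I. c (fst i) (snd i) *\<^sub>R \<phi> i j) = (\<Sum>k<n. \<Sum>x\<in>P k. c k x *\<^sub>R (if r j = k then x else 0))"
        unfolding I_def by (subst sum.Sigma) (auto simp: fP \<phi>_def intro!: sum.cong)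
      also have "\<dots> = (\<Sum>k<n. if k = r j then \<eta> k else 0)"
        by (intro sum.cong refl) (auto simp: c)
      also have "\<dots> = \<eta> (r j)" using rj by (simp add: sum.delta)
      also have "\<dots> = \<eta> j" using \<eta> by (auto simp: r_def nodal_space_def)
      finally show ?thesis by simp
    qed
    then show ?thesis by (intro exI[of _ "\<lambda>i. c (fst i) (snd i)"]) auto
  qed
  let ?A = "step_form J W \<tau>"
  have A_cong: "?A u \<eta> = ?A u' \<eta>'" if "\<And>j. j \<le> J \<Longrightarrow> u j = u' j" "\<And>j. j \<le> J \<Longrightarrow> \<eta> j = \<eta>' j" for u u' \<eta> \<eta>' :: "nat \<Rightarrow> 'a"
    using that by (simp add: step_form_def lump_def stiff_def)
  have A_lin: "?A (\<lambda>j. \<Sum>i\<in>S. c i *\<^sub>R v i j) \<eta> = (\<Sum>i\<in>S. c i * ?A (v i) \<eta>)" if "finite S" for S :: "(nat \<times> 'a) set" and c v \<eta>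
    using that
  proof (induction S rule: finite_induct)
    case empty
    then show ?case by (simp add: step_form_def lump_def stiff_def)
  next
    case (insert x S)
    have "?A (\<lambda>j. \<Sum>i\<in>insert x S. c i *\<^sub>R v i j) \<eta> = ?A (\<lambda>j. c x *\<^sub>R v x j + (\<Sum>i\<in>S. c i *\<^sub>R v i j)) \<eta>"
      using insert.hyps by simp
    also have "\<dots> = c x * ?A (v x) \<eta> + ?A (\<lambda>j. \<Sum>i\<in>S. c i *\<^sub>R v i j) \<eta>"
      by (simp add: step_form_def lump_lin stiff_lin algebra_simps)
    finally show ?case using insert by simp
  qed
  have A_sym: "?A u v = ?A v u" for u v by (simp add: step_form_def lump_commute stiff_commute)
  have A_lin2: "?A \<eta> (\<lambda>j. \<Sum>i\<in>I. c i *\<^sub>R \<phi> i j) = (\<Sum>i\<in>I. c i * ?A \<eta> (\<phi> i))" for c \<eta>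
    using A_lin[OF fI, of c \<phi> \<eta>] by (simp add: A_sym)
  have pos: "0 < (\<Sum>i\<in>I. \<Sum>j\<in>I. c i * ?A (\<phi> j) (\<phi> i) * c j)" if ne: "\<exists>i\<in>I. c i \<noteq> 0" for c
  proof -
    define v where "v = (\<lambda>j. \<Sum>i\<in>I. c i *\<^sub>R \<phi> i j)"
    obtain i where "i \<in> I" "c i \<noteq> 0" using ne by blast
    moreover define k x where "k = fst i" and "x = snd i"
    ultimately have kx: "k < n" "x \<in> P k" "c (k, x) \<noteq> 0" by (auto simp: I_def)
    have rk: "r k = k" "k \<le> J" using kx(1) by (auto simp: r_def n_def split: if_splits)
    have "v k = (\<Sum>l<n. \<Sum>z\<in>P l. c (l, z) *\<^sub>R (if r k = l then z else 0))"
      unfolding v_def I_def by (subst sum.Sigma) (auto simp: fP \<phi>_def intro!: sum.cong)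
    also have "\<dots> = (\<Sum>l<n. if l = k then (\<Sum>z\<in>P k. c (k, z) *\<^sub>R z) else 0)"
      by (intro sum.cong refl) (auto simp: rk)
    also have "\<dots> = (\<Sum>z\<in>P k. c (k, z) *\<^sub>R z)" using kx by (simp add: sum.delta)
    finally have vk: "v k = (\<Sum>z\<in>P k. c (k, z) *\<^sub>R z)" .
    have "v k \<bullet> x = (\<Sum>z\<in>P k. if z = x then c (k, x) else 0)"
      unfolding vk inner_sum_left
    proof (intro sum.cong refl)
      fix z assume z: "z \<in> P k"
      show "(c (k, z) *\<^sub>R z) \<bullet> x = (if z = x then c (k, x) else 0)"
        using P(2)[of k] P(3)[OF kx(2)] z kx(2) by (auto simp: pairwise_def orthogonal_def norm_eq_1)
    qed
    also have "\<dots> = c (k, x)" using kx(2) fP by (simp add: sum.delta)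
    finally have "v k \<noteq> 0" using kx(3) by auto
    then have "0 < ?A v v" by (intro step_form_pos[OF J \<tau> W rk(2)])
    also have "?A v v = (\<Sum>i\<in>I. \<Sum>j\<in>I. c i * ?A (\<phi> j) (\<phi> i) * c j)"
    proof -
      have "?A v v = (\<Sum>i\<in>I. c i * ?A v (\<phi> i))" unfolding v_def by (rule A_lin2)
      also have "\<dots> = (\<Sum>i\<in>I. c i * (\<Sum>j\<in>I. c j * ?A (\<phi> j) (\<phi> i)))"
        unfolding v_def A_lin[OF fI] ..
      finally show ?thesis by (simp add: sum_distrib_left mult_ac)
    qed
    finally show ?thesis .
  qed
  obtain c where c: "\<forall>i\<in>I. (\<Sum>j\<in>I. ?A (\<phi> j) (\<phi> i) * c j) = f (\<phi> i)"
  proof -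
    have "\<exists>c. \<forall>i\<in>I. (\<Sum>j\<in>I. ?A (\<phi> j) (\<phi> i) * c j) = f (\<phi> i)"
      by (rule positive_definite_solvable[OF fI A_sym pos])
    then show thesis using that by blast
  qed
  define u where "u = (\<lambda>j. \<Sum>i\<in>I. c i *\<^sub>R \<phi> i j)"
  have "u \<in> nodal_space cl J bd g"
    using \<phi>in by (auto simp: u_def nodal_space_def inner_sum_left)
  moreover have "?A u \<eta> = f \<eta>" if \<eta>: "\<eta> \<in> nodal_space cl J bd g" for \<eta>
  proof -
    obtain d where d: "\<And>j. j \<le> J \<Longrightarrow> \<eta> j = (\<Sum>i\<in>I. d i *\<^sub>R \<phi> i j)" using rep[OF \<eta>] by blast
    have u\<phi>: "?A u (\<phi> i) = f (\<phi> i)" if "i \<in> I" for i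
      using c that unfolding u_def A_lin[OF fI] by (simp add: mult.commute)
    have "?A u \<eta> = ?A u (\<lambda>j. \<Sum>i\<in>I. d i *\<^sub>R \<phi> i j)" using d by (intro A_cong) auto
    also have "\<dots> = (\<Sum>i\<in>I. d i * f (\<phi> i))" unfolding A_lin2 using u\<phi> by simp
    also have "\<dots> = f (\<lambda>j. \<Sum>i\<in>I. d i *\<^sub>R \<phi> i j)"
      using f_sum[OF fI, of "\<lambda>i j. d i *\<^sub>R \<phi> i j"] by (simp add: f_scale)
    also have "\<dots> = f \<eta>" using d by (intro f_cong) auto
    finally show ?thesis .
  qed
  ultimately show thesis by (rule that)
qed

lemma step_unique:
  fixes u :: "nat \<Rightarrow> 'a::real_inner"
  assumes J: "0 < J" and \<tau>: "0 < \<tau>" and W: "\<And>j. j < J \<Longrightarrow> 0 < W j"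
    and u: "u \<in> nodal_space cl J bd g" "v \<in> nodal_space cl J bd g"
    and eq: "\<And>\<eta>. \<eta> \<in> nodal_space cl J bd g \<Longrightarrow> step_form J W \<tau> u \<eta> = step_form J W \<tau> v \<eta>"
    and k: "k \<le> J"
  shows "u k = v k"
proof (rule ccontr)
  assume "u k \<noteq> v k"
  then have "0 < step_form J W \<tau> (\<lambda>j. u j - v j) (\<lambda>j. u j - v j)"
    by (intro step_form_pos[OF J \<tau> W k]) auto
  moreover have "(\<lambda>j. u j - v j) \<in> nodal_space cl J bd g"
    using u by (auto simp: nodal_space_def inner_diff_left)
  from eq[OF this] have "step_form J W \<tau> (\<lambda>j. u j - v j) (\<lambda>j. u j - v j) = 0"
    by (simp add: step_form_def lump_lin stiff_lin algebra_simps)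
  ultimately show False by simp
qed

section \<open>Discrete Gronwall inequality\<close>

lemma discrete_gronwall:
  fixes y :: "nat \<Rightarrow> real"
  assumes y1: "0 \<le> y 1" and \<tau>: "0 \<le> K * \<tau>" "0 \<le> \<delta>"
    and step: "\<And>m. 1 \<le> m \<Longrightarrow> m < n \<Longrightarrow> y (Suc m) \<le> (1 + K * \<tau>) * y m + K * \<tau> * \<delta>"
    and n: "1 \<le> n"
  shows "y n \<le> exp (K * \<tau> * real n) * (y 1 + \<delta>)"
proof -
  have "y (Suc m) + \<delta> \<le> (1 + K * \<tau>) ^ m * (y 1 + \<delta>)" if "Suc m \<le> n" for m
    using that
  proof (induction m)
    case (Suc m)
    have "y (Suc (Suc m)) + \<delta> \<le> (1 + K * \<tau>) * (y (Suc m) + \<delta>)"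
      using step[of "Suc m"] Suc.prems \<tau> by (simp add: algebra_simps)
    also have "\<dots> \<le> (1 + K * \<tau>) * ((1 + K * \<tau>) ^ m * (y 1 + \<delta>))"
      using Suc \<tau> by (intro mult_left_mono) auto
    finally show ?case by simp
  qed simp
  from this[of "n - 1"] n have "y n + \<delta> \<le> (1 + K * \<tau>) ^ (n - 1) * (y 1 + \<delta>)" by simp
  also have "\<dots> \<le> exp (K * \<tau> * real n) * (y 1 + \<delta>)"
  proof (intro mult_right_mono)
    have "(1 + K * \<tau>) ^ (n - 1) \<le> (1 + K * \<tau>) ^ n" using \<tau> by (intro power_increasing) auto
    also have "\<dots> \<le> exp (K * \<tau>) ^ n" using \<tau> exp_ge_add_one_self[of "K * \<tau>"] by (intro power_mono) auto
    also have "\<dots> = exp (K * \<tau> * real n)" by (simp add: exp_of_nat_mult mult.commute)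
    finally show "(1 + K * \<tau>) ^ (n - 1) \<le> exp (K * \<tau> * real n)" .
  qed (use y1 \<tau> in auto)
  finally show ?thesis using \<tau> by linarith
qed

section \<open>Convergence of the nodal scheme\<close>

text \<open>
  What the analysis needs to know about the boundary: along the trajectories of the end points, \<open>G\<close>
  stands for the gradient of the level set function and \<open>H\<close> for its Hessian. The neighbourhood \<open>near\<close>
  combines the existence of \<open>G\<close> close to the trajectory with its first order expansion.
\<close>

locale bd_flow = smooth_flow X T B
  for X :: "nat \<Rightarrow> nat \<Rightarrow> real \<Rightarrow> real \<Rightarrow> 'a::euclidean_space" and T B :: real +
  fixes cl :: bool and U :: "'a set" and G :: "'a \<Rightarrow> 'a" and H :: "real \<Rightarrow> real \<Rightarrow> 'a \<Rightarrow> 'a" and c0 r0 CF :: real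
  assumes T: "0 < T" and c0: "0 < c0" and r0: "0 < r0" and CF: "1 \<le> CF"
    and speed: "\<And>\<rho> t. \<rho> \<in> {0..1} \<Longrightarrow> t \<in> {0..T} \<Longrightarrow> c0 \<le> norm (X 1 0 \<rho> t)"
    and periodic: "\<And>i k t. cl \<Longrightarrow> t \<in> {0..T} \<Longrightarrow> X i k 0 t = X i k 1 t"
    and near: "\<And>\<rho> t y. \<not> cl \<Longrightarrow> \<rho> \<in> {0, 1} \<Longrightarrow> t \<in> {0..T} \<Longrightarrow> norm (y - X 0 0 \<rho> t) \<le> r0 \<Longrightarrow>
        y \<in> U \<and> norm (G y - G (X 0 0 \<rho> t) - H \<rho> t (y - X 0 0 \<rho> t)) \<le> CF * (norm (y - X 0 0 \<rho> t))\<^sup>2"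
    and H_linear: "\<And>\<rho> t. \<not> cl \<Longrightarrow> \<rho> \<in> {0, 1} \<Longrightarrow> t \<in> {0..T} \<Longrightarrow> linear (H \<rho> t)"
    and H_sym: "\<And>\<rho> t u v. \<not> cl \<Longrightarrow> \<rho> \<in> {0, 1} \<Longrightarrow> t \<in> {0..T} \<Longrightarrow> H \<rho> t u \<bullet> v = u \<bullet> H \<rho> t v"
    and H_bound: "\<And>\<rho> t u. \<not> cl \<Longrightarrow> \<rho> \<in> {0, 1} \<Longrightarrow> t \<in> {0..T} \<Longrightarrow> norm (H \<rho> t u) \<le> CF * norm u"
    and H_lipschitz: "\<And>\<rho> s t u. \<not> cl \<Longrightarrow> \<rho> \<in> {0, 1} \<Longrightarrow> s \<in> {0..T} \<Longrightarrow> t \<in> {0..T} \<Longrightarrow>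
        norm (H \<rho> s u - H \<rho> t u) \<le> CF * \<bar>s - t\<bar> * norm u"
    and G_norm: "\<And>\<rho> t. \<not> cl \<Longrightarrow> \<rho> \<in> {0, 1} \<Longrightarrow> t \<in> {0..T} \<Longrightarrow> norm (G (X 0 0 \<rho> t)) = 1"
    and G_lipschitz: "\<And>\<rho> s t. \<not> cl \<Longrightarrow> \<rho> \<in> {0, 1} \<Longrightarrow> s \<in> {0..T} \<Longrightarrow> t \<in> {0..T} \<Longrightarrow>
        norm (G (X 0 0 \<rho> s) - G (X 0 0 \<rho> t)) \<le> CF * \<bar>s - t\<bar>"
    and normal: "\<And>\<rho> t. \<not> cl \<Longrightarrow> \<rho> \<in> {0, 1} \<Longrightarrow> t \<in> {0<..T} \<Longrightarrow>
        X 1 0 \<rho> t = (X 1 0 \<rho> t \<bullet> G (X 0 0 \<rho> t)) *\<^sub>R G (X 0 0 \<rho> t)"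
    and velocity: "\<And>\<rho> t. \<not> cl \<Longrightarrow> \<rho> \<in> {0, 1} \<Longrightarrow> t \<in> {0<..T} \<Longrightarrow> X 0 1 \<rho> t \<bullet> G (X 0 0 \<rho> t) = 0"
begin

definition bdn :: "nat \<Rightarrow> nat set" where
  "bdn J = (if cl then {} else {0, J})"

text \<open>
  The outer normal of the parameter interval at the node \<open>k\<close>.
\<close>

definition sg :: "nat \<Rightarrow> real" where
  "sg k = (if k = 0 then -1 else 1)"

definition slope_n :: "real \<Rightarrow> real \<Rightarrow> real" where
  "slope_n \<rho> t = X 1 0 \<rho> t \<bullet> G (X 0 0 \<rho> t)"

text \<open>
  The normal flux \<open>x\<^sub>\<rho> = (x\<^sub>\<rho> \<bullet> n) n\<close>, tested with a vector that is tangential at a nearby point, amounts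
  to this form: the difference of the two normals is the Hessian applied to the difference of the
  points.
\<close>

definition bd_form :: "nat \<Rightarrow> real \<Rightarrow> nat \<Rightarrow> 'a \<Rightarrow> 'a \<Rightarrow> real" where
  "bd_form J t k u v = sg k * slope_n (node J k) t * (H (node J k) t u \<bullet> v)"

text \<open>
  The remaining flux of second order. Its last term arises because the extrapolated exact solution is
  off \<open>x\<close> by \<open>\<tau>\<^sup>2 x\<^sub>t\<^sub>t\<close> to leading order, to which the Hessian responds.
\<close>

definition bd_defect :: "nat \<Rightarrow> real \<Rightarrow> real \<Rightarrow> nat \<Rightarrow> 'a" where
  "bd_defect J \<tau> t k = sg k *\<^sub>R (bd_flux (1 / real J) \<tau> (node J k) t - X 1 0 (node J k) t
     + (\<tau>\<^sup>2 * slope_n (node J k) t) *\<^sub>R H (node J k) t (X 0 2 (node J k) t))"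

text \<open>
  One constant that dominates every constant occurring in the estimates.
\<close>

definition \<Lambda> :: real where
  "\<Lambda> = 1000 * B ^ 3 * CF\<^sup>2 + 4 / c0\<^sup>2"

lemma bdnD: "k \<in> bdn J \<Longrightarrow> 0 < J \<Longrightarrow> \<not> cl \<and> node J k \<in> {0, 1} \<and> k \<le> J"
  by (auto simp: bdn_def node_def split: if_splits)

lemma B0: "0 < B" using B1 by simp

lemma const_le_\<Lambda>:
  assumes "i \<le> 3" "j \<le> 2" "0 \<le> x" "x \<le> 1000"
  shows "x * B ^ i * CF ^ j \<le> \<Lambda>"
proof -
  have "x * B ^ i * CF ^ j \<le> 1000 * B ^ 3 * CF ^ 2"
    using assms B1 CF by (intro mult_mono power_increasing) auto
  then show ?thesis using c0 by (simp add: \<Lambda>_def add_increasing2)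
qed

lemma \<Lambda>1: "1 \<le> \<Lambda>"
  using const_le_\<Lambda>[of 0 0 1] by simp

lemma X_lipschitz:
  assumes "i \<le> 4" "k \<le> 3" "\<rho> \<in> {0..1}" "s \<in> {0..T}" "t \<in> {0..T}"
  shows "norm (X i k \<rho> s - X i k \<rho> t) \<le> B * \<bar>s - t\<bar>"
  using taylor_bound[of 1 0 T "\<lambda>k'. X i (k + k') \<rho>" B s t] der_t bound assms by simp

lemma slope_n_bound:
  assumes "\<not> cl" "\<rho> \<in> {0, 1}" "t \<in> {0..T}"
  shows "\<bar>slope_n \<rho> t\<bar> \<le> B"
proof -
  have "\<bar>slope_n \<rho> t\<bar> \<le> norm (X 1 0 \<rho> t) * norm (G (X 0 0 \<rho> t))"
    unfolding slope_n_def by (rule Cauchy_Schwarz_ineq2)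
  also have "\<dots> \<le> B" using bound[of 1 0 \<rho> t] G_norm[OF assms] assms by auto
  finally show ?thesis .
qed

lemma slope_n_lipschitz:
  assumes cl: "\<not> cl" and \<rho>: "\<rho> \<in> {0, 1}" and st: "s \<in> {0..T}" "t \<in> {0..T}"
  shows "\<bar>slope_n \<rho> s - slope_n \<rho> t\<bar> \<le> 2 * B * CF * \<bar>s - t\<bar>"
proof -
  let ?G = "\<lambda>t. G (X 0 0 \<rho> t)"
  have \<rho>': "\<rho> \<in> {0..1}" using \<rho> by auto
  have "slope_n \<rho> s - slope_n \<rho> t = (X 1 0 \<rho> s - X 1 0 \<rho> t) \<bullet> ?G s + X 1 0 \<rho> t \<bullet> (?G s - ?G t)"
    by (simp add: slope_n_def inner_simps)
  also have "\<bar>\<dots>\<bar> \<le> norm (X 1 0 \<rho> s - X 1 0 \<rho> t) * norm (?G s) + norm (X 1 0 \<rho> t) * norm (?G s - ?G t)"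
    by (rule order_trans[OF abs_triangle_ineq]) (intro add_mono Cauchy_Schwarz_ineq2)
  also have "\<dots> \<le> (B * \<bar>s - t\<bar>) * 1 + B * (CF * \<bar>s - t\<bar>)"
    using X_lipschitz[of 1 0 \<rho> s t] G_norm[OF cl \<rho> st(1)] G_lipschitz[OF cl \<rho> st] bound[of 1 0 \<rho> t] \<rho>' st B0
    by (intro add_mono mult_mono) auto
  also have "\<dots> \<le> 2 * B * CF * \<bar>s - t\<bar>"
    using mult_right_mono[OF CF, of "B * \<bar>s - t\<bar>"] B0 by (simp add: mult_ac)
  finally show ?thesis .
qed

lemma bd_form_bilinear:
  assumes "k \<in> bdn J" "0 < J" "t \<in> {0..T}"
  shows "bounded_bilinear (bd_form J t k)" and "bd_form J t k u v = bd_form J t k v u"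
    and "\<bar>bd_form J t k u v\<bar> \<le> \<Lambda> * norm u * norm v"
proof -
  note k = bdnD[OF assms(1,2)]
  have lin: "linear (H (node J k) t)" using H_linear k assms(3) by blast
  have "\<bar>bd_form J t k u v\<bar> \<le> (B * CF) * norm u * norm v" for u v
  proof -
    have "\<bar>bd_form J t k u v\<bar> = \<bar>slope_n (node J k) t\<bar> * \<bar>H (node J k) t u \<bullet> v\<bar>"
      by (simp add: bd_form_def sg_def abs_mult)
    also have "\<dots> \<le> B * (norm (H (node J k) t u) * norm v)"
      using slope_n_bound k assms(3) B0 by (intro mult_mono Cauchy_Schwarz_ineq2) auto
    also have "\<dots> \<le> B * ((CF * norm u) * norm v)"
      using H_bound k assms(3) B0 by (intro mult_left_mono mult_right_mono) auto
    finally show ?thesis by (simp add: mult.assoc)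
  qed
  note b = this
  show "\<bar>bd_form J t k u v\<bar> \<le> \<Lambda> * norm u * norm v"
    using b[of u v] mult_right_mono[OF const_le_\<Lambda>[of 1 1 1], of "norm u * norm v"] by (simp add: mult.assoc)
  show "bd_form J t k u v = bd_form J t k v u"
    using H_sym[of "node J k" t u v] k assms(3) by (simp add: bd_form_def inner_commute)
  show "bounded_bilinear (bd_form J t k)"
  proof
    show "\<exists>K. \<forall>a b. norm (bd_form J t k a b) \<le> norm a * norm b * K"
      using b by (intro exI[of _ "B * CF"]) (simp add: mult_ac)
  qed (simp_all add: bd_form_def linear_add[OF lin] linear_scale[OF lin] inner_simps algebra_simps)
qed

lemma bd_form_lipschitz:
  assumes "k \<in> bdn J" "0 < J" and st: "s \<in> {0..T}" "t \<in> {0..T}"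
  shows "\<bar>bd_form J s k u v - bd_form J t k u v\<bar> \<le> \<Lambda> * \<bar>s - t\<bar> * norm u * norm v"
proof -
  note k = bdnD[OF assms(1,2)]
  define \<rho> where "\<rho> = node J k"
  have \<rho>: "\<not> cl" "\<rho> \<in> {0, 1}" using k by (auto simp: \<rho>_def)
  have "bd_form J s k u v - bd_form J t k u v = sg k * ((slope_n \<rho> s - slope_n \<rho> t) * (H \<rho> s u \<bullet> v) + slope_n \<rho> t * ((H \<rho> s u - H \<rho> t u) \<bullet> v))"
    by (simp add: bd_form_def \<rho>_def inner_simps algebra_simps)
  also have "\<bar>\<dots>\<bar> \<le> \<bar>slope_n \<rho> s - slope_n \<rho> t\<bar> * \<bar>H \<rho> s u \<bullet> v\<bar> + \<bar>slope_n \<rho> t\<bar> * \<bar>(H \<rho> s u - H \<rho> t u) \<bullet> v\<bar>"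
    by (simp add: sg_def abs_mult) (metis abs_mult abs_triangle_ineq)
  also have "\<dots> \<le> (2 * B * CF * \<bar>s - t\<bar>) * (norm (H \<rho> s u) * norm v) + B * (norm (H \<rho> s u - H \<rho> t u) * norm v)"
    using slope_n_lipschitz[OF \<rho> st] slope_n_bound[OF \<rho> st(2)] B0 CF
    by (intro add_mono mult_mono Cauchy_Schwarz_ineq2) auto
  also have "\<dots> \<le> (2 * B * CF * \<bar>s - t\<bar>) * ((CF * norm u) * norm v) + B * ((CF * \<bar>s - t\<bar> * norm u) * norm v)"
    using H_bound[OF \<rho> st(1)] H_lipschitz[OF \<rho> st] B0 CF
    by (intro add_mono mult_left_mono mult_right_mono) auto
  also have "\<dots> = (2 * B ^ 1 * CF ^ 2 + 1 * B ^ 1 * CF ^ 1) * (\<bar>s - t\<bar> * norm u * norm v)"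
    by (simp add: power2_eq_square algebra_simps)
  also have "\<dots> \<le> \<Lambda> * (\<bar>s - t\<bar> * norm u * norm v)"
  proof (intro mult_right_mono)
    have "1 * B ^ 1 * CF ^ 1 \<le> 1 * B ^ 1 * CF ^ 2"
      using self_le_power[OF CF, of 2] B0 by (intro mult_left_mono) auto
    then show "2 * B ^ 1 * CF ^ 2 + 1 * B ^ 1 * CF ^ 1 \<le> \<Lambda>"
      using const_le_\<Lambda>[of 1 2 3] by simp
  qed auto
  finally show ?thesis by (simp add: mult.assoc)
qed

lemma triple_bound:
  assumes \<rho>: "\<rho> \<in> {0..1}" and st: "s \<in> {0..T}" "t \<in> {0..T}"
  defines "f \<equiv> \<lambda>t. (X 1 0 \<rho> t \<bullet> X 2 0 \<rho> t) *\<^sub>R X 0 1 \<rho> t"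
  shows "norm (f t) \<le> B ^ 3" "norm (f s - f t) \<le> 3 * B ^ 3 * \<bar>s - t\<bar>"
proof -
  let ?u = "X 1 0 \<rho>" and ?v = "X 2 0 \<rho>" and ?w = "X 0 1 \<rho>"
  have n: "norm (?u r) \<le> B" "norm (?v r) \<le> B" "norm (?w r) \<le> B" if "r \<in> {0..T}" for r
    using bound[OF _ _ \<rho> that] by auto
  have l: "norm (?u s - ?u t) \<le> B * \<bar>s - t\<bar>" "norm (?v s - ?v t) \<le> B * \<bar>s - t\<bar>" "norm (?w s - ?w t) \<le> B * \<bar>s - t\<bar>"
    using X_lipschitz[OF _ _ \<rho> st] by auto
  have uv: "\<bar>?u r \<bullet> ?v r'\<bar> \<le> B * B" if "r \<in> {0..T}" "r' \<in> {0..T}" for r r'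
    using n that B0 by (intro order_trans[OF Cauchy_Schwarz_ineq2] mult_mono) auto
  show "norm (f t) \<le> B ^ 3"
    using mult_mono[OF uv[OF st(2) st(2)] n(3)[OF st(2)]] B0 by (simp add: f_def power3_eq_cube)
  have eq: "f s - f t = ((?u s - ?u t) \<bullet> ?v s) *\<^sub>R ?w s + (?u t \<bullet> (?v s - ?v t)) *\<^sub>R ?w s + (?u t \<bullet> ?v t) *\<^sub>R (?w s - ?w t)"
    by (rule vec_eqI) (simp add: f_def inner_simps algebra_simps)
  have "norm (f s - f t) \<le> \<bar>(?u s - ?u t) \<bullet> ?v s\<bar> * norm (?w s) + \<bar>?u t \<bullet> (?v s - ?v t)\<bar> * norm (?w s) + \<bar>?u t \<bullet> ?v t\<bar> * norm (?w s - ?w t)"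
    unfolding eq by (intro order_trans[OF norm_triangle_ineq] add_mono) auto
  also have "\<dots> \<le> ((B * \<bar>s - t\<bar>) * B) * B + (B * (B * \<bar>s - t\<bar>)) * B + (B * B) * (B * \<bar>s - t\<bar>)"
    using n st l B0 uv by (intro add_mono mult_mono order_trans[OF Cauchy_Schwarz_ineq2]) auto
  also have "\<dots> = 3 * B ^ 3 * \<bar>s - t\<bar>" by (simp add: power3_eq_cube)
  finally show "norm (f s - f t) \<le> 3 * B ^ 3 * \<bar>s - t\<bar>" .
qed

lemma curvature_term_bound:
  assumes cl: "\<not> cl" and \<rho>: "\<rho> \<in> {0, 1}" and st: "s \<in> {0..T}" "t \<in> {0..T}"
  defines "f \<equiv> \<lambda>t. slope_n \<rho> t *\<^sub>R H \<rho> t (X 0 2 \<rho> t)"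
  shows "norm (f t) \<le> B\<^sup>2 * CF" "norm (f s - f t) \<le> 4 * B\<^sup>2 * CF\<^sup>2 * \<bar>s - t\<bar>"
proof -
  let ?w = "X 0 2 \<rho>"
  have \<rho>': "\<rho> \<in> {0..1}" using \<rho> by auto
  have n: "norm (?w r) \<le> B" if "r \<in> {0..T}" for r using bound[OF _ _ \<rho>' that] by auto
  have Hn: "norm (H \<rho> r (?w r)) \<le> CF * B" if "r \<in> {0..T}" for r
    using H_bound[OF cl \<rho> that, of "?w r"] mult_left_mono[OF n[OF that], of CF] CF by linarith
  show "norm (f t) \<le> B\<^sup>2 * CF"
    using mult_mono[OF slope_n_bound[OF cl \<rho> st(2)] Hn[OF st(2)]] B0 by (simp add: f_def power2_eq_square mult_ac)
  have eq: "f s - f t = (slope_n \<rho> s - slope_n \<rho> t) *\<^sub>R H \<rho> s (?w s) + slope_n \<rho> t *\<^sub>R (H \<rho> s (?w s) - H \<rho> t (?w s)) + slope_n \<rho> t *\<^sub>R H \<rho> t (?w s - ?w t)"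
    by (simp add: f_def linear_diff[OF H_linear[OF cl \<rho> st(2)]] algebra_simps)
  have "norm (f s - f t) \<le> \<bar>slope_n \<rho> s - slope_n \<rho> t\<bar> * norm (H \<rho> s (?w s)) + \<bar>slope_n \<rho> t\<bar> * norm (H \<rho> s (?w s) - H \<rho> t (?w s)) + \<bar>slope_n \<rho> t\<bar> * norm (H \<rho> t (?w s - ?w t))"
    unfolding eq by (intro order_trans[OF norm_triangle_ineq] add_mono) auto
  also have "\<dots> \<le> (2 * B * CF * \<bar>s - t\<bar>) * (CF * B) + B * (CF * \<bar>s - t\<bar> * B) + B * (CF * (B * \<bar>s - t\<bar>))"
  proof (intro add_mono mult_mono)
    show "norm (H \<rho> s (?w s) - H \<rho> t (?w s)) \<le> CF * \<bar>s - t\<bar> * B"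
      by (rule order_trans[OF H_lipschitz[OF cl \<rho> st] mult_left_mono[OF n[OF st(1)]]]) (use CF in auto)
    show "norm (H \<rho> t (?w s - ?w t)) \<le> CF * (B * \<bar>s - t\<bar>)"
      by (rule order_trans[OF H_bound[OF cl \<rho> st(2)] mult_left_mono[OF X_lipschitz]]) (use CF \<rho>' st in auto)
  qed (use slope_n_bound[OF cl \<rho> st(2)] slope_n_lipschitz[OF cl \<rho> st] Hn[OF st(1)] B0 CF in auto)
  also have "\<dots> = (2 * CF\<^sup>2 + 2 * CF) * (B\<^sup>2 * \<bar>s - t\<bar>)" by (simp add: power2_eq_square algebra_simps)
  also have "\<dots> \<le> (4 * CF\<^sup>2) * (B\<^sup>2 * \<bar>s - t\<bar>)"
    using self_le_power[OF CF, of 2] by (intro mult_right_mono) auto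
  finally show "norm (f s - f t) \<le> 4 * B\<^sup>2 * CF\<^sup>2 * \<bar>s - t\<bar>" by (simp add: mult_ac)
qed

text \<open>
  The defect is \<open>h\<^sup>2\<close> or \<open>\<tau>\<^sup>2\<close> times products of derivatives of the flow and the Hessian along it, all of
  which are bounded and Lipschitz in time.
\<close>

lemma bd_defect_bounds:
  fixes \<tau> :: real
  assumes "k \<in> bdn J" "0 < J" and st: "s \<in> {0..T}" "t \<in> {0..T}"
  defines "D \<equiv> (1 / real J)\<^sup>2 + \<tau>\<^sup>2"
  shows "norm (bd_defect J \<tau> t k) \<le> \<Lambda> * D"
    and "norm (bd_defect J \<tau> s k - bd_defect J \<tau> t k) \<le> \<Lambda> * \<bar>s - t\<bar> * D"
proof -
  note k = bdnD[OF assms(1,2)]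
  define \<rho> where "\<rho> = node J k"
  have \<rho>: "\<not> cl" "\<rho> \<in> {0, 1}" "\<rho> \<in> {0..1}" using k by (auto simp: \<rho>_def)
  define f1 where "f1 t = (X 1 0 \<rho> t \<bullet> X 2 0 \<rho> t) *\<^sub>R X 0 1 \<rho> t" for t
  define f2 where "f2 t = slope_n \<rho> t *\<^sub>R H \<rho> t (X 0 2 \<rho> t)" for t
  let ?h = "1 / real J"
  have eq: "bd_defect J \<tau> r k = sg k *\<^sub>R (?h\<^sup>2 *\<^sub>R ((1/6) *\<^sub>R X 3 0 \<rho> r - (1/2) *\<^sub>R f1 r) + \<tau>\<^sup>2 *\<^sub>R ((1/2) *\<^sub>R X 1 2 \<rho> r + f2 r))" for r
    by (simp add: bd_defect_def bd_flux_def f1_def f2_def \<rho>_def[symmetric] scaleR_add_right scaleR_diff_right)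
  have f: "norm (f1 t) \<le> B ^ 3" "norm (f1 s - f1 t) \<le> 3 * B ^ 3 * \<bar>s - t\<bar>" "norm (f2 t) \<le> B\<^sup>2 * CF" "norm (f2 s - f2 t) \<le> 4 * B\<^sup>2 * CF\<^sup>2 * \<bar>s - t\<bar>"
    unfolding f1_def f2_def using triple_bound[OF \<rho>(3) st] curvature_term_bound[OF \<rho>(1,2) st] by auto
  have x: "norm (X 3 0 \<rho> t) \<le> B" "norm (X 1 2 \<rho> t) \<le> B" "norm (X 3 0 \<rho> s - X 3 0 \<rho> t) \<le> B * \<bar>s - t\<bar>" "norm (X 1 2 \<rho> s - X 1 2 \<rho> t) \<le> B * \<bar>s - t\<bar>"
    using bound[OF _ _ \<rho>(3) st(2)] X_lipschitz[OF _ _ \<rho>(3) st] by auto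
  have gen: "norm (?h\<^sup>2 *\<^sub>R ((1/6) *\<^sub>R a - (1/2) *\<^sub>R b) + \<tau>\<^sup>2 *\<^sub>R ((1/2) *\<^sub>R c + d)) \<le> (5 * B ^ 3 * CF\<^sup>2 * m) * D"
    if "norm a \<le> B * m" "norm b \<le> 3 * B ^ 3 * m" "norm c \<le> B * m" "norm d \<le> 4 * B\<^sup>2 * CF\<^sup>2 * m" "0 \<le> m" for a b c d :: 'a and m
  proof -
    have p: "B * m \<le> B ^ 3 * CF\<^sup>2 * m" "B ^ 3 * m \<le> B ^ 3 * CF\<^sup>2 * m" "B\<^sup>2 * CF\<^sup>2 * m \<le> B ^ 3 * CF\<^sup>2 * m"
    proof -
      have "B * 1 \<le> B ^ 3 * CF\<^sup>2" "B ^ 3 * 1 \<le> B ^ 3 * CF\<^sup>2" "B\<^sup>2 * CF\<^sup>2 \<le> B ^ 3 * CF\<^sup>2"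
        using B1 CF self_le_power[OF B1, of 3] one_le_power[OF CF, of 2] power_increasing[OF _ B1, of 2 3]
        by (intro mult_mono; simp)+
      then show "B * m \<le> B ^ 3 * CF\<^sup>2 * m" "B ^ 3 * m \<le> B ^ 3 * CF\<^sup>2 * m" "B\<^sup>2 * CF\<^sup>2 * m \<le> B ^ 3 * CF\<^sup>2 * m"
        using \<open>0 \<le> m\<close> by (auto intro: mult_right_mono)
    qed
    have M: "0 \<le> B ^ 3 * CF\<^sup>2 * m" using B0 that by auto
    have 1: "norm ((1/6) *\<^sub>R a - (1/2) *\<^sub>R b) \<le> 5 * B ^ 3 * CF\<^sup>2 * m"
      using norm_triangle_ineq4[of "(1/6) *\<^sub>R a" "(1/2) *\<^sub>R b"] that p M unfolding norm_scaleR mult.assoc by simp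
    have 2: "norm ((1/2) *\<^sub>R c + d) \<le> 5 * B ^ 3 * CF\<^sup>2 * m"
      using norm_triangle_ineq[of "(1/2) *\<^sub>R c" d] that p M unfolding norm_scaleR mult.assoc by simp
    have "norm (?h\<^sup>2 *\<^sub>R ((1/6) *\<^sub>R a - (1/2) *\<^sub>R b) + \<tau>\<^sup>2 *\<^sub>R ((1/2) *\<^sub>R c + d)) \<le> ?h\<^sup>2 * (5 * B ^ 3 * CF\<^sup>2 * m) + \<tau>\<^sup>2 * (5 * B ^ 3 * CF\<^sup>2 * m)"
      by (rule order_trans[OF norm_triangle_ineq], unfold norm_scaleR, intro add_mono mult_mono) (use 1 2 in auto)
    then show ?thesis by (simp add: D_def algebra_simps)
  qed
  have D: "0 \<le> D" by (simp add: D_def)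
  have L: "(5 * B ^ 3 * CF\<^sup>2 * m) * D \<le> \<Lambda> * m * D" if "0 \<le> m" for m
    using const_le_\<Lambda>[of 3 2 5] that D by (intro mult_right_mono) auto
  have sgn: "norm (sg k *\<^sub>R v) = norm v" for v :: 'a by (simp add: sg_def)
  have c1: "B\<^sup>2 * CF \<le> 4 * B\<^sup>2 * CF\<^sup>2 * 1"
  proof -
    have "CF \<le> 4 * CF\<^sup>2" using self_le_power[OF CF, of 2] CF by simp
    then have "B\<^sup>2 * CF \<le> B\<^sup>2 * (4 * CF\<^sup>2)" by (intro mult_left_mono) auto
    then show ?thesis by simp
  qed
  have "B ^ 3 \<le> 3 * B ^ 3 * 1" using B0 by simp
  then have "norm (bd_defect J \<tau> t k) \<le> (5 * B ^ 3 * CF\<^sup>2 * 1) * D"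
    unfolding eq sgn using f(1,3) x(1,2) c1 by (intro gen) linarith+
  also have "\<dots> \<le> \<Lambda> * 1 * D" by (rule L) simp
  finally show "norm (bd_defect J \<tau> t k) \<le> \<Lambda> * D" by simp
  have "bd_defect J \<tau> s k - bd_defect J \<tau> t k = sg k *\<^sub>R (?h\<^sup>2 *\<^sub>R ((1/6) *\<^sub>R (X 3 0 \<rho> s - X 3 0 \<rho> t) - (1/2) *\<^sub>R (f1 s - f1 t)) + \<tau>\<^sup>2 *\<^sub>R ((1/2) *\<^sub>R (X 1 2 \<rho> s - X 1 2 \<rho> t) + (f2 s - f2 t)))"
    unfolding eq by (simp add: algebra_simps)
  then have "norm (bd_defect J \<tau> s k - bd_defect J \<tau> t k) \<le> (5 * B ^ 3 * CF\<^sup>2 * \<bar>s - t\<bar>) * D"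
    by (simp only: sgn) (intro gen f x abs_ge_zero)
  also have "\<dots> \<le> \<Lambda> * \<bar>s - t\<bar> * D" by (rule L) simp
  finally show "norm (bd_defect J \<tau> s k - bd_defect J \<tau> t k) \<le> \<Lambda> * \<bar>s - t\<bar> * D" .
qed

end

definition cell_weight :: "nat \<Rightarrow> (nat \<Rightarrow> 'a::real_normed_vector) \<Rightarrow> nat \<Rightarrow> real" where
  "cell_weight J w j = (norm (real J *\<^sub>R (w (Suc j) - w j)))\<^sup>2"

text \<open>
  The step of the scheme in terms of nodal values, with the unfiltered iterate eliminated. A gradient
  field \<open>G\<close> on \<open>U\<close> enters only through the constraint.
\<close>

definition nodal_step :: "bool \<Rightarrow> nat \<Rightarrow> nat set \<Rightarrow> 'a::real_inner set \<Rightarrow> ('a \<Rightarrow> 'a) \<Rightarrow> real \<Rightarrow>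
    (nat \<Rightarrow> 'a) \<Rightarrow> (nat \<Rightarrow> 'a) \<Rightarrow> (nat \<Rightarrow> 'a) \<Rightarrow> bool" where
  "nodal_step cl J bd U G \<tau> Y0 Y1 Y2 \<longleftrightarrow>
     (\<forall>k\<in>bd. vhat Y1 Y0 k \<in> U) \<and>
     bdf Y2 Y1 Y0 \<in> nodal_space cl J bd (\<lambda>k. G (vhat Y1 Y0 k)) \<and>
     (\<forall>\<eta>\<in>nodal_space cl J bd (\<lambda>k. G (vhat Y1 Y0 k)).
        lump J (cell_weight J (vhat Y1 Y0)) (\<lambda>j. (1 / \<tau>) *\<^sub>R bdf Y2 Y1 Y0 j) \<eta> + stiff J (vbar Y2 Y1 Y0) \<eta> = 0)"

context bd_flow
begin

text \<open>
  A radius within which the speed of the curve stays bounded below and the normals stay well defined.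
\<close>

definition \<delta> :: real where
  "\<delta> = min (min 1 (c0 / 6)) (min (r0 / 2) (1 / (8 * CF)))"

lemma \<delta>: "0 < \<delta>" "\<delta> \<le> 1" "6 * \<delta> \<le> c0" "2 * \<delta> \<le> r0" "8 * CF * \<delta> \<le> 1"
proof -
  show "0 < \<delta>" "\<delta> \<le> 1" "6 * \<delta> \<le> c0" "2 * \<delta> \<le> r0" using c0 r0 CF by (auto simp: \<delta>_def)
  have "\<delta> \<le> 1 / (8 * CF)" by (simp add: \<delta>_def)
  then show "8 * CF * \<delta> \<le> 1" using CF by (simp add: field_simps)
qed

text \<open>
  The smallness of the extrapolated error that is propagated in time; the last condition makes squares
  of boundary values of the error harmless against the inverse estimate.
\<close>

definition small :: "nat \<Rightarrow> real \<Rightarrow> (nat \<Rightarrow> 'a) \<Rightarrow> bool" where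
  "small J \<tau> E \<longleftrightarrow> \<tau>\<^sup>2 \<le> 1 / real J \<and> 6 * B * \<tau>\<^sup>2 \<le> \<delta> \<and> B / real J \<le> \<delta> \<and>
     (\<forall>j<J. real J * norm (E (Suc j) - E j) \<le> \<delta>) \<and> (\<forall>k\<le>J. norm (E k) \<le> \<delta> \<and> norm (E k) * sqrt (real J) \<le> 1)"

text \<open>
  An \<open>H\<^sup>1\<close> error of order \<open>h\<^sup>2 + \<tau>\<^sup>2 \<le> 2h\<close> has slopes of order \<open>h\<^sup>1\<^sup>/\<^sup>2\<close>, and boundary values of order \<open>h\<close>.
\<close>

lemma smallI:
  assumes J: "0 < J" and \<tau>: "\<tau>\<^sup>2 \<le> 1 / real J" and E: "h1_sq J E \<le> K * ((1 / real J)\<^sup>2 + \<tau>\<^sup>2)\<^sup>2" and K: "1 \<le> K"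
    and h: "8 * K * (1 / real J) \<le> \<delta>\<^sup>2" "6 * B * (1 / real J) \<le> \<delta>"
  shows "small J \<tau> E"
proof -
  define h' where "h' = 1 / real J"
  have h0: "0 < h'" "h' \<le> 1" and Jh: "real J = 1 / h'" using J by (auto simp: h'_def)
  have t: "\<tau>\<^sup>2 \<le> h'" using \<tau> by (simp add: h'_def)
  have "h'\<^sup>2 \<le> h'" unfolding power2_eq_square using h0 by (intro mult_left_le) auto
  then have "h'\<^sup>2 + \<tau>\<^sup>2 \<le> 2 * h'" using t by linarith
  then have "(h'\<^sup>2 + \<tau>\<^sup>2)\<^sup>2 \<le> (2 * h')\<^sup>2" by (intro power_mono) auto
  then have "K * (h'\<^sup>2 + \<tau>\<^sup>2)\<^sup>2 \<le> K * (2 * h')\<^sup>2" using K by (intro mult_left_mono) auto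
  then have E': "h1_sq J E \<le> 4 * K * h'\<^sup>2" using E unfolding h'_def[symmetric] power_mult_distrib by simp
  have hh: "4 * K * h'\<^sup>2 * real J = 4 * K * h'" using h0 by (simp add: Jh power2_eq_square)
  have "0 \<le> K * h'" using K h0 by simp
  moreover have "8 * (K * h') \<le> \<delta>\<^sup>2" using h(1) by (simp add: h'_def)
  ultimately have dd: "4 * K * h' \<le> \<delta>\<^sup>2" "8 * K * h' \<le> \<delta>\<^sup>2" unfolding mult.assoc by linarith+
  have d1: "\<delta>\<^sup>2 \<le> 1" using \<delta>(1,2) by (simp add: power_le_one)
  have slope: "real J * norm (E (Suc j) - E j) \<le> \<delta>" if j: "j < J" for j
  proof -
    have "(norm (E (Suc j) - E j))\<^sup>2 * real J \<le> 4 * K * h'\<^sup>2"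
      using slope_sq_le_stiff[OF j, of E] E' lump_sq_nonneg[of J E] by (simp add: h1_sq_def)
    then have "(norm (E (Suc j) - E j))\<^sup>2 * real J * real J \<le> 4 * K * h'\<^sup>2 * real J" by (intro mult_right_mono) auto
    then have "(real J * norm (E (Suc j) - E j))\<^sup>2 \<le> \<delta>\<^sup>2" unfolding hh using dd(1) by (simp add: power2_eq_square mult_ac)
    then show ?thesis using \<delta>(1) by (simp add: power2_le_iff_abs_le)
  qed
  have nodes: "norm (E k) \<le> \<delta> \<and> norm (E k) * sqrt (real J) \<le> 1" if k: "k \<le> J" for k
  proof -
    have e: "(norm (E k))\<^sup>2 \<le> 8 * K * h'\<^sup>2" using trace_h1[OF J k, of E] E' by simp
    also have "\<dots> = 8 * K * h' * h'" by (simp add: power2_eq_square)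
    also have "\<dots> \<le> \<delta>\<^sup>2 * h'" using dd(2) h0 by (intro mult_right_mono) auto
    finally have e1: "(norm (E k))\<^sup>2 \<le> \<delta>\<^sup>2 * h'" .
    have "\<delta>\<^sup>2 * h' \<le> \<delta>\<^sup>2" using h0 by (intro mult_left_le) auto
    then have 1: "norm (E k) \<le> \<delta>" using e1 \<delta>(1) power2_le_imp_le[of "norm (E k)" \<delta>] by linarith
    have "(norm (E k) * sqrt (real J))\<^sup>2 = (norm (E k))\<^sup>2 * real J" by (simp add: power_mult_distrib)
    also have "\<dots> \<le> \<delta>\<^sup>2 * h' * real J" using e1 by (intro mult_right_mono) auto
    also have "\<dots> \<le> 1\<^sup>2" using h0 d1 by (simp add: Jh)
    finally have "norm (E k) * sqrt (real J) \<le> 1" by (rule power2_le_imp_le) simp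
    with 1 show ?thesis by simp
  qed
  have "6 * B * \<tau>\<^sup>2 \<le> \<delta>" using mult_left_mono[OF t, of "6 * B"] h(2) B0 by (simp add: h'_def)
  moreover have "B / real J \<le> \<delta>"
  proof -
    have "0 \<le> B / real J" "6 * (B / real J) \<le> \<delta>" using h(2) B0 by auto
    then show ?thesis by linarith
  qed
  ultimately show ?thesis using \<tau> slope nodes by (auto simp: small_def)
qed

context
  fixes J :: nat and \<tau> t :: real and E :: "nat \<Rightarrow> 'a"
  assumes J: "0 < J" and \<tau>: "0 < \<tau>" "2 * \<tau> \<le> t" "t \<le> T" and sm: "small J \<tau> E"
begin

definition "xa = xnode J t"
definition "xb = xnode J (t - \<tau>)"
definition "xc = xnode J (t - 2 * \<tau>)"
definition "wh = (\<lambda>j. vhat xb xc j - E j)"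

lemma tT: "t \<in> {0..T}" "t \<in> {0<..T}" using \<tau> by auto

lemma sm': "\<tau>\<^sup>2 \<le> 1 / real J" "6 * B * \<tau>\<^sup>2 \<le> \<delta>" "B / real J \<le> \<delta>"
    "\<And>j. j < J \<Longrightarrow> real J * norm (E (Suc j) - E j) \<le> \<delta>"
    "\<And>k. k \<le> J \<Longrightarrow> norm (E k) \<le> \<delta>" "\<And>k. k \<le> J \<Longrightarrow> norm (E k) * sqrt (real J) \<le> 1"
  using sm by (auto simp: small_def)

lemma weight_bounds:
  assumes j: "j < J"
  shows "1 / \<Lambda> \<le> cell_weight J wh j" and "cell_weight J wh j \<le> \<Lambda>"
proof -
  define s where "s = real J *\<^sub>R (wh (Suc j) - wh j)"
  have "norm (s - real J *\<^sub>R (xnode J t (Suc j) - xnode J t j)) \<le> 6 * B * \<tau>\<^sup>2 + real J * norm (E (Suc j) - E j)"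
    using extrapolated_slope[OF j \<tau>, of E] by (simp add: s_def wh_def xb_def xc_def)
  then have d: "norm (s - X 1 0 (node J j) t) \<le> 3 * \<delta>"
    using slope_bounds(2)[OF j \<tau>] sm'(2,3) sm'(4)[OF j]
      norm_triangle_ineq[of "s - real J *\<^sub>R (xnode J t (Suc j) - xnode J t j)" "real J *\<^sub>R (xnode J t (Suc j) - xnode J t j) - X 1 0 (node J j) t"]
    by simp
  have \<rho>: "node J j \<in> {0..1}" using j by (intro node_in) simp
  have l: "c0 / 2 \<le> norm s"
    using speed[OF \<rho> tT(1)] d \<delta>(3) norm_triangle_ineq2[of "X 1 0 (node J j) t" s] by (simp add: norm_minus_commute)
  have u: "norm s \<le> 4 * B"
    using bound[of 1 0 "node J j" t] \<rho> tT(1) d \<delta>(2) B1 norm_triangle_ineq2[of s "X 1 0 (node J j) t"] by simp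
  have "(norm s)\<^sup>2 \<le> (4 * B)\<^sup>2" using u by (intro power_mono) auto
  also have "\<dots> = 16 * B ^ 2 * CF ^ 0" by (simp add: power_mult_distrib)
  also have "\<dots> \<le> \<Lambda>" by (rule const_le_\<Lambda>) auto
  finally show "cell_weight J wh j \<le> \<Lambda>" by (simp add: cell_weight_def s_def)
  have "4 / c0\<^sup>2 \<le> \<Lambda>" using B0 CF by (simp add: \<Lambda>_def)
  then have "1 / \<Lambda> \<le> 1 / (4 / c0\<^sup>2)" using c0 by (intro divide_left_mono mult_pos_pos) (auto intro: order_less_le_trans[of 0 "4 / c0\<^sup>2"])
  also have "\<dots> = (c0 / 2)\<^sup>2" by (simp add: power_divide)
  also have "\<dots> \<le> (norm s)\<^sup>2" using l c0 by (intro power_mono) auto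
  finally show "1 / \<Lambda> \<le> cell_weight J wh j" by (simp add: cell_weight_def s_def)
qed

text \<open>
  The extrapolated discrete end point \<open>wh k\<close> is displaced from \<open>x\<close> by \<open>y\<close>, the sum of the extrapolation
  error in time and the extrapolated nodal error, and stays where the expansion of \<open>G\<close> is valid.
\<close>

lemma boundary_point:
  assumes k: "k \<in> bdn J"
  defines "x \<equiv> X 0 0 (node J k) t" and "y \<equiv> dtt \<tau> t 0 (node J k) + E k"
  shows "wh k = x - y" and "norm y \<le> 2 * \<delta>" and "norm y \<le> 6 * B * \<tau>\<^sup>2 + norm (E k)"
    and "wh k \<in> U" and "norm (G (wh k) - G x) \<le> 2 * CF * norm y" and "1 / 2 \<le> norm (G (wh k))"
    and "norm (G x - G (wh k) - H (node J k) t y) \<le> CF * (norm y)\<^sup>2"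
proof -
  note kk = bdnD[OF k J]
  then have \<rho>: "\<not> cl" "node J k \<in> {0, 1}" "node J k \<in> {0..1}" "k \<le> J" by auto
  show w: "wh k = x - y" by (simp add: wh_def xb_def xc_def vhat_xnode x_def y_def xnode_def)
  show y1: "norm y \<le> 6 * B * \<tau>\<^sup>2 + norm (E k)"
    using dtt_bound(1)[OF _ \<rho>(3) \<tau>, of 0] norm_triangle_ineq[of "dtt \<tau> t 0 (node J k)" "E k"] by (simp add: y_def)
  show y2: "norm y \<le> 2 * \<delta>" using y1 sm'(2) sm'(5)[OF \<rho>(4)] by simp
  have wx: "wh k - x = - y" by (simp add: w)
  have lin: "linear (H (node J k) t)" by (rule H_linear[OF \<rho>(1,2) tT(1)])
  have nr: "wh k \<in> U" "norm (G (wh k) - G x - H (node J k) t (wh k - x)) \<le> CF * (norm (wh k - x))\<^sup>2"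
    using near[OF \<rho>(1,2) tT(1), of "wh k"] y2 \<delta>(4) by (auto simp: wx x_def[symmetric])
  show "wh k \<in> U" by (rule nr(1))
  have g: "norm (G (wh k) - G x + H (node J k) t y) \<le> CF * (norm y)\<^sup>2"
    using nr(2) unfolding wx by (simp add: linear_neg[OF lin])
  then show "norm (G x - G (wh k) - H (node J k) t y) \<le> CF * (norm y)\<^sup>2"
    by (metis (no_types, lifting) add_diff_cancel_left' diff_add_cancel diff_diff_eq2 minus_diff_eq norm_minus_cancel)
  have y3: "norm y \<le> 1" using y2 \<delta>(2,5) CF mult_right_mono[OF CF, of \<delta>] \<delta>(1) by linarith
  have "norm (G (wh k) - G x) \<le> norm (G (wh k) - G x + H (node J k) t y) + norm (H (node J k) t y)"
    using norm_triangle_ineq4[of "G (wh k) - G x + H (node J k) t y" "H (node J k) t y"] by simp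
  also have "\<dots> \<le> CF * (norm y)\<^sup>2 + CF * norm y" using g H_bound[OF \<rho>(1,2) tT(1)] by (intro add_mono) auto
  also have "\<dots> \<le> CF * norm y + CF * norm y"
    using y3 CF by (intro add_mono mult_left_mono) (auto simp: power2_eq_square mult_left_le)
  finally show g2: "norm (G (wh k) - G x) \<le> 2 * CF * norm y" by simp
  have "2 * CF * norm y \<le> 2 * CF * (2 * \<delta>)" using y2 CF by (intro mult_left_mono) auto
  also have "\<dots> \<le> 1 / 2" using \<delta>(5) by simp
  finally show "1 / 2 \<le> norm (G (wh k))"
    using g2 G_norm[OF \<rho>(1,2) tT(1)] norm_triangle_ineq2[of "G x" "G (wh k)"] by (simp add: x_def norm_minus_commute)
qed

text \<open>
  The discrete velocity of the exact curve is nearly tangential at the extrapolated discrete point: the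
  exact velocity is tangential at \<open>x\<close>, and the normals differ by the order of the displacement.
\<close>

lemma exact_tangential:
  assumes k: "k \<in> bdn J"
  shows "\<bar>((1 / \<tau>) *\<^sub>R bdf xa xb xc k) \<bullet> G (wh k)\<bar> \<le> \<Lambda> * ((1 / real J)\<^sup>2 + \<tau>\<^sup>2 + norm (E k))"
proof -
  note kk = bdnD[OF k J]
  then have \<rho>: "\<not> cl" "node J k \<in> {0, 1}" "node J k \<in> {0..1}" "k \<le> J" by auto
  define x where "x = X 0 0 (node J k) t"
  define y where "y = dtt \<tau> t 0 (node J k) + E k"
  note bp = boundary_point[OF k, folded x_def y_def]
  define Dx where "Dx = (1 / \<tau>) *\<^sub>R bdf xa xb xc k"
  have "norm ((1 / \<tau>) *\<^sub>R ((3/2) *\<^sub>R X 0 0 (node J k) t - 2 *\<^sub>R X 0 0 (node J k) (t - \<tau>) + (1/2) *\<^sub>R X 0 0 (node J k) (t - 2 * \<tau>)) - X 0 1 (node J k) t) \<le> 6 * B * \<tau>\<^sup>2"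
    using \<rho> \<tau> by (intro time_differences(3)[where T=T and f="\<lambda>k'. X 0 k' (node J k)"] der_t bound) auto
  then have D1: "norm (Dx - X 0 1 (node J k) t) \<le> 6 * B * \<tau>\<^sup>2"
    by (simp add: Dx_def bdf_def xa_def xb_def xc_def xnode_def)
  have D2: "norm Dx \<le> 2 * B"
    using D1 bound[of 0 1 "node J k" t] \<rho> tT(1) sm'(2) \<delta>(2) B1 norm_triangle_ineq2[of Dx "X 0 1 (node J k) t"] by simp
  have "Dx \<bullet> G (wh k) = Dx \<bullet> (G (wh k) - G x) + (Dx - X 0 1 (node J k) t) \<bullet> G x"
    using velocity[OF \<rho>(1,2) tT(2)] by (simp add: inner_simps x_def)
  also have "\<bar>\<dots>\<bar> \<le> norm Dx * norm (G (wh k) - G x) + norm (Dx - X 0 1 (node J k) t) * norm (G x)"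
    by (rule order_trans[OF abs_triangle_ineq]) (intro add_mono Cauchy_Schwarz_ineq2)
  also have "\<dots> \<le> (2 * B) * (2 * CF * norm y) + (6 * B * \<tau>\<^sup>2) * 1"
    using D1 D2 bp(5) G_norm[OF \<rho>(1,2) tT(1)] B0 CF by (intro add_mono mult_mono) (auto simp: x_def)
  also have "\<dots> \<le> (2 * B) * (2 * CF * (6 * B * \<tau>\<^sup>2 + norm (E k))) + (6 * B * \<tau>\<^sup>2) * 1"
    using bp(3) B0 CF by (intro add_mono mult_left_mono) auto
  also have "\<dots> = (24 * B ^ 2 * CF ^ 1) * \<tau>\<^sup>2 + (6 * B ^ 1 * CF ^ 0) * \<tau>\<^sup>2 + (4 * B ^ 1 * CF ^ 1) * norm (E k)"
    by (simp add: power2_eq_square algebra_simps)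
  also have "\<dots> \<le> (24 * B ^ 2 * CF ^ 1) * \<tau>\<^sup>2 + (6 * B ^ 2 * CF ^ 1) * \<tau>\<^sup>2 + (30 * B ^ 2 * CF ^ 1) * norm (E k)"
    using B1 CF self_le_power[OF B1, of 2] mult_mono[of B "B\<^sup>2" 1 CF]
    by (intro add_mono mult_right_mono mult_mono) auto
  also have "\<dots> = (30 * B ^ 2 * CF ^ 1) * (\<tau>\<^sup>2 + norm (E k))" by (simp add: algebra_simps)
  also have "\<dots> \<le> \<Lambda> * ((1 / real J)\<^sup>2 + \<tau>\<^sup>2 + norm (E k))"
    using const_le_\<Lambda>[of 2 1 30] \<Lambda>1 by (intro mult_mono) auto
  finally show ?thesis by (simp add: Dx_def)
qed

text \<open>
  The flux terms of \<open>consistency\<close> brought into the form needed for the energy estimate. The normal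
  boundary condition turns \<open>x\<^sub>\<rho> \<bullet> \<eta>\<close> into the difference of two normals times \<open>\<eta>\<close>, since \<open>\<eta>\<close> is orthogonal to
  the normal at the extrapolated point.
\<close>

lemma consistency_bd:
  assumes \<eta>: "\<eta> \<in> nodal_space cl J (bdn J) (\<lambda>k. G (wh k))"
  shows "lump J (cell_weight J wh) (\<lambda>j. (1 / \<tau>) *\<^sub>R bdf xa xb xc j) \<eta> + stiff J (vbar xa xb xc) \<eta>
    \<le> (\<Sum>k\<in>bdn J. bd_defect J \<tau> t k \<bullet> \<eta> k + bd_form J t k (E k) (\<eta> k))
      + \<Lambda> * ((1 / real J)\<^sup>2 + \<tau>\<^sup>2 + sqrt (h1_sq J E)) * sqrt (lump_sq J \<eta>)" (is "?R \<le> ?S + _")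
proof -
  define h where "h = 1 / real J"
  define N where "N = sqrt (lump_sq J \<eta>)"
  define V where "V = sqrt (h1_sq J E)"
  have N: "0 \<le> N" by (simp add: N_def lump_sq_nonneg)
  have V: "0 \<le> V" "sqrt (stiff_sq J E) \<le> V" by (simp_all add: V_def h1_sq_def lump_sq_nonneg stiff_sq_nonneg)
  have cons: "\<bar>?R - (bd_flux h \<tau> 1 t \<bullet> \<eta> J - bd_flux h \<tau> 0 t \<bullet> \<eta> 0)\<bar> \<le> 500 * B ^ 3 * (h\<^sup>2 + \<tau>\<^sup>2 + sqrt (stiff_sq J E)) * N"
    unfolding xa_def xb_def xc_def wh_def cell_weight_def[abs_def] h_def N_def
    by (rule consistency[OF J \<tau> sm'(1)]) (use sm'(4) \<delta>(2) in force)
  have P: "500 * B ^ 3 * (h\<^sup>2 + \<tau>\<^sup>2 + sqrt (stiff_sq J E)) * N \<le> 500 * (B ^ 3 * CF) * (h\<^sup>2 + \<tau>\<^sup>2 + V) * N"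
    using V N CF B0 by (intro mult_right_mono mult_mono add_nonneg_nonneg real_sqrt_ge_zero stiff_sq_nonneg) auto
  have rem: "sg k * (bd_flux h \<tau> (node J k) t \<bullet> \<eta> k) \<le> bd_defect J \<tau> t k \<bullet> \<eta> k + bd_form J t k (E k) (\<eta> k) + 200 * (B ^ 3 * CF) * (h\<^sup>2 + \<tau>\<^sup>2 + V) * N"
    if k: "k \<in> bdn J" for k
  proof -
    note kk = bdnD[OF k J]
    then have \<rho>: "\<not> cl" "node J k \<in> {0, 1}" "node J k \<in> {0..1}" "k \<le> J" by auto
    define \<rho> where "\<rho> = node J k"
    define x where "x = X 0 0 \<rho> t"
    define y where "y = dtt \<tau> t 0 \<rho> + E k"
    note bp = boundary_point[OF k, folded \<rho>_def, folded x_def y_def]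
    have lin: "linear (H \<rho> t)" using H_linear[OF \<rho>(1,2) tT(1)] by (simp add: \<rho>_def)
    have tan: "G (wh k) \<bullet> \<eta> k = 0" using \<eta> k by (simp add: nodal_space_def inner_commute)
    define q where "q = (G x - G (wh k) - H \<rho> t y) + H \<rho> t (dtt \<tau> t 0 \<rho> - \<tau>\<^sup>2 *\<^sub>R X 0 2 \<rho> t)"
    have xr: "X 1 0 \<rho> t \<bullet> \<eta> k = slope_n \<rho> t * ((G x - G (wh k)) \<bullet> \<eta> k)"
    proof -
      have "X 1 0 \<rho> t = slope_n \<rho> t *\<^sub>R G x" using normal[OF \<rho>(1,2) tT(2)] by (simp add: \<rho>_def x_def slope_n_def)
      then show ?thesis using tan by (simp add: inner_diff_left)
    qed
    have eq: "sg k * (bd_flux h \<tau> \<rho> t \<bullet> \<eta> k) = bd_defect J \<tau> t k \<bullet> \<eta> k + bd_form J t k (E k) (\<eta> k) + sg k * slope_n \<rho> t * (q \<bullet> \<eta> k)"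
    proof -
      have qe: "q \<bullet> \<eta> k = (G x - G (wh k)) \<bullet> \<eta> k - H \<rho> t (E k) \<bullet> \<eta> k - \<tau>\<^sup>2 * (H \<rho> t (X 0 2 \<rho> t) \<bullet> \<eta> k)"
        by (simp add: q_def y_def linear_add[OF lin] linear_diff[OF lin] linear_scale[OF lin] inner_simps)
      have de: "bd_defect J \<tau> t k \<bullet> \<eta> k = sg k * (bd_flux h \<tau> \<rho> t \<bullet> \<eta> k - X 1 0 \<rho> t \<bullet> \<eta> k + \<tau>\<^sup>2 * slope_n \<rho> t * (H \<rho> t (X 0 2 \<rho> t) \<bullet> \<eta> k))"
        by (simp add: bd_defect_def h_def \<rho>_def inner_simps)
      show ?thesis unfolding de qe xr by (simp add: bd_form_def \<rho>_def[symmetric] algebra_simps)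
    qed
    have qn: "norm q \<le> CF * (norm y)\<^sup>2 + CF * (10 * B * \<tau> ^ 3)"
    proof -
      have "norm (H \<rho> t (dtt \<tau> t 0 \<rho> - \<tau>\<^sup>2 *\<^sub>R X 0 2 \<rho> t)) \<le> CF * norm (dtt \<tau> t 0 \<rho> - \<tau>\<^sup>2 *\<^sub>R X 0 2 \<rho> t)"
        using H_bound[OF \<rho>(1,2) tT(1)] by (simp add: \<rho>_def)
      also have "\<dots> \<le> CF * (10 * B * \<tau> ^ 3)"
        using dtt_bound(2)[OF _ \<rho>(3) \<tau>, of 0] CF by (intro mult_left_mono) (auto simp: \<rho>_def)
      finally show ?thesis unfolding q_def using bp(7) by (intro order_trans[OF norm_triangle_ineq] add_mono) auto
    qed
    define s where "s = sqrt (real J)"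
    have s: "1 \<le> s" using J by (simp add: s_def)
    have ts: "\<tau> * s \<le> 1"
    proof -
      have "(\<tau> * s)\<^sup>2 \<le> 1\<^sup>2" using sm'(1) J by (simp add: power_mult_distrib s_def field_simps)
      then show ?thesis by (rule power2_le_imp_le) simp
    qed
    have "\<tau> * 1 \<le> \<tau> * s" using s \<tau>(1) by (intro mult_left_mono) auto
    then have \<tau>1: "\<tau> \<le> 1" using ts by simp
    have t3: "\<tau> ^ 3 * s \<le> \<tau>\<^sup>2"
    proof -
      have "\<tau> ^ 3 * s = \<tau>\<^sup>2 * (\<tau> * s)" by (simp add: power3_eq_cube power2_eq_square)
      also have "\<dots> \<le> \<tau>\<^sup>2" using ts by (intro mult_left_le) auto
      finally show ?thesis .
    qed
    have t4: "(\<tau>\<^sup>2)\<^sup>2 * s \<le> \<tau>\<^sup>2"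
    proof -
      have "(\<tau>\<^sup>2)\<^sup>2 * s = \<tau> * (\<tau> ^ 3 * s)" by (simp add: power3_eq_cube power2_eq_square)
      also have "\<dots> \<le> 1 * \<tau>\<^sup>2" using t3 \<tau> \<tau>1 s by (intro mult_mono) auto
      finally show ?thesis by simp
    qed
    have e2: "(norm (E k))\<^sup>2 * s \<le> norm (E k)"
    proof -
      have "(norm (E k))\<^sup>2 * s = norm (E k) * (norm (E k) * s)" by (simp add: power2_eq_square)
      also have "\<dots> \<le> norm (E k)" using sm'(6)[OF \<rho>(4)] by (intro mult_left_le) (auto simp: s_def)
      finally show ?thesis .
    qed
    have eV: "norm (E k) \<le> 3/2 * V"
    proof (rule power2_le_imp_le)
      have "(norm (E k))\<^sup>2 \<le> 2 * h1_sq J E" by (rule trace_h1[OF J \<rho>(4)])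
      also have "\<dots> \<le> (3/2 * V)\<^sup>2" using h1_sq_nonneg[of J E] by (simp add: V_def power_mult_distrib power2_eq_square[of "3::real"] power_divide)
      finally show "(norm (E k))\<^sup>2 \<le> (3/2 * V)\<^sup>2" .
    qed (use V in simp)
    have y2: "(norm y)\<^sup>2 \<le> 72 * B\<^sup>2 * (\<tau>\<^sup>2)\<^sup>2 + 2 * (norm (E k))\<^sup>2"
    proof -
      have "(norm y)\<^sup>2 \<le> (6 * B * \<tau>\<^sup>2 + norm (E k))\<^sup>2" using bp(3) by (intro power_mono) auto
      also have "\<dots> \<le> 2 * (6 * B * \<tau>\<^sup>2)\<^sup>2 + 2 * (norm (E k))\<^sup>2"
        using zero_le_power2[of "6 * B * \<tau>\<^sup>2 - norm (E k)"] unfolding power2_sum power2_diff by linarith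
      also have "\<dots> = 72 * B\<^sup>2 * (\<tau>\<^sup>2)\<^sup>2 + 2 * (norm (E k))\<^sup>2" by (simp add: power_mult_distrib)
      finally show ?thesis .
    qed
    have "norm q * s \<le> (CF * (norm y)\<^sup>2 + CF * (10 * B * \<tau> ^ 3)) * s" using qn s by (intro mult_right_mono) auto
    also have "\<dots> \<le> (CF * (72 * B\<^sup>2 * (\<tau>\<^sup>2)\<^sup>2 + 2 * (norm (E k))\<^sup>2) + CF * (10 * B * \<tau> ^ 3)) * s"
      using y2 CF s B0 \<tau>(1) by (intro mult_right_mono add_mono mult_left_mono) auto
    also have "\<dots> = CF * (72 * B\<^sup>2 * ((\<tau>\<^sup>2)\<^sup>2 * s) + 2 * ((norm (E k))\<^sup>2 * s) + 10 * B * (\<tau> ^ 3 * s))"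
      by (simp add: algebra_simps)
    also have "\<dots> \<le> CF * (72 * B\<^sup>2 * \<tau>\<^sup>2 + 2 * (3/2 * V) + 10 * B * \<tau>\<^sup>2)"
      using t3 t4 e2 eV B0 CF by (intro mult_left_mono add_mono) auto
    also have "\<dots> \<le> CF * (82 * B\<^sup>2 * (h\<^sup>2 + \<tau>\<^sup>2 + V))"
    proof (intro mult_left_mono)
      have "B * \<tau>\<^sup>2 \<le> B\<^sup>2 * \<tau>\<^sup>2" using self_le_power[OF B1, of 2] by (intro mult_right_mono) auto
      moreover have "1 * V \<le> B\<^sup>2 * V" by (rule mult_right_mono[OF one_le_power[OF B1] V(1)])
      moreover have "0 \<le> B\<^sup>2 * h\<^sup>2" "0 \<le> B\<^sup>2 * V" using V by auto
      ultimately show "72 * B\<^sup>2 * \<tau>\<^sup>2 + 2 * (3/2 * V) + 10 * B * \<tau>\<^sup>2 \<le> 82 * B\<^sup>2 * (h\<^sup>2 + \<tau>\<^sup>2 + V)"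
        unfolding distrib_left mult.assoc by linarith
    qed (use CF in simp)
    finally have qs: "norm q * s \<le> CF * (82 * B\<^sup>2 * (h\<^sup>2 + \<tau>\<^sup>2 + V))" .
    have "sg k * slope_n \<rho> t * (q \<bullet> \<eta> k) \<le> \<bar>slope_n \<rho> t\<bar> * \<bar>q \<bullet> \<eta> k\<bar>"
      by (rule order_trans[OF abs_ge_self]) (simp add: abs_mult sg_def)
    also have "\<dots> \<le> B * (norm q * (3/2 * s * N))"
      using slope_n_bound[OF \<rho>(1,2) tT(1)] norm_node_le[OF J \<rho>(4), of \<eta>] B0
      by (intro mult_mono order_trans[OF Cauchy_Schwarz_ineq2] mult_left_mono) (auto simp: \<rho>_def s_def N_def)
    also have "\<dots> = 3/2 * B * (norm q * s) * N" by simp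
    also have "\<dots> \<le> 3/2 * B * (CF * (82 * B\<^sup>2 * (h\<^sup>2 + \<tau>\<^sup>2 + V))) * N"
      using qs B0 N by (intro mult_right_mono mult_left_mono) auto
    also have "\<dots> = 123 * ((B ^ 3 * CF) * (h\<^sup>2 + \<tau>\<^sup>2 + V) * N)" by (simp add: power3_eq_cube power2_eq_square)
    also have "\<dots> \<le> 200 * ((B ^ 3 * CF) * (h\<^sup>2 + \<tau>\<^sup>2 + V) * N)"
      using B0 CF V N by (intro mult_right_mono) auto
    finally show ?thesis using eq by (simp add: \<rho>_def mult.assoc)
  qed
  have flux: "bd_flux h \<tau> 1 t \<bullet> \<eta> J - bd_flux h \<tau> 0 t \<bullet> \<eta> 0 \<le> ?S + 400 * ((B ^ 3 * CF) * (h\<^sup>2 + \<tau>\<^sup>2 + V) * N)"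
  proof (cases cl)
    case True
    then have "bd_flux h \<tau> 1 t = bd_flux h \<tau> 0 t" "\<eta> J = \<eta> 0"
      using \<eta> periodic[OF True tT(1)] by (auto simp: bd_flux_def nodal_space_def)
    moreover have "bdn J = {}" unfolding bdn_def using True by simp
    ultimately show ?thesis using B0 CF V N by simp
  next
    case False
    then have b: "bdn J = {0, J}" unfolding bdn_def by simp
    have n: "node J 0 = 0" "node J J = 1" using J by (auto simp: node_def)
    show ?thesis
      using rem[of 0] rem[of J] J unfolding b by (simp add: n sg_def)
  qed
  have "?R \<le> ?S + 900 * B ^ 3 * CF ^ 1 * (h\<^sup>2 + \<tau>\<^sup>2 + V) * N"
    using cons P flux by (simp add: mult.assoc)
  also have "900 * B ^ 3 * CF ^ 1 * (h\<^sup>2 + \<tau>\<^sup>2 + V) * N \<le> \<Lambda> * (h\<^sup>2 + \<tau>\<^sup>2 + V) * N"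
    using const_le_\<Lambda>[of 3 1 900] V N by (intro mult_right_mono) auto
  finally show ?thesis by (simp add: h_def V_def N_def)
qed

end

end

lemma h1_sq_cong: "(\<And>j. j \<le> J \<Longrightarrow> u j = v j) \<Longrightarrow> h1_sq J u = h1_sq J v"
  by (simp add: h1_sq_def stiff_def lump_def)

text \<open>
  Only the values at the nodes up to \<open>J\<close> are fixed by the scheme, so the initial values are compared on
  these.
\<close>

definition nodal_path :: "bool \<Rightarrow> nat \<Rightarrow> nat set \<Rightarrow> 'a::real_inner set \<Rightarrow> ('a \<Rightarrow> 'a) \<Rightarrow> real \<Rightarrow>
    (nat \<Rightarrow> 'a) \<Rightarrow> (nat \<Rightarrow> 'a) \<Rightarrow> nat \<Rightarrow> (nat \<Rightarrow> nat \<Rightarrow> 'a) \<Rightarrow> bool" where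
  "nodal_path cl J bd U G \<tau> Y0 Y1 n Y \<longleftrightarrow>
     (\<forall>j\<le>J. Y 0 j = Y0 j) \<and> (\<forall>j\<le>J. Y 1 j = Y1 j) \<and> (cl \<longrightarrow> (\<forall>m\<le>n. Y m 0 = Y m J)) \<and>
     (\<forall>m\<in>{1..<n}. nodal_step cl J bd U G \<tau> (Y (m - 1)) (Y m) (Y (m + 1)))"

context bd_flow
begin

lemma wh_eq:
  assumes J: "0 < J" and \<tau>: "0 < \<tau>" "2 * \<tau> \<le> t" "t \<le> T" and sm: "small J \<tau> E"
    and E: "E = vhat (\<lambda>j. xnode J (t - \<tau>) j - Y1 j) (\<lambda>j. xnode J (t - 2 * \<tau>) j - Y0 j)"
  shows "wh J \<tau> t E = vhat Y1 Y0"
  unfolding wh_def[OF J \<tau> sm] xb_def[OF J \<tau> sm] xc_def[OF J \<tau> sm] unfolding E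
  by (rule ext, rule vec_eqI) (simp add: vhat_def inner_simps)

text \<open>
  The general energy estimate applied to the scheme: subtracting the scheme from the consistency
  relation yields the error equation, whose residual has the required structure.
\<close>

lemma step_energy:
  assumes J: "0 < J" and \<tau>: "0 < \<tau>" "2 * \<tau> \<le> t" "t \<le> T"
    and step: "nodal_step cl J (bdn J) U G \<tau> Y0 Y1 Y2"
    and closed: "cl \<Longrightarrow> Y0 0 = Y0 J \<and> Y1 0 = Y1 J \<and> Y2 0 = Y2 J"
  defines "a \<equiv> \<lambda>j. xnode J t j - Y2 j" and "b \<equiv> \<lambda>j. xnode J (t - \<tau>) j - Y1 j" and "c \<equiv> \<lambda>j. xnode J (t - 2 * \<tau>) j - Y0 j"
  defines "D \<equiv> (1 / real J)\<^sup>2 + \<tau>\<^sup>2"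
  assumes sm: "small J \<tau> (vhat b c)"
  shows "energy J (bdn J) \<Lambda> D (bd_defect J \<tau> t) (bd_form J t) a b
    \<le> energy J (bdn J) \<Lambda> D (bd_defect J \<tau> (t - \<tau>)) (bd_form J (t - \<tau>)) b c
     + \<tau> * (10 ^ 9 * \<Lambda> ^ 5 * (h1_sq J a + h1_sq J b + h1_sq J c + D\<^sup>2))"
proof -
  define E where "E = vhat b c"
  note smE = sm[folded E_def]
  define w where "w = wh J \<tau> t E"
  have w: "w = vhat Y1 Y0"
    unfolding w_def by (rule wh_eq[OF J \<tau> smE]) (simp add: E_def b_def c_def)
  let ?xa = "xa J t" and ?xb = "xb J \<tau> t" and ?xc = "xc J \<tau> t"
  have x: "?xa = xnode J t" "?xb = xnode J (t - \<tau>)" "?xc = xnode J (t - 2 * \<tau>)"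
    using xa_def[OF J \<tau> smE] xb_def[OF J \<tau> smE] xc_def[OF J \<tau> smE] by auto
  have bdf: "bdf a b c j = bdf ?xa ?xb ?xc j - bdf Y2 Y1 Y0 j" for j
    by (rule vec_eqI) (simp add: a_def b_def c_def x bdf_def inner_simps algebra_simps)
  have vb: "vbar a b c = (\<lambda>j. vbar ?xa ?xb ?xc j - vbar Y2 Y1 Y0 j)"
    by (rule ext, rule vec_eqI) (simp add: a_def b_def c_def x vbar_def inner_simps algebra_simps)
  have bdD: "\<not> cl" if "k \<in> bdn J" for k using that by (auto simp: bdn_def split: if_splits)
  have xcl: "cl \<Longrightarrow> s \<in> {0..T} \<Longrightarrow> xnode J s 0 = xnode J s J" for s
    using periodic J by (simp add: xnode_def node_def)
  have tt: "t \<in> {0..T}" "t - \<tau> \<in> {0..T}" "t - 2 * \<tau> \<in> {0..T}" using \<tau> by auto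
  have D: "0 \<le> D" by (simp add: D_def)
  show ?thesis
  proof (rule energy_step[where cl=cl and g="\<lambda>k. G (w k)" and W="cell_weight J w" and
      R="\<lambda>\<eta>. lump J (cell_weight J w) (\<lambda>j. (1 / \<tau>) *\<^sub>R bdf ?xa ?xb ?xc j) \<eta> + stiff J (vbar ?xa ?xb ?xc) \<eta>"])
    show "bdn J \<subseteq> {0, J}" by (simp add: bdn_def)
    show "1 / \<Lambda> \<le> cell_weight J w j \<and> cell_weight J w j \<le> \<Lambda>" if "j < J" for j
      unfolding w_def using weight_bounds[OF J \<tau> smE that] by simp
    show "bdn J = {} \<and> a 0 = a J \<and> b 0 = b J \<and> c 0 = c J" if cl
    proof -
      have "bdn J = {}" unfolding bdn_def using that by simp
      then show ?thesis using closed[OF that] xcl[OF that] tt by (simp add: a_def b_def c_def)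
    qed
    show "lump J (cell_weight J w) (\<lambda>j. (1 / \<tau>) *\<^sub>R bdf a b c j) \<eta> + stiff J (vbar a b c) \<eta>
       = lump J (cell_weight J w) (\<lambda>j. (1 / \<tau>) *\<^sub>R bdf ?xa ?xb ?xc j) \<eta> + stiff J (vbar ?xa ?xb ?xc) \<eta>"
      if "\<forall>k\<in>bdn J. \<eta> k \<bullet> G (w k) = 0" "cl \<longrightarrow> \<eta> 0 = \<eta> J" for \<eta>
    proof -
      have "\<eta> \<in> nodal_space cl J (bdn J) (\<lambda>k. G (vhat Y1 Y0 k))" using that by (simp add: nodal_space_def w)
      then have "lump J (cell_weight J w) (\<lambda>j. (1 / \<tau>) *\<^sub>R bdf Y2 Y1 Y0 j) \<eta> + stiff J (vbar Y2 Y1 Y0) \<eta> = 0"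
        using step unfolding nodal_step_def w by blast
      then show ?thesis unfolding bdf vb scaleR_diff_right lump_diff stiff_diff by linarith
    qed
    show "1 / 2 \<le> norm (G (w k))" if "k \<in> bdn J" for k
      unfolding w_def by (rule boundary_point(6)[OF J \<tau> smE that])
    show "\<bar>((1 / \<tau>) *\<^sub>R bdf a b c k) \<bullet> G (w k)\<bar> \<le> \<Lambda> * (D + norm (vhat b c k))" if k: "k \<in> bdn J" for k
    proof -
      have "bdf Y2 Y1 Y0 k \<bullet> G (w k) = 0" using step k unfolding nodal_step_def nodal_space_def w by auto
      then have eq: "((1 / \<tau>) *\<^sub>R bdf a b c k) \<bullet> G (w k) = ((1 / \<tau>) *\<^sub>R bdf ?xa ?xb ?xc k) \<bullet> G (w k)"
        by (simp add: bdf inner_diff_left diff_divide_distrib)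
      show ?thesis
        unfolding eq using exact_tangential[OF J \<tau> smE k] unfolding w_def[symmetric] D_def[symmetric] unfolding E_def .
    qed
    show "lump J (cell_weight J w) (\<lambda>j. (1 / \<tau>) *\<^sub>R bdf ?xa ?xb ?xc j) \<eta> + stiff J (vbar ?xa ?xb ?xc) \<eta>
        \<le> (\<Sum>k\<in>bdn J. bd_defect J \<tau> t k \<bullet> \<eta> k + bd_form J t k (vhat b c k) (\<eta> k))
           + \<Lambda> * (D + sqrt (h1_sq J (vhat b c))) * sqrt (lump_sq J \<eta>)"
      if "\<forall>k\<in>bdn J. \<eta> k \<bullet> G (w k) = 0" "cl \<longrightarrow> \<eta> 0 = \<eta> J" for \<eta>
      using consistency_bd[OF J \<tau> smE, of \<eta>] that by (simp add: nodal_space_def w_def D_def E_def)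
    show "norm (bd_defect J \<tau> t k) \<le> \<Lambda> * D" if "k \<in> bdn J" for k
      unfolding D_def by (rule bd_defect_bounds(1)[OF that J tt(1) tt(1)])
    show "norm (bd_defect J \<tau> t k - bd_defect J \<tau> (t - \<tau>) k) \<le> \<Lambda> * \<tau> * D" if "k \<in> bdn J" for k
      using bd_defect_bounds(2)[OF that J tt(1,2), of \<tau>] \<tau> by (simp add: D_def)
    show "\<bar>bd_form J t k u v - bd_form J (t - \<tau>) k u v\<bar> \<le> \<Lambda> * \<tau> * norm u * norm v" if "k \<in> bdn J" for k u v
      using bd_form_lipschitz[OF that J tt(1,2), of u v] \<tau> by simp
    show "bounded_bilinear (bd_form J t k)" "bd_form J t k u v = bd_form J t k v u" "\<bar>bd_form J t k u v\<bar> \<le> \<Lambda> * norm u * norm v"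
      if "k \<in> bdn J" for k u v
      using bd_form_bilinear[OF that J tt(1)] by blast+
  qed (use \<Lambda>1 J D \<tau> in auto)
qed

text \<open>
  For small errors the weights are positive, so the form of the step is positive definite on the space
  of admissible increments. The increment sought is \<open>bdf\<close>, and the new iterate is recovered from it.
\<close>

lemma step_exists:
  assumes J: "0 < J" and \<tau>: "0 < \<tau>" "2 * \<tau> \<le> t" "t \<le> T"
    and closed: "cl \<Longrightarrow> Y0 0 = Y0 J \<and> Y1 0 = Y1 J"
    and sm: "small J \<tau> (vhat (\<lambda>j. xnode J (t - \<tau>) j - Y1 j) (\<lambda>j. xnode J (t - 2 * \<tau>) j - Y0 j))"
  obtains Y2 where "nodal_step cl J (bdn J) U G \<tau> Y0 Y1 Y2" "cl \<longrightarrow> Y2 0 = Y2 J"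
    and "\<And>Y2' k. nodal_step cl J (bdn J) U G \<tau> Y0 Y1 Y2' \<Longrightarrow> k \<le> J \<Longrightarrow> Y2' k = Y2 k"
proof -
  define E where "E = vhat (\<lambda>j. xnode J (t - \<tau>) j - Y1 j) (\<lambda>j. xnode J (t - 2 * \<tau>) j - Y0 j)"
  note smE = sm[folded E_def]
  define w where "w = wh J \<tau> t E"
  have w: "w = vhat Y1 Y0"
    unfolding w_def by (rule wh_eq[OF J \<tau> smE]) (simp add: E_def)
  let ?V = "nodal_space cl J (bdn J) (\<lambda>k. G (w k))" and ?W = "cell_weight J w"
  have W: "0 < ?W j" if "j < J" for j
    using weight_bounds(1)[OF J \<tau> smE that] \<Lambda>1 by (simp add: w_def) (smt (verit) divide_pos_pos)
  define f where "f \<eta> = - stiff J Y1 \<eta>" for \<eta>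
  have sum: "stiff J Y1 (\<lambda>j. \<Sum>i\<in>S. v i j) = (\<Sum>i\<in>S. stiff J Y1 (v i))" if "finite S" for S :: "(nat \<times> 'a) set" and v
    using that
  proof (induction S rule: finite_induct)
    case (insert x S)
    then show ?case using stiff_lin2(1)[of J Y1 "v x" "\<lambda>j. \<Sum>i\<in>S. v i j"] by simp
  qed (simp add: stiff_def)
  obtain d where d: "d \<in> ?V" "\<And>\<eta>. \<eta> \<in> ?V \<Longrightarrow> step_form J ?W \<tau> d \<eta> = f \<eta>"
  proof (rule step_solvable[where J=J and \<tau>=\<tau> and W="?W" and cl=cl and bd="bdn J" and g="\<lambda>k. G (w k)" and f=f])
    show "f (\<lambda>j. \<Sum>i\<in>S. v i j) = (\<Sum>i\<in>S. f (v i))" if "finite S" for S :: "(nat \<times> 'a) set" and v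
      using sum[OF that] by (simp add: f_def sum_negf)
    show "f (\<lambda>j. r *\<^sub>R v j) = r * f v" for r v by (simp add: f_def stiff_lin2)
    show "f u = f v" if "\<And>j. j \<le> J \<Longrightarrow> u j = v j" for u v using that by (simp add: f_def stiff_def)
    show "bdn J = {}" if cl unfolding bdn_def using that by simp
  qed (use J \<tau> W in auto)
  have vbd: "vbar Y2 Y1 Y0 = (\<lambda>j. Y1 j + bdf Y2 Y1 Y0 j)" for Y2 :: "nat \<Rightarrow> 'a"
    by (rule ext, rule vec_eqI) (simp add: vbar_def bdf_def inner_simps)
  have iff: "nodal_step cl J (bdn J) U G \<tau> Y0 Y1 Y2 \<longleftrightarrow>
      bdf Y2 Y1 Y0 \<in> ?V \<and> (\<forall>\<eta>\<in>?V. step_form J ?W \<tau> (bdf Y2 Y1 Y0) \<eta> = f \<eta>)" for Y2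
  proof -
    have "\<forall>k\<in>bdn J. vhat Y1 Y0 k \<in> U"
      using boundary_point(4)[OF J \<tau> smE] unfolding w[symmetric] by (simp add: w_def)
    moreover have "lump J ?W (\<lambda>j. (1 / \<tau>) *\<^sub>R bdf Y2 Y1 Y0 j) \<eta> + stiff J (vbar Y2 Y1 Y0) \<eta> = 0 \<longleftrightarrow>
        step_form J ?W \<tau> (bdf Y2 Y1 Y0) \<eta> = f \<eta>" for \<eta>
      unfolding vbd lump_scale stiff_add step_form_def f_def by linarith
    ultimately show ?thesis unfolding nodal_step_def w[symmetric] by simp
  qed
  define Y2 where "Y2 j = (2/3) *\<^sub>R d j + (4/3) *\<^sub>R Y1 j - (1/3) *\<^sub>R Y0 j" for j
  have bd: "bdf Y2 Y1 Y0 = d"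
    by (rule ext, rule vec_eqI) (simp add: bdf_def Y2_def inner_simps field_simps)
  show thesis
  proof (rule that[of Y2])
    show "nodal_step cl J (bdn J) U G \<tau> Y0 Y1 Y2" unfolding iff bd using d by blast
    show "cl \<longrightarrow> Y2 0 = Y2 J" using closed d(1) by (auto simp: Y2_def nodal_space_def)
    show "Y2' k = Y2 k" if st: "nodal_step cl J (bdn J) U G \<tau> Y0 Y1 Y2'" and k: "k \<le> J" for Y2' k
    proof -
      note s = st[unfolded iff]
      have "bdf Y2' Y1 Y0 k = d k"
      proof (rule step_unique[OF J \<tau>(1) W _ d(1) _ k])
        show "bdf Y2' Y1 Y0 \<in> ?V" using s by blast
        show "step_form J ?W \<tau> (bdf Y2' Y1 Y0) \<eta> = step_form J ?W \<tau> d \<eta>" if "\<eta> \<in> ?V" for \<eta>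
          using s d(2) that by simp
      qed
      also have "d k = bdf Y2 Y1 Y0 k" by (simp add: bd)
      finally show ?thesis by (simp add: bdf_def)
    qed
  qed
qed

text \<open>
  The energy of the new level also occurs on the right hand side, with a factor of order \<open>\<tau>\<close>; for
  \<open>\<theta> \<le> 1/2\<close> it is absorbed.
\<close>

lemma implicit_gronwall_step:
  fixes e e' \<theta> D N :: real
  assumes "0 \<le> e" "0 \<le> \<theta>" "\<theta> \<le> 1/2" "e' \<le> e + \<theta> / 24 * (N + D)" "N \<le> 24 * e' + 24 * e" "0 \<le> D"
  shows "e' \<le> (1 + 4 * \<theta>) * e + 4 * \<theta> * D"
proof -
  have "\<theta> / 24 * (N + D) \<le> \<theta> / 24 * (24 * e' + 24 * e + D)" using assms by (intro mult_left_mono) auto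
  moreover have "\<theta> / 24 * (24 * e' + 24 * e + D) = \<theta> * e' + \<theta> * e + \<theta> * D / 24" by (simp add: field_simps)
  ultimately have "(1 - \<theta>) * e' \<le> (1 + \<theta>) * e + \<theta> * D / 24"
    using assms(4) unfolding left_diff_distrib distrib_right mult_1 by linarith
  also have "\<dots> \<le> (1 - \<theta>) * ((1 + 4 * \<theta>) * e + 4 * \<theta> * D)"
  proof -
    have "0 \<le> (2 * \<theta> * (1 - 2 * \<theta>)) * e" using assms by (intro mult_nonneg_nonneg) auto
    moreover have "0 \<le> (1 - 2 * \<theta>) * (2 * (\<theta> * D))" using assms by (intro mult_nonneg_nonneg) auto
    moreover have "0 \<le> \<theta> * D" using assms by simp
    ultimately show ?thesis by (simp add: algebra_simps)
  qed
  finally show ?thesis using assms by (simp add: mult_le_cancel_left)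
qed

text \<open>
  Induction over the steps: a bound on the energy at the last two levels implies smallness of the
  extrapolated error, hence solvability of the next step and the energy inequality for it. The constant
  \<open>K\<close> is fixed beforehand from Gronwall's inequality, and \<open>h0\<close> depends on \<open>K\<close>, so the induction closes.
  Solvability is stated for initial segments of a solution, because existence of a whole solution is
  built up from it step by step.
\<close>

theorem nodal_convergence:
  assumes c1: "0 \<le> c1"
  shows "\<exists>h0>0. \<exists>\<gamma>>0. \<exists>K>0. \<forall>J M Y1. 2 \<le> J \<longrightarrow> 1 \<le> M \<longrightarrow> 1 / real J \<le> h0 \<longrightarrow> T / real M \<le> \<gamma> * sqrt (1 / real J) \<longrightarrow>
     h1_sq J (\<lambda>j. xnode J (T / real M) j - Y1 j) \<le> c1 * ((1 / real J)\<^sup>2 + (T / real M)\<^sup>2)\<^sup>2 \<longrightarrow>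
     (\<forall>n Y. n \<le> M \<longrightarrow> nodal_path cl J (bdn J) U G (T / real M) (xnode J 0) Y1 n Y \<longrightarrow>
        (\<forall>m\<le>n. h1_sq J (\<lambda>j. xnode J (real m * (T / real M)) j - Y m j) \<le> K * ((1 / real J)\<^sup>2 + (T / real M)\<^sup>2)\<^sup>2) \<and>
        (1 \<le> n \<and> n < M \<longrightarrow> (\<exists>Y2. nodal_step cl J (bdn J) U G (T / real M) (Y (n - 1)) (Y n) Y2 \<and> (cl \<longrightarrow> Y2 0 = Y2 J) \<and>
           (\<forall>Y2'. nodal_step cl J (bdn J) U G (T / real M) (Y (n - 1)) (Y n) Y2' \<longrightarrow> (\<forall>k\<le>J. Y2' k = Y2 k)))))"
proof -
  define K5 where "K5 = 96 * 10 ^ 9 * \<Lambda> ^ 5"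
  define K where "K = 24 * exp (K5 * T) * (16000 * \<Lambda>\<^sup>2 * c1 + 4 * \<Lambda>\<^sup>2 + 1)"
  define h0 where "h0 = min 1 (min (\<delta>\<^sup>2 / (80 * K)) (\<delta> / (6 * B)))"
  define \<gamma> where "\<gamma> = min 1 (2 / K5)"
  have K5: "0 < K5" using \<Lambda>1 by (simp add: K5_def)
  have K1: "1 \<le> K"
  proof -
    have "1 * 1 \<le> exp (K5 * T) * (16000 * \<Lambda>\<^sup>2 * c1 + 4 * \<Lambda>\<^sup>2 + 1)" using K5 T c1 by (intro mult_mono) auto
    then show ?thesis by (simp add: K_def)
  qed
  have h0: "0 < h0" using \<delta>(1) K1 B0 by (simp add: h0_def)
  have \<gamma>: "0 < \<gamma>" using K5 by (simp add: \<gamma>_def)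
  have K0: "0 < K" using K1 by simp
  show ?thesis
  proof (rule exI[of _ h0], rule conjI[OF h0], rule exI[of _ \<gamma>], rule conjI[OF \<gamma>], rule exI[of _ K], rule conjI[OF K0],
      intro conjI allI impI)
    fix J M :: nat and Y1 :: "nat \<Rightarrow> 'a"
    assume J2: "2 \<le> J" and M: "1 \<le> M" and h: "1 / real J \<le> h0" and t\<gamma>: "T / real M \<le> \<gamma> * sqrt (1 / real J)"
      and Y1: "h1_sq J (\<lambda>j. xnode J (T / real M) j - Y1 j) \<le> c1 * ((1 / real J)\<^sup>2 + (T / real M)\<^sup>2)\<^sup>2"
    define \<tau> where "\<tau> = T / real M"
    define D where "D = (1 / real J)\<^sup>2 + \<tau>\<^sup>2"
    have J: "0 < J" using J2 by simp
    have \<tau>: "0 < \<tau>" using T M by (simp add: \<tau>_def)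
    have D: "0 \<le> D" by (simp add: D_def)
    have h1: "sqrt (1 / real J) \<le> 1" using J by simp
    have \<tau>h: "\<tau>\<^sup>2 \<le> 1 / real J"
    proof -
      have "\<tau> \<le> 1 * sqrt (1 / real J)"
        by (rule order_trans[OF t\<gamma>[folded \<tau>_def]], rule mult_right_mono) (auto simp: \<gamma>_def)
      then have "\<tau>\<^sup>2 \<le> (sqrt (1 / real J))\<^sup>2" using \<tau> by (intro power_mono) auto
      then show ?thesis by simp
    qed
    have \<tau>K: "K5 * \<tau> \<le> 2"
    proof -
      have "\<tau> \<le> \<gamma> * 1" using t\<gamma>[folded \<tau>_def] mult_left_mono[OF h1, of \<gamma>] \<gamma> by linarith
      also have "\<dots> \<le> 2 / K5" by (simp add: \<gamma>_def)
      finally show ?thesis using K5 by (simp add: field_simps)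
    qed
    have hh: "8 * (10 * K) * (1 / real J) \<le> \<delta>\<^sup>2" "6 * B * (1 / real J) \<le> \<delta>"
    proof -
      have "1 / real J \<le> \<delta>\<^sup>2 / (80 * K)" "1 / real J \<le> \<delta> / (6 * B)" using h by (auto simp: h0_def)
      then show "8 * (10 * K) * (1 / real J) \<le> \<delta>\<^sup>2" "6 * B * (1 / real J) \<le> \<delta>"
        using K1 B0 by (simp_all add: pos_le_divide_eq mult_ac)
    qed
    have small: "small J \<tau> (vhat b c)" if "h1_sq J b + h1_sq J c \<le> K * D\<^sup>2" for b c
    proof (rule smallI[OF J \<tau>h _ _ hh])
      have "h1_sq J (vhat b c) \<le> 8 * h1_sq J b + 2 * h1_sq J c" by (rule h1_sq_vhat)
      also have "\<dots> \<le> 10 * (h1_sq J b + h1_sq J c)" using h1_sq_nonneg[of J b] h1_sq_nonneg[of J c] by simp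
      also have "\<dots> \<le> 10 * (K * D\<^sup>2)" using that by simp
      finally show "h1_sq J (vhat b c) \<le> 10 * K * ((1 / real J)\<^sup>2 + \<tau>\<^sup>2)\<^sup>2" by (simp add: D_def)
    qed (use K1 in simp)
    have times: "real (Suc m) * \<tau> - \<tau> = real m * \<tau>" "real (Suc m) * \<tau> - 2 * \<tau> = real (m - 1) * \<tau>"
      "2 * \<tau> \<le> real (Suc m) * \<tau>" if "1 \<le> m" for m
      using that \<tau> by (auto simp: of_nat_diff algebra_simps)
    have tM: "real m * \<tau> \<le> T" if "m \<le> M" for m
    proof -
      have "real m * \<tau> \<le> real M * \<tau>" using that \<tau> by (intro mult_right_mono) auto
      then show ?thesis using M by (simp add: \<tau>_def)
    qed
    define e where "e Y m = (\<lambda>j. xnode J (real m * \<tau>) j - Y m j)" for Y :: "nat \<Rightarrow> nat \<Rightarrow> 'a" and m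
    let ?path = "nodal_path cl J (bdn J) U G \<tau> (xnode J 0) Y1"
    define en where "en Y m = energy J (bdn J) \<Lambda> D (bd_defect J \<tau> (real m * \<tau>)) (bd_form J (real m * \<tau>)) (e Y m) (e Y (m - 1))" for Y m
    have enb: "(h1_sq J (e Y m) + h1_sq J (e Y (m - 1))) / 24 \<le> en Y m"
      "en Y m \<le> 16000 * \<Lambda>\<^sup>2 * (h1_sq J (e Y m) + h1_sq J (e Y (m - 1))) + 4 * \<Lambda>\<^sup>2 * D\<^sup>2" if "m \<le> M" for Y m
    proof -
      have t: "real m * \<tau> \<in> {0..T}" using tM[OF that] \<tau> by simp
      have sub: "bdn J \<subseteq> {0, J}" by (simp add: bdn_def)
      note * = energy_bounds[OF \<Lambda>1 J sub D, of "bd_defect J \<tau> (real m * \<tau>)" "bd_form J (real m * \<tau>)" "e Y m" "e Y (m - 1)"]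
      have 1: "norm (bd_defect J \<tau> (real m * \<tau>) k) \<le> \<Lambda> * D" if "k \<in> bdn J" for k
        unfolding D_def by (rule bd_defect_bounds(1)[OF that J t t])
      have 2: "\<bar>bd_form J (real m * \<tau>) k u v\<bar> \<le> \<Lambda> * norm u * norm v" if "k \<in> bdn J" for k u v
        by (rule bd_form_bilinear(3)[OF that J t])
      show "(h1_sq J (e Y m) + h1_sq J (e Y (m - 1))) / 24 \<le> en Y m"
        "en Y m \<le> 16000 * \<Lambda>\<^sup>2 * (h1_sq J (e Y m) + h1_sq J (e Y (m - 1))) + 4 * \<Lambda>\<^sup>2 * D\<^sup>2"
        unfolding en_def using *[OF 1 2] by auto
    qed
    have bound: "\<forall>m\<in>{1..n}. h1_sq J (e Y m) + h1_sq J (e Y (m - 1)) \<le> K * D\<^sup>2"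
      if "1 \<le> n" "n \<le> M" "?path n Y" for n Y
      using that
    proof (induction n)
      case (Suc n)
      have IH: "\<forall>m\<in>{1..n}. h1_sq J (e Y m) + h1_sq J (e Y (m - 1)) \<le> K * D\<^sup>2"
      proof (cases "n = 0")
        case False
        moreover have "?path n Y" using Suc.prems(3) by (simp add: nodal_path_def)
        ultimately show ?thesis using Suc by simp
      qed simp
      have step: "en Y (Suc m) \<le> (1 + K5 * \<tau>) * en Y m + K5 * \<tau> * D\<^sup>2" if m: "1 \<le> m" "m < Suc n" for m
      proof -
        define t where "t = real (Suc m) * \<tau>"
        have tt: "t - \<tau> = real m * \<tau>" "t - 2 * \<tau> = real (m - 1) * \<tau>" "2 * \<tau> \<le> t" "t \<le> T"
          using times[OF m(1)] tM[of "Suc m"] m Suc.prems by (auto simp: t_def)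
        have eqs: "(\<lambda>j. xnode J t j - Y (Suc m) j) = e Y (Suc m)" "(\<lambda>j. xnode J (t - \<tau>) j - Y m j) = e Y m"
          "(\<lambda>j. xnode J (t - 2 * \<tau>) j - Y (m - 1) j) = e Y (m - 1)"
          by (simp_all only: e_def tt(1,2)) (simp_all add: t_def)
        have st: "nodal_step cl J (bdn J) U G \<tau> (Y (m - 1)) (Y m) (Y (Suc m))"
          using Suc.prems(3) m by (simp add: nodal_path_def)
        have clo: "Y (m - 1) 0 = Y (m - 1) J \<and> Y m 0 = Y m J \<and> Y (Suc m) 0 = Y (Suc m) J" if cl
          using Suc.prems(3) m that by (simp add: nodal_path_def)
        have sm: "small J \<tau> (vhat (e Y m) (e Y (m - 1)))" using IH m by (intro small) auto
        have "en Y (Suc m) \<le> en Y m + \<tau> * (10 ^ 9 * \<Lambda> ^ 5 * (h1_sq J (e Y (Suc m)) + h1_sq J (e Y m) + h1_sq J (e Y (m - 1)) + D\<^sup>2))"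
          using step_energy[OF J \<tau> tt(3,4) st clo, unfolded eqs, OF _ sm] 
          unfolding en_def D_def[symmetric] tt(1) t_def[symmetric] by simp
        also have "\<dots> = en Y m + K5 * \<tau> / 4 / 24 * (h1_sq J (e Y (Suc m)) + h1_sq J (e Y m) + h1_sq J (e Y (m - 1)) + D\<^sup>2)"
          by (simp add: K5_def)
        finally have main: "en Y (Suc m) \<le> en Y m + K5 * \<tau> / 4 / 24 * (h1_sq J (e Y (Suc m)) + h1_sq J (e Y m) + h1_sq J (e Y (m - 1)) + D\<^sup>2)" .
        have mM: "m \<le> M" "Suc m \<le> M" using m Suc.prems by auto
        have b: "(h1_sq J (e Y (Suc m)) + h1_sq J (e Y m)) / 24 \<le> en Y (Suc m)" using enb(1)[OF mM(2), of Y] by simp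
        have n: "0 \<le> h1_sq J (e Y (Suc m))" "0 \<le> h1_sq J (e Y m)" "0 \<le> h1_sq J (e Y (m - 1))" by (rule h1_sq_nonneg)+
        have "en Y (Suc m) \<le> (1 + 4 * (K5 * \<tau> / 4)) * en Y m + 4 * (K5 * \<tau> / 4) * D\<^sup>2"
        proof (rule implicit_gronwall_step[OF _ _ _ main])
          show "h1_sq J (e Y (Suc m)) + h1_sq J (e Y m) + h1_sq J (e Y (m - 1)) \<le> 24 * en Y (Suc m) + 24 * en Y m"
            using b enb(1)[OF mM(1), of Y] n unfolding add_divide_distrib by linarith
          show "0 \<le> en Y m" using enb(1)[OF mM(1), of Y] n unfolding add_divide_distrib by linarith
        qed (use K5 \<tau> \<tau>K in auto)
        then show ?thesis by simp
      qed
      have e0: "h1_sq J (e Y 0) = 0"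
      proof -
        have "h1_sq J (e Y 0) = h1_sq J (\<lambda>_. 0 :: 'a)" using Suc.prems(3) by (intro h1_sq_cong) (simp add: e_def nodal_path_def)
        then show ?thesis by (simp add: h1_sq_def stiff_def lump_def)
      qed
      have e1: "h1_sq J (e Y 1) \<le> c1 * D\<^sup>2"
      proof -
        have "h1_sq J (e Y 1) = h1_sq J (\<lambda>j. xnode J \<tau> j - Y1 j)" using Suc.prems(3) by (intro h1_sq_cong) (simp add: e_def nodal_path_def)
        then show ?thesis using Y1 by (simp add: D_def \<tau>_def)
      qed
      have en1: "en Y 1 \<le> (16000 * \<Lambda>\<^sup>2 * c1 + 4 * \<Lambda>\<^sup>2) * D\<^sup>2"
      proof -
        have "en Y 1 \<le> 16000 * \<Lambda>\<^sup>2 * h1_sq J (e Y 1) + 4 * \<Lambda>\<^sup>2 * D\<^sup>2" using enb(2)[OF M, of Y] e0 by simp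
        also have "\<dots> \<le> 16000 * \<Lambda>\<^sup>2 * (c1 * D\<^sup>2) + 4 * \<Lambda>\<^sup>2 * D\<^sup>2" using e1 by (intro add_right_mono mult_left_mono) auto
        finally show ?thesis by (simp add: algebra_simps)
      qed
      have "0 \<le> en Y 1" using enb(1)[OF M, of Y] h1_sq_nonneg[of J "e Y 1"] e0 by simp
      then have "en Y (Suc n) \<le> exp (K5 * \<tau> * real (Suc n)) * (en Y 1 + D\<^sup>2)"
        by (intro discrete_gronwall step) (use K5 \<tau> in auto)
      also have "\<dots> \<le> exp (K5 * T) * ((16000 * \<Lambda>\<^sup>2 * c1 + 4 * \<Lambda>\<^sup>2 + 1) * D\<^sup>2)"
      proof (rule mult_mono)
        show "exp (K5 * \<tau> * real (Suc n)) \<le> exp (K5 * T)"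
          using tM[OF Suc.prems(2)] K5 mult_left_mono[of "real (Suc n) * \<tau>" T K5] by (simp add: mult_ac)
        show "en Y 1 + D\<^sup>2 \<le> (16000 * \<Lambda>\<^sup>2 * c1 + 4 * \<Lambda>\<^sup>2 + 1) * D\<^sup>2" using en1 by (simp add: algebra_simps)
      qed (use \<open>0 \<le> en Y 1\<close> in auto)
      finally have "24 * en Y (Suc n) \<le> K * D\<^sup>2" by (simp add: K_def)
      then have "h1_sq J (e Y (Suc n)) + h1_sq J (e Y n) \<le> K * D\<^sup>2"
        using enb(1)[OF Suc.prems(2), of Y] by simp
      then show ?case using IH by (auto simp: atLeastAtMostSuc_conv)
    qed simp
    fix n Y assume n: "n \<le> M" and path: "nodal_path cl J (bdn J) U G (T / real M) (xnode J 0) Y1 n Y"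
    note path' = path[folded \<tau>_def]
    {
      fix m assume m: "m \<le> n"
      have "h1_sq J (e Y m) \<le> K * D\<^sup>2"
      proof (cases "m = 0")
        case True
        have "h1_sq J (e Y 0) = h1_sq J (\<lambda>_. 0 :: 'a)" using path by (intro h1_sq_cong) (simp add: e_def nodal_path_def)
        then show ?thesis using True K1 by (simp add: h1_sq_def stiff_def lump_def)
      next
        case False
        then have "m \<in> {1..n}" "1 \<le> n" using m by auto
        then have "h1_sq J (e Y m) + h1_sq J (e Y (m - 1)) \<le> K * D\<^sup>2" using bound[OF _ n path'] by blast
        then show ?thesis using h1_sq_nonneg[of J "e Y (m - 1)"] by linarith
      qed
      then show "h1_sq J (\<lambda>j. xnode J (real m * (T / real M)) j - Y m j) \<le> K * ((1 / real J)\<^sup>2 + (T / real M)\<^sup>2)\<^sup>2"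
        by (simp add: e_def D_def \<tau>_def)
    }
    assume nM: "1 \<le> n \<and> n < M"
    define t where "t = real (Suc n) * \<tau>"
    have tt: "t - \<tau> = real n * \<tau>" "t - 2 * \<tau> = real (n - 1) * \<tau>" "2 * \<tau> \<le> t" "t \<le> T"
      using times[of n] tM[of "Suc n"] nM by (auto simp: t_def)
    have "small J \<tau> (vhat (e Y n) (e Y (n - 1)))" using bound[OF _ n path'] nM by (intro small) auto
    then have sm: "small J \<tau> (vhat (\<lambda>j. xnode J (t - \<tau>) j - Y n j) (\<lambda>j. xnode J (t - 2 * \<tau>) j - Y (n - 1) j))"
      unfolding e_def tt(1,2) .
    have clo: "cl \<Longrightarrow> Y (n - 1) 0 = Y (n - 1) J \<and> Y n 0 = Y n J" using path by (simp add: nodal_path_def)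
    show "\<exists>Y2. nodal_step cl J (bdn J) U G (T / real M) (Y (n - 1)) (Y n) Y2 \<and> (cl \<longrightarrow> Y2 0 = Y2 J) \<and>
           (\<forall>Y2'. nodal_step cl J (bdn J) U G (T / real M) (Y (n - 1)) (Y n) Y2' \<longrightarrow> (\<forall>k\<le>J. Y2' k = Y2 k))"
      unfolding \<tau>_def[symmetric] by (rule step_exists[OF J \<tau> tt(3,4) clo sm]) blast+
  qed
qed

end

section \<open>Smooth flows and their partial derivatives\<close>

lemma smooth_on_imp_continuous: "smooth_on S f \<Longrightarrow> continuous_on S f"
  using Ck_on.simps(1) unfolding smooth_on_def by blast

lemma smooth_on_imp_differentiable: "smooth_on S f \<Longrightarrow> f differentiable_on S"
  using Ck_on.simps(2)[of 0 S f] unfolding smooth_on_def by blast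

lemma smooth_on_partial:
  "smooth_on S f \<Longrightarrow> b \<in> Basis \<Longrightarrow> smooth_on S (\<lambda>z. frechet_derivative f (at z within S) b)"
  using Ck_on.simps(2)[of _ S f] unfolding smooth_on_def by blast

definition d_rho :: "(real \<times> real) set \<Rightarrow> (real \<times> real \<Rightarrow> 'a::real_normed_vector) \<Rightarrow> real \<times> real \<Rightarrow> 'a" where
  "d_rho S f z = frechet_derivative f (at z within S) (1, 0)"

definition d_t :: "(real \<times> real) set \<Rightarrow> (real \<times> real \<Rightarrow> 'a::real_normed_vector) \<Rightarrow> real \<times> real \<Rightarrow> 'a" where
  "d_t S f z = frechet_derivative f (at z within S) (0, 1)"

lemma smooth_on_d_rho: "smooth_on S f \<Longrightarrow> smooth_on S (d_rho S f)"
  unfolding d_rho_def[abs_def] by (rule smooth_on_partial) (auto simp: Basis_prod_def)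

lemma smooth_on_d_t: "smooth_on S f \<Longrightarrow> smooth_on S (d_t S f)"
  unfolding d_t_def[abs_def] by (rule smooth_on_partial) (auto simp: Basis_prod_def)

text \<open>
  Derivatives within the closed cylinder restrict to one-sided or full derivatives along its slices,
  which is what \<open>D_rho\<close> and \<open>D_t\<close> refer to.
\<close>

lemma smooth_on_slices:
  fixes f :: "real \<times> real \<Rightarrow> 'a::real_normed_vector"
  assumes f: "smooth_on (A \<times> I) f" and "\<rho> \<in> A" "t \<in> I"
  shows "((\<lambda>r. f (r, t)) has_vector_derivative d_rho (A \<times> I) f (\<rho>, t)) (at \<rho> within A)"
    and "((\<lambda>s. f (\<rho>, s)) has_vector_derivative d_t (A \<times> I) f (\<rho>, t)) (at t within I)"
proof -
  let ?f' = "frechet_derivative f (at (\<rho>, t) within A \<times> I)"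
  have d: "(f has_derivative ?f') (at (\<rho>, t) within A \<times> I)"
    using smooth_on_imp_differentiable[OF f] assms(2,3) by (auto simp: differentiable_on_def frechet_derivative_works)
  then have lin: "linear ?f'" by (rule has_derivative_linear)
  have 1: "(f has_derivative ?f') (at (\<rho>, t) within (\<lambda>r. (r, t)) ` A)"
    by (rule has_derivative_subset[OF d]) (use assms in auto)
  have "((\<lambda>r. f (r, t)) has_derivative (\<lambda>h. ?f' (h, 0))) (at \<rho> within A)"
    by (rule has_derivative_in_compose[OF _ 1]) (auto intro!: derivative_eq_intros)
  moreover have "?f' (h, 0) = h *\<^sub>R d_rho (A \<times> I) f (\<rho>, t)" for h
    using linear_scale[OF lin, of h "(1, 0)"] by (simp add: d_rho_def)
  ultimately show "((\<lambda>r. f (r, t)) has_vector_derivative d_rho (A \<times> I) f (\<rho>, t)) (at \<rho> within A)"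
    by (simp add: has_vector_derivative_def)
  have 2: "(f has_derivative ?f') (at (\<rho>, t) within (\<lambda>s. (\<rho>, s)) ` I)"
    by (rule has_derivative_subset[OF d]) (use assms in auto)
  have "((\<lambda>s. f (\<rho>, s)) has_derivative (\<lambda>h. ?f' (0, h))) (at t within I)"
    by (rule has_derivative_in_compose[OF _ 2]) (auto intro!: derivative_eq_intros)
  moreover have "?f' (0, h) = h *\<^sub>R d_t (A \<times> I) f (\<rho>, t)" for h
    using linear_scale[OF lin, of h "(0, 1)"] by (simp add: d_t_def)
  ultimately show "((\<lambda>s. f (\<rho>, s)) has_vector_derivative d_t (A \<times> I) f (\<rho>, t)) (at t within I)"
    by (simp add: has_vector_derivative_def)
qed

lemma at_within_dom_cl: "\<rho> \<in> dom_cl \<kappa> \<Longrightarrow> at \<rho> within dom_cl \<kappa> \<noteq> bot"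
  by (cases \<kappa>) (auto simp: trivial_limit_within intro!: islimpt_closure_open[where s="{0<..<1::real}"])

lemma at_within_time: "0 < T \<Longrightarrow> t \<in> {0..T} \<Longrightarrow> at t within {0..T::real} \<noteq> bot"
  by (auto simp: trivial_limit_within intro!: islimpt_closure_open[where s="{0<..<T}"])

lemma dom_cl_unit: "{0..1} \<subseteq> dom_cl \<kappa>" "dom_int \<kappa> \<subseteq> dom_cl \<kappa>" "{0<..<1} \<subseteq> dom_int \<kappa>"
  by (cases \<kappa>; auto)+

definition flow_deriv :: "curve_type \<Rightarrow> real \<Rightarrow> (real \<Rightarrow> real \<Rightarrow> 'a::real_normed_vector) \<Rightarrow> nat \<Rightarrow> nat \<Rightarrow> real \<Rightarrow> real \<Rightarrow> 'a" where
  "flow_deriv \<kappa> T x i k \<rho> t = ((d_t (dom_cl \<kappa> \<times> {0..T}) ^^ k) ((d_rho (dom_cl \<kappa> \<times> {0..T}) ^^ i) (\<lambda>(\<rho>, t). x \<rho> t))) (\<rho>, t)"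

context
  fixes \<kappa> :: curve_type and T :: real and x :: "real \<Rightarrow> real \<Rightarrow> 'a::euclidean_space"
  assumes T: "0 < T" and flow: "smooth_curve_flow \<kappa> T x"
begin

abbreviation "cyl \<equiv> dom_cl \<kappa> \<times> {0..T}"

lemma smooth_flow_deriv:
  "smooth_on cyl ((d_t cyl ^^ k) ((d_rho cyl ^^ i) (\<lambda>(\<rho>, t). x \<rho> t)))"
proof -
  have "smooth_on cyl ((d_rho cyl ^^ i) (\<lambda>(\<rho>, t). x \<rho> t))"
    by (induction i) (use flow in \<open>auto simp: smooth_curve_flow_def intro: smooth_on_d_rho\<close>)
  then show ?thesis by (induction k) (auto intro: smooth_on_d_t)
qed

lemma flow_deriv_0: "flow_deriv \<kappa> T x 0 0 = x"
  by (intro ext) (simp add: flow_deriv_def)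

lemma flow_deriv_rho:
  assumes "\<rho> \<in> dom_cl \<kappa>" "t \<in> {0..T}"
  shows "((\<lambda>r. flow_deriv \<kappa> T x i 0 r t) has_vector_derivative flow_deriv \<kappa> T x (Suc i) 0 \<rho> t) (at \<rho> within dom_cl \<kappa>)"
  using smooth_on_slices(1)[OF smooth_flow_deriv[of 0 i] assms] by (simp add: flow_deriv_def)

lemma flow_deriv_t:
  assumes "\<rho> \<in> dom_cl \<kappa>" "t \<in> {0..T}"
  shows "(flow_deriv \<kappa> T x i k \<rho> has_vector_derivative flow_deriv \<kappa> T x i (Suc k) \<rho> t) (at t within {0..T})"
  using smooth_on_slices(2)[OF smooth_flow_deriv[of k i] assms] by (simp add: flow_deriv_def[abs_def])

lemma flow_deriv_continuous:
  assumes "A \<subseteq> dom_cl \<kappa>" "J \<subseteq> {0..T}"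
  shows "continuous_on (A \<times> J) (\<lambda>(\<rho>, t). flow_deriv \<kappa> T x i k \<rho> t)"
proof -
  have "continuous_on cyl (\<lambda>(\<rho>, t). flow_deriv \<kappa> T x i k \<rho> t)"
    using smooth_on_imp_continuous[OF smooth_flow_deriv[of k i]] by (simp add: flow_deriv_def case_prod_unfold)
  then show ?thesis by (rule continuous_on_subset) (use assms in auto)
qed

lemma flow_deriv_continuous_rho:
  assumes "t \<in> {0..T}"
  shows "continuous_on {0..1} (\<lambda>\<rho>. flow_deriv \<kappa> T x i k \<rho> t)"
proof -
  have "continuous_on {0..1} ((\<lambda>(\<rho>, t). flow_deriv \<kappa> T x i k \<rho> t) \<circ> (\<lambda>\<rho>. (\<rho>, t)))"
    by (intro continuous_on_compose continuous_intros continuous_on_subset[OF flow_deriv_continuous[of "{0..1}" "{0..T}"]])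
       (use assms dom_cl_unit in auto)
  then show ?thesis by (simp add: o_def)
qed

lemma flow_deriv_bounded: "\<exists>B\<ge>1. \<forall>i\<le>4. \<forall>k\<le>4. \<forall>\<rho>\<in>{0..1}. \<forall>t\<in>{0..T}. norm (flow_deriv \<kappa> T x i k \<rho> t) \<le> B"
proof -
  have "\<exists>b. \<forall>\<rho>\<in>{0..1}. \<forall>t\<in>{0..T}. norm (flow_deriv \<kappa> T x i k \<rho> t) \<le> b" for i k
  proof -
    have "compact ((\<lambda>(\<rho>, t). flow_deriv \<kappa> T x i k \<rho> t) ` ({0..1} \<times> {0..T}))"
      by (intro compact_continuous_image flow_deriv_continuous compact_Times) (use dom_cl_unit in auto)
    then obtain b where "\<forall>y\<in>(\<lambda>(\<rho>, t). flow_deriv \<kappa> T x i k \<rho> t) ` ({0..1} \<times> {0..T}). norm y \<le> b"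
      using compact_imp_bounded bounded_iff by metis
    then show ?thesis by force
  qed
  then obtain b where b: "\<And>i k \<rho> t. \<rho> \<in> {0..1} \<Longrightarrow> t \<in> {0..T} \<Longrightarrow> norm (flow_deriv \<kappa> T x i k \<rho> t) \<le> b i k"
    by metis
  define B where "B = 1 + (\<Sum>i\<le>4. \<Sum>k\<le>4. \<bar>b i k\<bar>)"
  have "b i k \<le> B" if "i \<le> 4" "k \<le> (4::nat)" for i k :: nat
  proof -
    have "\<bar>b i k\<bar> \<le> (\<Sum>k\<le>4. \<bar>b i k\<bar>)" using that by (intro member_le_sum) auto
    also have "\<dots> \<le> (\<Sum>i\<le>4. \<Sum>k\<le>4. \<bar>b i k\<bar>)"
      using that by (intro member_le_sum[of i "{..4}" "\<lambda>i. \<Sum>k\<le>4. \<bar>b i k\<bar>"]) (auto intro: sum_nonneg)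
    finally show ?thesis by (simp add: B_def)
  qed
  moreover have "1 \<le> B" by (simp add: B_def sum_nonneg)
  ultimately show ?thesis using b by (intro exI[of _ B]) (meson order_trans)
qed

lemma D_rho_eq: "\<rho> \<in> dom_cl \<kappa> \<Longrightarrow> t \<in> {0..T} \<Longrightarrow> D_rho \<kappa> x \<rho> t = flow_deriv \<kappa> T x 1 0 \<rho> t"
  using vector_derivative_within[OF at_within_dom_cl flow_deriv_rho[of \<rho> t 0]] by (simp add: D_rho_def flow_deriv_0)

lemma D_rho2_eq:
  assumes "\<rho> \<in> dom_cl \<kappa>" "t \<in> {0..T}"
  shows "D_rho \<kappa> (D_rho \<kappa> x) \<rho> t = flow_deriv \<kappa> T x 2 0 \<rho> t"
proof -
  have "((\<lambda>r. D_rho \<kappa> x r t) has_vector_derivative flow_deriv \<kappa> T x 2 0 \<rho> t) (at \<rho> within dom_cl \<kappa>)"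
    by (rule has_vector_derivative_transform[OF assms(1) _ flow_deriv_rho[OF assms, of 1, unfolded Suc_1]])
       (use D_rho_eq assms in simp)
  then show ?thesis unfolding D_rho_def[of \<kappa> "D_rho \<kappa> x"]
    by (rule vector_derivative_within[OF at_within_dom_cl[OF assms(1)]])
qed

lemma D_t_eq: "\<rho> \<in> dom_cl \<kappa> \<Longrightarrow> t \<in> {0..T} \<Longrightarrow> D_t T x \<rho> t = flow_deriv \<kappa> T x 0 1 \<rho> t"
  using vector_derivative_within[OF at_within_time[OF T] flow_deriv_t[of \<rho> t 0 0]]
  by (simp add: D_t_def flow_deriv_0)

text \<open>
  The derivative at a point is determined by the function near this point, and a translation by the
  period maps the cylinder to itself.
\<close>

lemma flow_deriv_periodic:
  assumes \<kappa>: "\<kappa> = Closed_curve" and t: "t \<in> {0..T}"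
  shows "flow_deriv \<kappa> T x i k (\<rho> + 1) t = flow_deriv \<kappa> T x i k \<rho> t"
proof -
  have A: "flow_deriv \<kappa> T x i 0 (\<rho> + 1) t = flow_deriv \<kappa> T x i 0 \<rho> t" if t: "t \<in> {0..T}" for i \<rho> t
  proof (induction i arbitrary: \<rho>)
    case 0
    then show ?case using flow \<kappa> t unfolding flow_deriv_0 by (simp add: smooth_curve_flow_def)
  next
    case (Suc i)
    have "((\<lambda>r. flow_deriv \<kappa> T x i 0 r t) \<circ> (\<lambda>r. r + 1) has_vector_derivative (1 *\<^sub>R flow_deriv \<kappa> T x (Suc i) 0 (\<rho> + 1) t)) (at \<rho>)"
      by (rule vector_diff_chain_at)
         (use flow_deriv_rho[of "\<rho> + 1" t i] \<kappa> t in \<open>auto intro!: derivative_eq_intros\<close>)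
    then have "((\<lambda>r. flow_deriv \<kappa> T x i 0 r t) has_vector_derivative flow_deriv \<kappa> T x (Suc i) 0 (\<rho> + 1) t) (at \<rho>)"
      by (simp add: o_def Suc)
    moreover have "((\<lambda>r. flow_deriv \<kappa> T x i 0 r t) has_vector_derivative flow_deriv \<kappa> T x (Suc i) 0 \<rho> t) (at \<rho>)"
      using flow_deriv_rho[of \<rho> t i] \<kappa> t by simp
    ultimately show ?case by (rule vector_derivative_unique_at)
  qed
  show ?thesis using t
  proof (induction k arbitrary: t)
    case 0
    then show ?case by (rule A)
  next
    case (Suc k)
    have "(flow_deriv \<kappa> T x i k (\<rho> + 1) has_vector_derivative flow_deriv \<kappa> T x i (Suc k) (\<rho> + 1) t) (at t within {0..T})"
      using flow_deriv_t[of "\<rho> + 1" t i k] \<kappa> Suc.prems by simp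
    then have "(flow_deriv \<kappa> T x i k \<rho> has_vector_derivative flow_deriv \<kappa> T x i (Suc k) (\<rho> + 1) t) (at t within {0..T})"
      by (rule has_vector_derivative_transform[OF Suc.prems, rotated]) (use Suc.IH in auto)
    moreover have "(flow_deriv \<kappa> T x i k \<rho> has_vector_derivative flow_deriv \<kappa> T x i (Suc k) \<rho> t) (at t within {0..T})"
      using flow_deriv_t[of \<rho> t i k] \<kappa> Suc.prems by simp
    ultimately show ?case by (rule vector_derivative_unique_within[OF at_within_time[OF T Suc.prems]])
  qed
qed

text \<open>The equation and the bounds on the speed extend to the end points of the interval by continuity.\<close>

text \<open>
  The differential equation holds in the interior of the parameter interval by assumption and extends to
  the end points by continuity.
\<close>

lemma flow_equation:
  assumes sol: "solves_P \<kappa> \<Omega> T x0 x" and \<rho>: "\<rho> \<in> {0..1}" and t: "t \<in> {0<..T}"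
  shows "(norm (flow_deriv \<kappa> T x 1 0 \<rho> t))\<^sup>2 *\<^sub>R flow_deriv \<kappa> T x 0 1 \<rho> t = flow_deriv \<kappa> T x 2 0 \<rho> t"
proof -
  have tT: "t \<in> {0..T}" using t by auto
  let ?f = "\<lambda>\<rho>. (norm (flow_deriv \<kappa> T x 1 0 \<rho> t))\<^sup>2 *\<^sub>R flow_deriv \<kappa> T x 0 1 \<rho> t - flow_deriv \<kappa> T x 2 0 \<rho> t"
  have "?f \<rho> = 0"
  proof (rule continuous_constant_on_closure[where S="{0<..<1::real}" and f="?f" and a=0 and x=\<rho>])
    show "continuous_on (closure {0<..<1}) ?f"
      by (simp, intro continuous_intros flow_deriv_continuous_rho tT)
    show "?f r = 0" if "r \<in> {0<..<1}" for r
    proof -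
      have r: "r \<in> dom_int \<kappa>" "r \<in> dom_cl \<kappa>" using that dom_cl_unit(2,3)[of \<kappa>] by auto
      then have "(norm (D_rho \<kappa> x r t))\<^sup>2 *\<^sub>R D_t T x r t - D_rho \<kappa> (D_rho \<kappa> x) r t = 0"
        using sol t unfolding solves_P_def by blast
      then show ?thesis using r tT by (simp add: D_rho_eq D_rho2_eq D_t_eq)
    qed
  qed (use \<rho> in simp)
  then show ?thesis by simp
qed

lemma flow_speed:
  assumes sp: "\<forall>\<rho>\<in>dom_int \<kappa>. \<forall>t\<in>{0..T}. c0 \<le> norm (D_rho \<kappa> x \<rho> t)" and \<rho>: "\<rho> \<in> {0..1}" and t: "t \<in> {0..T}"
  shows "c0 \<le> norm (flow_deriv \<kappa> T x 1 0 \<rho> t)"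
proof (rule continuous_ge_on_closure[where S="{0<..<1::real}" and f="\<lambda>\<rho>. norm (flow_deriv \<kappa> T x 1 0 \<rho> t)" and a=c0 and x=\<rho>])
  show "continuous_on (closure {0<..<1}) (\<lambda>\<rho>. norm (flow_deriv \<kappa> T x 1 0 \<rho> t))"
    by (simp, intro continuous_intros flow_deriv_continuous_rho t)
  show "c0 \<le> norm (flow_deriv \<kappa> T x 1 0 r t)" if "r \<in> {0<..<1}" for r
  proof -
    have r: "r \<in> dom_int \<kappa>" "r \<in> dom_cl \<kappa>" using that dom_cl_unit(2,3)[of \<kappa>] by auto
    show ?thesis unfolding D_rho_eq[OF r(2) t, symmetric] using sp r t by blast
  qed
qed (use \<rho> in simp)

end

section \<open>The boundary hypersurface\<close>

lemma has_derivative_partials: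
  fixes f :: "'a::euclidean_space \<Rightarrow> real"
  assumes "f differentiable_on U" "open U" "z \<in> U"
  shows "(f has_derivative (\<lambda>h. \<Sum>b\<in>Basis. (h \<bullet> b) * frechet_derivative f (at z within U) b)) (at z)"
proof -
  let ?f' = "frechet_derivative f (at z within U)"
  have d: "(f has_derivative ?f') (at z within U)"
    using assms by (auto simp: differentiable_on_def frechet_derivative_works)
  then have lin: "linear ?f'" by (rule has_derivative_linear)
  have "?f' h = (\<Sum>b\<in>Basis. (h \<bullet> b) * ?f' b)" for h
  proof -
    have "?f' h = ?f' (\<Sum>b\<in>Basis. (h \<bullet> b) *\<^sub>R b)" by (simp only: euclidean_representation)
    also have "\<dots> = (\<Sum>b\<in>Basis. (h \<bullet> b) * ?f' b)"
      unfolding linear_sum[OF lin] linear_scale[OF lin] by simp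
    finally show ?thesis .
  qed
  then have "?f' = (\<lambda>h. \<Sum>b\<in>Basis. (h \<bullet> b) * ?f' b)" by (rule ext)
  then show ?thesis using d at_within_open[OF assms(3,2)] by metis
qed

text \<open>
  The mean value theorem, applied first in the direction \<open>a\<close> and then in the direction \<open>b\<close>, expresses the
  second difference as a mixed derivative at an intermediate point.
\<close>

lemma mixed_difference:
  fixes F :: "'a::euclidean_space \<Rightarrow> real"
  assumes F: "\<And>y. y \<in> ball z r \<Longrightarrow> (F has_derivative F' y) (at y)"
    and Fa: "\<And>y. y \<in> ball z r \<Longrightarrow> ((\<lambda>y. F' y a) has_derivative Fa' y) (at y)"
    and n: "norm a = 1" "norm b = 1" and s: "0 < s" "2 * s < r"
  shows "\<exists>w. dist w z \<le> 2 * s \<and> F (z + s *\<^sub>R a + s *\<^sub>R b) - F (z + s *\<^sub>R a) - F (z + s *\<^sub>R b) + F z = s * (s * Fa' w b)"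
proof -
  have inb: "z + p *\<^sub>R a + q *\<^sub>R b \<in> ball z r" "dist (z + p *\<^sub>R a + q *\<^sub>R b) z \<le> 2 * s" if "0 \<le> p" "p \<le> s" "0 \<le> q" "q \<le> s" for p q
  proof -
    have "norm (p *\<^sub>R a + q *\<^sub>R b) \<le> p + q" using norm_triangle_ineq[of "p *\<^sub>R a" "q *\<^sub>R b"] that n by simp
    moreover have "dist (z + p *\<^sub>R a + q *\<^sub>R b) z = norm (p *\<^sub>R a + q *\<^sub>R b)" by (simp add: dist_norm add.assoc)
    ultimately show "dist (z + p *\<^sub>R a + q *\<^sub>R b) z \<le> 2 * s" using that by simp
    then show "z + p *\<^sub>R a + q *\<^sub>R b \<in> ball z r" using s by (simp add: dist_commute)
  qed
  define \<phi> where "\<phi> p = F (z + p *\<^sub>R a + s *\<^sub>R b) - F (z + p *\<^sub>R a + 0 *\<^sub>R b)" for p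
  have line: "((\<lambda>p. F (z + p *\<^sub>R a + q *\<^sub>R b)) has_real_derivative F' (z + p *\<^sub>R a + q *\<^sub>R b) a) (at p)"
    if "0 \<le> p" "p \<le> s" "0 \<le> q" "q \<le> s" for p q
  proof -
    have d: "(F has_derivative F' (z + p *\<^sub>R a + q *\<^sub>R b)) (at (z + p *\<^sub>R a + q *\<^sub>R b))" by (rule F[OF inb(1)[OF that]])
    have "((\<lambda>p. F (z + p *\<^sub>R a + q *\<^sub>R b)) has_derivative (\<lambda>h. F' (z + p *\<^sub>R a + q *\<^sub>R b) (h *\<^sub>R a))) (at p)"
      by (rule has_derivative_compose[where g=F and f="\<lambda>p. z + p *\<^sub>R a + q *\<^sub>R b", OF _ d]) (auto intro!: derivative_eq_intros)
    then show ?thesis unfolding has_field_derivative_def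
      by (rule has_derivative_eq_rhs) (simp add: fun_eq_iff linear_scale[OF has_derivative_linear[OF d]])
  qed
  have "\<exists>\<xi>. 0 < \<xi> \<and> \<xi> < s \<and> \<phi> s - \<phi> 0 = (s - 0) * (F' (z + \<xi> *\<^sub>R a + s *\<^sub>R b) a - F' (z + \<xi> *\<^sub>R a + 0 *\<^sub>R b) a)"
    unfolding \<phi>_def by (rule MVT2[OF s(1)]) (intro DERIV_diff line; use s in simp)
  then obtain \<xi> where \<xi>: "0 < \<xi>" "\<xi> < s" "\<phi> s - \<phi> 0 = s * (F' (z + \<xi> *\<^sub>R a + s *\<^sub>R b) a - F' (z + \<xi> *\<^sub>R a + 0 *\<^sub>R b) a)"
    by auto
  have line2: "((\<lambda>q. F' (z + \<xi> *\<^sub>R a + q *\<^sub>R b) a) has_real_derivative Fa' (z + \<xi> *\<^sub>R a + q *\<^sub>R b) b) (at q)" if "0 \<le> q" "q \<le> s" for q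
  proof -
    have d: "((\<lambda>y. F' y a) has_derivative Fa' (z + \<xi> *\<^sub>R a + q *\<^sub>R b)) (at (z + \<xi> *\<^sub>R a + q *\<^sub>R b))"
      by (rule Fa[OF inb(1)]) (use \<xi> that in auto)
    have "((\<lambda>q. F' (z + \<xi> *\<^sub>R a + q *\<^sub>R b) a) has_derivative (\<lambda>h. Fa' (z + \<xi> *\<^sub>R a + q *\<^sub>R b) (h *\<^sub>R b))) (at q)"
      by (rule has_derivative_compose[where g="\<lambda>y. F' y a" and f="\<lambda>q. z + \<xi> *\<^sub>R a + q *\<^sub>R b", OF _ d]) (auto intro!: derivative_eq_intros)
    then show ?thesis unfolding has_field_derivative_def
      by (rule has_derivative_eq_rhs) (simp add: fun_eq_iff linear_scale[OF has_derivative_linear[OF d]])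
  qed
  have "\<exists>\<zeta>. 0 < \<zeta> \<and> \<zeta> < s \<and> F' (z + \<xi> *\<^sub>R a + s *\<^sub>R b) a - F' (z + \<xi> *\<^sub>R a + 0 *\<^sub>R b) a = (s - 0) * Fa' (z + \<xi> *\<^sub>R a + \<zeta> *\<^sub>R b) b"
    by (rule MVT2) (use s line2 in auto)
  then obtain \<zeta> where \<zeta>: "0 < \<zeta>" "\<zeta> < s" "F' (z + \<xi> *\<^sub>R a + s *\<^sub>R b) a - F' (z + \<xi> *\<^sub>R a + 0 *\<^sub>R b) a = s * Fa' (z + \<xi> *\<^sub>R a + \<zeta> *\<^sub>R b) b"
    by auto
  have "\<phi> s - \<phi> 0 = s * (s * Fa' (z + \<xi> *\<^sub>R a + \<zeta> *\<^sub>R b) b)" using \<xi>(3) \<zeta>(3) by simp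
  moreover have "\<phi> s - \<phi> 0 = F (z + s *\<^sub>R a + s *\<^sub>R b) - F (z + s *\<^sub>R a) - F (z + s *\<^sub>R b) + F z"
    by (simp add: \<phi>_def)
  ultimately show ?thesis using inb(2)[of \<xi> \<zeta>] \<xi> \<zeta> by (intro exI[of _ "z + \<xi> *\<^sub>R a + \<zeta> *\<^sub>R b"]) auto
qed

text \<open>
  Schwarz's theorem: the second difference is symmetric in the two directions.
\<close>

lemma mixed_partials_commute:
  fixes F :: "'a::euclidean_space \<Rightarrow> real"
  assumes U: "open U" "z \<in> U"
    and F: "\<And>y. y \<in> U \<Longrightarrow> (F has_derivative F' y) (at y)"
    and F2: "\<And>y b. y \<in> U \<Longrightarrow> b \<in> Basis \<Longrightarrow> ((\<lambda>y. F' y b) has_derivative F'' y b) (at y)"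
    and cont: "\<And>a b. a \<in> Basis \<Longrightarrow> b \<in> Basis \<Longrightarrow> continuous_on U (\<lambda>y. F'' y a b)"
    and ab: "a \<in> Basis" "b \<in> Basis"
  shows "F'' z a b = F'' z b a"
proof (rule ccontr)
  assume ne: "F'' z a b \<noteq> F'' z b a"
  define \<epsilon> where "\<epsilon> = \<bar>F'' z a b - F'' z b a\<bar> / 2"
  have \<epsilon>: "0 < \<epsilon>" using ne by (simp add: \<epsilon>_def)
  have "\<forall>y\<in>U. \<forall>e>0. \<exists>d>0. \<forall>w\<in>U. dist w y < d \<longrightarrow> dist (F'' w a b) (F'' y a b) < e"
    using cont[OF ab] unfolding continuous_on_iff by blast
  then obtain d1 where d1: "0 < d1" "\<And>w. w \<in> U \<Longrightarrow> dist w z < d1 \<Longrightarrow> dist (F'' w a b) (F'' z a b) < \<epsilon>"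
    using U(2) \<epsilon> by blast
  have "\<forall>y\<in>U. \<forall>e>0. \<exists>d>0. \<forall>w\<in>U. dist w y < d \<longrightarrow> dist (F'' w b a) (F'' y b a) < e"
    using cont[OF ab(2,1)] unfolding continuous_on_iff by blast
  then obtain d2 where d2: "0 < d2" "\<And>w. w \<in> U \<Longrightarrow> dist w z < d2 \<Longrightarrow> dist (F'' w b a) (F'' z b a) < \<epsilon>"
    using U(2) \<epsilon> by blast
  obtain r where r: "0 < r" "ball z r \<subseteq> U" using U open_contains_ball by blast
  define s where "s = min r (min d1 d2) / 4"
  have s: "0 < s" "2 * s < r" "2 * s < d1" "2 * s < d2" using r d1 d2 by (auto simp: s_def)
  have n: "norm a = 1" "norm b = 1" using ab by auto
  obtain w1 where w1: "dist w1 z \<le> 2 * s" "F (z + s *\<^sub>R a + s *\<^sub>R b) - F (z + s *\<^sub>R a) - F (z + s *\<^sub>R b) + F z = s * (s * F'' w1 a b)"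
  proof -
    have "\<exists>w. dist w z \<le> 2 * s \<and> F (z + s *\<^sub>R a + s *\<^sub>R b) - F (z + s *\<^sub>R a) - F (z + s *\<^sub>R b) + F z = s * (s * F'' w a b)"
      by (rule mixed_difference[where r=r and F'=F' and Fa'="\<lambda>y. F'' y a"]) (use F F2 r(2) ab n s in auto)
    then show thesis using that by blast
  qed
  obtain w2 where w2: "dist w2 z \<le> 2 * s" "F (z + s *\<^sub>R b + s *\<^sub>R a) - F (z + s *\<^sub>R b) - F (z + s *\<^sub>R a) + F z = s * (s * F'' w2 b a)"
  proof -
    have "\<exists>w. dist w z \<le> 2 * s \<and> F (z + s *\<^sub>R b + s *\<^sub>R a) - F (z + s *\<^sub>R b) - F (z + s *\<^sub>R a) + F z = s * (s * F'' w b a)"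
      by (rule mixed_difference[where r=r and F'=F' and Fa'="\<lambda>y. F'' y b"]) (use F F2 r(2) ab n s in auto)
    then show thesis using that by blast
  qed
  have "s * (s * F'' w1 a b) = s * (s * F'' w2 b a)"
    unfolding w1(2)[symmetric] w2(2)[symmetric] by (simp add: add_ac)
  then have eq: "F'' w1 a b = F'' w2 b a" using s by simp
  have "w1 \<in> U" "w2 \<in> U" using w1(1) w2(1) s r(2) by (auto simp: dist_commute subset_iff)
  then have "dist (F'' w1 a b) (F'' z a b) < \<epsilon>" "dist (F'' w2 b a) (F'' z b a) < \<epsilon>"
    using d1(2) d2(2) w1(1) w2(1) s by auto
  then show False unfolding eq \<epsilon>_def dist_real_def by (auto simp: abs_if split: if_splits)
qed

lemma sum_inner_Basis:
  assumes "b \<in> Basis"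
  shows "(\<Sum>a\<in>Basis. (b \<bullet> a) * f a) = (f b :: real)"
proof -
  have "(\<Sum>a\<in>Basis. (b \<bullet> a) * f a) = (\<Sum>a\<in>Basis. if a = b then f b else 0)"
    using assms by (intro sum.cong refl) (auto simp: inner_Basis)
  then show ?thesis using assms by (simp add: sum.delta)
qed

definition partial :: "'a::euclidean_space set \<Rightarrow> 'a \<Rightarrow> ('a \<Rightarrow> real) \<Rightarrow> 'a \<Rightarrow> real" where
  "partial U b f z = frechet_derivative f (at z within U) b"

definition hess :: "'a::euclidean_space set \<Rightarrow> ('a \<Rightarrow> real) \<Rightarrow> 'a \<Rightarrow> 'a \<Rightarrow> 'a" where
  "hess U F z u = (\<Sum>b\<in>Basis. (\<Sum>a\<in>Basis. (u \<bullet> a) * partial U a (partial U b F) z) *\<^sub>R b)"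

context
  fixes U :: "'a::euclidean_space set" and F :: "'a \<Rightarrow> real"
  assumes U: "open U" and C3: "Ck_on 3 U F"
begin

lemma C3_regularity:
  shows "F differentiable_on U"
    and "b \<in> Basis \<Longrightarrow> partial U b F differentiable_on U"
    and "a \<in> Basis \<Longrightarrow> b \<in> Basis \<Longrightarrow> partial U a (partial U b F) differentiable_on U"
    and "a \<in> Basis \<Longrightarrow> b \<in> Basis \<Longrightarrow> c \<in> Basis \<Longrightarrow> continuous_on U (partial U c (partial U a (partial U b F)))"
  using C3 by (simp_all add: numeral_3_eq_3 partial_def[abs_def])

lemma has_derivative_F: "z \<in> U \<Longrightarrow> (F has_derivative (\<lambda>h. \<Sum>b\<in>Basis. (h \<bullet> b) * partial U b F z)) (at z)"
  unfolding partial_def by (rule has_derivative_partials[OF C3_regularity(1) U])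

lemma has_derivative_partial:
  "z \<in> U \<Longrightarrow> b \<in> Basis \<Longrightarrow> (partial U b F has_derivative (\<lambda>h. \<Sum>a\<in>Basis. (h \<bullet> a) * partial U a (partial U b F) z)) (at z)"
  unfolding partial_def[of U _ "partial U b F"] by (rule has_derivative_partials[OF C3_regularity(2) U])

lemma has_derivative_partial2:
  "z \<in> U \<Longrightarrow> a \<in> Basis \<Longrightarrow> b \<in> Basis \<Longrightarrow>
    (partial U a (partial U b F) has_derivative (\<lambda>h. \<Sum>c\<in>Basis. (h \<bullet> c) * partial U c (partial U a (partial U b F)) z)) (at z)"
  unfolding partial_def[of U _ "partial U a (partial U b F)"] by (rule has_derivative_partials[OF C3_regularity(3) U])

lemma grad_eq:
  assumes z: "z \<in> U"
  shows "grad F z = (\<Sum>b\<in>Basis. partial U b F z *\<^sub>R b)"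
    and "(F has_derivative (\<lambda>h. h \<bullet> grad F z)) (at z)"
proof -
  let ?g = "\<Sum>b\<in>Basis. partial U b F z *\<^sub>R b"
  have d: "(F has_derivative (\<lambda>h. h \<bullet> ?g)) (at z)"
    by (rule has_derivative_eq_rhs[OF has_derivative_F[OF z]]) (simp add: inner_sum_right mult.commute)
  have g: "GDERIV F z :> ?g" using d by (simp add: gderiv_def)
  have "grad F z = ?g" unfolding grad_def
  proof (rule the_equality[where P="\<lambda>D. GDERIV F z :> D", OF g])
    fix D assume "GDERIV F z :> D"
    then have "(\<lambda>h. h \<bullet> D) = (\<lambda>h. h \<bullet> ?g)"
      using d has_derivative_unique unfolding gderiv_def by blast
    then have "h \<bullet> D = h \<bullet> ?g" for h by (rule fun_cong)
    then show "D = ?g" using vector_eq_ldot[of D ?g] by blast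
  qed
  then show "grad F z = ?g" "(F has_derivative (\<lambda>h. h \<bullet> grad F z)) (at z)" using d by simp_all
qed

lemma hess_symmetric:
  assumes z: "z \<in> U"
  shows "hess U F z u \<bullet> v = u \<bullet> hess U F z v"
proof -
  have sym: "partial U a (partial U b F) z = partial U b (partial U a F) z" if "a \<in> Basis" "b \<in> Basis" for a b
  proof -
    have "(\<lambda>y b h. \<Sum>a\<in>Basis. (h \<bullet> a) * partial U a (partial U b F) y) z b a = (\<lambda>y b h. \<Sum>a\<in>Basis. (h \<bullet> a) * partial U a (partial U b F) y) z a b"
    proof (rule mixed_partials_commute[OF U z has_derivative_F _ _ that(2,1)])
      have e: "(\<Sum>b'\<in>Basis. (b \<bullet> b') * partial U b' F y) = partial U b F y" if "b \<in> Basis" for b y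
        by (rule sum_inner_Basis[OF that])
      show "((\<lambda>y. \<Sum>b'\<in>Basis. (b \<bullet> b') * partial U b' F y) has_derivative (\<lambda>h. \<Sum>a\<in>Basis. (h \<bullet> a) * partial U a (partial U b F) y)) (at y)"
        if "y \<in> U" "b \<in> Basis" for y b
        using has_derivative_partial[OF that] e[OF that(2)] by simp
      show "continuous_on U (\<lambda>y. \<Sum>a'\<in>Basis. (b \<bullet> a') * partial U a' (partial U a F) y)" if "a \<in> Basis" "b \<in> Basis" for a b
        using C3_regularity(3)[OF _ that(1)] by (intro continuous_intros differentiable_imp_continuous_on)
    qed
    then show ?thesis unfolding sum_inner_Basis[OF that(1)] sum_inner_Basis[OF that(2)] .
  qed
  have "hess U F z u \<bullet> v = (\<Sum>b\<in>Basis. \<Sum>a\<in>Basis. (u \<bullet> a) * (v \<bullet> b) * partial U a (partial U b F) z)"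
    unfolding hess_def inner_sum_left inner_scaleR_left sum_distrib_right
    by (intro sum.cong refl) (simp add: inner_commute mult_ac)
  also have "\<dots> = (\<Sum>a\<in>Basis. \<Sum>b\<in>Basis. (u \<bullet> a) * (v \<bullet> b) * partial U b (partial U a F) z)"
    by (subst sum.swap) (simp add: sym)
  also have "\<dots> = u \<bullet> hess U F z v"
    unfolding hess_def inner_sum_right inner_scaleR_right sum_distrib_right
    by (intro sum.cong refl) (simp add: mult_ac)
  finally show ?thesis .
qed

lemma linear_hess: "linear (hess U F z)"
  by (rule linearI) (simp_all add: hess_def inner_simps sum.distrib distrib_right scaleR_add_left scaleR_sum_right sum_distrib_left mult.assoc)

lemma has_derivative_grad:
  assumes z: "z \<in> U"
  shows "(grad F has_derivative hess U F z) (at z)"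
proof -
  have "((\<lambda>z. \<Sum>b\<in>Basis. partial U b F z *\<^sub>R b) has_derivative hess U F z) (at z)"
    unfolding hess_def by (intro has_derivative_sum has_derivative_scaleR_left has_derivative_partial z)
  then show ?thesis
    by (rule has_derivative_transform_within_open[OF _ U z]) (simp add: grad_eq(1))
qed

lemma continuous_on_grad: "continuous_on U (grad F)"
  by (rule has_derivative_continuous_on) (use has_derivative_grad has_derivative_at_withinI in blast)


lemma sum_basis_bound:
  fixes h :: 'a
  assumes "\<And>c. c \<in> Basis \<Longrightarrow> \<bar>m c\<bar> \<le> M"
  shows "\<bar>\<Sum>c\<in>Basis. (h \<bullet> c) * m c\<bar> \<le> real DIM('a) * M * norm h"
proof -
  have "\<bar>\<Sum>c\<in>Basis. (h \<bullet> c) * m c\<bar> \<le> (\<Sum>c\<in>(Basis :: 'a set). norm h * M)"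
  proof (rule order_trans[OF sum_abs], rule sum_mono)
    fix c :: 'a assume "c \<in> Basis"
    then show "\<bar>(h \<bullet> c) * m c\<bar> \<le> norm h * M"
      unfolding abs_mult using assms Basis_le_norm by (intro mult_mono) auto
  qed
  then show ?thesis by (simp add: mult_ac)
qed

lemma hess_combination_bound:
  fixes m :: "'a \<Rightarrow> 'a \<Rightarrow> real" and u :: 'a
  assumes "\<And>a b. a \<in> Basis \<Longrightarrow> b \<in> Basis \<Longrightarrow> \<bar>m a b\<bar> \<le> M" "0 \<le> M"
  shows "norm (\<Sum>b\<in>Basis. (\<Sum>a\<in>Basis. (u \<bullet> a) * m a b) *\<^sub>R (b :: 'a)) \<le> (real DIM('a))\<^sup>2 * M * norm u"
proof -
  have "norm (\<Sum>b\<in>Basis. (\<Sum>a\<in>Basis. (u \<bullet> a) * m a b) *\<^sub>R (b :: 'a)) \<le> (\<Sum>b\<in>(Basis :: 'a set). real DIM('a) * M * norm u)"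
  proof (rule sum_norm_le)
    fix b :: 'a assume b: "b \<in> Basis"
    show "norm ((\<Sum>a\<in>Basis. (u \<bullet> a) * m a b) *\<^sub>R b) \<le> real DIM('a) * M * norm u"
      using sum_basis_bound[of "\<lambda>a. m a b" M u] assms(1)[OF _ b] b by simp
  qed
  then show ?thesis by (simp add: power2_eq_square)
qed

lemma hess_diff: "hess U F y u - hess U F z u =
   (\<Sum>b\<in>Basis. (\<Sum>a\<in>Basis. (u \<bullet> a) * (partial U a (partial U b F) y - partial U a (partial U b F) z)) *\<^sub>R b)"
  unfolding hess_def right_diff_distrib sum_subtractf scaleR_diff_left ..

text \<open>
  On a compact subset of \<open>U\<close> the derivatives of \<open>F\<close> up to order three are bounded in a neighbourhood,
  and the mean value inequality gives all estimates.
\<close>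

lemma grad_estimates:
  assumes K: "compact K" "K \<subseteq> U"
  obtains r C where "0 < r" "1 \<le> C"
    and "\<And>z y. z \<in> K \<Longrightarrow> norm (y - z) \<le> r \<Longrightarrow>
       y \<in> U \<and> norm (grad F y - grad F z - hess U F z (y - z)) \<le> C * (norm (y - z))\<^sup>2"
    and "\<And>z u. z \<in> K \<Longrightarrow> norm (hess U F z u) \<le> C * norm u"
    and "\<And>y y' B s t u. (\<And>t. t \<in> {0..T} \<Longrightarrow> y t \<in> K) \<Longrightarrow> (\<And>t. t \<in> {0..T} \<Longrightarrow> (y has_vector_derivative y' t) (at t within {0..T})) \<Longrightarrow>
       (\<And>t. t \<in> {0..T} \<Longrightarrow> norm (y' t) \<le> B) \<Longrightarrow> s \<in> {0..T} \<Longrightarrow> t \<in> {0..T} \<Longrightarrow>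
       norm (hess U F (y s) u - hess U F (y t) u) \<le> C * B * \<bar>s - t\<bar> * norm u \<and> norm (grad F (y s) - grad F (y t)) \<le> C * B * \<bar>s - t\<bar>"
proof -
  obtain e where e: "0 < e" "(\<Union>x\<in>K. ball x e) \<subseteq> U"
    using compact_subset_open_imp_ball_epsilon_subset[OF K(1) U K(2)] by blast
  define r where "r = e / 2"
  define Kr where "Kr = (\<Union>x\<in>K. \<Union>y\<in>cball 0 r. {x + y})"
  have r: "0 < r" using e by (simp add: r_def)
  have inKr: "y \<in> Kr" if "z \<in> K" "norm (y - z) \<le> r" for y z
    unfolding Kr_def using that by (intro UN_I[of z] UN_I[of "y - z"]) auto
  have KrU: "Kr \<subseteq> U"
  proof
    fix w assume "w \<in> Kr"
    then obtain z y where zy: "z \<in> K" "norm y \<le> r" "w = z + y" by (auto simp: Kr_def)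
    then have "w \<in> ball z e" using e by (simp add: r_def dist_norm)
    then show "w \<in> U" using e zy(1) by blast
  qed
  have cKr: "compact Kr" unfolding Kr_def by (intro compact_sums' K compact_cball)
  have bnd: "\<exists>M. \<forall>z\<in>Kr. \<bar>f z\<bar> \<le> M" if "continuous_on U f" for f :: "'a \<Rightarrow> real"
  proof -
    have "compact (f ` Kr)" by (intro compact_continuous_image cKr continuous_on_subset[OF that KrU])
    then obtain M where "\<forall>y\<in>f ` Kr. norm y \<le> M" using compact_imp_bounded bounded_iff by metis
    then show ?thesis by auto
  qed
  have "\<exists>M. \<forall>z\<in>Kr. \<bar>partial U a (partial U b F) z\<bar> \<le> M" if "a \<in> Basis" "b \<in> Basis" for a b
    by (rule bnd[OF differentiable_imp_continuous_on[OF C3_regularity(3)[OF that]]])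
  then obtain m2 where m2: "\<And>a b z. a \<in> Basis \<Longrightarrow> b \<in> Basis \<Longrightarrow> z \<in> Kr \<Longrightarrow> \<bar>partial U a (partial U b F) z\<bar> \<le> m2 a b"
    by metis
  have "\<exists>M. \<forall>z\<in>Kr. \<bar>partial U c (partial U a (partial U b F)) z\<bar> \<le> M" if "a \<in> Basis" "b \<in> Basis" "c \<in> Basis" for a b c
    by (rule bnd[OF C3_regularity(4)[OF that]])
  then obtain m3 where m3: "\<And>a b c z. a \<in> Basis \<Longrightarrow> b \<in> Basis \<Longrightarrow> c \<in> Basis \<Longrightarrow> z \<in> Kr \<Longrightarrow> \<bar>partial U c (partial U a (partial U b F)) z\<bar> \<le> m3 a b c"
    by metis
  define M where "M = (\<Sum>a\<in>(Basis::'a set). \<Sum>b\<in>(Basis::'a set). \<bar>m2 a b\<bar>) + (\<Sum>a\<in>(Basis::'a set). \<Sum>b\<in>(Basis::'a set). \<Sum>c\<in>(Basis::'a set). \<bar>m3 a b c\<bar>)"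
  have sum3: "g a b c \<le> (\<Sum>a\<in>(Basis::'a set). \<Sum>b\<in>(Basis::'a set). \<Sum>c\<in>(Basis::'a set). g a b c)"
    if "\<And>a b c. 0 \<le> g a b c" "a \<in> Basis" "b \<in> Basis" "c \<in> Basis" for g :: "'a \<Rightarrow> 'a \<Rightarrow> 'a \<Rightarrow> real" and a b c
  proof -
    have "g a b c \<le> (\<Sum>c\<in>(Basis::'a set). g a b c)" using that by (intro member_le_sum) auto
    also have "\<dots> \<le> (\<Sum>b\<in>(Basis::'a set). \<Sum>c\<in>(Basis::'a set). g a b c)"
      using that by (intro member_le_sum[of b Basis "\<lambda>b. \<Sum>c\<in>(Basis::'a set). g a b c"]) (auto intro: sum_nonneg)
    also have "\<dots> \<le> (\<Sum>a\<in>(Basis::'a set). \<Sum>b\<in>(Basis::'a set). \<Sum>c\<in>(Basis::'a set). g a b c)"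
      using that by (intro member_le_sum[of a Basis "\<lambda>a. \<Sum>b\<in>(Basis::'a set). \<Sum>c\<in>(Basis::'a set). g a b c"]) (auto intro!: sum_nonneg)
    finally show ?thesis .
  qed
  have sum2: "g a b \<le> (\<Sum>a\<in>(Basis::'a set). \<Sum>b\<in>(Basis::'a set). g a b)"
    if "\<And>a b. 0 \<le> g a b" "a \<in> Basis" "b \<in> Basis" for g :: "'a \<Rightarrow> 'a \<Rightarrow> real" and a b
  proof -
    have "g a b \<le> (\<Sum>b\<in>(Basis::'a set). g a b)" using that by (intro member_le_sum) auto
    also have "\<dots> \<le> (\<Sum>a\<in>(Basis::'a set). \<Sum>b\<in>(Basis::'a set). g a b)"
      using that by (intro member_le_sum[of a Basis "\<lambda>a. \<Sum>b\<in>(Basis::'a set). g a b"]) (auto intro: sum_nonneg)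
    finally show ?thesis .
  qed
  have M0: "0 \<le> M" unfolding M_def by (intro add_nonneg_nonneg sum_nonneg) auto
  have M2: "\<bar>partial U a (partial U b F) z\<bar> \<le> M" if "a \<in> Basis" "b \<in> Basis" "z \<in> Kr" for a b z
  proof -
    have "0 \<le> (\<Sum>a\<in>(Basis::'a set). \<Sum>b\<in>(Basis::'a set). \<Sum>c\<in>(Basis::'a set). \<bar>m3 a b c\<bar>)" by (intro sum_nonneg) auto
    then show ?thesis using m2[OF that] sum2[of "\<lambda>a b. \<bar>m2 a b\<bar>" a b] that by (simp add: M_def)
  qed
  have M3: "\<bar>partial U c (partial U a (partial U b F)) z\<bar> \<le> M" if "a \<in> Basis" "b \<in> Basis" "c \<in> Basis" "z \<in> Kr" for a b c z
  proof -
    have "0 \<le> (\<Sum>a\<in>(Basis::'a set). \<Sum>b\<in>(Basis::'a set). \<bar>m2 a b\<bar>)" by (intro sum_nonneg) auto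
    then show ?thesis using m3[OF that] sum3[of "\<lambda>a b c. \<bar>m3 a b c\<bar>" a b c] that by (simp add: M_def)
  qed
  define n where "n = real DIM('a)"
  have n1: "1 \<le> n" by (simp add: n_def Suc_leI)
  define C where "C = n ^ 3 * M + n\<^sup>2 * M + 1"
  have CL: "n\<^sup>2 * (n * M) \<le> C" and CM: "n\<^sup>2 * M \<le> C" and C1: "1 \<le> C"
    using M0 n1 by (auto simp: C_def power2_eq_square power3_eq_cube mult.assoc)
  have hess_bd: "norm (hess U F z u) \<le> C * norm u" if "z \<in> Kr" for z u
  proof -
    have "norm (hess U F z u) \<le> n\<^sup>2 * M * norm u"
      unfolding hess_def n_def by (rule hess_combination_bound) (use M2 that M0 in auto)
    also have "\<dots> \<le> C * norm u" using CM by (intro mult_right_mono) auto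
    finally show ?thesis .
  qed
  have KKr: "z \<in> Kr" if "z \<in> K" for z using inKr[OF that, of z] r by simp
  have hess_lip: "norm (hess U F y u - hess U F z u) \<le> C * norm (y - z) * norm u" if z: "z \<in> K" and y: "norm (y - z) \<le> r" for y z u
  proof -
    have p: "\<bar>partial U a (partial U b F) y - partial U a (partial U b F) z\<bar> \<le> n * M * norm (y - z)" if ab: "a \<in> Basis" "b \<in> Basis" for a b
    proof -
      have "norm (partial U a (partial U b F) y - partial U a (partial U b F) z) \<le> n * M * norm (y - z)"
      proof (rule differentiable_bound[where S="cball z r"])
        fix w assume w: "w \<in> cball z r"
        then have wK: "w \<in> Kr" using inKr[OF z, of w] by (simp add: dist_norm norm_minus_commute)
        then show "(partial U a (partial U b F) has_derivative (\<lambda>h. \<Sum>c\<in>Basis. (h \<bullet> c) * partial U c (partial U a (partial U b F)) w)) (at w within cball z r)"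
          using has_derivative_at_withinI[OF has_derivative_partial2[OF _ ab]] KrU by blast
        show "onorm (\<lambda>h. \<Sum>c\<in>Basis. (h \<bullet> c) * partial U c (partial U a (partial U b F)) w) \<le> n * M"
          by (rule onorm_bound) (use sum_basis_bound[of "\<lambda>c. partial U c (partial U a (partial U b F)) w" M] M3 ab wK M0 n1 in \<open>auto simp: n_def\<close>)
      qed (use y r in \<open>auto simp: dist_norm norm_minus_commute\<close>)
      then show ?thesis by simp
    qed
    have "norm (hess U F y u - hess U F z u) \<le> n\<^sup>2 * (n * M * norm (y - z)) * norm u"
      unfolding hess_diff n_def by (rule hess_combination_bound) (use p M0 in \<open>auto simp: n_def\<close>)
    also have "\<dots> = (n\<^sup>2 * (n * M)) * (norm (y - z) * norm u)" by simp
    also have "\<dots> \<le> C * (norm (y - z) * norm u)" using CL by (intro mult_right_mono) auto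
    finally show ?thesis by (simp add: mult.assoc)
  qed
  show thesis
  proof (rule that[OF r C1])
    show "norm (hess U F z u) \<le> C * norm u" if "z \<in> K" for z u by (rule hess_bd[OF KKr[OF that]])
    show "y \<in> U \<and> norm (grad F y - grad F z - hess U F z (y - z)) \<le> C * (norm (y - z))\<^sup>2" if z: "z \<in> K" and y: "norm (y - z) \<le> r" for z y
    proof
      show "y \<in> U" using inKr[OF z y] KrU by blast
      have "norm (grad F y - grad F z - hess U F z (y - z)) \<le> norm (y - z) * (C * norm (y - z))"
      proof (rule differentiable_bound_linearization[where S="cball z (norm (y - z))" and f="grad F" and f'="hess U F" and ?x0.0=z])
        show "z + t *\<^sub>R (y - z) \<in> cball z (norm (y - z))" if "t \<in> {0..1}" for t
          using that by (simp add: dist_norm mult_left_le_one_le)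
        fix w assume w: "w \<in> cball z (norm (y - z))"
        then have w': "norm (w - z) \<le> norm (y - z)" by (simp add: dist_norm norm_minus_commute)
        then have wr: "norm (w - z) \<le> r" using y by linarith
        show "(grad F has_derivative hess U F w) (at w within cball z (norm (y - z)))"
          using has_derivative_at_withinI[OF has_derivative_grad] inKr[OF z wr] KrU by blast
        show "onorm (hess U F w - hess U F z) \<le> C * norm (y - z)"
          unfolding fun_diff_def
        proof (rule onorm_bound)
          fix u :: 'a
          have "C * norm (w - z) * norm u \<le> C * norm (y - z) * norm u"
            using w' C1 by (intro mult_right_mono mult_left_mono) auto
          then show "norm (hess U F w u - hess U F z u) \<le> C * norm (y - z) * norm u"
            using hess_lip[OF z wr, of u] by linarith
        qed (use C1 in simp)
      qed simp
      then show "norm (grad F y - grad F z - hess U F z (y - z)) \<le> C * (norm (y - z))\<^sup>2"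
        by (simp add: power2_eq_square mult_ac)
    qed
    fix y y' :: "real \<Rightarrow> 'a" and B s t u
    assume yK: "\<And>t. t \<in> {0..T} \<Longrightarrow> y t \<in> K" and y': "\<And>t. t \<in> {0..T} \<Longrightarrow> (y has_vector_derivative y' t) (at t within {0..T})"
      and B: "\<And>t. t \<in> {0..T} \<Longrightarrow> norm (y' t) \<le> B" and st: "s \<in> {0..T}" "t \<in> {0..T}"
    have B0: "0 \<le> B" using B[OF st(1)] norm_ge_zero order_trans by blast
    have p: "\<bar>partial U a (partial U b F) (y s) - partial U a (partial U b F) (y t)\<bar> \<le> n * M * B * \<bar>s - t\<bar>" if ab: "a \<in> Basis" "b \<in> Basis" for a b
    proof -
      let ?g' = "\<lambda>w h. \<Sum>c\<in>Basis. (h \<bullet> c) * partial U c (partial U a (partial U b F)) w"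
      have "norm (partial U a (partial U b F) (y s) - partial U a (partial U b F) (y t)) \<le> n * M * B * norm (s - t)"
      proof (rule differentiable_bound[where S="{0..T}" and f="\<lambda>t. partial U a (partial U b F) (y t)" and f'="\<lambda>t h. ?g' (y t) (h *\<^sub>R y' t)"])
        fix w assume w: "w \<in> {0..T}"
        have "y w \<in> U" using yK[OF w] K by blast
        then show "((\<lambda>t. partial U a (partial U b F) (y t)) has_derivative (\<lambda>h. ?g' (y w) (h *\<^sub>R y' w))) (at w within {0..T})"
          using y'[OF w] unfolding has_vector_derivative_def
          by (intro has_derivative_compose[where g="partial U a (partial U b F)" and f=y] has_derivative_partial2 ab)
        show "onorm (\<lambda>h. ?g' (y w) (h *\<^sub>R y' w)) \<le> n * M * B"
        proof (rule onorm_bound)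
          fix h :: real
          have "\<bar>?g' (y w) (h *\<^sub>R y' w)\<bar> \<le> n * M * norm (h *\<^sub>R y' w)"
            unfolding n_def by (rule sum_basis_bound) (use M3 ab KKr[OF yK[OF w]] in auto)
          also have "\<dots> \<le> n * M * (\<bar>h\<bar> * B)"
            using B[OF w] n1 M0 by (intro mult_left_mono) (auto intro: mult_left_mono)
          finally show "norm (?g' (y w) (h *\<^sub>R y' w)) \<le> n * M * B * norm h" by (simp add: mult_ac)
        qed (use n1 M0 B0 in simp)
      qed (use st in auto)
      then show ?thesis by simp
    qed
    have "norm (hess U F (y s) u - hess U F (y t) u) \<le> n\<^sup>2 * (n * M * B * \<bar>s - t\<bar>) * norm u"
      unfolding hess_diff n_def by (rule hess_combination_bound) (use p M0 B0 in \<open>auto simp: n_def\<close>)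
    also have "\<dots> = (n\<^sup>2 * (n * M)) * (B * \<bar>s - t\<bar> * norm u)" by simp
    also have "\<dots> \<le> C * (B * \<bar>s - t\<bar> * norm u)" using CL B0 by (intro mult_right_mono) auto
    finally have 1: "norm (hess U F (y s) u - hess U F (y t) u) \<le> C * B * \<bar>s - t\<bar> * norm u" by (simp add: mult.assoc)
    have "norm (grad F (y s) - grad F (y t)) \<le> C * B * norm (s - t)"
    proof (rule differentiable_bound[where S="{0..T}" and f="\<lambda>t. grad F (y t)" and f'="\<lambda>t h. hess U F (y t) (h *\<^sub>R y' t)"])
      fix w assume w: "w \<in> {0..T}"
      have "y w \<in> U" using yK[OF w] K by blast
      then show "((\<lambda>t. grad F (y t)) has_derivative (\<lambda>h. hess U F (y w) (h *\<^sub>R y' w))) (at w within {0..T})"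
        using y'[OF w] unfolding has_vector_derivative_def
        by (intro has_derivative_compose[where g="grad F" and f=y] has_derivative_grad)
      show "onorm (\<lambda>h. hess U F (y w) (h *\<^sub>R y' w)) \<le> C * B"
      proof (rule onorm_bound)
        fix h :: real
        have "norm (hess U F (y w) (h *\<^sub>R y' w)) \<le> C * norm (h *\<^sub>R y' w)" by (rule hess_bd[OF KKr[OF yK[OF w]]])
        also have "\<dots> \<le> C * (\<bar>h\<bar> * B)" using B[OF w] C1 by (intro mult_left_mono) (auto intro: mult_left_mono)
        finally show "norm (hess U F (y w) (h *\<^sub>R y' w)) \<le> C * B * norm h" by (simp add: mult_ac)
      qed (use C1 B0 in simp)
    qed (use st in auto)
    with 1 show "norm (hess U F (y s) u - hess U F (y t) u) \<le> C * B * \<bar>s - t\<bar> * norm u \<and> norm (grad F (y s) - grad F (y t)) \<le> C * B * \<bar>s - t\<bar>"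
      by simp
  qed
qed

end

text \<open>
  The inverse function theorem for the map that replaces the normal coordinate by \<open>F\<close> straightens the
  level set; the preimage of a straight line with tangential direction \<open>v\<close> is a curve in the boundary
  with velocity \<open>v\<close>.
\<close>

lemma level_set_tangent:
  fixes F :: "'a::euclidean_space \<Rightarrow> real"
  assumes dom: "level_set_domain \<Omega> U F" and p: "p \<in> frontier \<Omega>" and v: "v \<bullet> grad F p = 0"
  shows "v \<in> tangent_space (frontier \<Omega>) p"
proof -
  have U: "open U" and C3: "Ck_on 3 U F" and fr: "frontier \<Omega> = {z\<in>U. F z = 0}" and n1: "norm (grad F p) = 1"
    using dom p by (auto simp: level_set_domain_def)
  have pU: "p \<in> U" "F p = 0" using p fr by auto
  define n where "n = grad F p"
  have nn: "n \<bullet> n = 1" using n1 by (simp add: n_def norm_eq_1)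
  have vn: "v \<bullet> n = 0" using v by (simp add: n_def)
  define \<Psi> where "\<Psi> z = (z - p) - ((z - p) \<bullet> n) *\<^sub>R n + F z *\<^sub>R n" for z
  define \<Psi>' where "\<Psi>' z = (\<lambda>h. h - (h \<bullet> n) *\<^sub>R n + (h \<bullet> grad F z) *\<^sub>R n)" for z
  have d\<Psi>: "(\<Psi> has_derivative \<Psi>' z) (at z)" if "z \<in> U" for z
    unfolding \<Psi>_def[abs_def] \<Psi>'_def using grad_eq(2)[OF U C3 that]
    by (auto intro!: derivative_eq_intros simp: fun_eq_iff)
  have bl: "bounded_linear (\<Psi>' z)" for z
    unfolding \<Psi>'_def by (intro bounded_linear_intros)
  define B where "B z = Blinfun (\<Psi>' z)" for z
  have B: "blinfun_apply (B z) = \<Psi>' z" for z unfolding B_def by (rule bounded_linear_Blinfun_apply[OF bl])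
  have contB: "continuous_on U B"
  proof (rule continuous_on_blinfun_componentwise)
    fix i :: 'a
    show "continuous_on U (\<lambda>x. blinfun_apply (B x) i)"
      unfolding B \<Psi>'_def by (intro continuous_intros continuous_on_grad[OF U C3])
  qed
  have id: "id_blinfun o\<^sub>L B p = id_blinfun"
    by (rule blinfun_eqI) (simp add: B \<Psi>'_def n_def)
  obtain U' V g g' where g: "open U'" "U' \<subseteq> U" "p \<in> U'" "open V" "\<Psi> p \<in> V" "homeomorphism U' V \<Psi> g"
    "\<And>y. y \<in> V \<Longrightarrow> (g has_derivative (g' y)) (at y)" "\<And>y. y \<in> V \<Longrightarrow> g' y = inv (blinfun_apply (B (g y)))"
    "\<And>y. y \<in> V \<Longrightarrow> bij (blinfun_apply (B (g y)))"
    using inverse_function_theorem[OF U _ contB pU(1) id, of \<Psi>] d\<Psi> B by metis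
  have \<Psi>p: "\<Psi> p = 0" by (simp add: \<Psi>_def pU)
  obtain e where e: "0 < e" "ball 0 e \<subseteq> V" using g(4,5) \<Psi>p open_contains_ball by metis
  define e' where "e' = e / (norm v + 1)"
  have np: "0 < norm v + 1" using norm_ge_zero[of v] by linarith
  have e': "0 < e'" using e np by (simp add: e'_def)
  have sV: "s *\<^sub>R v \<in> V" if "s \<in> {-e'<..<e'}" for s
  proof -
    have "\<bar>s\<bar> * norm v \<le> \<bar>s\<bar> * (norm v + 1)" by (intro mult_left_mono) auto
    also have "\<dots> < e' * (norm v + 1)" using that np by (intro mult_strict_right_mono) auto
    also have "\<dots> = e" using np by (simp add: e'_def)
    finally show ?thesis using e(2) by (auto simp: subset_iff)
  qed
  define \<gamma> where "\<gamma> s = g (s *\<^sub>R v)" for s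
  have \<gamma>U: "\<gamma> s \<in> U" "\<Psi> (\<gamma> s) = s *\<^sub>R v" if "s \<in> {-e'<..<e'}" for s
    using g(2,6) sV[OF that] unfolding \<gamma>_def homeomorphism_def by auto
  define G where "G s = grad F (\<gamma> s)" for s
  have D: "(\<gamma> has_vector_derivative v - ((v \<bullet> G s) / (n \<bullet> G s)) *\<^sub>R n) (at s)" and Gn: "n \<bullet> G s \<noteq> 0" if s: "s \<in> {-e'<..<e'}" for s
  proof -
    note V = sV[OF s]
    have bij: "bij (\<Psi>' (\<gamma> s))" using g(9)[OF V] by (simp add: B \<gamma>_def)
    have z0: "\<Psi>' (\<gamma> s) 0 = 0" by (simp add: \<Psi>'_def)
    show Gn: "n \<bullet> G s \<noteq> 0"
    proof
      assume "n \<bullet> G s = 0"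
      then have "\<Psi>' (\<gamma> s) n = \<Psi>' (\<gamma> s) 0" by (simp add: \<Psi>'_def nn G_def)
      then have "n = 0" using bij by (simp add: bij_def inj_eq)
      then show False using nn by simp
    qed
    have "((\<lambda>s. g (s *\<^sub>R v)) has_derivative (\<lambda>h. g' (s *\<^sub>R v) (h *\<^sub>R v))) (at s)"
      by (rule has_derivative_compose[where g=g and f="\<lambda>s. s *\<^sub>R v", OF _ g(7)[OF V]]) (auto intro!: derivative_eq_intros)
    moreover have "g' (s *\<^sub>R v) (h *\<^sub>R v) = h *\<^sub>R (v - ((v \<bullet> G s) / (n \<bullet> G s)) *\<^sub>R n)" for h
    proof -
      have "\<Psi>' (\<gamma> s) (h *\<^sub>R (v - ((v \<bullet> G s) / (n \<bullet> G s)) *\<^sub>R n)) = h *\<^sub>R v"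
        using Gn by (simp add: \<Psi>'_def G_def[symmetric] inner_simps vn nn algebra_simps)
      then have "inv (\<Psi>' (\<gamma> s)) (h *\<^sub>R v) = h *\<^sub>R (v - ((v \<bullet> G s) / (n \<bullet> G s)) *\<^sub>R n)"
        using bij by (metis bij_def inv_f_f)
      then show ?thesis using g(8)[OF V] by (simp add: B \<gamma>_def)
    qed
    ultimately show "(\<gamma> has_vector_derivative v - ((v \<bullet> G s) / (n \<bullet> G s)) *\<^sub>R n) (at s)"
      unfolding has_vector_derivative_def \<gamma>_def[abs_def] by simp
  qed
  have cont\<gamma>: "continuous_on {-e'<..<e'} \<gamma>"
    using D by (intro continuous_at_imp_continuous_on ballI has_vector_derivative_continuous)
  have contG: "continuous_on {-e'<..<e'} G"
    unfolding G_def[abs_def] by (rule continuous_on_compose2[OF continuous_on_grad[OF U C3] cont\<gamma>]) (use \<gamma>U in auto)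
  have "continuous_on {-e'<..<e'} (\<lambda>s. v - ((v \<bullet> G s) / (n \<bullet> G s)) *\<^sub>R n)"
    by (intro continuous_intros contG) (use Gn in auto)
  then have C1: "\<gamma> C1_differentiable_on {-e'<..<e'}"
    unfolding C1_differentiable_on_def
    by (intro exI[of _ "\<lambda>s. v - ((v \<bullet> G s) / (n \<bullet> G s)) *\<^sub>R n"] conjI ballI D) auto
  have onF: "\<gamma> ` {-e'<..<e'} \<subseteq> frontier \<Omega>"
  proof (clarify)
    fix s assume s: "s \<in> {-e'<..<e'}"
    have "F (\<gamma> s) = \<Psi> (\<gamma> s) \<bullet> n" by (simp add: \<Psi>_def inner_simps nn)
    also have "\<dots> = 0" using \<gamma>U(2)[OF s] vn by simp
    finally show "\<gamma> s \<in> frontier \<Omega>" using \<gamma>U(1)[OF s] fr by simp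
  qed
  have \<gamma>0: "\<gamma> 0 = p" using g(3,6) \<Psi>p unfolding \<gamma>_def homeomorphism_def by force
  have "(\<gamma> has_vector_derivative v) (at 0)"
    using D[of 0] e' v by (simp add: G_def \<gamma>0)
  then show ?thesis
    unfolding tangent_space_def mem_Collect_eq using e' C1 onF \<gamma>0
    by (intro exI[of _ \<gamma>] exI[of _ e'] conjI)
qed

section \<open>Weak derivatives of piecewise smooth functions\<close>

text \<open>
  A continuously differentiable function that vanishes for nonpositive arguments and increases to \<open>1\<close>.
\<close>

definition cutoff :: "real \<Rightarrow> real" where
  "cutoff s = (max 0 s)\<^sup>2 / (1 + (max 0 s)\<^sup>2)"

lemma max_squared_derivative: "((\<lambda>s. (max 0 s)\<^sup>2) has_real_derivative 2 * max 0 s) (at s)"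
proof -
  consider "s < 0" | "s = 0" | "0 < s" by linarith
  then show ?thesis
  proof cases
    case 1
    have "((\<lambda>s. 0::real) has_real_derivative 0) (at s)" by simp
    then have "((\<lambda>s. (max 0 s)\<^sup>2) has_real_derivative 0) (at s)"
      by (rule has_field_derivative_transform_within_open[where S="{..<0}"]) (use 1 in auto)
    then show ?thesis using 1 by simp
  next
    case 2
    have "(\<lambda>h. ((max 0 (0 + h))\<^sup>2 - (max 0 0)\<^sup>2) / h) \<midarrow>0\<rightarrow> (0::real)"
    proof (rule Lim_null_comparison)
      show "\<forall>\<^sub>F h in at 0. norm (((max 0 (0 + h))\<^sup>2 - (max 0 0)\<^sup>2) / h) \<le> \<bar>h\<bar>"
        by (intro always_eventually allI) (auto simp: max_def power2_eq_square)
      show "(\<lambda>h::real. \<bar>h\<bar>) \<midarrow>0\<rightarrow> 0" by (auto intro!: tendsto_eq_intros)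
    qed
    then show ?thesis using 2 by (simp add: DERIV_def)
  next
    case 3
    have "((\<lambda>s::real. s\<^sup>2) has_real_derivative 2 * s) (at s)" by (auto intro!: derivative_eq_intros)
    then have "((\<lambda>s. (max 0 s)\<^sup>2) has_real_derivative 2 * s) (at s)"
      by (rule has_field_derivative_transform_within_open[where S="{0<..}"]) (use 3 in auto)
    then show ?thesis using 3 by simp
  qed
qed

lemma cutoff_derivative:
  "(cutoff has_real_derivative 2 * max 0 s / (1 + (max 0 s)\<^sup>2)\<^sup>2) (at s)"
proof -
  have nz: "1 + (max 0 s)\<^sup>2 \<noteq> 0" using zero_le_power2[of "max 0 s"] by linarith
  have "((\<lambda>s. (max 0 s)\<^sup>2 / (1 + (max 0 s)\<^sup>2)) has_real_derivative
     (2 * max 0 s * (1 + (max 0 s)\<^sup>2) - (max 0 s)\<^sup>2 * (0 + 2 * max 0 s)) / ((1 + (max 0 s)\<^sup>2) * (1 + (max 0 s)\<^sup>2))) (at s)"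
    by (intro DERIV_divide DERIV_add DERIV_const max_squared_derivative nz)
  moreover have "(2 * max 0 s * (1 + (max 0 s)\<^sup>2) - (max 0 s)\<^sup>2 * (0 + 2 * max 0 s)) / ((1 + (max 0 s)\<^sup>2) * (1 + (max 0 s)\<^sup>2))
     = 2 * max 0 s / (1 + (max 0 s)\<^sup>2)\<^sup>2"
    by (simp add: algebra_simps power2_eq_square)
  ultimately show ?thesis unfolding cutoff_def[abs_def] by simp
qed

lemma cutoff_bounds: "0 \<le> cutoff s" "cutoff s \<le> 1"
  by (auto simp: cutoff_def divide_le_eq add_pos_nonneg)

lemma cutoff_nonpos: "s \<le> 0 \<Longrightarrow> cutoff s = 0"
  by (simp add: cutoff_def)

lemma cutoff_lower: "0 < s \<Longrightarrow> 1 - 1 / s \<le> cutoff s"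
proof -
  assume s: "0 < s"
  have "1 - cutoff s = 1 / (1 + s\<^sup>2)" using s zero_le_power2[of s] by (simp add: cutoff_def field_simps add_nonneg_eq_0_iff)
  also have "\<dots> \<le> 1 / s"
  proof -
    have "s \<le> 1 + s\<^sup>2" using zero_le_power2[of "s - 1"] s by (simp add: power2_diff)
    then show ?thesis using s by (intro divide_left_mono) (auto simp: add_pos_nonneg)
  qed
  finally show ?thesis by linarith
qed

lemma Ck_on_1_UNIV:
  assumes "\<And>r. (\<phi> has_real_derivative \<phi>' r) (at r)" "continuous_on UNIV \<phi>'"
  shows "Ck_on 1 (UNIV :: real set) \<phi>"
proof -
  have d: "(\<phi> has_derivative (\<lambda>h. \<phi>' r * h)) (at r)" for r
    using assms(1)[of r] by (simp add: has_field_derivative_def)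
  have f: "frechet_derivative \<phi> (at r) = (\<lambda>h. \<phi>' r * h)" for r
    using frechet_derivative_at[OF d] by simp
  show ?thesis
    using d assms(2) unfolding One_nat_def by (auto simp: differentiable_on_def differentiable_def f)
qed

text \<open>
  The test functions are \<open>cutoff (k q)\<close> with \<open>q\<close> positive exactly on the interval, or on slightly
  smaller intervals for compact support. A product of two sines serves in the periodic case, because
  \<open>sin (\<pi>(r - a)) sin (\<pi>(b - r))\<close> has period \<open>1\<close>; a quadratic polynomial serves in the other.
\<close>

lemma test_functions_approximate_intervals:
  assumes ab: "0 \<le> a" "a < b" "b \<le> 1"
  obtains \<phi> where "\<And>k::nat. test_function \<kappa> (\<phi> k)" "\<And>k r. \<bar>\<phi> k r\<bar> \<le> 1"
    "\<And>r. r \<in> {0..1} \<Longrightarrow> (\<lambda>k. \<phi> k r) \<longlonglongrightarrow> indicator {a<..<b} r"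
proof -
  (* it suffices to find functions that are bounded below on the interval and nonpositive off it *)
  have reduce: "\<exists>\<phi>. (\<forall>k::nat. Ck_on 1 UNIV (\<phi> k)) \<and> (\<forall>k r. \<phi> k r = cutoff (real k * q k r)) \<and> (\<forall>k r. \<bar>\<phi> k r\<bar> \<le> 1) \<and>
     (\<forall>r\<in>{0..1}. (\<lambda>k. \<phi> k r) \<longlonglongrightarrow> indicator {a<..<b} r)"
    if q: "\<And>k r. (q k has_real_derivative q' k r) (at r)" "\<And>k. continuous_on UNIV (q' k)"
      and off: "\<And>k r. r \<in> {0..1} \<Longrightarrow> r \<notin> {a<..<b} \<Longrightarrow> q k r \<le> 0"
      and on: "\<And>r. r \<in> {a<..<b} \<Longrightarrow> \<exists>\<epsilon>>0. \<forall>\<^sub>F k in sequentially. \<epsilon> \<le> q k r"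
    for q q' :: "nat \<Rightarrow> real \<Rightarrow> real"
  proof (intro exI[of _ "\<lambda>k r. cutoff (real k * q k r)"] conjI allI ballI)
    show "cutoff (real k * q k r) = cutoff (real k * q k r)" for k :: nat and r :: real by simp
    fix k :: nat and r :: real
    let ?c' = "\<lambda>s::real. 2 * max 0 s / (1 + (max 0 s)\<^sup>2)\<^sup>2"
    have contq: "continuous_on UNIV (q k)"
      using q(1) by (intro continuous_at_imp_continuous_on ballI DERIV_isCont)
    show "Ck_on 1 UNIV (\<lambda>r. cutoff (real k * q k r))"
    proof (rule Ck_on_1_UNIV)
      show "((\<lambda>r. cutoff (real k * q k r)) has_real_derivative ?c' (real k * q k r) * (real k * q' k r)) (at r)" for r
        by (rule DERIV_chain2[OF cutoff_derivative DERIV_cmult[OF q(1)]])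
      have "1 + (max 0 (real k * q k r))\<^sup>2 \<noteq> 0" for r
        using zero_le_power2[of "max 0 (real k * q k r)"] by linarith
      then show "continuous_on UNIV (\<lambda>r. ?c' (real k * q k r) * (real k * q' k r))"
        by (intro continuous_intros contq q(2)) auto
    qed
    show "\<bar>cutoff (real k * q k r)\<bar> \<le> 1" using cutoff_bounds[of "real k * q k r"] by linarith
  next
    fix r :: real assume r: "r \<in> {0..1}"
    show "(\<lambda>k. cutoff (real k * q k r)) \<longlonglongrightarrow> indicator {a<..<b} r"
    proof (cases "r \<in> {a<..<b}")
      case False
      then have "cutoff (real k * q k r) = 0" for k
        using off[OF r] by (intro cutoff_nonpos) (simp add: mult_nonneg_nonpos)
      then show ?thesis using False by simp
    next
      case True
      obtain \<epsilon> where \<epsilon>: "0 < \<epsilon>" "\<forall>\<^sub>F k in sequentially. \<epsilon> \<le> q k r" using on[OF True] by blast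
      have "(\<lambda>k. cutoff (real k * q k r)) \<longlonglongrightarrow> 1"
      proof (rule tendsto_sandwich)
        have "(\<lambda>k. 1 - (1 / \<epsilon>) * inverse (real k)) \<longlonglongrightarrow> 1 - (1 / \<epsilon>) * 0"
          by (intro tendsto_intros lim_inverse_n)
        then show "(\<lambda>k. 1 - (1 / \<epsilon>) * inverse (real k)) \<longlonglongrightarrow> 1" by simp
        show "\<forall>\<^sub>F k in sequentially. 1 - (1 / \<epsilon>) * inverse (real k) \<le> cutoff (real k * q k r)"
          using \<epsilon>(2) eventually_gt_at_top[of 0]
        proof eventually_elim
          case (elim k)
          have p: "0 < real k * q k r" using elim \<epsilon>(1) by (intro mult_pos_pos) auto
          have "1 / (real k * q k r) \<le> 1 / (real k * \<epsilon>)"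
            using elim \<epsilon>(1) p by (intro divide_left_mono mult_left_mono mult_pos_pos) auto
          then show ?case using cutoff_lower[OF p] by (simp add: divide_inverse mult_ac)
        qed
        show "\<forall>\<^sub>F k in sequentially. cutoff (real k * q k r) \<le> 1" using cutoff_bounds by simp
      qed simp
      then show ?thesis using True by simp
    qed
  qed
  show thesis
  proof (cases \<kappa>)
    case Closed_curve
    define q where "q k r = sin (pi * (r - a)) * sin (pi * (b - r))" for k :: nat and r :: real
    define q' where "q' k r = (cos (pi * (r - a)) * pi) * sin (pi * (b - r)) + (cos (pi * (b - r)) * (- pi)) * sin (pi * (r - a))" for k :: nat and r :: real
    have d: "(q k has_real_derivative q' k r) (at r)" for k r
      unfolding q_def[abs_def] q'_def by (auto intro!: derivative_eq_intros)
    have c: "continuous_on UNIV (q' k)" for k unfolding q'_def by (intro continuous_intros)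
    have off: "q k r \<le> 0" if "r \<in> {0..1}" "r \<notin> {a<..<b}" for k r
    proof (cases "r \<le> a")
      case True
      have "0 \<le> sin (pi * (a - r))" using True that ab by (intro sin_ge_zero) (auto intro: mult_left_le)
      moreover have "sin (pi * (r - a)) = - sin (pi * (a - r))" using sin_minus[of "pi * (a - r)"] by (simp add: algebra_simps)
      moreover have "0 \<le> sin (pi * (b - r))" using True that ab by (intro sin_ge_zero) (auto intro: mult_left_le)
      ultimately show ?thesis unfolding q_def by (intro mult_nonpos_nonneg) auto
    next
      case False
      then have rb: "b \<le> r" using that by auto
      have "0 \<le> sin (pi * (r - b))" using rb that ab by (intro sin_ge_zero) (auto intro: mult_left_le)
      moreover have "sin (pi * (b - r)) = - sin (pi * (r - b))" using sin_minus[of "pi * (r - b)"] by (simp add: algebra_simps)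
      moreover have "0 \<le> sin (pi * (r - a))" using False that ab by (intro sin_ge_zero) (auto intro: mult_left_le)
      ultimately show ?thesis unfolding q_def by (intro mult_nonneg_nonpos) auto
    qed
    have on: "\<exists>\<epsilon>>0. \<forall>\<^sub>F k in sequentially. \<epsilon> \<le> q k r" if r: "r \<in> {a<..<b}" for r
    proof -
      have "0 < q 0 r" unfolding q_def using r ab by (intro mult_pos_pos sin_gt_zero) (auto simp: mult_less_cancel_left)
      then show ?thesis by (intro exI[of _ "q 0 r"]) (auto simp: q_def)
    qed
    obtain \<phi> where \<phi>: "\<forall>k::nat. Ck_on 1 UNIV (\<phi> k)" "\<forall>k r. \<phi> k r = cutoff (real k * q k r)" "\<forall>k r. \<bar>\<phi> k r\<bar> \<le> 1"
     "\<forall>r\<in>{0..1}. (\<lambda>k. \<phi> k r) \<longlonglongrightarrow> indicator {a<..<b} r"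
      using reduce[of q q', OF d c off on] by blast
    have "q k (r + 1) = q k r" for k r
    proof -
      have "sin (pi * (r + 1 - a)) = - sin (pi * (r - a))" using sin_periodic_pi[of "pi * (r - a)"] by (simp add: algebra_simps)
      moreover have "sin (pi * (b - (r + 1))) = - sin (pi * (b - r))"
        using sin_periodic_pi[of "pi * (b - (r + 1))"] by (simp add: algebra_simps)
      ultimately show ?thesis by (simp add: q_def)
    qed
    then show thesis using \<phi> Closed_curve by (intro that[of \<phi>]) auto
  next
    case Open_curve
    define al where "al k = a + (b - a) / (real k + 3)" for k :: nat
    define be where "be k = b - (b - a) / (real k + 3)" for k :: nat
    have l: "0 < al k" "be k < 1" "a < al k" "be k < b" for k
      using ab by (auto simp: al_def be_def add_nonneg_pos intro!: add_nonneg_pos less_le_trans[OF _ ab(3)])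
    define q where "q k r = (r - al k) * (be k - r)" for k r
    define q' where "q' k r = 1 * (be k - r) + (0 - 1) * (r - al k)" for k r
    have d: "(q k has_real_derivative q' k r) (at r)" for k r
      unfolding q_def[abs_def] q'_def by (auto intro!: derivative_eq_intros)
    have c: "continuous_on UNIV (q' k)" for k unfolding q'_def by (intro continuous_intros)
    have neg: "q k r \<le> 0" if out: "r \<notin> {al k..be k}" for k r
    proof -
      have "(b - a) / (real k + 3) \<le> (b - a) / 3" using ab by (intro divide_left_mono) auto
      moreover have "a + d \<le> b - d" if "d \<le> (b - a) / 3" for d
        using that ab unfolding diff_divide_distrib by linarith
      ultimately have "al k \<le> be k" unfolding al_def be_def by blast
      then consider "r \<le> al k" "r \<le> be k" | "al k \<le> r" "be k \<le> r" using out by force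
      then show ?thesis unfolding q_def
        by cases (simp_all add: mult_nonpos_nonneg mult_nonneg_nonpos)
    qed
    have off: "q k r \<le> 0" if "r \<in> {0..1}" "r \<notin> {a<..<b}" for k r
      using that(2) l[of k] by (intro neg) auto
    have lim: "al \<longlonglongrightarrow> a" "be \<longlonglongrightarrow> b"
    proof -
      have "(\<lambda>k. (b - a) * inverse (real (k + 3))) \<longlonglongrightarrow> (b - a) * 0"
        by (intro tendsto_intros LIMSEQ_ignore_initial_segment[OF lim_inverse_n])
      then have 0: "(\<lambda>k. (b - a) / (real k + 3)) \<longlonglongrightarrow> 0" by (simp add: divide_inverse)
      show "al \<longlonglongrightarrow> a" unfolding al_def[abs_def] using tendsto_add[OF tendsto_const[of a] 0] by simp
      show "be \<longlonglongrightarrow> b" unfolding be_def[abs_def] using tendsto_diff[OF tendsto_const[of b] 0] by simp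
    qed
    have on: "\<exists>\<epsilon>>0. \<forall>\<^sub>F k in sequentially. \<epsilon> \<le> q k r" if r: "r \<in> {a<..<b}" for r
    proof -
      have "(\<lambda>k. q k r) \<longlonglongrightarrow> (r - a) * (b - r)" unfolding q_def by (intro tendsto_intros lim)
      then have ev: "\<forall>\<^sub>F k in sequentially. \<epsilon> < q k r" if "\<epsilon> < (r - a) * (b - r)" for \<epsilon>
        using that by (rule order_tendstoD(1))
      have p: "0 < (r - a) * (b - r)" using r by simp
      then have "(r - a) * (b - r) / 2 < (r - a) * (b - r)" by linarith
      then have "\<forall>\<^sub>F k in sequentially. (r - a) * (b - r) / 2 < q k r" by (rule ev)
      then show ?thesis using p
        by (intro exI[of _ "(r - a) * (b - r) / 2"] conjI) (auto elim: eventually_mono)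
    qed
    obtain \<phi> where \<phi>: "\<forall>k::nat. Ck_on 1 UNIV (\<phi> k)" "\<forall>k r. \<phi> k r = cutoff (real k * q k r)" "\<forall>k r. \<bar>\<phi> k r\<bar> \<le> 1"
     "\<forall>r\<in>{0..1}. (\<lambda>k. \<phi> k r) \<longlonglongrightarrow> indicator {a<..<b} r"
      using reduce[of q q', OF d c off on] by blast
    have z: "\<phi> k r = 0" if "r \<notin> {al k..be k}" for k r
      using neg[OF that] \<phi>(2) by (simp add: cutoff_nonpos mult_nonneg_nonpos)
    have "test_function \<kappa> (\<phi> k)" for k
    proof -
      have "\<exists>a b. 0 < a \<and> b < 1 \<and> (\<forall>\<rho>. \<rho> \<notin> {a..b} \<longrightarrow> \<phi> k \<rho> = 0)"
        by (rule exI[of _ "al k"], rule exI[of _ "be k"]) (use l z in simp)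
      then show ?thesis using \<phi>(1) Open_curve by simp
    qed
    then show thesis using \<phi> by (intro that[of \<phi>]) auto
  qed
qed

text \<open>
  Intervals form a generator of the Borel sets that is stable under intersection, so the integral
  vanishes over every Borel set.
\<close>

lemma integrable_zero_on_intervals:
  fixes w :: "real \<Rightarrow> 'a::euclidean_space"
  assumes w: "set_integrable lborel {0..1} w"
    and z: "\<And>a b. 0 \<le> a \<Longrightarrow> a < b \<Longrightarrow> b \<le> 1 \<Longrightarrow> (LBINT r:{a<..<b}. w r) = 0"
  shows "AE r in lborel. indicator {0..1} r *\<^sub>R w r = 0"
proof -
  define v where "v r = indicator {0..1} r *\<^sub>R w r" for r
  have v: "integrable lborel v" using w by (simp add: set_integrable_def v_def[abs_def])
  have sv: "set_integrable lborel A v" if "A \<in> sets borel" for A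
    unfolding set_integrable_def using v that by (intro integrable_mult_indicator) auto
  have Iint: "(LBINT r:{a<..b}. v r) = 0" for a b :: real
  proof (cases "max a 0 < min b 1")
    case True
    have "(LBINT r:{a<..b}. v r) = (LBINT r:{max a 0<..<min b 1}. w r)"
      unfolding set_lebesgue_integral_def
      by (rule integral_discrete_difference[where X="{0, 1, a, b}"]) (auto simp: v_def indicator_def)
    also have "\<dots> = 0" using True by (intro z) auto
    finally show ?thesis .
  next
    case False
    have "(LBINT r:{a<..b}. v r) = (LBINT r:{}. v r)"
      unfolding set_lebesgue_integral_def
      by (rule integral_discrete_difference[where X="{0, 1, a, b}"]) (use False in \<open>auto simp: v_def indicator_def\<close>)
    then show ?thesis by (simp add: set_lebesgue_integral_def)
  qed
  have total: "(LBINT r:UNIV. v r) = 0"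
  proof -
    have "(LBINT r:UNIV. v r) = (LBINT r:{-1<..1}. v r)"
      unfolding set_lebesgue_integral_def by (intro Bochner_Integration.integral_cong) (auto simp: v_def indicator_def)
    then show ?thesis using Iint by simp
  qed
  have "(LBINT r:A. v r) = 0" if "A \<in> sets borel" for A
  proof -
    have gen: "sets (borel :: real measure) = sigma_sets UNIV (range (\<lambda>(a, b). {a<..b}))"
      unfolding borel_sigma_sets_Ioc by simp
    have A: "A \<in> sigma_sets UNIV (range (\<lambda>(a, b). {a<..b::real}))" using that gen by simp
    have stable: "Int_stable (range (\<lambda>(a, b). {a<..b::real}))"
    proof (rule Int_stableI)
      fix A B :: "real set" assume "A \<in> range (\<lambda>(a, b). {a<..b})" "B \<in> range (\<lambda>(a, b). {a<..b})"
      then obtain a b c d where "A = {a<..b}" "B = {c<..d}" by auto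
      then have "A \<inter> B = (\<lambda>(a, b). {a<..b}) (max a c, min b d)" by auto
      then show "A \<inter> B \<in> range (\<lambda>(a, b). {a<..b})" by (rule range_eqI)
    qed
    show ?thesis
    proof (rule sigma_sets_induct_disjoint[OF stable _ A, where P="\<lambda>A. (LBINT r:A. v r) = 0"])
      show "range (\<lambda>(a, b). {a<..b::real}) \<subseteq> Pow UNIV" by auto
      show "(LBINT r:A. v r) = 0" if "A \<in> range (\<lambda>(a, b). {a<..b})" for A using that Iint by auto
      show "(LBINT r:{}. v r) = 0" by (simp add: set_lebesgue_integral_def)
      show "(LBINT r:UNIV - A. v r) = 0" if "A \<in> sigma_sets UNIV (range (\<lambda>(a, b). {a<..b::real}))" "(LBINT r:A. v r) = 0" for A
      proof -
        have Ab: "A \<in> sets borel" using that(1) gen by simp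
        have "(LBINT r:A \<union> (UNIV - A). v r) = (LBINT r:A. v r) + (LBINT r:UNIV - A. v r)"
          by (rule set_integral_Un) (use Ab sv in auto)
        then show ?thesis using that(2) total by simp
      qed
      show "(LBINT r:\<Union> (range A). v r) = 0"
        if "disjoint_family A" "range A \<subseteq> sigma_sets UNIV (range (\<lambda>(a, b). {a<..b::real}))" "\<And>i::nat. (LBINT r:A i. v r) = 0" for A
      proof -
        have Ab: "A i \<in> sets borel" for i using that(2) gen by auto
        have "(LBINT r:(\<Union>i. A i). v r) = (\<Sum>i. (LBINT r:A i. v r))"
          using that(1) Ab by (intro lebesgue_integral_countable_add sv sets.countable_UN) (auto simp: disjoint_family_on_def)
        then show ?thesis using that(3) by simp
      qed
    qed
  qed
  then have "AE r in lborel. v r = 0"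
    by (intro sigma_finite_measure.density_zero[OF lborel.sigma_finite_measure_axioms v]) auto
  then show ?thesis by (simp add: v_def)
qed

lemma test_function_continuous:
  assumes "test_function \<kappa> \<phi>"
  shows "continuous_on UNIV \<phi>" "continuous_on UNIV (deriv \<phi>)" "\<And>r. (\<phi> has_real_derivative deriv \<phi> r) (at r)"
proof -
  have C: "Ck_on 1 UNIV \<phi>" using assms by (cases \<kappa>) auto
  then have d: "\<And>r. \<phi> differentiable (at r)" and c: "continuous_on UNIV (\<lambda>r. frechet_derivative \<phi> (at r) 1)"
    unfolding One_nat_def by (auto simp: differentiable_on_def)
  show D: "(\<phi> has_real_derivative deriv \<phi> r) (at r)" for r
    using d[of r] DERIV_deriv_iff_real_differentiable by blast
  have "frechet_derivative \<phi> (at r) 1 = deriv \<phi> r" for r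
    using frechet_derivative_at[of \<phi> "(*) (deriv \<phi> r)" r] D[of r] unfolding has_field_derivative_def by (metis mult.right_neutral)
  then show "continuous_on UNIV (deriv \<phi>)" using c by simp
  show "continuous_on UNIV \<phi>"
    using D by (intro continuous_at_imp_continuous_on ballI DERIV_isCont)
qed

lemma set_integrable_bounded:
  fixes g :: "real \<Rightarrow> 'a::euclidean_space"
  assumes "set_borel_measurable lborel {0..1} g" "\<And>r. r \<in> {0..1} \<Longrightarrow> norm (g r) \<le> C"
  shows "set_integrable lborel {0..1} g"
proof (rule set_integrable_bound[of _ _ "\<lambda>_. C"])
  show "set_integrable lborel {0..1::real} (\<lambda>_. C)"
    by (intro borel_integrable_atLeastAtMost' continuous_on_const)
  show "AE r in lborel. r \<in> {0..1} \<longrightarrow> norm (g r) \<le> norm C"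
    using assms(2) by (intro AE_I2) force
qed (use assms in auto)

lemma set_borel_measurable_mult:
  fixes g :: "real \<Rightarrow> 'a::euclidean_space"
  assumes "continuous_on UNIV \<phi>" "set_borel_measurable lborel {0..1} g"
  shows "set_borel_measurable lborel {0..1} (\<lambda>r. \<phi> r *\<^sub>R g r)"
proof -
  have "(\<lambda>r. \<phi> r *\<^sub>R (indicator {0..1} r *\<^sub>R g r)) \<in> borel_measurable lborel"
  proof (rule borel_measurable_scaleR)
    show "\<phi> \<in> borel_measurable lborel" using borel_measurable_continuous_onI[OF assms(1)] by simp
    show "(\<lambda>r. indicator {0..1} r *\<^sub>R g r) \<in> borel_measurable lborel"
      using assms(2) by (simp add: set_borel_measurable_def)
  qed
  moreover have "(\<lambda>r. \<phi> r *\<^sub>R (indicator {0..1} r *\<^sub>R g r)) = (\<lambda>r. indicator {0..1} r *\<^sub>R (\<phi> r *\<^sub>R g r))"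
    by (rule ext) (rule scaleR_left_commute)
  ultimately show ?thesis unfolding set_borel_measurable_def by simp
qed

lemma in_L2_integrable:
  assumes "in_L2 g"
  shows "set_integrable lborel {0..1} g"
proof (rule set_integrable_bound)
  show "set_integrable lborel {0..1} (\<lambda>r. 1 + (norm (g r))\<^sup>2)"
  proof (rule set_integral_add(1))
    show "set_integrable lborel {0..1::real} (\<lambda>r. 1 :: real)"
      by (intro borel_integrable_atLeastAtMost' continuous_on_const)
  qed (use assms in \<open>simp add: in_L2_def\<close>)
  show "AE r in lborel. r \<in> {0..1} \<longrightarrow> norm (g r) \<le> norm (1 + (norm (g r))\<^sup>2)"
  proof (intro AE_I2 impI)
    fix r
    have "2 * norm (g r) \<le> 1 + (norm (g r))\<^sup>2" using zero_le_power2[of "norm (g r) - 1"] by (simp add: power2_diff)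
    then show "norm (g r) \<le> norm (1 + (norm (g r))\<^sup>2)" using norm_ge_zero[of "g r"] unfolding real_norm_def by linarith
  qed
qed (use assms in \<open>simp add: in_L2_def\<close>)

lemma set_integrable_test_mult:
  fixes g :: "real \<Rightarrow> 'a::euclidean_space"
  assumes \<phi>: "continuous_on UNIV \<phi>" and g: "set_integrable lborel {0..1} g"
  shows "set_integrable lborel {0..1} (\<lambda>r. \<phi> r *\<^sub>R g r)"
proof -
  have "bounded (\<phi> ` {0..1::real})"
    using \<phi> by (intro compact_imp_bounded compact_continuous_image) (auto intro: continuous_on_subset)
  then obtain C where "\<forall>r\<in>{0..1}. \<bar>\<phi> r\<bar> \<le> C" unfolding bounded_iff by auto
  then have C: "\<And>r. r \<in> {0..1} \<Longrightarrow> \<bar>\<phi> r\<bar> \<le> C" by blast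
  have meas: "set_borel_measurable lborel {0..1} g"
    using g unfolding set_integrable_def set_borel_measurable_def by (rule borel_measurable_integrable)
  show ?thesis
  proof (rule set_integrable_bound[of _ _ "\<lambda>r. C *\<^sub>R g r"])
    show "AE r in lborel. r \<in> {0..1} \<longrightarrow> norm (\<phi> r *\<^sub>R g r) \<le> norm (C *\<^sub>R g r)"
      using C by (intro AE_I2 impI) (auto intro!: mult_right_mono order_trans[OF C abs_ge_self])
  qed (use g set_borel_measurable_mult[OF \<phi> meas] in auto)
qed

text \<open>
  Dominated convergence along the test functions shows that the difference of two weak derivatives has
  vanishing integral over every interval.
\<close>

lemma weak_deriv_unique:
  fixes u :: "real \<Rightarrow> 'a::euclidean_space"
  assumes g: "is_weak_deriv \<kappa> u g1" "is_weak_deriv \<kappa> u g2"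
  shows "AE r in lborel. indicator {0..1} r *\<^sub>R g1 r = indicator {0..1} r *\<^sub>R g2 r"
proof -
  have i: "set_integrable lborel {0..1} g1" "set_integrable lborel {0..1} g2"
    using g by (auto simp: is_weak_deriv_def intro: in_L2_integrable)
  define w where "w r = g1 r - g2 r" for r
  have w: "set_integrable lborel {0..1} w" unfolding w_def using i by (rule set_integral_diff)
  have tz: "(LBINT r:{0..1}. \<phi> r *\<^sub>R w r) = 0" if "test_function \<kappa> \<phi>" for \<phi>
  proof -
    note c = test_function_continuous(1)[OF that]
    have "(LBINT r:{0..1}. \<phi> r *\<^sub>R w r) = (LBINT r:{0..1}. \<phi> r *\<^sub>R g1 r) - (LBINT r:{0..1}. \<phi> r *\<^sub>R g2 r)"
      unfolding w_def scaleR_diff_right using set_integrable_test_mult[OF c] i by (intro set_integral_diff)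
    also have "\<dots> = 0"
    proof -
      have "(LBINT \<rho>:{0..1}. deriv \<phi> \<rho> *\<^sub>R u \<rho>) = - (LBINT \<rho>:{0..1}. \<phi> \<rho> *\<^sub>R g1 \<rho>)"
        "(LBINT \<rho>:{0..1}. deriv \<phi> \<rho> *\<^sub>R u \<rho>) = - (LBINT \<rho>:{0..1}. \<phi> \<rho> *\<^sub>R g2 \<rho>)"
        using g that by (simp_all add: is_weak_deriv_def)
      then show ?thesis by simp
    qed
    finally show ?thesis .
  qed
  have "(LBINT r:{a<..<b}. w r) = 0" if ab: "0 \<le> a" "a < b" "b \<le> 1" for a b
  proof -
    obtain \<phi> where \<phi>: "\<And>k::nat. test_function \<kappa> (\<phi> k)" "\<And>k r. \<bar>\<phi> k r\<bar> \<le> 1"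
      "\<And>r. r \<in> {0..1} \<Longrightarrow> (\<lambda>k. \<phi> k r) \<longlonglongrightarrow> indicator {a<..<b} r"
      by (rule test_functions_approximate_intervals[OF ab, of \<kappa>]) (rule that)
    have "(\<lambda>k. \<integral>r. indicator {0..1} r *\<^sub>R (\<phi> k r *\<^sub>R w r) \<partial>lborel) \<longlonglongrightarrow> (\<integral>r. indicator {a<..<b} r *\<^sub>R (indicator {0..1} r *\<^sub>R w r) \<partial>lborel)"
    proof (rule integral_dominated_convergence[where w="\<lambda>r. norm (indicator {0..1} r *\<^sub>R w r)"])
      show "(\<lambda>r. indicator {a<..<b} r *\<^sub>R (indicator {0..1} r *\<^sub>R w r)) \<in> borel_measurable lborel"
      proof (rule borel_measurable_scaleR)
        show "(\<lambda>r. indicator {0..1} r *\<^sub>R w r) \<in> borel_measurable lborel"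
          using w unfolding set_integrable_def by (rule borel_measurable_integrable)
      qed simp
      show "(\<lambda>r. indicator {0..1} r *\<^sub>R (\<phi> k r *\<^sub>R w r)) \<in> borel_measurable lborel" for k
        using set_integrable_test_mult[OF test_function_continuous(1)[OF \<phi>(1)] w] unfolding set_integrable_def
        by (rule borel_measurable_integrable)
      show "integrable lborel (\<lambda>r. norm (indicator {0..1} r *\<^sub>R w r))"
        using w unfolding set_integrable_def by (rule integrable_norm)
      show "AE r in lborel. norm (indicator {0..1} r *\<^sub>R (\<phi> k r *\<^sub>R w r)) \<le> norm (indicator {0..1} r *\<^sub>R w r)" for k
        using \<phi>(2) by (intro AE_I2) (auto simp: indicator_def intro: mult_left_le_one_le)
      show "AE r in lborel. (\<lambda>k. indicator {0..1} r *\<^sub>R (\<phi> k r *\<^sub>R w r)) \<longlonglongrightarrow> indicator {a<..<b} r *\<^sub>R (indicator {0..1} r *\<^sub>R w r)"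
      proof (intro AE_I2)
        fix r :: real
        show "(\<lambda>k. indicator {0..1} r *\<^sub>R (\<phi> k r *\<^sub>R w r)) \<longlonglongrightarrow> indicator {a<..<b} r *\<^sub>R (indicator {0..1} r *\<^sub>R w r)"
        proof (cases "r \<in> {0..1}")
          case True
          then show ?thesis using tendsto_scaleR[OF \<phi>(3)[OF True] tendsto_const[of "w r"]] by simp
        qed simp
      qed
    qed
    moreover have "(\<integral>r. indicator {0..1} r *\<^sub>R (\<phi> k r *\<^sub>R w r) \<partial>lborel) = 0" for k
      using tz[OF \<phi>(1)] by (simp add: set_lebesgue_integral_def)
    ultimately have "(\<integral>r. indicator {a<..<b} r *\<^sub>R (indicator {0..1} r *\<^sub>R w r) \<partial>lborel) = 0"
      by (simp only: LIMSEQ_const_iff)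
    moreover
    have "indicator {a<..<b} r *\<^sub>R (indicator {0..1} r *\<^sub>R w r) = indicator {a<..<b} r *\<^sub>R w r" for r
      using ab by (auto simp: indicator_def)
    then have "(\<lambda>r. indicator {a<..<b} r *\<^sub>R (indicator {0..1} r *\<^sub>R w r)) = (\<lambda>r. indicator {a<..<b} r *\<^sub>R w r)"
      by (rule ext)
    ultimately show ?thesis unfolding set_lebesgue_integral_def by simp
  qed
  then have "AE r in lborel. indicator {0..1} r *\<^sub>R w r = 0"
    by (rule integrable_zero_on_intervals[OF w])
  then show ?thesis
    by eventually_elim (simp add: w_def scaleR_diff_right)
qed

text \<open>
  Integration by parts. The fundamental theorem of calculus tolerates finitely many exceptional points
  when the function is continuous.
\<close>

lemma is_weak_derivI:
  fixes u :: "real \<Rightarrow> 'a::euclidean_space"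
  assumes u: "continuous_on {0..1} u" and closed: "\<kappa> = Closed_curve \<Longrightarrow> u 0 = u 1"
    and N: "finite N" and der: "\<And>r. r \<in> {0<..<1} - N \<Longrightarrow> (u has_vector_derivative g r) (at r)"
    and g: "set_borel_measurable lborel {0..1} g" "\<And>r. r \<in> {0..1} \<Longrightarrow> norm (g r) \<le> C"
  shows "is_weak_deriv \<kappa> u g"
proof -
  have gi: "set_integrable lborel {0..1} g" by (rule set_integrable_bounded[OF g])
  have "set_integrable lborel {0..1} (\<lambda>r. (norm (g r))\<^sup>2)"
  proof (rule set_integrable_bounded)
    have "(\<lambda>r. (norm (indicator {0..1} r *\<^sub>R g r))\<^sup>2) \<in> borel_measurable lborel"
      using g(1) unfolding set_borel_measurable_def by measurable
    moreover have "(norm (indicator {0..1} r *\<^sub>R g r))\<^sup>2 = indicator {0..1} r *\<^sub>R (norm (g r))\<^sup>2" for r :: real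
      by (simp add: indicator_def)
    ultimately show "set_borel_measurable lborel {0..1} (\<lambda>r. (norm (g r))\<^sup>2)"
      unfolding set_borel_measurable_def by simp
    show "norm ((norm (g r))\<^sup>2) \<le> C\<^sup>2" if "r \<in> {0..1}" for r using g(2)[OF that] by (simp add: power_mono)
  qed
  then have L2: "in_L2 g" using g by (simp add: in_L2_def)
  have "(LBINT r:{0..1}. deriv \<phi> r *\<^sub>R u r) = - (LBINT r:{0..1}. \<phi> r *\<^sub>R g r)" if \<phi>: "test_function \<kappa> \<phi>" for \<phi>
  proof -
    note c = test_function_continuous[OF \<phi>]
    have i1: "set_integrable lborel {0..1} (\<lambda>r. deriv \<phi> r *\<^sub>R u r)"
      by (intro borel_integrable_atLeastAtMost' continuous_intros u continuous_on_subset[OF c(2)]) auto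
    have i2: "set_integrable lborel {0..1} (\<lambda>r. \<phi> r *\<^sub>R g r)" by (rule set_integrable_test_mult[OF c(1) gi])
    have "((\<lambda>r. deriv \<phi> r *\<^sub>R u r + \<phi> r *\<^sub>R g r) has_integral (\<phi> 1 *\<^sub>R u 1 - \<phi> 0 *\<^sub>R u 0)) {0..1}"
    proof (rule fundamental_theorem_of_calculus_interior_strong[OF N])
      show "continuous_on {0..1} (\<lambda>r. \<phi> r *\<^sub>R u r)" by (intro continuous_intros u continuous_on_subset[OF c(1)]) auto
      fix r assume r: "r \<in> {0<..<1} - N"
      have "((\<lambda>r. \<phi> r *\<^sub>R u r) has_vector_derivative (\<phi> r *\<^sub>R g r + deriv \<phi> r *\<^sub>R u r)) (at r)"
        by (rule has_vector_derivative_scaleR[OF c(3) der[OF r]])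
      then show "((\<lambda>r. \<phi> r *\<^sub>R u r) has_vector_derivative (deriv \<phi> r *\<^sub>R u r + \<phi> r *\<^sub>R g r)) (at r)"
        by (simp add: add.commute)
    qed simp
    moreover have "\<phi> 1 *\<^sub>R u 1 - \<phi> 0 *\<^sub>R u 0 = 0"
    proof (cases \<kappa>)
      case Closed_curve
      then have "\<forall>\<rho>. \<phi> (\<rho> + 1) = \<phi> \<rho>" using \<phi> by simp
      then have "\<phi> (0 + 1) = \<phi> 0" by blast
      then have "\<phi> 1 = \<phi> 0" by simp
      then show ?thesis using closed Closed_curve by simp
    next
      case Open_curve
      then obtain a b where "0 < a" "b < 1" "\<forall>r. r \<notin> {a..b} \<longrightarrow> \<phi> r = 0" using \<phi> by auto
      then have "\<phi> 0 = 0" "\<phi> 1 = 0" by auto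
      then show ?thesis by simp
    qed
    ultimately have "integral {0..1} (\<lambda>r. deriv \<phi> r *\<^sub>R u r + \<phi> r *\<^sub>R g r) = 0" by (simp add: integral_unique)
    moreover have "(LBINT r:{0..1}. deriv \<phi> r *\<^sub>R u r + \<phi> r *\<^sub>R g r) = integral {0..1} (\<lambda>r. deriv \<phi> r *\<^sub>R u r + \<phi> r *\<^sub>R g r)"
      by (rule set_borel_integral_eq_integral(2)[OF set_integral_add(1)[OF i1 i2]])
    moreover have "(LBINT r:{0..1}. deriv \<phi> r *\<^sub>R u r + \<phi> r *\<^sub>R g r) = (LBINT r:{0..1}. deriv \<phi> r *\<^sub>R u r) + (LBINT r:{0..1}. \<phi> r *\<^sub>R g r)"
      by (rule set_integral_add(2)[OF i1 i2])
    ultimately show ?thesis by (simp add: eq_neg_iff_add_eq_0)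
  qed
  then show ?thesis using L2 by (simp add: is_weak_deriv_def)
qed

text \<open>
  The chosen weak derivative in the definition of the seminorm may be replaced by any other.
\<close>

lemma h1_seminorm_eq:
  fixes u :: "real \<Rightarrow> 'a::euclidean_space"
  assumes g: "is_weak_deriv \<kappa> u g"
  shows "(h1_seminorm \<kappa> u)\<^sup>2 = (LBINT r:{0..1}. g r \<bullet> g r)"
proof -
  define f where "f = (SOME g. is_weak_deriv \<kappa> u g)"
  have f: "is_weak_deriv \<kappa> u f" unfolding f_def by (rule someI[where P="is_weak_deriv \<kappa> u", OF g])
  have meas: "(\<lambda>r. indicator {0..1} r *\<^sub>R f r) \<in> borel_measurable lborel" "(\<lambda>r. indicator {0..1} r *\<^sub>R g r) \<in> borel_measurable lborel"
    using f g by (auto simp: is_weak_deriv_def in_L2_def set_borel_measurable_def)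
  have e: "indicator {0..1} r *\<^sub>R (k r \<bullet> k r) = (indicator {0..1} r *\<^sub>R k r) \<bullet> (indicator {0..1} r *\<^sub>R k r)" for k :: "real \<Rightarrow> 'a" and r :: real
    by (simp add: indicator_def)
  have "(LBINT r:{0..1}. f r \<bullet> f r) = (LBINT r:{0..1}. g r \<bullet> g r)"
    unfolding set_lebesgue_integral_def e
  proof (rule integral_cong_AE)
    show "AE r in lborel. (indicator {0..1} r *\<^sub>R f r) \<bullet> (indicator {0..1} r *\<^sub>R f r) = (indicator {0..1} r *\<^sub>R g r) \<bullet> (indicator {0..1} r *\<^sub>R g r)"
      using weak_deriv_unique[OF f g]
    proof eventually_elim
      case (elim r)
      show ?case unfolding elim by (rule refl)
    qed
  qed (rule borel_measurable_inner meas)+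
  moreover have "0 \<le> (LBINT r:{0..1}. f r \<bullet> f r)"
    unfolding set_lebesgue_integral_def by (intro integral_nonneg_AE AE_I2) (simp add: indicator_def)
  ultimately show ?thesis
    by (simp add: h1_seminorm_def f_def[symmetric] l2_norm_def l2_inner_def)
qed

section \<open>Finite element functions and their nodal values\<close>

definition nodal :: "nat \<Rightarrow> (real \<Rightarrow> 'a) \<Rightarrow> nat \<Rightarrow> 'a" where
  "nodal J v j = v (node J j)"

definition affine_piece :: "nat \<Rightarrow> (real \<Rightarrow> 'a::real_vector) \<Rightarrow> nat \<Rightarrow> real \<Rightarrow> 'a" where
  "affine_piece J v j \<rho> = nodal J v j + (real J * \<rho> - real j) *\<^sub>R (nodal J v (Suc j) - nodal J v j)"

definition slope :: "nat \<Rightarrow> (real \<Rightarrow> 'a::real_vector) \<Rightarrow> nat \<Rightarrow> 'a" where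
  "slope J v j = real J *\<^sub>R (nodal J v (Suc j) - nodal J v j)"

abbreviation cell :: "nat \<Rightarrow> nat \<Rightarrow> real set" where
  "cell J j \<equiv> {node J j..node J (Suc j)}"

abbreviation open_cell :: "nat \<Rightarrow> nat \<Rightarrow> real set" where
  "open_cell J j \<equiv> {node J j<..<node J (Suc j)}"

lemma in_cell: "0 < J \<Longrightarrow> \<rho> \<in> cell J j \<longleftrightarrow> real j \<le> real J * \<rho> \<and> real J * \<rho> \<le> real j + 1"
  by (simp add: node_def field_simps)

lemma in_open_cell: "0 < J \<Longrightarrow> \<rho> \<in> open_cell J j \<longleftrightarrow> real j < real J * \<rho> \<and> real J * \<rho> < real j + 1"
  by (simp add: node_def field_simps)

lemma node_0: "node J 0 = 0"
  by (simp add: node_def)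

lemma node_J: "0 < J \<Longrightarrow> node J J = 1"
  by (simp add: node_def)

lemma real_node: "0 < J \<Longrightarrow> real J * node J j = real j"
  by (simp add: node_def)

lemma node_unit: "0 < J \<Longrightarrow> j \<le> J \<Longrightarrow> node J j \<in> {0..1}"
  by (simp add: node_def)

lemma cell_unit: "0 < J \<Longrightarrow> j < J \<Longrightarrow> cell J j \<subseteq> {0..1}"
  using node_unit[of J j] node_unit[of J "Suc j"] by auto

lemma cells_cover:
  assumes "0 < J" "\<rho> \<in> {0..1}"
  obtains j where "j < J" "\<rho> \<in> cell J j"
proof (cases "\<rho> = 1")
  case True
  then have "\<rho> \<in> cell J (J - 1)" unfolding in_cell[OF assms(1)] using assms(1) by (simp add: of_nat_diff)
  then show ?thesis using assms(1) by (intro that[of "J - 1"]) auto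
next
  case False
  define j where "j = nat \<lfloor>real J * \<rho>\<rfloor>"
  have nn: "0 \<le> real J * \<rho>" using assms by simp
  have lt: "real J * \<rho> < real J" using False assms by simp
  have "real j = of_int \<lfloor>real J * \<rho>\<rfloor>" using nn by (simp add: j_def)
  then have j: "real j \<le> real J * \<rho>" "real J * \<rho> \<le> real j + 1" by linarith+
  then have "j < J" using lt by linarith
  then show ?thesis using j in_cell[OF assms(1), of \<rho> j] by (intro that[of j]) auto
qed

lemma open_cells_cover:
  assumes "0 < J" "\<rho> \<in> {0..1}" "\<rho> \<notin> node J ` {..J}"
  obtains j where "j < J" "\<rho> \<in> open_cell J j"
proof -
  obtain j where j: "j < J" "\<rho> \<in> cell J j" using cells_cover[OF assms(1,2)] by blast
  have "\<rho> \<noteq> node J j" "\<rho> \<noteq> node J (Suc j)" using assms(3) j(1) by auto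
  then show ?thesis using j by (intro that[of j]) auto
qed

lemma fe_space_affine:
  assumes v: "v \<in> fe_space \<kappa> J" and J: "0 < J" and j: "j < J" and \<rho>: "\<rho> \<in> cell J j"
  shows "v \<rho> = affine_piece J v j \<rho>"
proof -
  have "\<forall>i\<in>{1..J}. \<exists>a b. \<forall>\<rho>\<in>{node J (i - 1)..node J i}. v \<rho> = a + \<rho> *\<^sub>R b"
    using v by (simp add: fe_space_def)
  moreover have "Suc j \<in> {1..J}" using j by simp
  ultimately have "\<exists>a b. \<forall>\<rho>\<in>{node J (Suc j - 1)..node J (Suc j)}. v \<rho> = a + \<rho> *\<^sub>R b" by blast
  then obtain a b where ab: "\<And>r. r \<in> cell J j \<Longrightarrow> v r = a + r *\<^sub>R b" by auto
  have ends: "node J j \<in> cell J j" "node J (Suc j) \<in> cell J j" by (simp_all add: node_def divide_right_mono)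
  have "nodal J v (Suc j) - nodal J v j = (1 / real J) *\<^sub>R b"
    unfolding nodal_def ab[OF ends(1)] ab[OF ends(2)] by (simp add: node_def add_divide_distrib scaleR_add_left)
  moreover have "(real J * \<rho> - real j) * (1 / real J) = \<rho> - node J j" using J by (simp add: node_def field_simps)
  ultimately show ?thesis
    unfolding affine_piece_def nodal_def ab[OF \<rho>] ab[OF ends(1)] by (simp add: scaleR_diff_left)
qed

lemma fe_space_closed: "v \<in> fe_space Closed_curve J \<Longrightarrow> v 0 = v 1"
  by (simp add: fe_space_def)

lemma fe_space_continuous: "v \<in> fe_space \<kappa> J \<Longrightarrow> continuous_on {0..1} v"
  by (simp add: fe_space_def)

lemma fe_space_combine:
  assumes "u \<in> fe_space \<kappa> J" "v \<in> fe_space \<kappa> J"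
  shows "(\<lambda>\<rho>. r *\<^sub>R u \<rho> + s *\<^sub>R v \<rho>) \<in> fe_space \<kappa> J"
proof -
  have "\<exists>a b. \<forall>\<rho>\<in>{node J (j - 1)..node J j}. r *\<^sub>R u \<rho> + s *\<^sub>R v \<rho> = a + \<rho> *\<^sub>R b" if j: "j \<in> {1..J}" for j
  proof -
    obtain a b where u: "\<forall>\<rho>\<in>{node J (j - 1)..node J j}. u \<rho> = a + \<rho> *\<^sub>R b" using assms(1) j unfolding fe_space_def by blast
    obtain c d where v: "\<forall>\<rho>\<in>{node J (j - 1)..node J j}. v \<rho> = c + \<rho> *\<^sub>R d" using assms(2) j unfolding fe_space_def by blast
    have "r *\<^sub>R u \<rho> + s *\<^sub>R v \<rho> = (r *\<^sub>R a + s *\<^sub>R c) + \<rho> *\<^sub>R (r *\<^sub>R b + s *\<^sub>R d)" if \<rho>: "\<rho> \<in> {node J (j - 1)..node J j}" for \<rho>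
      using bspec[OF u \<rho>] bspec[OF v \<rho>] by (simp add: scaleR_add_right mult.commute add_ac)
    then show ?thesis by blast
  qed
  moreover have "continuous_on {0..1} (\<lambda>\<rho>. r *\<^sub>R u \<rho> + s *\<^sub>R v \<rho>)"
    by (intro continuous_intros fe_space_continuous[OF assms(1)] fe_space_continuous[OF assms(2)])
  ultimately show ?thesis using assms by (simp add: fe_space_def)
qed

lemma fe_space_diff:
  assumes "u \<in> fe_space \<kappa> J" "v \<in> fe_space \<kappa> J"
  shows "(\<lambda>\<rho>. u \<rho> - v \<rho>) \<in> fe_space \<kappa> J"
  using fe_space_combine[OF assms, of 1 "-1"] by simp

text \<open>
  On a cell only the hat functions of its two end points contribute.
\<close>

lemma lagrange_interp_affine:
  assumes J: "0 < J" and j: "j < J" and \<rho>: "\<rho> \<in> cell J j"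
  shows "lagrange_interp J f \<rho> = affine_piece J f j \<rho>"
proof -
  have c: "real j \<le> real J * \<rho>" "real J * \<rho> \<le> real j + 1" using \<rho> unfolding in_cell[OF J] by auto
  have "lagrange_interp J f \<rho> = (\<Sum>i\<in>{j, Suc j}. max 0 (1 - \<bar>real J * \<rho> - real i\<bar>) *\<^sub>R f (node J i))"
    unfolding lagrange_interp_def
  proof (rule sum.mono_neutral_right)
    show "\<forall>i\<in>{0..J} - {j, Suc j}. max 0 (1 - \<bar>real J * \<rho> - real i\<bar>) *\<^sub>R f (node J i) = 0"
    proof
      fix i assume i: "i \<in> {0..J} - {j, Suc j}"
      then consider "Suc i \<le> j" | "Suc (Suc j) \<le> i" by force
      then have "1 - \<bar>real J * \<rho> - real i\<bar> \<le> 0"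
      proof cases
        case 1
        then have "real i + 1 \<le> real j" by linarith
        then show ?thesis using c by linarith
      next
        case 2
        then have "real j + 2 \<le> real i" by linarith
        then show ?thesis using c by linarith
      qed
      then show "max 0 (1 - \<bar>real J * \<rho> - real i\<bar>) *\<^sub>R f (node J i) = 0" by (simp add: max_absorb1)
    qed
  qed (use j in auto)
  also have "\<dots> = (1 - (real J * \<rho> - real j)) *\<^sub>R f (node J j) + (real J * \<rho> - real j) *\<^sub>R f (node J (Suc j))"
  proof -
    have "max 0 (1 - \<bar>real J * \<rho> - real j\<bar>) = 1 - (real J * \<rho> - real j)"
      "max 0 (1 - \<bar>real J * \<rho> - real (Suc j)\<bar>) = real J * \<rho> - real j"
      using c by auto
    then show ?thesis by (simp del: of_nat_Suc)
  qed
  finally show ?thesis by (simp add: affine_piece_def nodal_def algebra_simps)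
qed

lemma nodal_lagrange:
  assumes J: "0 < J" and j: "j \<le> J"
  shows "nodal J (lagrange_interp J f) j = nodal J f j"
proof (cases "j = J")
  case True
  have "node J (Suc (J - 1)) \<in> cell J (J - 1)" by (simp add: node_def divide_right_mono)
  then have "lagrange_interp J f (node J (Suc (J - 1))) = affine_piece J f (J - 1) (node J (Suc (J - 1)))"
    using J by (intro lagrange_interp_affine) auto
  then show ?thesis using True J by (simp add: affine_piece_def nodal_def real_node of_nat_diff)
next
  case False
  have "node J j \<in> cell J j" by (simp add: node_def divide_right_mono)
  then have "lagrange_interp J f (node J j) = affine_piece J f j (node J j)"
    using J j False by (intro lagrange_interp_affine) auto
  then show ?thesis using J by (simp add: affine_piece_def nodal_def real_node)
qed

lemma lagrange_interp_fe:
  assumes J: "0 < J" and closed: "\<kappa> = Closed_curve \<Longrightarrow> f 0 = f 1"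
  shows "lagrange_interp J f \<in> fe_space \<kappa> J"
proof -
  have "continuous_on {0..1} (lagrange_interp J f)"
    unfolding lagrange_interp_def by (intro continuous_intros)
  moreover have "\<exists>a b. \<forall>\<rho>\<in>{node J (j - 1)..node J j}. lagrange_interp J f \<rho> = a + \<rho> *\<^sub>R b" if j: "j \<in> {1..J}" for j
  proof -
    define i where "i = j - 1"
    have ij: "j - 1 = i" "j = Suc i" "i < J" using j by (auto simp: i_def)
    show ?thesis unfolding ij(1) unfolding ij(2)
      by (rule exI[of _ "nodal J f i - real i *\<^sub>R (nodal J f (Suc i) - nodal J f i)"],
          rule exI[of _ "real J *\<^sub>R (nodal J f (Suc i) - nodal J f i)"])
         (simp add: lagrange_interp_affine[OF J ij(3)] affine_piece_def scaleR_diff_left mult.commute)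
  qed
  moreover have "lagrange_interp J f 0 = lagrange_interp J f 1" if "\<kappa> = Closed_curve"
    using nodal_lagrange[OF J, of 0 f] nodal_lagrange[OF J, of J f] closed[OF that] J by (simp add: nodal_def node_0 node_J)
  ultimately show ?thesis by (simp add: fe_space_def)
qed

lemma fe_with_nodal_values:
  fixes a :: "nat \<Rightarrow> 'a::real_normed_vector"
  assumes J: "0 < J" and closed: "\<kappa> = Closed_curve \<Longrightarrow> a 0 = a J"
  obtains v where "v \<in> fe_space \<kappa> J" "\<And>j. j \<le> J \<Longrightarrow> nodal J v j = a j"
proof
  define f where "f r = a (nat (round (real J * r)))" for r
  have f: "nodal J f j = a j" for j using J by (simp add: nodal_def f_def real_node)
  show "lagrange_interp J f \<in> fe_space \<kappa> J"
    using closed f[of 0] f[of J] J by (intro lagrange_interp_fe) (auto simp: nodal_def node_0 node_J)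
  show "nodal J (lagrange_interp J f) j = a j" if "j \<le> J" for j
    using nodal_lagrange[OF J that, of f] f by simp
qed

lemma fe_space_eqI:
  assumes "u \<in> fe_space \<kappa> J" "v \<in> fe_space \<kappa> J" and J: "0 < J"
    and eq: "\<And>j. j \<le> J \<Longrightarrow> nodal J u j = nodal J v j" and \<rho>: "\<rho> \<in> {0..1}"
  shows "u \<rho> = v \<rho>"
proof -
  obtain j where j: "j < J" "\<rho> \<in> cell J j" using cells_cover[OF J \<rho>] by blast
  show ?thesis
    using fe_space_affine[OF assms(1) J j] fe_space_affine[OF assms(2) J j] eq[of j] eq[of "Suc j"] j
    by (simp add: affine_piece_def)
qed

lemma fe_space_derivative:
  assumes v: "v \<in> fe_space \<kappa> J" and J: "0 < J" and j: "j < J" and \<rho>: "\<rho> \<in> open_cell J j"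
  shows "(v has_vector_derivative slope J v j) (at \<rho>)" and "fe_deriv v \<rho> = slope J v j"
proof -
  have "(affine_piece J v j has_vector_derivative slope J v j) (at \<rho>)"
    unfolding affine_piece_def[abs_def] slope_def by (auto intro!: derivative_eq_intros)
  then show d: "(v has_vector_derivative slope J v j) (at \<rho>)"
    by (rule has_vector_derivative_transform_within_open[where S="open_cell J j"])
       (use \<rho> fe_space_affine[OF v J j] in auto)
  then show "fe_deriv v \<rho> = slope J v j" unfolding fe_deriv_def by (rule vector_derivative_at)
qed

text \<open>
  Its values at the nodes are \<open>0\<close>, which integrals do not see.
\<close>

definition step_function :: "nat \<Rightarrow> (nat \<Rightarrow> 'a::real_vector) \<Rightarrow> real \<Rightarrow> 'a" where
  "step_function J c \<rho> = (\<Sum>j<J. indicator (open_cell J j) \<rho> *\<^sub>R c j)"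

lemma step_function_eq:
  assumes J: "0 < J" and j: "j < J" and \<rho>: "\<rho> \<in> open_cell J j"
  shows "step_function J c \<rho> = c j"
proof -
  have "indicator (open_cell J i) \<rho> *\<^sub>R c i = (if i = j then c i else 0)" for i
  proof (cases "i = j")
    case False
    then have "\<rho> \<notin> open_cell J i" using \<rho> unfolding in_open_cell[OF J] by linarith
    then show ?thesis using False by (simp add: indicator_def)
  qed (use \<rho> in simp)
  then show ?thesis using j unfolding step_function_def by simp
qed

lemma step_function_measurable [measurable]:
  fixes c :: "nat \<Rightarrow> 'a::euclidean_space"
  shows "step_function J c \<in> borel_measurable borel"
  unfolding step_function_def[abs_def] by measurable

lemma step_function_integral:
  fixes c :: "nat \<Rightarrow> real"
  assumes J: "0 < J"
  shows "integrable lborel (step_function J c)" and "integral\<^sup>L lborel (step_function J c) = (\<Sum>j<J. c j) / real J"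
proof -
  have i: "integrable lborel (indicator (open_cell J j) :: real \<Rightarrow> real)" for j
  proof (rule integrable_real_indicator)
    have "node J j \<le> node J (Suc j)" by (simp add: node_def divide_right_mono)
    then show "emeasure lborel (open_cell J j) < \<infinity>" by (simp add: emeasure_lborel_Ioo)
  qed simp
  show "integrable lborel (step_function J c)"
    unfolding step_function_def[abs_def] using i by (intro Bochner_Integration.integrable_sum integrable_scaleR_left) auto
  have "measure lborel (open_cell J j) = 1 / real J" for j
    by (simp add: node_def divide_right_mono add_divide_distrib)
  then have "integral\<^sup>L lborel (\<lambda>\<rho>. indicator (open_cell J j) \<rho> *\<^sub>R c j) = c j / real J" for j
    using i[of j] by simp
  then show "integral\<^sup>L lborel (step_function J c) = (\<Sum>j<J. c j) / real J"
    unfolding step_function_def[abs_def] using i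
    by (subst Bochner_Integration.integral_sum) (auto simp: sum_divide_distrib)
qed

lemma integral_piecewise_constant:
  fixes f :: "real \<Rightarrow> real"
  assumes J: "0 < J" and f: "\<And>j \<rho>. j < J \<Longrightarrow> \<rho> \<in> open_cell J j \<Longrightarrow> f \<rho> = c j"
  shows "(LBINT \<rho>:{0..1}. f \<rho>) = (\<Sum>j<J. c j) / real J"
proof -
  have out: "step_function J c \<rho> = 0" if "\<rho> \<notin> {0..1}" for \<rho>
  proof -
    have "\<rho> \<notin> open_cell J j" if "j < J" for j using cell_unit[OF J that] \<open>\<rho> \<notin> {0..1}\<close> by auto
    then show ?thesis by (simp add: step_function_def)
  qed
  have "(LBINT \<rho>:{0..1}. f \<rho>) = integral\<^sup>L lborel (step_function J c)"
    unfolding set_lebesgue_integral_def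
  proof (rule integral_discrete_difference[where X="node J ` {..J}"])
    fix \<rho> assume \<rho>: "\<rho> \<notin> node J ` {..J}"
    show "indicator {0..1} \<rho> *\<^sub>R f \<rho> = step_function J c \<rho>"
    proof (cases "\<rho> \<in> {0..1}")
      case True
      obtain j where j: "j < J" "\<rho> \<in> open_cell J j" using open_cells_cover[OF J True \<rho>] by blast
      show ?thesis using True f[OF j] step_function_eq[OF J j, of c] by simp
    qed (simp add: out)
  qed (auto intro: countable_finite)
  then show ?thesis using step_function_integral[OF J, of c] by simp
qed

lemma integral_piecewise_bound:
  fixes f :: "real \<Rightarrow> real"
  assumes J: "0 < J" and f: "\<And>j \<rho>. j < J \<Longrightarrow> \<rho> \<in> open_cell J j \<Longrightarrow> f \<rho> \<le> c j" and c: "\<And>j. j < J \<Longrightarrow> 0 \<le> c j"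
  shows "(LBINT \<rho>:{0..1}. f \<rho>) \<le> (\<Sum>j<J. c j) / real J"
proof -
  have nonneg: "0 \<le> step_function J c \<rho>" for \<rho> unfolding step_function_def using c by (intro sum_nonneg) auto
  have "(\<integral>\<rho>. indicator {0..1} \<rho> *\<^sub>R f \<rho> \<partial>lborel) \<le> integral\<^sup>L lborel (step_function J c)"
  proof (rule integral_mono_AE')
    have "AE \<rho> in lborel. \<rho> \<notin> node J ` {..J}"
      by (intro AE_not_in countable_imp_null_set_lborel countable_finite finite_imageI finite_atMost)
    then show "AE \<rho> in lborel. indicator {0..1} \<rho> *\<^sub>R f \<rho> \<le> step_function J c \<rho>"
    proof eventually_elim
      case (elim \<rho>)
      show ?case
      proof (cases "\<rho> \<in> {0..1}")
        case True
        obtain j where j: "j < J" "\<rho> \<in> open_cell J j" using open_cells_cover[OF J True elim] by blast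
        show ?thesis using True f[OF j] step_function_eq[OF J j, of c] by simp
      qed (simp add: nonneg)
    qed
  qed (use nonneg step_function_integral[OF J] in auto)
  then show ?thesis using step_function_integral[OF J, of c] by (simp add: set_lebesgue_integral_def)
qed

lemma stiff_slope: "0 < J \<Longrightarrow> stiff J (nodal J u) (nodal J v) = (\<Sum>j<J. slope J u j \<bullet> slope J v j) / real J"
  by (simp add: stiff_def slope_def sum_divide_distrib sum_distrib_left mult_ac)

lemma l2_inner_fe_deriv:
  assumes "u \<in> fe_space \<kappa> J" "v \<in> fe_space \<kappa> J" and J: "0 < J"
  shows "l2_inner (fe_deriv u) (fe_deriv v) = stiff J (nodal J u) (nodal J v)"
  unfolding l2_inner_def stiff_slope[OF J]
  by (rule integral_piecewise_constant[OF J]) (simp add: fe_space_derivative(2)[OF assms(1) J] fe_space_derivative(2)[OF assms(2) J])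

text \<open>
  Within a cell the integrand of the lumped product is the product of affine functions and a constant, so
  its one-sided limits at the nodes are the nodal values.
\<close>

lemma lumped_inner_nodal:
  assumes u: "u \<in> fe_space \<kappa> J" and w: "w \<in> fe_space \<kappa> J" and v: "v \<in> fe_space \<kappa> J" and J: "0 < J"
  shows "lumped_inner J u (\<lambda>\<rho>. (norm (fe_deriv w \<rho>))\<^sup>2 *\<^sub>R v \<rho>)
     = lump J (cell_weight J (nodal J w)) (nodal J u) (nodal J v)"
proof -
  let ?f = "\<lambda>\<rho>. u \<rho> \<bullet> ((norm (fe_deriv w \<rho>))\<^sup>2 *\<^sub>R v \<rho>)"
  let ?W = "cell_weight J (nodal J w)"
  have piece: "?f \<rho> = affine_piece J u j \<rho> \<bullet> (?W j *\<^sub>R affine_piece J v j \<rho>)" if "j < J" "\<rho> \<in> open_cell J j" for j \<rho>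
    using fe_space_affine[OF u J that(1), of \<rho>] fe_space_affine[OF v J that(1), of \<rho>] fe_space_derivative(2)[OF w J that] that(2)
    by (simp add: cell_weight_def slope_def)
  have cont: "isCont (\<lambda>\<rho>. affine_piece J u j \<rho> \<bullet> (?W j *\<^sub>R affine_piece J v j \<rho>)) r" for j :: nat and r :: real
    unfolding affine_piece_def by (intro continuous_intros)
  have lim: "((\<lambda>\<rho>. affine_piece J u j \<rho> \<bullet> (?W j *\<^sub>R affine_piece J v j \<rho>)) \<longlongrightarrow> affine_piece J u j r \<bullet> (?W j *\<^sub>R affine_piece J v j r)) (at r within S)" for j :: nat and r :: real and S
    using cont[of r j] by (auto simp: isCont_def intro: tendsto_within_subset)
  have lt: "node J j < node J (Suc j)" for j using J by (simp add: node_def divide_strict_right_mono)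
  have L: "Lim (at_left (node J (Suc j))) ?f = ?W j * (nodal J u (Suc j) \<bullet> nodal J v (Suc j))" if j: "j < J" for j
  proof -
    have "(?f \<longlongrightarrow> affine_piece J u j (node J (Suc j)) \<bullet> (?W j *\<^sub>R affine_piece J v j (node J (Suc j)))) (at_left (node J (Suc j)))"
    proof (rule Lim_transform_eventually[OF lim])
      show "\<forall>\<^sub>F \<rho> in at_left (node J (Suc j)). affine_piece J u j \<rho> \<bullet> (?W j *\<^sub>R affine_piece J v j \<rho>) = ?f \<rho>"
        using eventually_at_left_real[OF lt[of j]] by eventually_elim (rule piece[OF j, symmetric])
    qed
    then have "Lim (at_left (node J (Suc j))) ?f = affine_piece J u j (node J (Suc j)) \<bullet> (?W j *\<^sub>R affine_piece J v j (node J (Suc j)))"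
      by (intro tendsto_Lim) auto
    then show ?thesis using J by (simp add: affine_piece_def real_node)
  qed
  have R: "Lim (at_right (node J j)) ?f = ?W j * (nodal J u j \<bullet> nodal J v j)" if j: "j < J" for j
  proof -
    have "(?f \<longlongrightarrow> affine_piece J u j (node J j) \<bullet> (?W j *\<^sub>R affine_piece J v j (node J j))) (at_right (node J j))"
    proof (rule Lim_transform_eventually[OF lim])
      show "\<forall>\<^sub>F \<rho> in at_right (node J j). affine_piece J u j \<rho> \<bullet> (?W j *\<^sub>R affine_piece J v j \<rho>) = ?f \<rho>"
        using eventually_at_right_real[OF lt[of j]] by eventually_elim (rule piece[OF j, symmetric])
    qed
    then have "Lim (at_right (node J j)) ?f = affine_piece J u j (node J j) \<bullet> (?W j *\<^sub>R affine_piece J v j (node J j))"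
      by (intro tendsto_Lim) auto
    then show ?thesis using J by (simp add: affine_piece_def real_node)
  qed
  have "lumped_inner J u (\<lambda>\<rho>. (norm (fe_deriv w \<rho>))\<^sup>2 *\<^sub>R v \<rho>) =
      1/2 * (\<Sum>j<J. (1 / real J) * (Lim (at_left (node J (Suc j))) ?f + Lim (at_right (node J j)) ?f))"
    unfolding lumped_inner_def One_nat_def sum.atLeast1_atMost_eq diff_Suc_Suc diff_zero ..
  also have "\<dots> = 1/2 * (\<Sum>j<J. (1 / real J) * (?W j * (nodal J u (Suc j) \<bullet> nodal J v (Suc j)) + ?W j * (nodal J u j \<bullet> nodal J v j)))"
    using L R by simp
  also have "\<dots> = lump J ?W (nodal J u) (nodal J v)"
    by (simp add: lump_def sum_divide_distrib sum_distrib_left distrib_left add_divide_distrib)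
  finally show ?thesis .
qed

lemma nodal_step_cong:
  assumes bd: "bd \<subseteq> {0, J}" and J: "0 < J"
    and eq: "\<And>j. j \<le> J \<Longrightarrow> Y0 j = Z0 j" "\<And>j. j \<le> J \<Longrightarrow> Y1 j = Z1 j" "\<And>j. j \<le> J \<Longrightarrow> Y2 j = Z2 j"
    and step: "nodal_step cl J bd U G \<tau> Y0 Y1 Y2"
  shows "nodal_step cl J bd U G \<tau> Z0 Z1 Z2"
proof -
  have k: "k \<le> J" if "k \<in> bd" for k using bd that by auto
  have h: "vhat Z1 Z0 j = vhat Y1 Y0 j" "bdf Z2 Z1 Z0 j = bdf Y2 Y1 Y0 j" "vbar Z2 Z1 Z0 j = vbar Y2 Y1 Y0 j" if "j \<le> J" for j
    using eq that by (simp_all add: vhat_def bdf_def vbar_def)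
  have sp: "nodal_space cl J bd (\<lambda>k. G (vhat Z1 Z0 k)) = nodal_space cl J bd (\<lambda>k. G (vhat Y1 Y0 k))"
    unfolding nodal_space_def using h(1) k by auto
  have "lump J (cell_weight J (vhat Z1 Z0)) (\<lambda>j. (1 / \<tau>) *\<^sub>R bdf Z2 Z1 Z0 j) \<eta> + stiff J (vbar Z2 Z1 Z0) \<eta>
      = lump J (cell_weight J (vhat Y1 Y0)) (\<lambda>j. (1 / \<tau>) *\<^sub>R bdf Y2 Y1 Y0 j) \<eta> + stiff J (vbar Y2 Y1 Y0) \<eta>" for \<eta>
    by (simp add: lump_def stiff_def cell_weight_def h)
  moreover have "bdf Z2 Z1 Z0 \<in> nodal_space cl J bd (\<lambda>k. G (vhat Y1 Y0 k)) \<longleftrightarrow> bdf Y2 Y1 Y0 \<in> nodal_space cl J bd (\<lambda>k. G (vhat Y1 Y0 k))"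
    using h(2) k by (simp add: nodal_space_def)
  ultimately show ?thesis using step h(1) k unfolding nodal_step_def sp by auto
qed

lemma fe_space_bd_nodal:
  assumes J: "0 < J"
  shows "\<eta> \<in> fe_space_bd \<kappa> J F w \<longleftrightarrow> \<eta> \<in> fe_space \<kappa> J \<and>
    nodal J \<eta> \<in> nodal_space (\<kappa> = Closed_curve) J (if \<kappa> = Closed_curve then {} else {0, J}) (\<lambda>k. grad F (nodal J w k))"
  using fe_space_closed[of \<eta> J]
  by (cases \<kappa>) (auto simp: fe_space_bd_def nodal_space_def nodal_def node_0 node_J[OF J])

lemma nodal_space_cong:
  assumes "bd \<subseteq> {0, J}" "\<And>k. k \<le> J \<Longrightarrow> u k = v k" "\<And>k. k \<le> J \<Longrightarrow> g k = g' k"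
  shows "u \<in> nodal_space cl J bd g \<longleftrightarrow> v \<in> nodal_space cl J bd g'"
proof -
  have "k \<le> J" if "k \<in> bd" for k using assms(1) that by auto
  then show ?thesis using assms(2,3) by (simp add: nodal_space_def)
qed

text \<open>
  The unfiltered iterate is determined on \<open>[0,1]\<close> by the filter formula; all forms depend only on nodal
  values, and every admissible nodal vector is attained by a test function.
\<close>

lemma scheme_step_nodal:
  fixes F :: "'a::euclidean_space \<Rightarrow> real"
  assumes J: "0 < J" and y: "y0 \<in> fe_space \<kappa> J" "y1 \<in> fe_space \<kappa> J" "y2 \<in> fe_space \<kappa> J"
  shows "scheme_step \<kappa> U F J \<tau> y0 y1 y2 \<longleftrightarrow>
    nodal_step (\<kappa> = Closed_curve) J (if \<kappa> = Closed_curve then {} else {0, J}) U (grad F) \<tau> (nodal J y0) (nodal J y1) (nodal J y2)"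
proof -
  let ?cl = "\<kappa> = Closed_curve" and ?bd = "if \<kappa> = Closed_curve then {} else {0, J}"
  let ?Y0 = "nodal J y0" and ?Y1 = "nodal J y1" and ?Y2 = "nodal J y2"
  define yhat where "yhat \<rho> = 2 *\<^sub>R y1 \<rho> - y0 \<rho>" for \<rho>
  define yb where "yb \<rho> = (3/2) *\<^sub>R y2 \<rho> + 1 *\<^sub>R ((-1) *\<^sub>R y1 \<rho> + (1/2) *\<^sub>R y0 \<rho>)" for \<rho>
  have yhat: "yhat \<in> fe_space \<kappa> J" using fe_space_combine[OF y(2,1), of 2 "-1"] by (simp add: yhat_def[abs_def])
  have yb: "yb \<in> fe_space \<kappa> J" unfolding yb_def by (intro fe_space_combine y)
  have nh: "nodal J yhat = vhat ?Y1 ?Y0" by (rule ext) (simp add: nodal_def yhat_def vhat_def)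
  have bdsub: "?bd \<subseteq> {0, J}" by simp
  let ?sp = "nodal_space ?cl J ?bd (\<lambda>k. grad F (vhat ?Y1 ?Y0 k))"
  have inU: "(\<forall>\<rho>\<in>dom_bd \<kappa>. yhat \<rho> \<in> U) \<longleftrightarrow> (\<forall>k\<in>?bd. vhat ?Y1 ?Y0 k \<in> U)"
    unfolding nh[symmetric] by (cases \<kappa>) (simp_all add: nodal_def node_0 node_J[OF J])
  have test: "\<eta> \<in> fe_space_bd \<kappa> J F yhat \<longleftrightarrow> \<eta> \<in> fe_space \<kappa> J \<and> nodal J \<eta> \<in> ?sp" for \<eta>
    unfolding fe_space_bd_nodal[OF J] nh ..
  have nb: "nodal J yb = vbar ?Y2 ?Y1 ?Y0"
    by (rule ext) (simp add: nodal_def yb_def vbar_def)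
  have eqn: "lumped_inner J (\<lambda>\<rho>. (1 / \<tau>) *\<^sub>R (ybar \<rho> - y1 \<rho>)) (\<lambda>\<rho>. (norm (fe_deriv yhat \<rho>))\<^sup>2 *\<^sub>R \<eta> \<rho>) + l2_inner (fe_deriv ybar) (fe_deriv \<eta>)
     = lump J (cell_weight J (vhat ?Y1 ?Y0)) (\<lambda>j. (1 / \<tau>) *\<^sub>R bdf ?Y2 ?Y1 ?Y0 j) (nodal J \<eta>) + stiff J (vbar ?Y2 ?Y1 ?Y0) (nodal J \<eta>)"
    if ybar: "ybar \<in> fe_space \<kappa> J" and \<eta>: "\<eta> \<in> fe_space \<kappa> J" and vals: "\<And>j. j \<le> J \<Longrightarrow> nodal J ybar j = vbar ?Y2 ?Y1 ?Y0 j" for ybar \<eta>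
  proof -
    have d: "(\<lambda>\<rho>. (1 / \<tau>) *\<^sub>R (ybar \<rho> - y1 \<rho>)) \<in> fe_space \<kappa> J"
      using fe_space_combine[OF fe_space_diff[OF ybar y(2)] y(1), of "1 / \<tau>" 0] by simp
    have nd: "nodal J (\<lambda>\<rho>. (1 / \<tau>) *\<^sub>R (ybar \<rho> - y1 \<rho>)) j = (1 / \<tau>) *\<^sub>R bdf ?Y2 ?Y1 ?Y0 j" if "j \<le> J" for j
    proof -
      have "nodal J ybar j - nodal J y1 j = bdf ?Y2 ?Y1 ?Y0 j"
        unfolding vals[OF that] by (rule vec_eqI) (simp add: bdf_def vbar_def inner_simps)
      then show ?thesis by (simp add: nodal_def)
    qed
    have "lump J W (nodal J (\<lambda>\<rho>. (1 / \<tau>) *\<^sub>R (ybar \<rho> - y1 \<rho>))) (nodal J \<eta>) = lump J W (\<lambda>j. (1 / \<tau>) *\<^sub>R bdf ?Y2 ?Y1 ?Y0 j) (nodal J \<eta>)" for W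
      unfolding lump_def using nd by simp
    moreover have "stiff J (nodal J ybar) (nodal J \<eta>) = stiff J (vbar ?Y2 ?Y1 ?Y0) (nodal J \<eta>)"
      unfolding stiff_def using vals by simp
    ultimately show ?thesis
      unfolding lumped_inner_nodal[OF d yhat \<eta> J] l2_inner_fe_deriv[OF ybar \<eta> J] nh by simp
  qed
  have admissible: "(\<lambda>\<rho>. ybar \<rho> - y1 \<rho>) \<in> fe_space_bd \<kappa> J F yhat \<longleftrightarrow> bdf ?Y2 ?Y1 ?Y0 \<in> ?sp"
    if ybar: "ybar \<in> fe_space \<kappa> J" and vals: "\<And>j. j \<le> J \<Longrightarrow> nodal J ybar j = vbar ?Y2 ?Y1 ?Y0 j" for ybar
  proof -
    have "nodal J (\<lambda>\<rho>. ybar \<rho> - y1 \<rho>) j = bdf ?Y2 ?Y1 ?Y0 j" if "j \<le> J" for j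
    proof -
      have "nodal J ybar j - nodal J y1 j = bdf ?Y2 ?Y1 ?Y0 j"
        unfolding vals[OF that] by (rule vec_eqI) (simp add: bdf_def vbar_def inner_simps)
      then show ?thesis by (simp add: nodal_def)
    qed
    then have "nodal J (\<lambda>\<rho>. ybar \<rho> - y1 \<rho>) \<in> ?sp \<longleftrightarrow> bdf ?Y2 ?Y1 ?Y0 \<in> ?sp"
      by (intro nodal_space_cong bdsub) auto
    then show ?thesis unfolding test using fe_space_diff[OF ybar y(2)] by blast
  qed
  show ?thesis
  proof
    assume L: "scheme_step \<kappa> U F J \<tau> y0 y1 y2"
    then obtain ybar where ybar: "ybar \<in> fe_space \<kappa> J" "(\<lambda>\<rho>. ybar \<rho> - y1 \<rho>) \<in> fe_space_bd \<kappa> J F yhat"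
        "\<And>\<eta>. \<eta> \<in> fe_space_bd \<kappa> J F yhat \<Longrightarrow> lumped_inner J (\<lambda>\<rho>. (1 / \<tau>) *\<^sub>R (ybar \<rho> - y1 \<rho>)) (\<lambda>\<rho>. (norm (fe_deriv yhat \<rho>))\<^sup>2 *\<^sub>R \<eta> \<rho>) + l2_inner (fe_deriv ybar) (fe_deriv \<eta>) = 0"
        "\<And>\<rho>. \<rho> \<in> {0..1} \<Longrightarrow> y2 \<rho> = (2/3) *\<^sub>R ybar \<rho> + (2/3) *\<^sub>R y1 \<rho> - (1/3) *\<^sub>R y0 \<rho>" and U: "\<forall>\<rho>\<in>dom_bd \<kappa>. yhat \<rho> \<in> U"
      unfolding scheme_step_def Let_def yhat_def[abs_def] by blast
    have vals: "nodal J ybar j = vbar ?Y2 ?Y1 ?Y0 j" if "j \<le> J" for j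
      by (rule vec_eqI) (simp add: nodal_def vbar_def ybar(4)[OF node_unit[OF J that]] inner_simps field_simps)
    show "nodal_step ?cl J ?bd U (grad F) \<tau> ?Y0 ?Y1 ?Y2"
      unfolding nodal_step_def
    proof (intro conjI ballI)
      show "vhat ?Y1 ?Y0 k \<in> U" if "k \<in> ?bd" for k using U inU that by blast
      show "bdf ?Y2 ?Y1 ?Y0 \<in> ?sp" using admissible[OF ybar(1) vals] ybar(2) by blast
      fix \<eta> assume \<eta>: "\<eta> \<in> ?sp"
      then obtain v where v: "v \<in> fe_space \<kappa> J" "\<And>j. j \<le> J \<Longrightarrow> nodal J v j = \<eta> j"
        using fe_with_nodal_values[OF J, of \<kappa> \<eta>] unfolding nodal_space_def by blast
      have "nodal J v \<in> ?sp \<longleftrightarrow> \<eta> \<in> ?sp" using v(2) by (intro nodal_space_cong bdsub) auto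
      then have "v \<in> fe_space_bd \<kappa> J F yhat" using test v(1) \<eta> by blast
      then have "lump J (cell_weight J (vhat ?Y1 ?Y0)) (\<lambda>j. (1 / \<tau>) *\<^sub>R bdf ?Y2 ?Y1 ?Y0 j) (nodal J v) + stiff J (vbar ?Y2 ?Y1 ?Y0) (nodal J v) = 0"
        using ybar(3) eqn[OF ybar(1) v(1) vals] by simp
      moreover have "lump J W u (nodal J v) = lump J W u \<eta>" "stiff J u (nodal J v) = stiff J u \<eta>" for W u
        unfolding lump_def stiff_def using v(2) by simp_all
      ultimately show "lump J (cell_weight J (vhat ?Y1 ?Y0)) (\<lambda>j. (1 / \<tau>) *\<^sub>R bdf ?Y2 ?Y1 ?Y0 j) \<eta> + stiff J (vbar ?Y2 ?Y1 ?Y0) \<eta> = 0"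
        by simp
    qed
  next
    assume R: "nodal_step ?cl J ?bd U (grad F) \<tau> ?Y0 ?Y1 ?Y2"
    have vals: "nodal J yb j = vbar ?Y2 ?Y1 ?Y0 j" if "j \<le> J" for j unfolding nb ..
    show "scheme_step \<kappa> U F J \<tau> y0 y1 y2"
      unfolding scheme_step_def Let_def yhat_def[abs_def, symmetric]
    proof (intro conjI bexI[of _ yb] ballI)
      show "yhat \<rho> \<in> U" if "\<rho> \<in> dom_bd \<kappa>" for \<rho> using R inU that unfolding nodal_step_def by blast
      show "(\<lambda>\<rho>. yb \<rho> - y1 \<rho>) \<in> fe_space_bd \<kappa> J F yhat"
        using admissible[OF yb vals] R unfolding nodal_step_def by blast
      show "lumped_inner J (\<lambda>\<rho>. (1 / \<tau>) *\<^sub>R (yb \<rho> - y1 \<rho>)) (\<lambda>\<rho>. (norm (fe_deriv yhat \<rho>))\<^sup>2 *\<^sub>R \<eta> \<rho>) + l2_inner (fe_deriv yb) (fe_deriv \<eta>) = 0"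
        if \<eta>: "\<eta> \<in> fe_space_bd \<kappa> J F yhat" for \<eta>
        using eqn[OF yb _ vals, of \<eta>] R \<eta> unfolding test nodal_step_def by auto
      show "y2 \<rho> = (2/3) *\<^sub>R yb \<rho> + (2/3) *\<^sub>R y1 \<rho> - (1/3) *\<^sub>R y0 \<rho>" for \<rho>
        by (rule vec_eqI) (simp add: yb_def inner_simps field_simps)
    qed (rule yb)
  qed
qed

section \<open>Sobolev norms of the error\<close>

text \<open>
  The error is continuous and differentiable away from the nodes, so its pointwise derivative is a weak
  derivative.
\<close>

lemma h1_seminorm_minus_fe:
  fixes f :: "real \<Rightarrow> 'a::euclidean_space"
  assumes J: "0 < J" and v: "v \<in> fe_space \<kappa> J" and closed: "\<kappa> = Closed_curve \<Longrightarrow> f 0 = f 1"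
    and f: "\<And>\<rho>. \<rho> \<in> {0..1} \<Longrightarrow> (f has_vector_derivative f' \<rho>) (at \<rho> within {0..1})" and f': "continuous_on {0..1} f'"
  shows "(h1_seminorm \<kappa> (\<lambda>\<rho>. f \<rho> - v \<rho>))\<^sup>2 = (LBINT \<rho>:{0..1}. (norm (f' \<rho> - step_function J (slope J v) \<rho>))\<^sup>2)"
proof -
  have "bounded (f' ` {0..1})" using f' by (intro compact_imp_bounded compact_continuous_image) auto
  then obtain C where C: "\<forall>\<rho>\<in>{0..1}. norm (f' \<rho>) \<le> C" unfolding bounded_iff by auto
  have "is_weak_deriv \<kappa> (\<lambda>\<rho>. f \<rho> - v \<rho>) (\<lambda>\<rho>. f' \<rho> - step_function J (slope J v) \<rho>)"
  proof (rule is_weak_derivI[where N="node J ` {..J}" and C="C + (\<Sum>j<J. norm (slope J v j))"])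
    have "continuous_on {0..1} f"
      using f by (meson continuous_on_eq_continuous_within has_vector_derivative_continuous)
    then show "continuous_on {0..1} (\<lambda>\<rho>. f \<rho> - v \<rho>)" by (intro continuous_intros fe_space_continuous[OF v])
    show "f 0 - v 0 = f 1 - v 1" if "\<kappa> = Closed_curve" using closed[OF that] fe_space_closed v that by metis
    show "((\<lambda>\<rho>. f \<rho> - v \<rho>) has_vector_derivative f' r - step_function J (slope J v) r) (at r)" if r: "r \<in> {0<..<1} - node J ` {..J}" for r
    proof -
      have r01: "r \<in> {0..1}" "r \<notin> node J ` {..J}" using r by auto
      obtain j where j: "j < J" "r \<in> open_cell J j" using open_cells_cover[OF J r01] by blast
      have "(f has_vector_derivative f' r) (at r)" using f[OF r01(1)] r at_within_Icc_at[of 0 r 1] by simp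
      then show ?thesis
        unfolding step_function_eq[OF J j] by (intro has_vector_derivative_diff fe_space_derivative(1)[OF v J j])
    qed
    have "(\<lambda>\<rho>. indicator {0..1} \<rho> *\<^sub>R f' \<rho> - indicator {0..1} \<rho> *\<^sub>R step_function J (slope J v) \<rho>) \<in> borel_measurable borel"
    proof (rule borel_measurable_diff)
      show "(\<lambda>\<rho>. indicator {0..1} \<rho> *\<^sub>R f' \<rho>) \<in> borel_measurable borel"
        by (intro borel_measurable_continuous_on_indicator f') simp
      show "(\<lambda>\<rho>. indicator {0..1} \<rho> *\<^sub>R step_function J (slope J v) \<rho>) \<in> borel_measurable borel"
        by (intro borel_measurable_scaleR step_function_measurable) simp
    qed
    then show "set_borel_measurable lborel {0..1} (\<lambda>\<rho>. f' \<rho> - step_function J (slope J v) \<rho>)"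
      by (simp add: set_borel_measurable_def scaleR_diff_right)
    show "norm (f' r - step_function J (slope J v) r) \<le> C + (\<Sum>j<J. norm (slope J v j))" if r: "r \<in> {0..1}" for r
    proof -
      have "norm (step_function J (slope J v) r) \<le> (\<Sum>j<J. norm (slope J v j))"
        unfolding step_function_def by (rule sum_norm_le) (simp add: indicator_def)
      then show ?thesis using C r norm_triangle_ineq4[of "f' r" "step_function J (slope J v) r"] by force
    qed
  qed simp
  from h1_seminorm_eq[OF this] show ?thesis by (simp add: power2_norm_eq_inner)
qed

lemma h1_seminorm_fe:
  fixes v :: "real \<Rightarrow> 'a::euclidean_space"
  assumes J: "0 < J" and v: "v \<in> fe_space \<kappa> J"
  shows "(h1_seminorm \<kappa> v)\<^sup>2 = stiff_sq J (nodal J v)"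
proof -
  have "(\<lambda>\<rho>. (-1) *\<^sub>R v \<rho> + 0 *\<^sub>R v \<rho>) \<in> fe_space \<kappa> J" by (rule fe_space_combine[OF v v])
  then have v': "(\<lambda>\<rho>. - v \<rho>) \<in> fe_space \<kappa> J" by simp
  have "(h1_seminorm \<kappa> (\<lambda>\<rho>. 0 - - v \<rho>))\<^sup>2 = (LBINT \<rho>:{0..1}. (norm (0 - step_function J (slope J (\<lambda>\<rho>. - v \<rho>)) \<rho>))\<^sup>2)"
    by (rule h1_seminorm_minus_fe[OF J v']) (auto intro!: derivative_eq_intros)
  also have "\<dots> = (\<Sum>j<J. (norm (slope J v j))\<^sup>2) / real J"
  proof (rule integral_piecewise_constant[OF J])
    fix j \<rho> assume j: "j < J" "\<rho> \<in> open_cell J j"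
    have "slope J (\<lambda>\<rho>. - v \<rho>) j = - slope J v j" by (simp add: slope_def nodal_def algebra_simps)
    then show "(norm (0 - step_function J (slope J (\<lambda>\<rho>. - v \<rho>)) \<rho>))\<^sup>2 = (norm (slope J v j))\<^sup>2"
      unfolding step_function_eq[OF J j] by simp
  qed
  finally show ?thesis unfolding stiff_slope[OF J] by (simp add: power2_norm_eq_inner)
qed

lemma l2_norm_sq: "(l2_norm u)\<^sup>2 = (LBINT \<rho>:{0..1}. (norm (u \<rho>))\<^sup>2)"
proof -
  have "0 \<le> l2_inner u u"
    unfolding l2_inner_def set_lebesgue_integral_def by (intro integral_nonneg_AE AE_I2) (simp add: indicator_def)
  then show ?thesis by (simp add: l2_norm_def l2_inner_def power2_norm_eq_inner)
qed

lemma integral_affine_sq: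
  fixes a d :: "'a::euclidean_space"
  assumes J: "0 < J"
  shows "((\<lambda>\<rho>. (norm (a + (real J * \<rho> - real j) *\<^sub>R d))\<^sup>2) has_integral (a \<bullet> a + a \<bullet> d + (d \<bullet> d) / 3) / real J) (cell J j)"
proof -
  define P where "P \<rho> = ((real J * \<rho> - real j) * (a \<bullet> a) + (real J * \<rho> - real j)\<^sup>2 * (a \<bullet> d) + (real J * \<rho> - real j) ^ 3 * (d \<bullet> d) / 3) / real J" for \<rho>
  have "((\<lambda>\<rho>. (norm (a + (real J * \<rho> - real j) *\<^sub>R d))\<^sup>2) has_integral (P (node J (Suc j)) - P (node J j))) (cell J j)"
  proof (rule fundamental_theorem_of_calculus)
    show "node J j \<le> node J (Suc j)" by (simp add: node_def divide_right_mono)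
    fix \<rho>
    have "(P has_real_derivative (norm (a + (real J * \<rho> - real j) *\<^sub>R d))\<^sup>2) (at \<rho>)"
      unfolding P_def[abs_def] power2_norm_eq_inner using J
      by (auto intro!: derivative_eq_intros simp: inner_simps inner_commute field_simps power2_eq_square)
    then show "(P has_vector_derivative (norm (a + (real J * \<rho> - real j) *\<^sub>R d))\<^sup>2) (at \<rho> within cell J j)"
      by (simp add: has_real_derivative_iff_has_vector_derivative has_vector_derivative_at_within)
  qed
  moreover have "P (node J (Suc j)) - P (node J j) = (a \<bullet> a + a \<bullet> d + (d \<bullet> d) / 3) / real J"
    unfolding P_def real_node[OF J] by simp
  ultimately show ?thesis by simp
qed

text \<open>
  On a cell with end values \<open>a\<close> and \<open>b\<close> the integral of the square is
  \<open>h (\<bar>a\<bar>\<^sup>2 + a\<bullet>b + \<bar>b\<bar>\<^sup>2) / 3 \<ge> h (\<bar>a\<bar>\<^sup>2 + \<bar>b\<bar>\<^sup>2) / 6\<close>, a third of the trapezoidal rule.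
\<close>

lemma lump_sq_le_l2_norm:
  fixes v :: "real \<Rightarrow> 'a::euclidean_space"
  assumes J: "0 < J" and v: "v \<in> fe_space \<kappa> J"
  shows "lump_sq J (nodal J v) \<le> 3 * (l2_norm v)\<^sup>2"
proof -
  let ?f = "\<lambda>\<rho>. (norm (v \<rho>))\<^sup>2"
  have cont: "continuous_on {0..1} ?f" by (intro continuous_intros fe_space_continuous[OF v])
  have cell: "((nodal J v j \<bullet> nodal J v j) + (nodal J v (Suc j) \<bullet> nodal J v (Suc j))) / (6 * real J) \<le> integral (cell J j) ?f" if j: "j < J" for j
  proof -
    let ?a = "nodal J v j" and ?b = "nodal J v (Suc j)"
    have "(?f has_integral (?a \<bullet> ?a + ?a \<bullet> (?b - ?a) + ((?b - ?a) \<bullet> (?b - ?a)) / 3) / real J) (cell J j)"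
      by (rule has_integral_eq[OF _ integral_affine_sq[OF J, of ?a j "?b - ?a"]])
         (use fe_space_affine[OF v J j] in \<open>simp add: affine_piece_def\<close>)
    then have "integral (cell J j) ?f = (?a \<bullet> ?a + ?a \<bullet> (?b - ?a) + ((?b - ?a) \<bullet> (?b - ?a)) / 3) / real J"
      by (rule integral_unique)
    moreover have "(?a \<bullet> ?a + ?b \<bullet> ?b) / 6 \<le> ?a \<bullet> ?a + ?a \<bullet> (?b - ?a) + ((?b - ?a) \<bullet> (?b - ?a)) / 3"
      using inner_ge_zero[of "?a + ?b"] by (simp add: inner_simps inner_commute[of ?b ?a] field_simps)
    then have "(?a \<bullet> ?a + ?b \<bullet> ?b) / 6 / real J \<le> (?a \<bullet> ?a + ?a \<bullet> (?b - ?a) + ((?b - ?a) \<bullet> (?b - ?a)) / 3) / real J"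
      by (rule divide_right_mono) simp
    ultimately show ?thesis by (simp add: mult.commute)
  qed
  have "(\<Sum>j<k. ((nodal J v j \<bullet> nodal J v j) + (nodal J v (Suc j) \<bullet> nodal J v (Suc j))) / (6 * real J)) \<le> integral {0..node J k} ?f" if "k \<le> J" for k
    using that
  proof (induction k)
    case (Suc k)
    have sub: "{0..node J (Suc k)} \<subseteq> {0..1}" using node_unit[OF J Suc.prems] by auto
    have "integral {0..node J k} ?f + integral (cell J k) ?f = integral {0..node J (Suc k)} ?f"
    proof (rule Henstock_Kurzweil_Integration.integral_combine)
      show "?f integrable_on {0..node J (Suc k)}"
        by (rule integrable_continuous_real[OF continuous_on_subset[OF cont sub]])
    qed (simp_all add: node_def divide_right_mono)
    then show ?case using Suc.IH cell[of k] Suc.prems by simp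
  qed (simp add: node_0)
  from this[of J] have "(\<Sum>j<J. ((nodal J v j \<bullet> nodal J v j) + (nodal J v (Suc j) \<bullet> nodal J v (Suc j))) / (6 * real J)) \<le> integral {0..1} ?f"
    by (simp add: node_J[OF J])
  also have "integral {0..1} ?f = (l2_norm v)\<^sup>2"
    unfolding l2_norm_sq by (rule set_borel_integral_eq_integral(2)[OF borel_integrable_atLeastAtMost'[OF cont], symmetric])
  finally have "3 * (\<Sum>j<J. ((nodal J v j \<bullet> nodal J v j) + (nodal J v (Suc j) \<bullet> nodal J v (Suc j))) / (6 * real J)) \<le> 3 * (l2_norm v)\<^sup>2"
    by simp
  moreover have "lump_sq J (nodal J v) = 3 * (\<Sum>j<J. ((nodal J v j \<bullet> nodal J v j) + (nodal J v (Suc j) \<bullet> nodal J v (Suc j))) / (6 * real J))"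
    by (simp add: lump_def sum_divide_distrib[symmetric] add.commute)
  ultimately show ?thesis by simp
qed

text \<open>
  Taylor's formula at \<open>\<rho>\<close> is applied to both end points of the cell: in the affine interpolant the first
  order terms cancel.
\<close>

lemma interpolation_error:
  fixes f :: "nat \<Rightarrow> real \<Rightarrow> 'a::euclidean_space"
  assumes J: "0 < J" and j: "j < J" and \<rho>: "\<rho> \<in> cell J j"
    and der: "\<And>i \<rho>. \<rho> \<in> {0..1} \<Longrightarrow> (f i has_vector_derivative f (Suc i) \<rho>) (at \<rho> within {0..1})"
    and bound: "\<And>\<rho>. \<rho> \<in> {0..1} \<Longrightarrow> norm (f 2 \<rho>) \<le> B"
  shows "norm (f 0 \<rho> - affine_piece J (f 0) j \<rho>) \<le> B * (1 / real J)\<^sup>2"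
    and "norm (f 1 \<rho> - slope J (f 0) j) \<le> 2 * B * (1 / real J)"
proof -
  have \<rho>01: "\<rho> \<in> {0..1}" using cell_unit[OF J j] \<rho> by blast
  have B: "0 \<le> B" using bound[OF \<rho>01] norm_ge_zero order_trans by blast
  define s where "s = real J * \<rho> - real j"
  have s: "0 \<le> s" "s \<le> 1" using \<rho> unfolding in_cell[OF J] s_def by auto
  let ?a = "node J j" and ?b = "node J (Suc j)"
  define R where "R r = f 0 r - f 0 \<rho> - (r - \<rho>) *\<^sub>R f 1 \<rho>" for r
  have R: "norm (R r) \<le> B * (1 / real J)\<^sup>2" if r: "r \<in> cell J j" for r
  proof -
    have r01: "r \<in> {0..1}" using cell_unit[OF J j] r by blast
    have "norm (f 0 r - (\<Sum>i<2. ((r - \<rho>) ^ i / fact i) *\<^sub>R f i \<rho>)) \<le> B * \<bar>r - \<rho>\<bar> ^ 2"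
      by (rule taylor_bound[where lo=0 and hi=1]) (use der bound r01 \<rho>01 in auto)
    also have "\<dots> \<le> B * (1 / real J)\<^sup>2"
    proof (intro mult_left_mono power_mono B)
      have "\<bar>r - \<rho>\<bar> \<le> ?b - ?a" using r \<rho> by auto
      then show "\<bar>r - \<rho>\<bar> \<le> 1 / real J" by (simp add: node_def add_divide_distrib)
    qed simp
    finally show ?thesis by (simp add: R_def numeral_2_eq_2 diff_diff_eq)
  qed
  have ends: "?a \<in> cell J j" "?b \<in> cell J j" by (simp_all add: node_def divide_right_mono)
  have e: "real J * (?a - \<rho>) = - s" "real J * (?b - \<rho>) = 1 - s" using J by (simp_all add: s_def right_diff_distrib real_node)
  have e': "?a - \<rho> = - s / real J" "?b - \<rho> = (1 - s) / real J" using e J by (simp_all add: field_simps)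
  have "f 0 \<rho> - affine_piece J (f 0) j \<rho> = - ((1 - s) *\<^sub>R R ?a + s *\<^sub>R R ?b)"
    unfolding R_def e' affine_piece_def nodal_def s_def[symmetric] by (rule vec_eqI) (simp add: inner_simps algebra_simps add_divide_distrib diff_divide_distrib)
  then have "norm (f 0 \<rho> - affine_piece J (f 0) j \<rho>) = norm ((1 - s) *\<^sub>R R ?a + s *\<^sub>R R ?b)"
    by (simp only: norm_minus_cancel)
  also have "\<dots> \<le> (1 - s) * norm (R ?a) + s * norm (R ?b)"
    using norm_triangle_ineq[of "(1 - s) *\<^sub>R R ?a" "s *\<^sub>R R ?b"] s by simp
  also have "\<dots> \<le> (1 - s) * (B * (1 / real J)\<^sup>2) + s * (B * (1 / real J)\<^sup>2)"
    using s R[OF ends(1)] R[OF ends(2)] by (intro add_mono mult_left_mono) auto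
  finally show "norm (f 0 \<rho> - affine_piece J (f 0) j \<rho>) \<le> B * (1 / real J)\<^sup>2" by (simp add: algebra_simps)
  have "f 1 \<rho> - slope J (f 0) j = real J *\<^sub>R (R ?a - R ?b)"
  proof -
    have "R ?a - R ?b = (f 0 ?a - f 0 ?b) + (1 / real J) *\<^sub>R f 1 \<rho>"
      unfolding R_def e' by (rule vec_eqI) (simp add: inner_simps diff_divide_distrib algebra_simps)
    then have "real J *\<^sub>R (R ?a - R ?b) = real J *\<^sub>R (f 0 ?a - f 0 ?b) + f 1 \<rho>"
      using J by (simp add: scaleR_add_right)
    then show ?thesis by (simp add: slope_def nodal_def scaleR_diff_right)
  qed
  then have "norm (f 1 \<rho> - slope J (f 0) j) = real J * norm (R ?a - R ?b)" by simp
  also have "\<dots> \<le> real J * (2 * B * (1 / real J)\<^sup>2)"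
    using norm_triangle_ineq4[of "R ?a" "R ?b"] R[OF ends(1)] R[OF ends(2)] by (intro mult_left_mono) auto
  finally show "norm (f 1 \<rho> - slope J (f 0) j) \<le> 2 * B * (1 / real J)" using J by (simp add: power2_eq_square)
qed

lemma norm_add_sq_le: "norm a \<le> \<alpha> \<Longrightarrow> (norm (a + b))\<^sup>2 \<le> 2 * \<alpha>\<^sup>2 + 2 * (norm (b :: 'a::real_inner))\<^sup>2"
proof -
  assume a: "norm a \<le> \<alpha>"
  have "(norm (a + b))\<^sup>2 + (norm (a - b))\<^sup>2 = 2 * (norm a)\<^sup>2 + 2 * (norm b)\<^sup>2"
    by (simp add: power2_norm_eq_inner inner_simps inner_commute)
  moreover have "(norm a)\<^sup>2 \<le> \<alpha>\<^sup>2" using a by (intro power_mono) auto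
  ultimately show ?thesis using zero_le_power2[of "norm (a - b)"] by linarith
qed

text \<open>
  The error of a function is split into the interpolation error and the piecewise affine function with
  the nodal errors as values.
\<close>

lemma error_norms:
  fixes f :: "nat \<Rightarrow> real \<Rightarrow> 'a::euclidean_space"
  assumes J: "0 < J" and v: "v \<in> fe_space \<kappa> J" and closed: "\<kappa> = Closed_curve \<Longrightarrow> f 0 0 = f 0 1"
    and der: "\<And>i \<rho>. \<rho> \<in> {0..1} \<Longrightarrow> (f i has_vector_derivative f (Suc i) \<rho>) (at \<rho> within {0..1})"
    and bound: "\<And>\<rho>. \<rho> \<in> {0..1} \<Longrightarrow> norm (f 2 \<rho>) \<le> B"
  defines "e \<equiv> \<lambda>j. nodal J (f 0) j - nodal J v j"
  shows "(l2_norm (\<lambda>\<rho>. f 0 \<rho> - v \<rho>))\<^sup>2 \<le> 2 * B\<^sup>2 * (1 / real J) ^ 4 + 4 * lump_sq J e"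
    and "(h1_seminorm \<kappa> (\<lambda>\<rho>. f 0 \<rho> - v \<rho>))\<^sup>2 \<le> 8 * B\<^sup>2 * (1 / real J)\<^sup>2 + 2 * stiff_sq J e"
proof -
  define \<alpha> where "\<alpha> = B * (1 / real J)\<^sup>2"
  define \<beta> where "\<beta> = 2 * B * (1 / real J)"
  have "(LBINT \<rho>:{0..1}. (norm (f 0 \<rho> - v \<rho>))\<^sup>2) \<le> (\<Sum>j<J. 2 * \<alpha>\<^sup>2 + 2 * ((norm (e (Suc j)))\<^sup>2 + (norm (e j))\<^sup>2)) / real J"
  proof (rule integral_piecewise_bound[OF J])
    fix j \<rho> assume j: "j < J" "\<rho> \<in> open_cell J j"
    have \<rho>: "\<rho> \<in> cell J j" using j by auto
    define s where "s = real J * \<rho> - real j"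
    have s: "0 \<le> s" "s \<le> 1" using \<rho> unfolding in_cell[OF J] s_def by auto
    have eq: "f 0 \<rho> - v \<rho> = (f 0 \<rho> - affine_piece J (f 0) j \<rho>) + ((1 - s) *\<^sub>R e j + s *\<^sub>R e (Suc j))"
      unfolding fe_space_affine[OF v J j(1) \<rho>] affine_piece_def s_def[symmetric] e_def
      by (rule vec_eqI) (simp add: inner_simps algebra_simps)
    have "norm ((1 - s) *\<^sub>R e j + s *\<^sub>R e (Suc j)) \<le> (1 - s) * norm (e j) + s * norm (e (Suc j))"
      using norm_triangle_ineq[of "(1 - s) *\<^sub>R e j" "s *\<^sub>R e (Suc j)"] s by simp
    then have "(norm ((1 - s) *\<^sub>R e j + s *\<^sub>R e (Suc j)))\<^sup>2 \<le> ((1 - s) * norm (e j) + s * norm (e (Suc j)))\<^sup>2"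
      by (intro power_mono) auto
    also have "\<dots> \<le> (1 - s) * (norm (e j))\<^sup>2 + s * (norm (e (Suc j)))\<^sup>2"
    proof -
      have "0 \<le> s * (1 - s) * (norm (e j) - norm (e (Suc j)))\<^sup>2" using s by simp
      then show ?thesis by (simp add: power2_eq_square algebra_simps)
    qed
    also have "\<dots> \<le> 1 * (norm (e j))\<^sup>2 + 1 * (norm (e (Suc j)))\<^sup>2" using s by (intro add_mono mult_right_mono) auto
    finally have "(norm ((1 - s) *\<^sub>R e j + s *\<^sub>R e (Suc j)))\<^sup>2 \<le> (norm (e (Suc j)))\<^sup>2 + (norm (e j))\<^sup>2" by simp
    moreover have "norm (f 0 \<rho> - affine_piece J (f 0) j \<rho>) \<le> \<alpha>"
      unfolding \<alpha>_def by (rule interpolation_error(1)[where f=f, OF J j(1) \<rho> der bound])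
    ultimately show "(norm (f 0 \<rho> - v \<rho>))\<^sup>2 \<le> 2 * \<alpha>\<^sup>2 + 2 * ((norm (e (Suc j)))\<^sup>2 + (norm (e j))\<^sup>2)"
      unfolding eq using norm_add_sq_le[of "f 0 \<rho> - affine_piece J (f 0) j \<rho>" \<alpha> "(1 - s) *\<^sub>R e j + s *\<^sub>R e (Suc j)"]
      unfolding distrib_left by linarith
  qed simp
  also have "\<dots> = 2 * \<alpha>\<^sup>2 + 4 * lump_sq J e"
    using J by (simp add: lump_def sum.distrib add_divide_distrib sum_distrib_left[symmetric] power2_norm_eq_inner)
  finally show "(l2_norm (\<lambda>\<rho>. f 0 \<rho> - v \<rho>))\<^sup>2 \<le> 2 * B\<^sup>2 * (1 / real J) ^ 4 + 4 * lump_sq J e"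
    unfolding l2_norm_sq \<alpha>_def power_mult_distrib power_mult[symmetric] by simp
  have c1: "continuous_on {0..1} (f 1)"
    using der[of _ 1] by (meson continuous_on_eq_continuous_within has_vector_derivative_continuous)
  have "(h1_seminorm \<kappa> (\<lambda>\<rho>. f 0 \<rho> - v \<rho>))\<^sup>2 = (LBINT \<rho>:{0..1}. (norm (f 1 \<rho> - step_function J (slope J v) \<rho>))\<^sup>2)"
    by (rule h1_seminorm_minus_fe[OF J v closed]) (use der[of _ 0] c1 in auto)
  also have "\<dots> \<le> (\<Sum>j<J. 2 * \<beta>\<^sup>2 + 2 * (norm (slope J (f 0) j - slope J v j))\<^sup>2) / real J"
  proof (rule integral_piecewise_bound[OF J])
    fix j \<rho> assume j: "j < J" "\<rho> \<in> open_cell J j"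
    have \<rho>: "\<rho> \<in> cell J j" using j by auto
    have "norm (f 1 \<rho> - slope J (f 0) j) \<le> \<beta>"
      unfolding \<beta>_def by (rule interpolation_error(2)[where f=f, OF J j(1) \<rho> der bound])
    from norm_add_sq_le[OF this, of "slope J (f 0) j - slope J v j"]
    show "(norm (f 1 \<rho> - step_function J (slope J v) \<rho>))\<^sup>2 \<le> 2 * \<beta>\<^sup>2 + 2 * (norm (slope J (f 0) j - slope J v j))\<^sup>2"
      unfolding step_function_eq[OF J j] by simp
  qed simp
  also have "\<dots> = 2 * \<beta>\<^sup>2 + 2 * stiff_sq J e"
  proof -
    have "(norm (slope J (f 0) j - slope J v j))\<^sup>2 = real J * real J * ((e (Suc j) - e j) \<bullet> (e (Suc j) - e j))" for j
    proof -
      have "slope J (f 0) j - slope J v j = real J *\<^sub>R (e (Suc j) - e j)"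
        by (rule vec_eqI) (simp add: slope_def e_def inner_simps algebra_simps)
      then show ?thesis by (simp add: power2_norm_eq_inner[symmetric] power_mult_distrib power2_eq_square)
    qed
    then show ?thesis using J by (simp add: stiff_def sum.distrib add_divide_distrib sum_distrib_left[symmetric])
  qed
  finally show "(h1_seminorm \<kappa> (\<lambda>\<rho>. f 0 \<rho> - v \<rho>))\<^sup>2 \<le> 8 * B\<^sup>2 * (1 / real J)\<^sup>2 + 2 * stiff_sq J e"
    unfolding \<beta>_def power_mult_distrib by simp
qed

section \<open>The smooth flow satisfies the assumptions of the nodal analysis\<close>

lemma flow_on_boundary:
  fixes x :: "real \<Rightarrow> real \<Rightarrow> 'a::euclidean_space"
  assumes dom: "level_set_domain \<Omega> U F" and init: "\<forall>\<rho>\<in>dom_bd \<kappa>. x0 \<rho> \<in> U \<and> F (x0 \<rho>) = 0"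
    and sol: "solves_P \<kappa> \<Omega> T x0 x" and \<rho>: "\<rho> \<in> dom_bd \<kappa>" and t: "t \<in> {0..T}"
  shows "x \<rho> t \<in> frontier \<Omega>"
proof (cases "t = 0")
  case True
  have "\<rho> \<in> dom_cl \<kappa>" using \<rho> by (cases \<kappa>) auto
  then have "x \<rho> 0 = x0 \<rho>" using sol by (simp add: solves_P_def)
  then show ?thesis using init \<rho> dom True by (auto simp: level_set_domain_def)
next
  case False
  then show ?thesis using sol \<rho> t by (auto simp: solves_P_def)
qed

text \<open>
  In the open case, differentiating \<open>F(x) = 0\<close> in time shows that the velocity is tangential. The
  tangential part of \<open>x\<^sub>\<rho>\<close> belongs to the tangent space, so by the boundary condition it is orthogonal to
  \<open>x\<^sub>\<rho>\<close>, hence to itself.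
\<close>

theorem bd_flow_of_solution:
  fixes x :: "real \<Rightarrow> real \<Rightarrow> 'a::euclidean_space"
  assumes dom: "level_set_domain \<Omega> U F" and T: "0 < T"
    and init: "\<forall>\<rho>\<in>dom_bd \<kappa>. x0 \<rho> \<in> U \<and> F (x0 \<rho>) = 0"
    and flow: "smooth_curve_flow \<kappa> T x" and sol: "solves_P \<kappa> \<Omega> T x0 x"
    and c0: "0 < c0" and sp: "\<forall>\<rho>\<in>dom_int \<kappa>. \<forall>t\<in>{0..T}. c0 \<le> norm (D_rho \<kappa> x \<rho> t)"
  obtains B H r0 CF where "bd_flow (flow_deriv \<kappa> T x) T B (\<kappa> = Closed_curve) U (grad F) H c0 r0 CF"
proof -
  define X where "X = flow_deriv \<kappa> T x"
  obtain B where B: "1 \<le> B" "\<And>i k \<rho> t. i \<le> 4 \<Longrightarrow> k \<le> 4 \<Longrightarrow> \<rho> \<in> {0..1} \<Longrightarrow> t \<in> {0..T} \<Longrightarrow> norm (X i k \<rho> t) \<le> B"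
    using flow_deriv_bounded[OF T flow] unfolding X_def by blast
  have X0: "X 0 0 = x" unfolding X_def by (rule flow_deriv_0[OF T flow])
  have cl: "\<rho> \<in> dom_cl \<kappa>" if "\<rho> \<in> {0..1}" for \<rho> using dom_cl_unit(1)[of \<kappa>] that by blast
  have der_t: "(X i k \<rho> has_vector_derivative X i (Suc k) \<rho> t) (at t within {0..T})" if "\<rho> \<in> {0..1}" "t \<in> {0..T}" for i k \<rho> t
    unfolding X_def by (rule flow_deriv_t[OF T flow cl[OF that(1)] that(2)])
  have smooth: "smooth_flow X T B"
  proof (rule smooth_flow.intro)
    show "((\<lambda>r. X i 0 r t) has_vector_derivative X (Suc i) 0 \<rho> t) (at \<rho> within {0..1})" if "\<rho> \<in> {0..1}" "t \<in> {0..T}" for i \<rho> t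
      unfolding X_def
      by (rule has_vector_derivative_within_subset[OF flow_deriv_rho[OF T flow cl[OF that(1)] that(2)] dom_cl_unit(1)])
    show "(norm (X 1 0 \<rho> t))\<^sup>2 *\<^sub>R X 0 1 \<rho> t = X 2 0 \<rho> t" if "\<rho> \<in> {0..1}" "t \<in> {0<..T}" for \<rho> t
      unfolding X_def by (rule flow_equation[OF T flow sol that])
  qed (use B der_t in auto)
  have speed: "c0 \<le> norm (X 1 0 \<rho> t)" if "\<rho> \<in> {0..1}" "t \<in> {0..T}" for \<rho> t
    unfolding X_def by (rule flow_speed[OF T flow sp that])
  show thesis
  proof (cases \<kappa>)
    case Closed_curve
    have per: "X i k 0 t = X i k 1 t" if "t \<in> {0..T}" for i k t
      using flow_deriv_periodic[OF T flow Closed_curve that, of i k 0] unfolding X_def by simp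
    have "bd_flow X T B (\<kappa> = Closed_curve) U (grad F) (\<lambda>_ _ u. u) c0 1 1"
      by (intro bd_flow.intro bd_flow_axioms.intro smooth) (simp_all add: Closed_curve T c0 speed[simplified] per)
    then show thesis unfolding X_def by (rule that)
  next
    case Open_curve
    have fr: "x \<rho> t \<in> frontier \<Omega>" if "\<rho> \<in> {0, 1}" "t \<in> {0..T}" for \<rho> t
      by (rule flow_on_boundary[OF dom init sol _ that(2)]) (use that(1) Open_curve in simp)
    have U: "open U" and C3: "Ck_on 3 U F" and frU: "frontier \<Omega> = {z\<in>U. F z = 0}" and n1: "\<And>z. z \<in> frontier \<Omega> \<Longrightarrow> norm (grad F z) = 1"
      using dom by (auto simp: level_set_domain_def)
    define K where "K = x 0 ` {0..T} \<union> x 1 ` {0..T}"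
    have cont: "continuous_on {0..T} (x \<rho>)" if "\<rho> \<in> {0..1}" for \<rho>
      unfolding X0[symmetric] using der_t[OF that] by (meson continuous_on_eq_continuous_within has_vector_derivative_continuous)
    have K: "compact K" "K \<subseteq> U"
    proof -
      show "compact K" unfolding K_def by (intro compact_Un compact_continuous_image cont) auto
      show "K \<subseteq> U" unfolding K_def using fr frU by auto
    qed
    have xK: "x \<rho> t \<in> K" if "\<rho> \<in> {0, 1}" "t \<in> {0..T}" for \<rho> t using that by (auto simp: K_def)
    show thesis
    proof (rule grad_estimates[OF U C3 K, of T])
    fix r C assume r: "0 < r" and C: "1 \<le> C"
      and near: "\<And>z y. z \<in> K \<Longrightarrow> norm (y - z) \<le> r \<Longrightarrow>
         y \<in> U \<and> norm (grad F y - grad F z - hess U F z (y - z)) \<le> C * (norm (y - z))\<^sup>2"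
      and hbound: "\<And>z u. z \<in> K \<Longrightarrow> norm (hess U F z u) \<le> C * norm u"
      and lip: "\<And>y y' B s t u. (\<And>t. t \<in> {0..T} \<Longrightarrow> y t \<in> K) \<Longrightarrow> (\<And>t. t \<in> {0..T} \<Longrightarrow> (y has_vector_derivative y' t) (at t within {0..T})) \<Longrightarrow>
         (\<And>t. t \<in> {0..T} \<Longrightarrow> norm (y' t) \<le> B) \<Longrightarrow> s \<in> {0..T} \<Longrightarrow> t \<in> {0..T} \<Longrightarrow>
         norm (hess U F (y s) u - hess U F (y t) u) \<le> C * B * \<bar>s - t\<bar> * norm u \<and> norm (grad F (y s) - grad F (y t)) \<le> C * B * \<bar>s - t\<bar>"
    have CB: "C \<le> C * B" using B(1) C by simp
    have lip': "norm (hess U F (x \<rho> s) u - hess U F (x \<rho> t) u) \<le> C * B * \<bar>s - t\<bar> * norm u \<and> norm (grad F (x \<rho> s) - grad F (x \<rho> t)) \<le> C * B * \<bar>s - t\<bar>"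
      if "\<rho> \<in> {0, 1}" "s \<in> {0..T}" "t \<in> {0..T}" for \<rho> s t u
    proof (rule lip[where y'="X 0 1 \<rho>"])
      show "(x \<rho> has_vector_derivative X 0 1 \<rho> t) (at t within {0..T})" if "t \<in> {0..T}" for t
        using der_t[of \<rho> t 0 0] X0 that \<open>\<rho> \<in> {0, 1}\<close> by auto
      show "norm (X 0 1 \<rho> t) \<le> B" if "t \<in> {0..T}" for t using B(2)[of 0 1 \<rho> t] that \<open>\<rho> \<in> {0, 1}\<close> by auto
    qed (use xK that in auto)
    have "bd_flow X T B (\<kappa> = Closed_curve) U (grad F) (\<lambda>\<rho> t. hess U F (x \<rho> t)) c0 r (C * B)"
    proof (intro bd_flow.intro bd_flow_axioms.intro smooth)
      show "1 \<le> C * B" using CB C by linarith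
      show "y \<in> U \<and> norm (grad F y - grad F (X 0 0 \<rho> t) - hess U F (x \<rho> t) (y - X 0 0 \<rho> t)) \<le> C * B * (norm (y - X 0 0 \<rho> t))\<^sup>2"
        if "\<rho> \<in> {0, 1}" "t \<in> {0..T}" "norm (y - X 0 0 \<rho> t) \<le> r" for \<rho> t y
      proof -
        have "C * (norm (y - x \<rho> t))\<^sup>2 \<le> C * B * (norm (y - x \<rho> t))\<^sup>2" by (rule mult_right_mono[OF CB]) simp
        then show ?thesis using near[OF xK[OF that(1,2)], of y] that(3) unfolding X0 by force
      qed
      show "norm (hess U F (x \<rho> t) u) \<le> C * B * norm u" if "\<rho> \<in> {0, 1}" "t \<in> {0..T}" for \<rho> t u
        using hbound[OF xK[OF that], of u] mult_right_mono[OF CB, of "norm u"] by simp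
      show "linear (hess U F (x \<rho> t))" for \<rho> t by (rule linear_hess[OF U C3])
      show "hess U F (x \<rho> t) u \<bullet> v = u \<bullet> hess U F (x \<rho> t) v" if "\<rho> \<in> {0, 1}" "t \<in> {0..T}" for \<rho> t u v
        by (rule hess_symmetric[OF U C3]) (use xK[OF that] K in auto)
      show "norm (grad F (X 0 0 \<rho> t)) = 1" if "\<rho> \<in> {0, 1}" "t \<in> {0..T}" for \<rho> t
        unfolding X0 by (rule n1[OF fr[OF that]])
      show "X 1 0 \<rho> t = (X 1 0 \<rho> t \<bullet> grad F (X 0 0 \<rho> t)) *\<^sub>R grad F (X 0 0 \<rho> t)" if \<rho>t: "\<rho> \<in> {0, 1}" "t \<in> {0<..T}" for \<rho> t
      proof -
        have t: "t \<in> {0..T}" using \<rho>t by auto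
        define n where "n = grad F (x \<rho> t)"
        have nn: "n \<bullet> n = 1" using n1[OF fr[OF \<rho>t(1) t]] by (simp add: n_def norm_eq_1)
        define v where "v = X 1 0 \<rho> t - (X 1 0 \<rho> t \<bullet> n) *\<^sub>R n"
        have vn: "v \<bullet> n = 0" by (simp add: v_def inner_simps nn)
        have "v \<in> tangent_space (frontier \<Omega>) (x \<rho> t)"
          by (rule level_set_tangent[OF dom fr[OF \<rho>t(1) t]]) (use vn in \<open>simp add: n_def\<close>)
        moreover have "\<rho> \<in> dom_bd \<kappa>" "\<rho> \<in> dom_cl \<kappa>" using \<rho>t Open_curve by auto
        ultimately have "D_rho \<kappa> x \<rho> t \<bullet> v = 0" using sol \<rho>t(2) unfolding solves_P_def by blast
        then have "X 1 0 \<rho> t \<bullet> v = 0" unfolding X_def using D_rho_eq[OF T flow \<open>\<rho> \<in> dom_cl \<kappa>\<close> t] by simp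
        then have "v \<bullet> v = 0" using vn by (simp add: v_def inner_simps inner_commute)
        then show ?thesis unfolding X0 n_def[symmetric] by (simp add: v_def)
      qed
      show "X 0 1 \<rho> t \<bullet> grad F (X 0 0 \<rho> t) = 0" if \<rho>t: "\<rho> \<in> {0, 1}" "t \<in> {0<..T}" for \<rho> t
      proof -
        have t: "t \<in> {0..T}" using \<rho>t by auto
        have xU: "x \<rho> t \<in> U" using xK[OF \<rho>t(1) t] K by blast
        have "(x \<rho> has_derivative (\<lambda>h. h *\<^sub>R X 0 1 \<rho> t)) (at t within {0..T})"
          using der_t[of \<rho> t 0 0] X0 t \<rho>t(1) unfolding has_vector_derivative_def by auto
        then have "((\<lambda>s. F (x \<rho> s)) has_derivative (\<lambda>h. (h *\<^sub>R X 0 1 \<rho> t) \<bullet> grad F (x \<rho> t))) (at t within {0..T})"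
          by (rule has_derivative_compose[where f="x \<rho>" and x=t and g=F and g'="\<lambda>h. h \<bullet> grad F (x \<rho> t)", OF _ grad_eq(2)[OF U C3 xU]])
        then have d1: "((\<lambda>s. F (x \<rho> s)) has_vector_derivative (X 0 1 \<rho> t \<bullet> grad F (x \<rho> t))) (at t within {0..T})"
          by (simp add: has_vector_derivative_def)
        have d2: "((\<lambda>s. F (x \<rho> s)) has_vector_derivative 0) (at t within {0..T})"
          by (rule has_vector_derivative_transform[OF t _ has_vector_derivative_const])
             (use fr[OF \<rho>t(1)] frU in auto)
        show ?thesis unfolding X0 by (rule vector_derivative_unique_within[OF at_within_time[OF T t] d1 d2])
      qed
      show "norm (hess U F (x \<rho> s) u - hess U F (x \<rho> t) u) \<le> C * B * \<bar>s - t\<bar> * norm u" if "\<rho> \<in> {0, 1}" "s \<in> {0..T}" "t \<in> {0..T}" for \<rho> s t u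
        using lip'[OF that] by blast
      show "norm (grad F (X 0 0 \<rho> s) - grad F (X 0 0 \<rho> t)) \<le> C * B * \<bar>s - t\<bar>" if "\<rho> \<in> {0, 1}" "s \<in> {0..T}" "t \<in> {0..T}" for \<rho> s t
        unfolding X0 using lip'[OF that] by blast
    qed (simp_all add: Open_curve T c0 r speed[simplified])
    then show thesis unfolding X_def by (rule that)
    qed
  qed
qed

section \<open>Convergence of the finite element scheme\<close>

text \<open>
  The first \<open>n\<close> levels of a solution of the scheme with step size \<open>\<tau>\<close>, as needed to construct a solution
  level by level.
\<close>

definition scheme_path :: "curve_type \<Rightarrow> 'a::euclidean_space set \<Rightarrow> ('a \<Rightarrow> real) \<Rightarrow> nat \<Rightarrow> real \<Rightarrow>
    (real \<Rightarrow> 'a) \<Rightarrow> (real \<Rightarrow> 'a) \<Rightarrow> nat \<Rightarrow> (nat \<Rightarrow> real \<Rightarrow> 'a) \<Rightarrow> bool" where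
  "scheme_path \<kappa> U F J \<tau> xh0 xh1 n xh \<longleftrightarrow>
     (\<forall>m\<le>n. xh m \<in> fe_space \<kappa> J) \<and>
     (\<forall>\<rho>\<in>{0..1}. xh 0 \<rho> = xh0 \<rho> \<and> xh 1 \<rho> = xh1 \<rho>) \<and>
     (\<forall>m\<in>{1..<n}. scheme_step \<kappa> U F J \<tau> (xh (m - 1)) (xh m) (xh (m + 1)))"

lemma scheme_path_nodal:
  fixes F :: "'a::euclidean_space \<Rightarrow> real"
  assumes path: "scheme_path \<kappa> U F J \<tau> xh0 xh1 n xh" and J: "0 < J"
    and Y0: "\<And>j. j \<le> J \<Longrightarrow> nodal J xh0 j = Y0 j"
  shows "nodal_path (\<kappa> = Closed_curve) J (if \<kappa> = Closed_curve then {} else {0, J}) U (grad F) \<tau> Y0 (nodal J xh1) n (\<lambda>m. nodal J (xh m))"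
  unfolding nodal_path_def
proof (intro conjI allI impI ballI)
  have fe: "xh m \<in> fe_space \<kappa> J" if "m \<le> n" for m using path that by (simp add: scheme_path_def)
  have init: "xh 0 \<rho> = xh0 \<rho> \<and> xh 1 \<rho> = xh1 \<rho>" if "\<rho> \<in> {0..1}" for \<rho> using path that by (simp add: scheme_path_def)
  show "nodal J (xh 0) j = Y0 j" "nodal J (xh 1) j = nodal J xh1 j" if "j \<le> J" for j
    using init[OF node_unit[OF J that]] Y0[OF that] by (simp_all add: nodal_def)
  show "nodal J (xh m) 0 = nodal J (xh m) J" if "\<kappa> = Closed_curve" "m \<le> n" for m
    using fe_space_closed[of "xh m" J] fe[OF that(2)] that(1) by (simp add: nodal_def node_0 node_J[OF J])
  fix m assume m: "m \<in> {1..<n}"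
  then have "scheme_step \<kappa> U F J \<tau> (xh (m - 1)) (xh m) (xh (m + 1))" using path by (simp add: scheme_path_def)
  then show "nodal_step (\<kappa> = Closed_curve) J (if \<kappa> = Closed_curve then {} else {0, J}) U (grad F) \<tau> (nodal J (xh (m - 1))) (nodal J (xh m)) (nodal J (xh (m + 1)))"
    by (rule iffD1[OF scheme_step_nodal[OF J], rotated 3]) (use m in \<open>auto intro: fe\<close>)
qed

lemma scheme_path_mono: "scheme_path \<kappa> U F J \<tau> xh0 xh1 n xh \<Longrightarrow> m \<le> n \<Longrightarrow> scheme_path \<kappa> U F J \<tau> xh0 xh1 m xh"
  by (auto simp: scheme_path_def)

theorem theorem2p4:
  fixes \<kappa> :: curve_type
    and \<Omega> U :: "(real ^ 'n) set"
    and F :: "real ^ 'n \<Rightarrow> real"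
    and x :: "real \<Rightarrow> real \<Rightarrow> real ^ 'n"
    and x0 :: "real \<Rightarrow> real ^ 'n"
    and T c0 C0 cstar :: real
  assumes "CARD('n) \<ge> 2"
    and "level_set_domain \<Omega> U F"
    and "T > 0"
    and "\<forall>\<rho>\<in>dom_bd \<kappa>. x0 \<rho> \<in> U \<and> F (x0 \<rho>) = 0"
    and "smooth_curve_flow \<kappa> T x"
    and "solves_P \<kappa> \<Omega> T x0 x"
    and "c0 > 0" and "C0 > 0"
    and "\<forall>\<rho>\<in>dom_int \<kappa>. \<forall>t\<in>{0..T}. c0 \<le> norm (D_rho \<kappa> x \<rho> t) \<and> norm (D_rho \<kappa> x \<rho> t) \<le> C0"
    and "cstar > 0"
  shows "\<exists>h0>0. \<exists>\<gamma>>0. \<exists>c>0. \<forall>(J::nat) (M::nat) (h::real) (\<Delta>t::real).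
    J \<ge> 2 \<longrightarrow> M \<ge> 1 \<longrightarrow> h = 1 / real J \<longrightarrow> \<Delta>t = T / real M \<longrightarrow>
    h \<le> h0 \<longrightarrow> \<Delta>t \<le> \<gamma> * sqrt h \<longrightarrow>
    (\<forall>xh1 \<in> fe_space \<kappa> J.
       (h1_norm \<kappa> (\<lambda>\<rho>. lagrange_interp J (\<lambda>r. x r \<Delta>t) \<rho> - xh1 \<rho>))\<^sup>2 \<le> cstar * (h ^ 4 + \<Delta>t ^ 4) \<longrightarrow>
       (\<exists>xh. solves_S \<kappa> U F J M T (lagrange_interp J x0) xh1 xh \<and>
          (\<forall>yh. solves_S \<kappa> U F J M T (lagrange_interp J x0) xh1 yh \<longrightarrow>
             (\<forall>m\<le>M. \<forall>\<rho>\<in>{0..1}. yh m \<rho> = xh m \<rho>)) \<and>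
          (MAX m\<in>{0..M}. (l2_norm (\<lambda>\<rho>. x \<rho> (real m * \<Delta>t) - xh m \<rho>))\<^sup>2)
            \<le> c * (h ^ 4 + \<Delta>t ^ 4) \<and>
          (MAX m\<in>{0..M}. (h1_seminorm \<kappa> (\<lambda>\<rho>. x \<rho> (real m * \<Delta>t) - xh m \<rho>))\<^sup>2)
            \<le> c * (h ^ 2 + \<Delta>t ^ 4)))"
proof -
  note T = assms(3) and flow = assms(5) and sol = assms(6)
  have sp: "\<forall>\<rho>\<in>dom_int \<kappa>. \<forall>t\<in>{0..T}. c0 \<le> norm (D_rho \<kappa> x \<rho> t)" using assms(9) by blast
  define X where "X = flow_deriv \<kappa> T x"
  obtain B H r0 CF where "bd_flow (flow_deriv \<kappa> T x) T B (\<kappa> = Closed_curve) U (grad F) H c0 r0 CF"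
    by (rule bd_flow_of_solution[OF assms(2) T assms(4) flow sol assms(7) sp])
  then have inst: "bd_flow X T B (\<kappa> = Closed_curve) U (grad F) H c0 r0 CF" by (simp only: X_def)
  interpret bd_flow X T B "\<kappa> = Closed_curve" U "grad F" H c0 r0 CF by (rule inst)
  have X0: "X 0 0 = x" unfolding X_def by (rule flow_deriv_0[OF T flow])
  define c1 where "c1 = 3 * cstar"
  have "0 \<le> c1" using assms(10) by (simp add: c1_def)
  from nodal_convergence[OF this] obtain h0 \<gamma> K where pos: "0 < h0" "0 < \<gamma>" "0 < K" and
    conv: "\<forall>J M Y1. 2 \<le> J \<longrightarrow> 1 \<le> M \<longrightarrow> 1 / real J \<le> h0 \<longrightarrow> T / real M \<le> \<gamma> * sqrt (1 / real J) \<longrightarrow>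
       h1_sq J (\<lambda>j. xnode J (T / real M) j - Y1 j) \<le> c1 * ((1 / real J)\<^sup>2 + (T / real M)\<^sup>2)\<^sup>2 \<longrightarrow>
       (\<forall>n Y. n \<le> M \<longrightarrow> nodal_path (\<kappa> = Closed_curve) J (bdn J) U (grad F) (T / real M) (xnode J 0) Y1 n Y \<longrightarrow>
         (\<forall>m\<le>n. h1_sq J (\<lambda>j. xnode J (real m * (T / real M)) j - Y m j) \<le> K * ((1 / real J)\<^sup>2 + (T / real M)\<^sup>2)\<^sup>2) \<and>
         (1 \<le> n \<and> n < M \<longrightarrow> (\<exists>Y2. nodal_step (\<kappa> = Closed_curve) J (bdn J) U (grad F) (T / real M) (Y (n - 1)) (Y n) Y2 \<and>
            (\<kappa> = Closed_curve \<longrightarrow> Y2 0 = Y2 J) \<and>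
            (\<forall>Y2'. nodal_step (\<kappa> = Closed_curve) J (bdn J) U (grad F) (T / real M) (Y (n - 1)) (Y n) Y2' \<longrightarrow> (\<forall>k\<le>J. Y2' k = Y2 k)))))"
    by (elim exE conjE) (rule that)
  define c where "c = 8 * B\<^sup>2 + 8 * K"
  have c: "0 < c" using pos by (simp add: c_def add_nonneg_pos)
  show ?thesis
  proof (rule exI[of _ h0], rule conjI[OF pos(1)], rule exI[of _ \<gamma>], rule conjI[OF pos(2)],
      rule exI[of _ c], rule conjI[OF c], intro allI impI ballI)
    fix J M :: nat and h \<Delta>t :: real and xh1 :: "real \<Rightarrow> real ^ 'n"
    assume J2: "2 \<le> J" and M: "1 \<le> M" and h: "h = 1 / real J" and \<Delta>t: "\<Delta>t = T / real M"
      and small: "h \<le> h0" "\<Delta>t \<le> \<gamma> * sqrt h" and xh1: "xh1 \<in> fe_space \<kappa> J"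
      and start: "(h1_norm \<kappa> (\<lambda>\<rho>. lagrange_interp J (\<lambda>r. x r \<Delta>t) \<rho> - xh1 \<rho>))\<^sup>2 \<le> cstar * (h ^ 4 + \<Delta>t ^ 4)"
    have J: "0 < J" using J2 by simp
    have times: "real m * \<Delta>t \<in> {0..T}" if "m \<le> M" for m
      using that M T mult_right_mono[of "real m" "real M" "T / real M"] by (simp add: \<Delta>t)
    then have t1: "\<Delta>t \<in> {0..T}" using M times[of 1] by simp
    have per: "x 0 t = x 1 t" if "\<kappa> = Closed_curve" "t \<in> {0..T}" for t
      using periodic[OF that, of 0 0] by (simp add: X0)
    have x0: "x0 \<rho> = x \<rho> 0" if "\<rho> \<in> {0..1}" for \<rho>
      using sol that dom_cl_unit(1)[of \<kappa>] by (auto simp: solves_P_def)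
    have I0: "lagrange_interp J x0 \<in> fe_space \<kappa> J"
      using per[of 0] T by (intro lagrange_interp_fe[OF J]) (simp add: x0)
    have nodal0: "nodal J (lagrange_interp J x0) j = xnode J 0 j" if "j \<le> J" for j
      unfolding nodal_lagrange[OF J that] using x0[OF node_unit[OF J that]] by (simp add: nodal_def xnode_def X0)
    define D where "D = h\<^sup>2 + \<Delta>t\<^sup>2"
    have "D\<^sup>2 = h ^ 4 + 2 * (h\<^sup>2 * \<Delta>t\<^sup>2) + \<Delta>t ^ 4" "(h\<^sup>2 - \<Delta>t\<^sup>2)\<^sup>2 = h ^ 4 - 2 * (h\<^sup>2 * \<Delta>t\<^sup>2) + \<Delta>t ^ 4"
      by (simp_all add: D_def power2_eq_square power4_eq_xxxx algebra_simps)
    moreover have "0 \<le> h\<^sup>2 * \<Delta>t\<^sup>2" by simp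
    ultimately have D: "h ^ 4 + \<Delta>t ^ 4 \<le> D\<^sup>2" "D\<^sup>2 \<le> 2 * (h ^ 4 + \<Delta>t ^ 4)"
      using zero_le_power2[of "h\<^sup>2 - \<Delta>t\<^sup>2"] unfolding distrib_left by linarith+
    have bdn_eq: "bdn J = (if \<kappa> = Closed_curve then {} else {0, J})" by (rule bdn_def)
    have E1: "h1_sq J (\<lambda>j. xnode J \<Delta>t j - nodal J xh1 j) \<le> c1 * D\<^sup>2"
    proof -
      define d where "d \<rho> = lagrange_interp J (\<lambda>r. x r \<Delta>t) \<rho> - xh1 \<rho>" for \<rho>
      have d: "d \<in> fe_space \<kappa> J"
        unfolding d_def using per t1 by (intro fe_space_diff lagrange_interp_fe J xh1)
      have nd: "nodal J d j = xnode J \<Delta>t j - nodal J xh1 j" if "j \<le> J" for j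
        using nodal_lagrange[OF J that, of "\<lambda>r. x r \<Delta>t"] by (simp add: d_def nodal_def xnode_def X0)
      have "h1_sq J (\<lambda>j. xnode J \<Delta>t j - nodal J xh1 j) = stiff_sq J (nodal J d) + lump_sq J (nodal J d)"
        unfolding h1_sq_def[symmetric] by (rule h1_sq_cong) (simp add: nd)
      also have "\<dots> \<le> (h1_seminorm \<kappa> d)\<^sup>2 + 3 * (l2_norm d)\<^sup>2"
        unfolding h1_seminorm_fe[OF J d] using lump_sq_le_l2_norm[OF J d] by simp
      also have "\<dots> \<le> 3 * (h1_norm \<kappa> d)\<^sup>2" by (simp add: h1_norm_def)
      also have "\<dots> \<le> 3 * (cstar * (h ^ 4 + \<Delta>t ^ 4))" using start by (simp add: d_def[abs_def])
      also have "\<dots> \<le> c1 * D\<^sup>2" using D(1) assms(10) by (simp add: c1_def)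
      finally show ?thesis .
    qed
    note conv1 = conv[THEN spec[where x=J], THEN spec[where x=M], THEN spec[where x="nodal J xh1"], THEN mp[OF _ J2], THEN mp[OF _ M],
        THEN mp[OF _ small(1)[unfolded h]], THEN mp[OF _ small(2)[unfolded \<Delta>t h]], THEN mp[OF _ E1[unfolded D_def h \<Delta>t]]]
    have conv': "(\<forall>m\<le>n. h1_sq J (\<lambda>j. xnode J (real m * \<Delta>t) j - Y m j) \<le> K * D\<^sup>2) \<and>
         (1 \<le> n \<and> n < M \<longrightarrow> (\<exists>Y2. nodal_step (\<kappa> = Closed_curve) J (bdn J) U (grad F) \<Delta>t (Y (n - 1)) (Y n) Y2 \<and>
            (\<kappa> = Closed_curve \<longrightarrow> Y2 0 = Y2 J) \<and>
            (\<forall>Y2'. nodal_step (\<kappa> = Closed_curve) J (bdn J) U (grad F) \<Delta>t (Y (n - 1)) (Y n) Y2' \<longrightarrow> (\<forall>k\<le>J. Y2' k = Y2 k))))"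
      if "n \<le> M" "nodal_path (\<kappa> = Closed_curve) J (bdn J) U (grad F) \<Delta>t (xnode J 0) (nodal J xh1) n Y" for n Y
      unfolding D_def h \<Delta>t
      by (rule conv1[THEN spec[where x=n], THEN spec[where x=Y], THEN mp[OF _ that(1)], THEN mp[OF _ that(2)[unfolded \<Delta>t]]])
    let ?path = "scheme_path \<kappa> U F J \<Delta>t (lagrange_interp J x0) xh1"
    have nodal_path: "nodal_path (\<kappa> = Closed_curve) J (bdn J) U (grad F) \<Delta>t (xnode J 0) (nodal J xh1) n (\<lambda>m. nodal J (xh m))"
      if "?path n xh" for n xh
      unfolding bdn_eq by (rule scheme_path_nodal[OF that J nodal0])
    have solves: "solves_S \<kappa> U F J M T (lagrange_interp J x0) xh1 xh \<longleftrightarrow> ?path M xh" for xh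
      by (simp add: solves_S_def scheme_path_def \<Delta>t)
    have "\<exists>xh. ?path n xh" if "1 \<le> n" "n \<le> M" for n
      using that
    proof (induction n rule: nat_induct_at_least)
      case base
      show ?case
        by (rule exI[of _ "\<lambda>m. if m = 0 then lagrange_interp J x0 else xh1"]) (simp add: scheme_path_def I0 xh1)
    next
      case (Suc n)
      then obtain xh where xh: "?path n xh" by auto
      have fe: "xh m \<in> fe_space \<kappa> J" if "m \<le> n" for m using xh that by (simp add: scheme_path_def)
      have "\<exists>Y2. nodal_step (\<kappa> = Closed_curve) J (bdn J) U (grad F) \<Delta>t (nodal J (xh (n - 1))) (nodal J (xh n)) Y2 \<and>
          (\<kappa> = Closed_curve \<longrightarrow> Y2 0 = Y2 J)"
        using conv'[OF _ nodal_path[OF xh]] Suc by auto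
      then obtain Y2 where Y2: "nodal_step (\<kappa> = Closed_curve) J (bdn J) U (grad F) \<Delta>t (nodal J (xh (n - 1))) (nodal J (xh n)) Y2"
        "\<kappa> = Closed_curve \<Longrightarrow> Y2 0 = Y2 J" by blast
      obtain y2 where y2: "y2 \<in> fe_space \<kappa> J" "\<And>j. j \<le> J \<Longrightarrow> nodal J y2 j = Y2 j"
        by (rule fe_with_nodal_values[where \<kappa>=\<kappa> and a=Y2, OF J Y2(2)]) (simp_all add: that)
      have "nodal_step (\<kappa> = Closed_curve) J (bdn J) U (grad F) \<Delta>t (nodal J (xh (n - 1))) (nodal J (xh n)) (nodal J y2)"
        by (rule nodal_step_cong[OF _ J _ _ _ Y2(1)]) (use y2(2) in \<open>auto simp: bdn_eq\<close>)
      then have step: "scheme_step \<kappa> U F J \<Delta>t (xh (n - 1)) (xh n) y2"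
        unfolding bdn_eq by (rule iffD2[OF scheme_step_nodal[OF J fe fe y2(1)], rotated 2]) simp_all
      have "?path (Suc n) (xh(Suc n := y2))"
        unfolding scheme_path_def
      proof (intro conjI allI impI ballI)
        show "(xh(Suc n := y2)) m \<in> fe_space \<kappa> J" if "m \<le> Suc n" for m using that fe y2(1) by simp
        show "(xh(Suc n := y2)) 0 \<rho> = lagrange_interp J x0 \<rho>" "(xh(Suc n := y2)) 1 \<rho> = xh1 \<rho>" if "\<rho> \<in> {0..1}" for \<rho>
          using xh that Suc.hyps by (auto simp: scheme_path_def)
        fix m assume m: "m \<in> {1..<Suc n}"
        show "scheme_step \<kappa> U F J \<Delta>t ((xh(Suc n := y2)) (m - 1)) ((xh(Suc n := y2)) m) ((xh(Suc n := y2)) (m + 1))"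
        proof (cases "m = n")
          case True
          have "n - 1 \<noteq> Suc n" by linarith
          then show ?thesis using step True by simp
        next
          case False
          then have mn: "m \<in> {1..<n}" using m by auto
          then have "m - 1 \<noteq> Suc n" "m \<noteq> Suc n" "m + 1 \<noteq> Suc n" by auto
          moreover have "scheme_step \<kappa> U F J \<Delta>t (xh (m - 1)) (xh m) (xh (m + 1))"
            using xh mn unfolding scheme_path_def by blast
          ultimately show ?thesis by (simp only: fun_upd_apply if_False)
        qed
      qed
      then show ?case by blast
    qed
    then obtain xh where xh: "?path M xh" using M by blast
    have fe: "xh m \<in> fe_space \<kappa> J" if "m \<le> M" for m using xh that by (simp add: scheme_path_def)
    have unique: "yh m \<rho> = xh m \<rho>" if yh: "?path M yh" and m: "m \<le> M" and \<rho>: "\<rho> \<in> {0..1}" for yh m \<rho>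
    proof -
      have fey: "yh m \<in> fe_space \<kappa> J" if "m \<le> M" for m using yh that by (simp add: scheme_path_def)
      have "\<forall>j\<le>J. nodal J (yh m) j = nodal J (xh m) j" using m
      proof (induction m rule: less_induct)
        case (less m)
        show ?case
        proof (cases "m \<le> 1")
          case True
          then have "m = 0 \<or> m = 1" by auto
          then show ?thesis using xh yh node_unit[OF J] by (auto simp: scheme_path_def nodal_def simp del: One_nat_def)
        next
          case False
          define n where "n = m - 1"
          have n: "1 \<le> n" "n < M" "m = n + 1" using False less.prems by (auto simp: n_def)
          have IH: "nodal J (yh i) j = nodal J (xh i) j" if "i \<le> n" "j \<le> J" for i j
            using less.IH[of i] that n by simp
          have path: "?path n xh" by (rule scheme_path_mono[OF xh]) (use n in simp)
          have nx: "nodal_step (\<kappa> = Closed_curve) J (bdn J) U (grad F) \<Delta>t (nodal J (xh (n - 1))) (nodal J (xh n)) (nodal J (xh m))"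
            using nodal_path[OF xh] n unfolding nodal_path_def by simp
          have "nodal_step (\<kappa> = Closed_curve) J (bdn J) U (grad F) \<Delta>t (nodal J (yh (n - 1))) (nodal J (yh n)) (nodal J (yh m))"
            using nodal_path[OF yh] n unfolding nodal_path_def by simp
          then have ny: "nodal_step (\<kappa> = Closed_curve) J (bdn J) U (grad F) \<Delta>t (nodal J (xh (n - 1))) (nodal J (xh n)) (nodal J (yh m))"
            by (rule nodal_step_cong[OF _ J, rotated 4]) (use IH in \<open>auto simp: bdn_eq\<close>)
          obtain Y2 where "\<And>Y2'. nodal_step (\<kappa> = Closed_curve) J (bdn J) U (grad F) \<Delta>t (nodal J (xh (n - 1))) (nodal J (xh n)) Y2' \<Longrightarrow> \<forall>k\<le>J. Y2' k = Y2 k"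
            using conv'[OF _ nodal_path[OF path]] n by auto
          from this[OF nx] this[OF ny] show ?thesis by simp
        qed
      qed
      then show ?thesis using fe_space_eqI[OF fey[OF m] fe[OF m] J _ \<rho>] by blast
    qed
    have errors: "(l2_norm (\<lambda>\<rho>. x \<rho> (real m * \<Delta>t) - xh m \<rho>))\<^sup>2 \<le> c * (h ^ 4 + \<Delta>t ^ 4)"
      "(h1_seminorm \<kappa> (\<lambda>\<rho>. x \<rho> (real m * \<Delta>t) - xh m \<rho>))\<^sup>2 \<le> c * (h ^ 2 + \<Delta>t ^ 4)" if m: "m \<le> M" for m
    proof -
      let ?t = "real m * \<Delta>t"
      let ?e = "\<lambda>j. nodal J (\<lambda>\<rho>. X 0 0 \<rho> ?t) j - nodal J (xh m) j"
      have "h1_sq J (\<lambda>j. xnode J ?t j - nodal J (xh m) j) \<le> K * D\<^sup>2"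
        using conv'[OF _ nodal_path[OF xh]] m by blast
      also have "\<dots> \<le> 2 * K * (h ^ 4 + \<Delta>t ^ 4)" using D(2) pos(3) by simp
      finally have "stiff_sq J ?e + lump_sq J ?e \<le> 2 * K * (h ^ 4 + \<Delta>t ^ 4)"
        by (simp add: h1_sq_def xnode_def nodal_def)
      then have e: "stiff_sq J ?e \<le> 2 * K * (h ^ 4 + \<Delta>t ^ 4)" "lump_sq J ?e \<le> 2 * K * (h ^ 4 + \<Delta>t ^ 4)"
        using stiff_sq_nonneg[of J ?e] lump_sq_nonneg[of J ?e] by linarith+
      have n: "(l2_norm (\<lambda>\<rho>. X 0 0 \<rho> ?t - xh m \<rho>))\<^sup>2 \<le> 2 * B\<^sup>2 * (1 / real J) ^ 4 + 4 * lump_sq J ?e"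
        "(h1_seminorm \<kappa> (\<lambda>\<rho>. X 0 0 \<rho> ?t - xh m \<rho>))\<^sup>2 \<le> 8 * B\<^sup>2 * (1 / real J)\<^sup>2 + 2 * stiff_sq J ?e"
        by (rule error_norms[where f="\<lambda>i \<rho>. X i 0 \<rho> ?t", OF J fe[OF m]];
            use periodic der_rho bound times[OF m] in simp)+
      have h01: "0 \<le> h" "h \<le> 1" using J by (auto simp: h)
      have h4: "h ^ 4 \<le> h\<^sup>2" by (rule power_decreasing) (use h01 in auto)
      have q: "0 \<le> B\<^sup>2 * h ^ 4" "0 \<le> B\<^sup>2 * \<Delta>t ^ 4" "0 \<le> K * \<Delta>t ^ 4" "0 \<le> K * h\<^sup>2" "K * h ^ 4 \<le> K * h\<^sup>2" "0 \<le> K * h ^ 4" 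
        using pos(3) h4 h01 by auto
      show "(l2_norm (\<lambda>\<rho>. x \<rho> ?t - xh m \<rho>))\<^sup>2 \<le> c * (h ^ 4 + \<Delta>t ^ 4)"
        using n(1) e(2) q unfolding X0 h[symmetric] c_def distrib_left distrib_right mult.assoc by linarith
      show "(h1_seminorm \<kappa> (\<lambda>\<rho>. x \<rho> ?t - xh m \<rho>))\<^sup>2 \<le> c * (h ^ 2 + \<Delta>t ^ 4)"
        using n(2) e(1) q unfolding X0 h[symmetric] c_def distrib_left distrib_right mult.assoc by linarith
    qed
    show "\<exists>xh. solves_S \<kappa> U F J M T (lagrange_interp J x0) xh1 xh \<and>
          (\<forall>yh. solves_S \<kappa> U F J M T (lagrange_interp J x0) xh1 yh \<longrightarrow>
             (\<forall>m\<le>M. \<forall>\<rho>\<in>{0..1}. yh m \<rho> = xh m \<rho>)) \<and>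
          (MAX m\<in>{0..M}. (l2_norm (\<lambda>\<rho>. x \<rho> (real m * \<Delta>t) - xh m \<rho>))\<^sup>2)
            \<le> c * (h ^ 4 + \<Delta>t ^ 4) \<and>
          (MAX m\<in>{0..M}. (h1_seminorm \<kappa> (\<lambda>\<rho>. x \<rho> (real m * \<Delta>t) - xh m \<rho>))\<^sup>2)
            \<le> c * (h ^ 2 + \<Delta>t ^ 4)"
      unfolding solves
    proof (intro exI[of _ xh] conjI allI impI ballI)
      show "?path M xh" by (rule xh)
      show "yh m \<rho> = xh m \<rho>" if "?path M yh" "m \<le> M" "\<rho> \<in> {0..1}" for yh m \<rho> by (rule unique[OF that])
    qed (use errors in \<open>auto intro!: Max.boundedI\<close>)
  qed
qed

end
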